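(* Let $H\colon U\subset\mathbb{H}^{2n+1}_\ell\to\mathbb{H}^{2N+1}_{\ell'}$ be a transversal (smooth) CR map defined on an open subset $U$ of the hyperquadric $\mathbb{H}^{2n+1}_{\ell}$, and let $p\in U$. Then $$\operatorname{rk}\big(\mathcal{A}_{\alpha\bar\beta}(H)|_p\big)=\operatorname{rk}_H(p),$$ where $\mathcal{A}_{\alpha\bar\beta}(H)$ is the Hermitian part of the CR Ahlfors derivative of $H$ with respect to the standard pseudo-Hermitian structures and $\operatorname{rk}_H(p)$ is the geometric rank of $H$ at $p$.
   Context: Hyperquadric: in $\mathbb{C}^{n+1}$ with coordinates $(z,w)\in\mathbb{C}^n\times\mathbb{C}$ and for $0\le\ell\le n/2$ put $\epsilon_k=-1$ for $1\le k\le\ell$, $\epsilon_k=1$ for $\ell+1\le k\le n$, $\rho=\operatorname{Im}(w)-\sum_{k=1}^n\epsilon_k|z_k|^2$, and $\mathbb{H}^{2n+1}_\ell=\{\rho=0\}$, with standard pseudo-Hermitian structure $i\bar\partial\rho$. Similarly $\mathbb{H}^{2N+1}_{\ell'}\subset\mathbb{C}^{N+1}$ is $\{\rho'=0\}$ with $\rho'=\operatorname{Im}(w)-\sum_{k=1}^N\epsilon'_k|z_k|^2$, where $\epsilon'_k=-1$ for $k\le\ell'$ and $\epsilon'_k=1$ for $k>\ell'$. Write $\|z\|_\ell^2=\sum_{k=1}^n\epsilon_k|z_k|^2$ and $\langle \bar z,a\rangle_\ell=\sum_{k=1}^n\epsilon_k\bar z_k a_k$. CR Ahlfors derivative (Hermitian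 part): let $\tilde H$ be a smooth extension of $H$ to a neighborhood of $U$ in $\mathbb{C}^{n+1}$ with $\bar\partial\tilde H$ vanishing to infinite order along $U$ (a holomorphic extension if there is one). Then $\rho'\circ\tilde H=Q\rho$ for a smooth real-valued $Q$, and $H$ is transversal iff $Q\ne0$ on $U$. In the frame $Z_\alpha=\partial/\partial z_\alpha+2i\epsilon_\alpha\bar z_\alpha\,\partial/\partial w$, $Z_{\bar\beta}=\overline{Z_\beta}$, $1\le\alpha,\beta\le n$, $$\mathcal{A}_{\alpha\bar\beta}(H)=(\partial\bar\partial\log|Q|)(Z_\alpha,Z_{\bar\beta})\big|_U$$ (the complex Hessian of $\log|Q|$ evaluated on $Z_\alpha,Z_{\bar\beta}$); its rank at $p$ is the rank of this $n\times n$ matrix at $p$. Geometric rank: first suppose $Q>0$ near $p$ ($H$ preserves sides). Permute the target coordinates so that the first $n$ target signs are $\epsilon_1,\dots,\epsilon_n$, and denote the remaining ones by $\delta_{n+1},\dots,\delta_N$ (of which $\tau=\ell'-\ell$ equal $-1$). It is known that there are (local) CR automorphisms $\gamma$ of the source and $\psi$ of the target hyperquadric with $\gamma(0)=p$, $\psi(0)=H(p)$, such that $\psi^{-1}\circ H\circ\gamma=(F^1,\dots,F^{N+1})$ has the (formal Taylor) form $$F^\alpha=z_\alpha+\tfrac{i}{2}a_\alpha(z)w+O_{wt}(4)\ (1\le\alpha\le n),\quad F^l=\phi^{(2)}_l(z)+O_{wt}(3)\ (n+1\le l\le N),\quad F^{N+1}=w+O_{wt}(5),$$ where the $\phi_l^{(2)}$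 are homogeneous quadratic polynomials, $a(z)=(a_1(z),\dots,a_n(z))$ is linear in $z$ and $$\langle\bar z,a(z)\rangle_\ell\,\|z\|_\ell^2=\sum_{l=n+1}^N\delta_l|\phi^{(2)}_l(z)|^2 .$$ Here $z$ has weight $1$, $w$ has weight $2$, and $O_{wt}(k)$ denotes terms of weight at least $k$. Writing $a(z)=zA$ with an $n\times n$ matrix $A$, the rank of $A$ does not depend on the choice of such $\gamma,\psi$; it is the geometric rank $\operatorname{rk}_H(p)$. If $Q<0$ near $p$ ($H$ reverses sides), one uses the same definition after composing $H$ with $(z,w)\mapsto(z,-w)$ in the target and replacing all target signs $\epsilon'_k$ by $-\epsilon'_k$ (so that $Q$ is replaced by $-Q$). *)

theory Defs
  imports "HOL-Analysis.Analysis" "HOL-Library.Landau_Symbols"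
begin

section \<open>Smooth functions\<close>

text \<open>For open \<open>S\<close> this is the class of \<open>k\<close> times continuously differentiable functions.\<close>

primrec Ck_on :: "nat \<Rightarrow> 'a::real_normed_vector set \<Rightarrow> ('a \<Rightarrow> 'b::real_normed_vector) \<Rightarrow> bool" where
  "Ck_on 0 S f \<longleftrightarrow> continuous_on S f"
| "Ck_on (Suc k) S f \<longleftrightarrow>
     (\<forall>x\<in>S. f differentiable (at x)) \<and> (\<forall>v. Ck_on k S (\<lambda>x. frechet_derivative f (at x) v))"

definition smooth_on :: "'a::real_normed_vector set \<Rightarrow> ('a \<Rightarrow> 'b::real_normed_vector) \<Rightarrow> bool" where
  "smooth_on S f \<longleftrightarrow> (\<forall>k. Ck_on k S f)"

text \<open>Smoothness on a subset that need not be open, such as an open piece of a hypersurface: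
  local extendability to smooth functions on open sets.\<close>

definition locally_smooth_on :: "'a::real_normed_vector set \<Rightarrow> ('a \<Rightarrow> 'b::real_normed_vector) \<Rightarrow> bool" where
  "locally_smooth_on U f \<longleftrightarrow>
     (\<forall>p\<in>U. \<exists>W g. open W \<and> p \<in> W \<and> smooth_on W g \<and> (\<forall>x\<in>U \<inter> W. g x = f x))"

primrec iter_deriv :: "'a::real_normed_vector list \<Rightarrow> ('a \<Rightarrow> 'b::real_normed_vector) \<Rightarrow> 'a \<Rightarrow> 'b" where
  "iter_deriv [] f = f"
| "iter_deriv (v # vs) f = (\<lambda>x. frechet_derivative (iter_deriv vs f) (at x) v)"

definition vanishes_to_infinite_order_on ::
    "'a::real_normed_vector set \<Rightarrow> ('a \<Rightarrow> 'b::real_normed_vector) \<Rightarrow> bool" where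
  "vanishes_to_infinite_order_on S f \<longleftrightarrow> (\<forall>vs. \<forall>x\<in>S. iter_deriv vs f x = 0)"


section \<open>Complex calculus on \<open>\<complex>\<^sup>n \<times> \<complex>\<close>\<close>

text \<open>Points of \<open>\<complex>\<^sup>n\<^sup>+\<^sup>1\<close> are pairs \<open>(z, w)\<close>; the index type \<open>'n\<close> has \<open>n\<close> elements.\<close>

definition cscale :: "complex \<Rightarrow> (complex^'n) \<times> complex \<Rightarrow> (complex^'n) \<times> complex" where
  "cscale c x = (c *s fst x, c * snd x)"

text \<open>The derivatives of \<open>f\<close> along the constant fields \<open>\<Sum> v\<^sub>j \<partial>/\<partial>x\<^sub>j\<close> and \<open>\<Sum> cnj v\<^sub>j \<partial>/\<partial>cnj x\<^sub>j\<close>,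
  respectively; the latter is conjugate linear in \<open>v\<close>.\<close>

definition wirtinger ::
    "((complex^'n) \<times> complex \<Rightarrow> complex) \<Rightarrow> (complex^'n) \<times> complex \<Rightarrow> (complex^'n) \<times> complex \<Rightarrow> complex" where
  "wirtinger f v x =
     (frechet_derivative f (at x) v - \<i> * frechet_derivative f (at x) (cscale \<i> v)) / 2"

definition wirtinger_bar ::
    "((complex^'n) \<times> complex \<Rightarrow> complex) \<Rightarrow> (complex^'n) \<times> complex \<Rightarrow> (complex^'n) \<times> complex \<Rightarrow> complex" where
  "wirtinger_bar f v x =
     (frechet_derivative f (at x) v + \<i> * frechet_derivative f (at x) (cscale \<i> v)) / 2"

text \<open>The sesquilinear form \<open>\<Sum> f\<^sub>j\<^sub>k v\<^sub>j cnj (u\<^sub>k)\<close>, where \<open>f\<^sub>j\<^sub>k = \<partial>\<^sup>2 f / \<partial>x\<^sub>j \<partial>cnj x\<^sub>k\<close>,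
  i.e. the value of \<open>\<partial>\<partial>\<close>-bar \<open>f\<close> on the (1,0)-vector \<open>v\<close> and the conjugate of the (1,0)-vector \<open>u\<close>.\<close>

definition complex_hessian ::
    "((complex^'n) \<times> complex \<Rightarrow> complex) \<Rightarrow> (complex^'n) \<times> complex
      \<Rightarrow> (complex^'n) \<times> complex \<Rightarrow> (complex^'n) \<times> complex \<Rightarrow> complex" where
  "complex_hessian f x v u = wirtinger (wirtinger_bar f u) v x"


section \<open>Hyperquadrics and CR maps\<close>

text \<open>The signs are given by an arbitrary function \<open>\<epsilon>\<close> on the index type with exactly \<open>l\<close>
  negative values; for any enumeration of the indices this includes the convention that the
  first \<open>l\<close> signs are the negative ones.\<close>

definition signs :: "('n::finite \<Rightarrow> real) \<Rightarrow> nat \<Rightarrow> bool" where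
  "signs \<epsilon> l \<longleftrightarrow> (\<forall>k. \<epsilon> k = -1 \<or> \<epsilon> k = 1) \<and> card {k. \<epsilon> k = -1} = l"

definition rho :: "('n::finite \<Rightarrow> real) \<Rightarrow> (complex^'n) \<times> complex \<Rightarrow> real" where
  "rho \<epsilon> x = Im (snd x) - (\<Sum>k\<in>UNIV. \<epsilon> k * (cmod (fst x $ k))\<^sup>2)"

definition hyperquadric :: "('n::finite \<Rightarrow> real) \<Rightarrow> ((complex^'n) \<times> complex) set" where
  "hyperquadric \<epsilon> = {x. rho \<epsilon> x = 0}"

definition real_tangent ::
    "('n::finite \<Rightarrow> real) \<Rightarrow> (complex^'n) \<times> complex \<Rightarrow> ((complex^'n) \<times> complex) set" where
  "real_tangent \<epsilon> p = {v. frechet_derivative (rho \<epsilon>) (at p) v = 0}"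

definition complex_tangent ::
    "('n::finite \<Rightarrow> real) \<Rightarrow> (complex^'n) \<times> complex \<Rightarrow> ((complex^'n) \<times> complex) set" where
  "complex_tangent \<epsilon> p = {v \<in> real_tangent \<epsilon> p. cscale \<i> v \<in> real_tangent \<epsilon> p}"

text \<open>Smooth CR maps of a relatively open subset \<open>U\<close> of one hyperquadric into another.
  A derivative \<open>D\<close> of \<open>H\<close> within \<open>U\<close> is determined on the tangent space of the hyperquadric,
  where it is the differential of \<open>H\<close>; only tangent vectors are fed into it below.\<close>

definition CR_map_on ::
    "('n::finite \<Rightarrow> real) \<Rightarrow> ('m::finite \<Rightarrow> real) \<Rightarrow> ((complex^'n) \<times> complex) set
      \<Rightarrow> ((complex^'n) \<times> complex \<Rightarrow> (complex^'m) \<times> complex) \<Rightarrow> bool" where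
  "CR_map_on \<epsilon> \<epsilon>' U H \<longleftrightarrow>
     locally_smooth_on U H \<and> H ` U \<subseteq> hyperquadric \<epsilon>' \<and>
     (\<forall>p\<in>U. \<exists>D. (H has_derivative D) (at p within U) \<and>
        (\<forall>v\<in>complex_tangent \<epsilon> p.
           D v \<in> complex_tangent \<epsilon>' (H p) \<and> D (cscale \<i> v) = cscale \<i> (D v)))"

text \<open>CR transversality: the complex tangent space of the target and the image of the tangent
  space of the source span the tangent space of the target.\<close>

definition transversal_on ::
    "('n::finite \<Rightarrow> real) \<Rightarrow> ('m::finite \<Rightarrow> real) \<Rightarrow> ((complex^'n) \<times> complex) set
      \<Rightarrow> ((complex^'n) \<times> complex \<Rightarrow> (complex^'m) \<times> complex) \<Rightarrow> bool" where
  "transversal_on \<epsilon> \<epsilon>' U H \<longleftrightarrow>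
     (\<forall>p\<in>U. \<exists>D. (H has_derivative D) (at p within U) \<and>
        {u + D v | u v. u \<in> complex_tangent \<epsilon>' (H p) \<and> v \<in> real_tangent \<epsilon> p}
          = real_tangent \<epsilon>' (H p))"


section \<open>The Hermitian part of the CR Ahlfors derivative\<close>

text \<open>\<open>h\<close> is a smooth extension of \<open>H\<close> to the neighbourhood \<open>W\<close> of \<open>p\<close>, almost holomorphic
  along \<open>U\<close>, and \<open>Q\<close> is the corresponding smooth quotient of the defining functions. Since only
  the germs at \<open>p\<close> matter, \<open>W\<close> is not required to contain all of \<open>U\<close>.\<close>

definition almost_holomorphic_extension ::
    "('n::finite \<Rightarrow> real) \<Rightarrow> ('m::finite \<Rightarrow> real) \<Rightarrow> ((complex^'n) \<times> complex) set
      \<Rightarrow> ((complex^'n) \<times> complex \<Rightarrow> (complex^'m) \<times> complex) \<Rightarrow> (complex^'n) \<times> complex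
      \<Rightarrow> ((complex^'n) \<times> complex) set \<Rightarrow> ((complex^'n) \<times> complex \<Rightarrow> (complex^'m) \<times> complex)
      \<Rightarrow> ((complex^'n) \<times> complex \<Rightarrow> real) \<Rightarrow> bool" where
  "almost_holomorphic_extension \<epsilon> \<epsilon>' U H p W h Q \<longleftrightarrow>
     open W \<and> p \<in> W \<and> smooth_on W h \<and> (\<forall>x\<in>U \<inter> W. h x = H x) \<and>
     (\<forall>v. (\<forall>k. vanishes_to_infinite_order_on (U \<inter> W) (wirtinger_bar (\<lambda>x. fst (h x) $ k) v)) \<and>
          vanishes_to_infinite_order_on (U \<inter> W) (wirtinger_bar (\<lambda>x. snd (h x)) v)) \<and>
     smooth_on W Q \<and> (\<forall>x\<in>W. rho \<epsilon>' (h x) = Q x * rho \<epsilon> x)"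

text \<open>The coordinates of \<open>Z\<^sub>\<alpha> = \<partial>/\<partial>z\<^sub>\<alpha> + 2 \<i> \<epsilon>\<^sub>\<alpha> cnj z\<^sub>\<alpha> \<partial>/\<partial>w\<close>.\<close>

definition frame :: "('n::finite \<Rightarrow> real) \<Rightarrow> 'n \<Rightarrow> (complex^'n) \<times> complex \<Rightarrow> (complex^'n) \<times> complex" where
  "frame \<epsilon> \<alpha> x = (axis \<alpha> 1, 2 * \<i> * of_real (\<epsilon> \<alpha>) * cnj (fst x $ \<alpha>))"

text \<open>The matrix does not depend on the choice of the extension.\<close>

definition CR_Ahlfors ::
    "('n::finite \<Rightarrow> real) \<Rightarrow> ('m::finite \<Rightarrow> real) \<Rightarrow> ((complex^'n) \<times> complex) set
      \<Rightarrow> ((complex^'n) \<times> complex \<Rightarrow> (complex^'m) \<times> complex) \<Rightarrow> (complex^'n) \<times> complex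
      \<Rightarrow> complex^'n^'n" where
  "CR_Ahlfors \<epsilon> \<epsilon>' U H p =
     (SOME M. \<exists>W h Q. almost_holomorphic_extension \<epsilon> \<epsilon>' U H p W h Q \<and>
        M = (\<chi> \<alpha> \<beta>. complex_hessian (\<lambda>x. of_real (ln \<bar>Q x\<bar>)) p (frame \<epsilon> \<alpha> p) (frame \<epsilon> \<beta> p)))"


section \<open>The geometric rank\<close>

definition local_CR_automorphism ::
    "('n::finite \<Rightarrow> real) \<Rightarrow> ((complex^'n) \<times> complex) set
      \<Rightarrow> ((complex^'n) \<times> complex \<Rightarrow> (complex^'n) \<times> complex) \<Rightarrow> bool" where
  "local_CR_automorphism \<epsilon> V g \<longleftrightarrow>
     openin (top_of_set (hyperquadric \<epsilon>)) V \<and> CR_map_on \<epsilon> \<epsilon> V g \<and> inj_on g V \<and>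
     openin (top_of_set (hyperquadric \<epsilon>)) (g ` V) \<and> CR_map_on \<epsilon> \<epsilon> (g ` V) (inv_into V g)"

text \<open>Terms of weight at least \<open>k\<close> at the origin, where \<open>z\<close> has weight 1 and \<open>w\<close> has weight 2, for
  functions on the hyperquadric. For smooth CR functions this means that the formal
  (holomorphic) Taylor series in \<open>(z, w)\<close> has no terms of weight less than \<open>k\<close>.\<close>

definition O_wt :: "('n::finite \<Rightarrow> real) \<Rightarrow> nat \<Rightarrow> ((complex^'n) \<times> complex \<Rightarrow> complex) \<Rightarrow> bool" where
  "O_wt \<epsilon> k f \<longleftrightarrow> (\<lambda>x. cmod (f x))
     \<in> O[at 0 within hyperquadric \<epsilon>](\<lambda>x. (norm (fst x) + sqrt (cmod (snd x))) ^ k)"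

definition quadratic_form :: "complex^'n^'n \<Rightarrow> complex^'n \<Rightarrow> complex" where
  "quadratic_form B z = (\<Sum>i\<in>UNIV. \<Sum>j\<in>UNIV. B $ i $ j * z $ i * z $ j)"

text \<open>Instead of permuting the target coordinates, the injection \<open>\<sigma>\<close> selects the target
  coordinates that play the role of the first \<open>n\<close> ones; the others are those outside
  \<open>range \<sigma>\<close>. The matrix \<open>A\<close> acts on row vectors, \<open>a(z) = zA\<close>.\<close>

definition normal_form ::
    "('n::finite \<Rightarrow> real) \<Rightarrow> ('m::finite \<Rightarrow> real) \<Rightarrow> ('n \<Rightarrow> 'm)
      \<Rightarrow> ((complex^'n) \<times> complex \<Rightarrow> (complex^'m) \<times> complex) \<Rightarrow> complex^'n^'n
      \<Rightarrow> ('m \<Rightarrow> complex^'n^'n) \<Rightarrow> bool" where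
  "normal_form \<epsilon> \<epsilon>' \<sigma> F A B \<longleftrightarrow>
     inj \<sigma> \<and> (\<forall>\<alpha>. \<epsilon>' (\<sigma> \<alpha>) = \<epsilon> \<alpha>) \<and>
     (\<forall>\<alpha>. O_wt \<epsilon> 4 (\<lambda>x. fst (F x) $ \<sigma> \<alpha> - (fst x $ \<alpha> + \<i> / 2 * (fst x v* A) $ \<alpha> * snd x))) \<and>
     (\<forall>l. l \<notin> range \<sigma> \<longrightarrow> O_wt \<epsilon> 3 (\<lambda>x. fst (F x) $ l - quadratic_form (B l) (fst x))) \<and>
     O_wt \<epsilon> 5 (\<lambda>x. snd (F x) - snd x) \<and>
     (\<forall>z. (\<Sum>\<alpha>\<in>UNIV. of_real (\<epsilon> \<alpha>) * cnj (z $ \<alpha>) * (z v* A) $ \<alpha>)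
            * of_real (\<Sum>k\<in>UNIV. \<epsilon> k * (cmod (z $ k))\<^sup>2)
          = of_real (\<Sum>l\<in>- range \<sigma>. \<epsilon>' l * (cmod (quadratic_form (B l) z))\<^sup>2))"

definition normal_form_rank ::
    "('n::finite \<Rightarrow> real) \<Rightarrow> ('m::finite \<Rightarrow> real)
      \<Rightarrow> ((complex^'n) \<times> complex \<Rightarrow> (complex^'m) \<times> complex) \<Rightarrow> (complex^'n) \<times> complex \<Rightarrow> nat" where
  "normal_form_rank \<epsilon> \<epsilon>' H p =
     (THE r. \<exists>V \<gamma> V' \<psi> \<sigma> A B.
        local_CR_automorphism \<epsilon> V \<gamma> \<and> 0 \<in> V \<and> \<gamma> 0 = p \<and>
        local_CR_automorphism \<epsilon>' V' \<psi> \<and> 0 \<in> V' \<and> \<psi> 0 = H p \<and>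
        normal_form \<epsilon> \<epsilon>' \<sigma> (inv_into V' \<psi> \<circ> H \<circ> \<gamma>) A B \<and> r = rank A)"

definition preserves_sides_at ::
    "('n::finite \<Rightarrow> real) \<Rightarrow> ('m::finite \<Rightarrow> real) \<Rightarrow> ((complex^'n) \<times> complex) set
      \<Rightarrow> ((complex^'n) \<times> complex \<Rightarrow> (complex^'m) \<times> complex) \<Rightarrow> (complex^'n) \<times> complex \<Rightarrow> bool" where
  "preserves_sides_at \<epsilon> \<epsilon>' U H p \<longleftrightarrow>
     (\<exists>W h Q. almost_holomorphic_extension \<epsilon> \<epsilon>' U H p W h Q \<and> Q p > 0)"

text \<open>A transversal map that does not preserve sides reverses them (\<open>Q < 0\<close>); it is then composed
  with \<open>(z, w) \<mapsto> (z, -w)\<close>, which maps the target to the hyperquadric with the opposite signs.\<close>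

definition geometric_rank ::
    "('n::finite \<Rightarrow> real) \<Rightarrow> ('m::finite \<Rightarrow> real) \<Rightarrow> ((complex^'n) \<times> complex) set
      \<Rightarrow> ((complex^'n) \<times> complex \<Rightarrow> (complex^'m) \<times> complex) \<Rightarrow> (complex^'n) \<times> complex \<Rightarrow> nat" where
  "geometric_rank \<epsilon> \<epsilon>' U H p =
     (if preserves_sides_at \<epsilon> \<epsilon>' U H p then normal_form_rank \<epsilon> \<epsilon>' H p
      else normal_form_rank \<epsilon> (\<lambda>k. - \<epsilon>' k) (\<lambda>x. (fst (H x), - snd (H x))) p)"

end

theory Submission
  imports Defs "HOL-Library.Nat_Bijection"
begin

text \<open>
  Let \<open>h\<close> be an almost holomorphic extension of the CR map, so that \<open>rho' \<circ> h = Q rho\<close>. In the ring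
  of infinite jets at \<open>p\<close> the components of \<open>h\<close> are annihilated by the conjugate derivatives, and
  differentiating this single equation relates the derivatives of \<open>h\<close> to those of \<open>Q\<close>. Two
  consequences carry the proof. The differential of \<open>h\<close> preserves the Levi forms up to the factor
  \<open>Q\<close> (\<open>D1_isometry\<close>), and the square of the second derivatives of \<open>h\<close> in tangential directions is
  the mixed second derivative of \<open>Q\<close> times the Levi form (\<open>gauss_equation\<close>).

  The rank of the Ahlfors matrix is invariant under composition with automorphisms on both sides: in
  equal dimensions there are no normal directions, the Gauss equation forces the Hessian of \<open>log |Q|\<close>
  to vanish on the frame (\<open>ahlfors_matrix_equidimensional\<close>), and quotients of composites multiply, so
  that the matrix changes by an invertible change of frame (\<open>rank_ahlfors_matrix_invariant\<close>). For a
  map in normal form the Gauss equation turns into the quadratic identity that defines the matrix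
  \<open>A\<close>, and therefore the Ahlfors matrix is \<open>A\<close> with columns multiplied by signs
  (\<open>normal_form_ahlfors_matrix\<close>). So the rank of \<open>A\<close> is the rank of the Ahlfors matrix for every
  normal form (\<open>rank_normal_form\<close>).

  It remains to see that the objects in the definitions exist. A normal form is reached with
  translations, a pseudo-unitary map supplied by Witt's theorem, a dilation, and an automorphism
  that fixes the origin to first order in the tangential directions (\<open>normalization\<close>); after this the
  remaining conditions follow from the differentiated mapping equation (\<open>normalized_map\<close>).
  Almost holomorphic extensions are needed for the given map and for all automorphisms that occur in
  the definition of the geometric rank, which are only smooth CR maps
  (\<open>almost_holomorphic_extension_exists\<close>). They are obtained without solving any equation: in
  coordinates \<open>(z, u)\<close> on the hyperquadric a function is continued to \<open>(z, u + i t)\<close> as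
  \<open>\<Sum> a\<^sub>k f (z, u + b\<^sub>k t)\<close>, where the real numbers \<open>b\<^sub>k\<close> and the complex weights \<open>a\<^sub>k\<close> have the moments
  \<open>i\<^sup>j\<close> of a point mass at \<open>i\<close>. Since only moments enter the Taylor series at \<open>t = 0\<close>, this series is
  the formal continuation, and the CR equations make all conjugate derivatives flat.

  Transversality means \<open>Q p \<noteq> 0\<close>, and the sign of \<open>Q p\<close> decides whether the map preserves sides. A map that
  reverses sides is composed with a reflection, which replaces \<open>Q\<close> by \<open>-Q\<close> and leaves the Ahlfors
  matrix unchanged.
\<close>

section \<open>Calculus of smooth functions\<close>

text \<open>The direction comes first, so that iterated derivatives are compositions of operators.\<close>

definition dir_deriv :: "'a::real_normed_vector \<Rightarrow> ('a \<Rightarrow> 'b::real_normed_vector) \<Rightarrow> 'a \<Rightarrow> 'b" where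
  "dir_deriv v f = (\<lambda>x. frechet_derivative f (at x) v)"

lemma dir_deriv_eq: "(f has_derivative D) (at x) \<Longrightarrow> dir_deriv v f x = D v"
  unfolding dir_deriv_def using frechet_derivative_at by metis

lemma has_derivative_dir_deriv:
  "f differentiable (at x) \<Longrightarrow> (f has_derivative (\<lambda>v. dir_deriv v f x)) (at x)"
  unfolding dir_deriv_def using frechet_derivative_works by (metis (no_types, lifting) ext)

lemma linear_dir_deriv: "f differentiable (at x) \<Longrightarrow> linear (\<lambda>v. dir_deriv v f x)"
  using has_derivative_dir_deriv has_derivative_linear by blast

lemma dir_deriv_cong_open:
  assumes "open S" "x \<in> S" "\<And>y. y \<in> S \<Longrightarrow> f y = g y"
  shows "dir_deriv v f x = dir_deriv v g x"
proof -
  have "(f has_derivative D) (at x) \<longleftrightarrow> (g has_derivative D) (at x)" for D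
    using assms by (metis has_derivative_transform_within_open)
  thus ?thesis by (simp add: dir_deriv_def frechet_derivative_def)
qed

lemma dir_deriv_basis:
  fixes f :: "'a::euclidean_space \<Rightarrow> 'b::real_normed_vector"
  assumes "f differentiable (at x)"
  shows "dir_deriv v f x = (\<Sum>b\<in>Basis. (v \<bullet> b) *\<^sub>R dir_deriv b f x)"
proof -
  interpret linear "\<lambda>v. dir_deriv v f x" by (rule linear_dir_deriv[OF assms])
  have "dir_deriv v f x = dir_deriv (\<Sum>b\<in>Basis. (v \<bullet> b) *\<^sub>R b) f x"
    by (simp add: euclidean_representation)
  also have "\<dots> = (\<Sum>b\<in>Basis. (v \<bullet> b) *\<^sub>R dir_deriv b f x)" by (simp add: sum scale)
  finally show ?thesis .
qed

lemma Ck_on_Suc_dir: "Ck_on (Suc k) S f \<longleftrightarrow>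
    (\<forall>x\<in>S. f differentiable (at x)) \<and> (\<forall>v. Ck_on k S (dir_deriv v f))"
  by (simp add: dir_deriv_def)

declare Ck_on.simps(2)[simp del]

lemma Ck_on_cong:
  assumes "open S" "\<And>x. x \<in> S \<Longrightarrow> f x = g x" "Ck_on k S f"
  shows "Ck_on k S g"
  using assms(2,3)
proof (induction k arbitrary: f g)
  case 0 thus ?case using continuous_on_cong by fastforce
next
  case (Suc k)
  have "g differentiable (at x)" if "x \<in> S" for x
    using Suc.prems that \<open>open S\<close> unfolding Ck_on_Suc_dir differentiable_def
    by (metis has_derivative_transform_within_open)
  moreover have "Ck_on k S (dir_deriv v g)" for v
  proof (rule Suc.IH)
    show "dir_deriv v f x = dir_deriv v g x" if "x \<in> S" for x
      by (rule dir_deriv_cong_open[OF \<open>open S\<close> that Suc.prems(1)])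
    show "Ck_on k S (dir_deriv v f)" using Suc.prems(2) by (simp add: Ck_on_Suc_dir)
  qed
  ultimately show ?case by (simp add: Ck_on_Suc_dir)
qed

lemma Ck_on_imp_continuous_on: "Ck_on k S f \<Longrightarrow> continuous_on S f"
  by (cases k) (auto simp: Ck_on_Suc_dir intro!: continuous_at_imp_continuous_on
      differentiable_imp_continuous_within)

lemma Ck_on_SucD: "Ck_on (Suc k) S f \<Longrightarrow> Ck_on k S f"
proof (induction k arbitrary: f)
  case 0 thus ?case using Ck_on_imp_continuous_on by auto
next
  case (Suc k) thus ?case by (simp add: Ck_on_Suc_dir)
qed

lemma Ck_on_subset: "Ck_on k S f \<Longrightarrow> T \<subseteq> S \<Longrightarrow> Ck_on k T f"
  by (induction k arbitrary: f) (auto simp: Ck_on_Suc_dir intro: continuous_on_subset)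

lemma dir_deriv_const [simp]: "dir_deriv v (\<lambda>x. c) = (\<lambda>x. 0)"
  by (simp add: dir_deriv_def)

lemma Ck_on_const: "Ck_on k S (\<lambda>x. c)"
  by (induction k arbitrary: c) (auto simp: Ck_on_Suc_dir)

text \<open>The derivatives of a composite with a linear or bilinear map are again composites of
  the same kind, so that smoothness propagates by induction on the order.\<close>

lemma Ck_on_bounded_linear:
  assumes "open S" "bounded_linear L" "Ck_on k S f"
  shows "Ck_on k S (\<lambda>x. L (f x))"
  using assms(3)
proof (induction k arbitrary: f)
  case 0 thus ?case
    using assms(2) by (auto intro: bounded_linear.continuous_on)
next
  case (Suc k)
  have hd: "((\<lambda>x. L (f x)) has_derivative (\<lambda>v. L (dir_deriv v f x))) (at x)" if "x \<in> S" for x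
    using Suc.prems that
    by (intro bounded_linear.has_derivative[OF assms(2)] has_derivative_dir_deriv) (auto simp: Ck_on_Suc_dir)
  have "dir_deriv v (\<lambda>x. L (f x)) x = L (dir_deriv v f x)" if "x \<in> S" for x v
    using dir_deriv_eq[OF hd[OF that]] .
  moreover have "Ck_on k S (\<lambda>x. L (dir_deriv v f x))" for v
    using Suc by (auto simp: Ck_on_Suc_dir)
  ultimately have "Ck_on k S (dir_deriv v (\<lambda>x. L (f x)))" for v
    using Ck_on_cong[OF \<open>open S\<close>, of "\<lambda>x. L (dir_deriv v f x)"] by simp
  thus ?case using hd by (auto simp: Ck_on_Suc_dir differentiable_def)
qed

lemma dir_deriv_add:
  "f differentiable (at x) \<Longrightarrow> g differentiable (at x) \<Longrightarrow>
    dir_deriv v (\<lambda>x. f x + g x) x = dir_deriv v f x + dir_deriv v g x"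
  by (rule dir_deriv_eq) (intro has_derivative_add has_derivative_dir_deriv)

lemma Ck_on_add:
  assumes "open S" "Ck_on k S f" "Ck_on k S g"
  shows "Ck_on k S (\<lambda>x. f x + g x)"
  using assms(2,3)
proof (induction k arbitrary: f g)
  case 0 thus ?case by (auto intro: continuous_on_add)
next
  case (Suc k)
  have "Ck_on k S (dir_deriv v (\<lambda>x. f x + g x))" for v
    using Suc Ck_on_cong[OF \<open>open S\<close>, of "\<lambda>x. dir_deriv v f x + dir_deriv v g x"]
    by (simp add: Ck_on_Suc_dir dir_deriv_add)
  thus ?case using Suc by (auto simp: Ck_on_Suc_dir)
qed

lemma Ck_on_sum:
  assumes "open S" "\<And>i. i \<in> I \<Longrightarrow> Ck_on k S (f i)"
  shows "Ck_on k S (\<lambda>x. \<Sum>i\<in>I. f i x)"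
proof (cases "finite I")
  case True
  thus ?thesis using assms(2)
    by (induction I) (auto intro!: Ck_on_add Ck_on_const assms(1))
qed (simp add: Ck_on_const)

lemma dir_deriv_bilinear:
  assumes "bounded_bilinear B" "f differentiable (at x)" "g differentiable (at x)"
  shows "dir_deriv v (\<lambda>x. B (f x) (g x)) x = B (f x) (dir_deriv v g x) + B (dir_deriv v f x) (g x)"
  using dir_deriv_eq[OF bounded_bilinear.FDERIV[OF assms(1) has_derivative_dir_deriv[OF assms(2)]
      has_derivative_dir_deriv[OF assms(3)]]] .

lemma Ck_on_bilinear:
  assumes "open S" "bounded_bilinear B" "Ck_on k S f" "Ck_on k S g"
  shows "Ck_on k S (\<lambda>x. B (f x) (g x))"
  using assms(3,4)
proof (induction k arbitrary: f g)
  case 0 thus ?case using bounded_bilinear.continuous_on[OF assms(2)] by simp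
next
  case (Suc k)
  have d: "f differentiable (at x)" "g differentiable (at x)" if "x \<in> S" for x
    using Suc.prems that by (auto simp: Ck_on_Suc_dir)
  have "Ck_on k S (dir_deriv v (\<lambda>x. B (f x) (g x)))" for v
  proof (rule Ck_on_cong[OF \<open>open S\<close>])
    show "Ck_on k S (\<lambda>x. B (f x) (dir_deriv v g x) + B (dir_deriv v f x) (g x))"
      using Suc.prems Ck_on_SucD[of k S f] Ck_on_SucD[of k S g]
      by (intro Ck_on_add Suc.IH \<open>open S\<close>) (auto simp: Ck_on_Suc_dir)
  qed (simp add: dir_deriv_bilinear[OF assms(2)] d)
  moreover have "(\<lambda>x. B (f x) (g x)) differentiable (at x)" if "x \<in> S" for x
    using bounded_bilinear.FDERIV[OF assms(2) has_derivative_dir_deriv[OF d(1)[OF that]]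
        has_derivative_dir_deriv[OF d(2)[OF that]]]
    by (auto simp: differentiable_def)
  ultimately show ?case by (simp add: Ck_on_Suc_dir)
qed

lemma dir_deriv_compose:
  fixes f :: "'a::real_normed_vector \<Rightarrow> 'b::euclidean_space"
  assumes "f differentiable (at x)" "g differentiable (at (f x))"
  shows "dir_deriv v (\<lambda>x. g (f x)) x = (\<Sum>b\<in>Basis. (dir_deriv v f x \<bullet> b) *\<^sub>R dir_deriv b g (f x))"
proof -
  have "((g \<circ> f) has_derivative ((\<lambda>v. dir_deriv v g (f x)) \<circ> (\<lambda>v. dir_deriv v f x))) (at x)"
    by (intro diff_chain_at has_derivative_dir_deriv assms)
  hence "dir_deriv v (g \<circ> f) x = dir_deriv (dir_deriv v f x) g (f x)"
    by (simp add: dir_deriv_eq)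
  thus ?thesis using dir_deriv_basis[OF assms(2), of "dir_deriv v f x"] by (simp add: o_def)
qed

text \<open>Written with the basis expansion of \<open>dir_deriv_compose\<close>, the derivative of a composite is a sum of
  products of composites, which makes the induction on the order work.\<close>

lemma Ck_on_compose:
  fixes f :: "'a::real_normed_vector \<Rightarrow> 'b::euclidean_space"
  assumes "open S" "open T" "\<And>x. x \<in> S \<Longrightarrow> f x \<in> T" "Ck_on k S f" "Ck_on k T g"
  shows "Ck_on k S (\<lambda>x. g (f x))"
  using assms(4,5)
proof (induction k arbitrary: g)
  case 0 thus ?case using assms(3) by (auto intro: continuous_on_compose2)
next
  case (Suc k)
  have d: "f differentiable (at x)" "g differentiable (at (f x))" if "x \<in> S" for x
    using Suc.prems that assms(3) by (auto simp: Ck_on_Suc_dir)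
  have "Ck_on k S (dir_deriv v (\<lambda>x. g (f x)))" for v
  proof (rule Ck_on_cong[OF \<open>open S\<close>])
    have "Ck_on k S (\<lambda>x. dir_deriv v f x \<bullet> b)" for b
      using Suc.prems
      by (auto simp: Ck_on_Suc_dir intro: Ck_on_bounded_linear[OF \<open>open S\<close> bounded_linear_inner_left])
    thus "Ck_on k S (\<lambda>x. \<Sum>b\<in>Basis. (dir_deriv v f x \<bullet> b) *\<^sub>R dir_deriv b g (f x))"
      using Suc.prems Ck_on_SucD[of k S f]
      by (intro Ck_on_sum \<open>open S\<close> Ck_on_bilinear[OF \<open>open S\<close> bounded_bilinear_scaleR] Suc.IH)
        (auto simp: Ck_on_Suc_dir)
  qed (simp add: dir_deriv_compose d)
  moreover have "(\<lambda>x. g (f x)) differentiable (at x)" if "x \<in> S" for x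
    using differentiable_chain_at[OF d(1)[OF that] d(2)[OF that]] by (simp add: o_def)
  ultimately show ?case by (simp add: Ck_on_Suc_dir)
qed

lemma Ck_on_inverse:
  fixes f :: "'a::real_normed_vector \<Rightarrow> 'b::real_normed_field"
  assumes "open S" "\<And>x. x \<in> S \<Longrightarrow> f x \<noteq> 0" "Ck_on k S f"
  shows "Ck_on k S (\<lambda>x. inverse (f x))"
  using assms(3)
proof (induction k)
  case 0 thus ?case using assms(2) by (auto intro: continuous_on_inverse)
next
  case (Suc k)
  have hd: "((\<lambda>x. inverse (f x)) has_derivative
      (\<lambda>v. - (inverse (f x) * dir_deriv v f x * inverse (f x)))) (at x)" if "x \<in> S" for x
  proof (rule Deriv.has_derivative_inverse)
    show "f x \<noteq> 0" by (rule assms(2)[OF that])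
    show "(f has_derivative (\<lambda>v. dir_deriv v f x)) (at x)"
      by (rule has_derivative_dir_deriv) (use Suc.prems that in \<open>simp add: Ck_on_Suc_dir\<close>)
  qed
  have "Ck_on k S (dir_deriv v (\<lambda>x. inverse (f x)))" for v
  proof (rule Ck_on_cong[OF \<open>open S\<close>])
    have "Ck_on k S (\<lambda>x. inverse (f x))" using Suc Ck_on_SucD by blast
    moreover have "Ck_on k S (dir_deriv v f)" using Suc.prems by (auto simp: Ck_on_Suc_dir)
    ultimately show "Ck_on k S (\<lambda>x. - (inverse (f x) * dir_deriv v f x * inverse (f x)))"
      using Ck_on_bilinear[OF \<open>open S\<close> bounded_bilinear_mult]
        Ck_on_bounded_linear[OF \<open>open S\<close> bounded_linear_minus[OF bounded_linear_ident]] by blast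
  qed (simp add: dir_deriv_eq[OF hd])
  thus ?case using hd by (auto simp: Ck_on_Suc_dir differentiable_def)
qed

lemma smooth_on_cong: "open S \<Longrightarrow> (\<And>x. x \<in> S \<Longrightarrow> f x = g x) \<Longrightarrow> smooth_on S f \<Longrightarrow> smooth_on S g"
  unfolding smooth_on_def using Ck_on_cong by blast

lemma smooth_on_subset: "smooth_on S f \<Longrightarrow> T \<subseteq> S \<Longrightarrow> smooth_on T f"
  unfolding smooth_on_def using Ck_on_subset by blast

lemma smooth_on_imp_differentiable: "smooth_on S f \<Longrightarrow> x \<in> S \<Longrightarrow> f differentiable (at x)"
  unfolding smooth_on_def using Ck_on_Suc_dir by blast

lemma smooth_on_imp_continuous_on: "smooth_on S f \<Longrightarrow> continuous_on S f"
  unfolding smooth_on_def using Ck_on_imp_continuous_on by blast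

lemma smooth_on_dir_deriv: "smooth_on S f \<Longrightarrow> smooth_on S (dir_deriv v f)"
  unfolding smooth_on_def using Ck_on_Suc_dir by blast

lemma smooth_on_const: "smooth_on S (\<lambda>x. c)"
  by (simp add: smooth_on_def Ck_on_const)

lemma smooth_on_ident: "smooth_on S (\<lambda>x. x)"
proof -
  have "Ck_on k S (\<lambda>x. x)" for k
    by (cases k) (auto simp: Ck_on_Suc_dir dir_deriv_def Ck_on_const)
  thus ?thesis by (simp add: smooth_on_def)
qed

lemma smooth_on_bounded_linear:
  "bounded_linear L \<Longrightarrow> open S \<Longrightarrow> smooth_on S f \<Longrightarrow> smooth_on S (\<lambda>x. L (f x))"
  by (simp add: smooth_on_def Ck_on_bounded_linear)

lemma smooth_on_add:
  "open S \<Longrightarrow> smooth_on S f \<Longrightarrow> smooth_on S g \<Longrightarrow> smooth_on S (\<lambda>x. f x + g x)"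
  by (simp add: smooth_on_def Ck_on_add)

lemma smooth_on_sum:
  "open S \<Longrightarrow> (\<And>i. i \<in> I \<Longrightarrow> smooth_on S (f i)) \<Longrightarrow> smooth_on S (\<lambda>x. \<Sum>i\<in>I. f i x)"
  by (simp add: smooth_on_def Ck_on_sum)

lemma smooth_on_bilinear:
  "bounded_bilinear B \<Longrightarrow> open S \<Longrightarrow> smooth_on S f \<Longrightarrow> smooth_on S g
    \<Longrightarrow> smooth_on S (\<lambda>x. B (f x) (g x))"
  by (simp add: smooth_on_def Ck_on_bilinear)

lemmas smooth_on_mult = smooth_on_bilinear[OF bounded_bilinear_mult]
lemmas smooth_on_scaleR = smooth_on_bilinear[OF bounded_bilinear_scaleR]
lemmas smooth_on_uminus = smooth_on_bounded_linear[OF bounded_linear_minus[OF bounded_linear_ident]]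
lemmas smooth_on_cnj = smooth_on_bounded_linear[OF bounded_linear_cnj]
lemmas smooth_on_Re = smooth_on_bounded_linear[OF bounded_linear_Re]
lemmas smooth_on_Im = smooth_on_bounded_linear[OF bounded_linear_Im]
lemmas smooth_on_of_real = smooth_on_bounded_linear[OF bounded_linear_of_real]
lemmas smooth_on_fst = smooth_on_bounded_linear[OF bounded_linear_fst]
lemmas smooth_on_snd = smooth_on_bounded_linear[OF bounded_linear_snd]
lemmas smooth_on_nth = smooth_on_bounded_linear[OF bounded_linear_vec_nth]

lemma smooth_on_diff:
  "open S \<Longrightarrow> smooth_on S f \<Longrightarrow> smooth_on S g \<Longrightarrow> smooth_on S (\<lambda>x. f x - g x)"
  using smooth_on_add[of S f "\<lambda>x. - g x"] smooth_on_uminus[of S g] by simp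

lemma smooth_on_compose:
  fixes f :: "'a::real_normed_vector \<Rightarrow> 'b::euclidean_space"
  shows "smooth_on S f \<Longrightarrow> smooth_on T g \<Longrightarrow> open S \<Longrightarrow> open T \<Longrightarrow> f ` S \<subseteq> T
    \<Longrightarrow> smooth_on S (\<lambda>x. g (f x))"
  unfolding smooth_on_def by (metis Ck_on_compose image_subset_iff)

lemma smooth_on_inverse:
  fixes f :: "'a::real_normed_vector \<Rightarrow> 'b::real_normed_field"
  shows "open S \<Longrightarrow> (\<And>x. x \<in> S \<Longrightarrow> f x \<noteq> 0) \<Longrightarrow> smooth_on S f \<Longrightarrow> smooth_on S (\<lambda>x. inverse (f x))"
  by (simp add: smooth_on_def Ck_on_inverse)

lemma smooth_on_Pair:
  assumes "open S" "smooth_on S f" "smooth_on S g"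
  shows "smooth_on S (\<lambda>x. (f x, g x))"
proof -
  have "bounded_linear (\<lambda>a. (a, 0::'c))" "bounded_linear (\<lambda>b. (0::'b, b))"
    by (auto intro!: bounded_linear_Pair bounded_linear_ident bounded_linear_zero)
  from smooth_on_add[OF assms(1) smooth_on_bounded_linear[OF this(1) assms(1,2)]
      smooth_on_bounded_linear[OF this(2) assms(1,3)]]
  show ?thesis by simp
qed

lemma smooth_on_vec_lambda:
  fixes f :: "'k::finite \<Rightarrow> 'a::real_normed_vector \<Rightarrow> complex"
  assumes "open S" "\<And>k. smooth_on S (f k)"
  shows "smooth_on S (\<lambda>x. \<chi> k. f k x)"
proof -
  have "bounded_linear (axis k :: complex \<Rightarrow> complex^'k)" for k
    by (intro linear_conv_bounded_linear[THEN iffD1] linearI) (auto simp: axis_def vec_eq_iff)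
  hence "smooth_on S (\<lambda>x. \<Sum>k\<in>UNIV. axis k (f k x))"
    using smooth_on_bounded_linear[OF _ assms(1) assms(2)] by (intro smooth_on_sum assms(1)) blast
  moreover have "(\<Sum>k\<in>UNIV. axis k (f k x)) = (\<chi> k. f k x)" for x
    by (simp add: vec_eq_iff axis_def if_distrib cong: if_cong)
  ultimately show ?thesis by simp
qed

lemma smooth_on_iff_dir_deriv:
  "smooth_on S f \<longleftrightarrow> (\<forall>x\<in>S. f differentiable (at x)) \<and> (\<forall>v. smooth_on S (dir_deriv v f))"
proof
  assume r: "(\<forall>x\<in>S. f differentiable (at x)) \<and> (\<forall>v. smooth_on S (dir_deriv v f))"
  hence "Ck_on (Suc k) S f" for k by (simp add: smooth_on_def Ck_on_Suc_dir)
  thus "smooth_on S f" unfolding smooth_on_def using Ck_on_SucD by blast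
qed (auto intro: smooth_on_imp_differentiable smooth_on_dir_deriv)

subsection \<open>Symmetry of the second derivative\<close>

text \<open>The mean value inequality for \<open>t \<mapsto> f (x + t v) - t c\<close>.\<close>

lemma segment_increment_bound:
  fixes f :: "'a::real_normed_vector \<Rightarrow> 'b::real_normed_vector"
  assumes "\<And>t. 0 \<le> t \<Longrightarrow> t \<le> 1 \<Longrightarrow> f differentiable (at (x + t *\<^sub>R v))"
    and "\<And>t. 0 \<le> t \<Longrightarrow> t \<le> 1 \<Longrightarrow> norm (dir_deriv v f (x + t *\<^sub>R v) - c) \<le> e"
  shows "norm (f (x + v) - f x - c) \<le> e"
proof -
  define g where "g t = f (x + t *\<^sub>R v) - t *\<^sub>R c" for t
  have "norm (g 1 - g 0) \<le> e * norm (1 - 0 :: real)"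
  proof (rule differentiable_bound[of "{0..1}" g "\<lambda>t s. s *\<^sub>R (dir_deriv v f (x + t *\<^sub>R v) - c)"])
    fix t :: real assume t: "t \<in> {0..1}"
    have d: "f differentiable (at (x + t *\<^sub>R v))" using assms(1) t by auto
    have sc: "dir_deriv (s *\<^sub>R v) f (x + t *\<^sub>R v) = s *\<^sub>R dir_deriv v f (x + t *\<^sub>R v)" for s
      using linear_dir_deriv[OF d] linear_scale by blast
    have l: "((\<lambda>t. x + t *\<^sub>R v) has_derivative (\<lambda>s. s *\<^sub>R v)) (at t)"
      by (auto intro!: derivative_eq_intros)
    have "((f \<circ> (\<lambda>t. x + t *\<^sub>R v)) has_derivative
        ((\<lambda>u. dir_deriv u f (x + t *\<^sub>R v)) \<circ> (\<lambda>s. s *\<^sub>R v))) (at t)"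
      by (rule diff_chain_at[OF l has_derivative_dir_deriv[OF d]])
    hence "(g has_derivative (\<lambda>s. s *\<^sub>R (dir_deriv v f (x + t *\<^sub>R v) - c))) (at t)"
      unfolding g_def by (auto intro!: derivative_eq_intros simp: o_def sc scaleR_diff_right)
    thus "(g has_derivative (\<lambda>s. s *\<^sub>R (dir_deriv v f (x + t *\<^sub>R v) - c))) (at t within {0..1})"
      by (rule has_derivative_at_withinI)
    have "0 \<le> e" using assms(2)[of t] t norm_ge_zero order_trans by (metis atLeastAtMost_iff)
    show "onorm (\<lambda>s. s *\<^sub>R (dir_deriv v f (x + t *\<^sub>R v) - c)) \<le> e"
      by (rule onorm_le) (use assms(2)[of t] t in \<open>auto simp: mult.commute[of e] intro: mult_left_mono\<close>)
  qed auto
  thus ?thesis by (simp add: g_def algebra_simps)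
qed

text \<open>The mean value inequality is applied twice: to \<open>y \<mapsto> f (y + s w) - f y\<close> along \<open>v\<close>, and then to the
  derivative of \<open>f\<close> along \<open>v\<close> in the direction \<open>w\<close>.\<close>

lemma second_difference_quotient:
  fixes f :: "'a::real_normed_vector \<Rightarrow> 'b::real_normed_vector"
  assumes S: "open S" "x \<in> S" and f: "smooth_on S f" and "0 < e"
  shows "\<forall>\<^sub>F s in at_right 0. norm (f (x + s *\<^sub>R v + s *\<^sub>R w) - f (x + s *\<^sub>R v) - f (x + s *\<^sub>R w) + f x
            - s\<^sup>2 *\<^sub>R dir_deriv w (dir_deriv v f) x) \<le> s\<^sup>2 * e"
proof -
  define c where "c = dir_deriv w (dir_deriv v f) x"
  have cont: "continuous_on S (dir_deriv w (dir_deriv v f))"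
    by (intro smooth_on_imp_continuous_on smooth_on_dir_deriv f)
  obtain d0 where d0: "d0 > 0" "ball x d0 \<subseteq> S" using S openE by blast
  obtain d1 where d1: "d1 > 0" "\<And>y. y \<in> S \<Longrightarrow> dist y x < d1 \<Longrightarrow> dist (dir_deriv w (dir_deriv v f) y) c < e"
    using cont S \<open>0 < e\<close> unfolding continuous_on_iff c_def by metis
  define d where "d = min d0 d1"
  have near: "y \<in> S \<and> norm (dir_deriv w (dir_deriv v f) y - c) \<le> e" if "dist y x < d" for y
  proof -
    have "y \<in> S" using d0(2) that by (auto simp: d_def dist_commute)
    moreover have "dist (dir_deriv w (dir_deriv v f) y) c < e"
      using d1(2)[OF \<open>y \<in> S\<close>] that by (simp add: d_def)
    ultimately show ?thesis by (simp add: dist_norm)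
  qed
  have "d > 0" using d0 d1 by (simp add: d_def)
  have "\<forall>\<^sub>F s in at_right 0. s * (norm v + norm w) < d"
  proof -
    have "((\<lambda>s. s * (norm v + norm w)) \<longlongrightarrow> 0 * (norm v + norm w)) (at_right 0)"
      by (intro tendsto_intros)
    thus ?thesis using \<open>d > 0\<close> by (intro order_tendstoD(2)) auto
  qed
  moreover have "\<forall>\<^sub>F s in at_right (0::real). s > 0" by (rule eventually_at_right_less)
  ultimately show ?thesis
  proof eventually_elim
    case (elim s)
    have in_ball: "dist (x + a *\<^sub>R v + b *\<^sub>R w) x < d" if "0 \<le> a" "a \<le> s" "0 \<le> b" "b \<le> s" for a b
    proof -
      have "dist (x + a *\<^sub>R v + b *\<^sub>R w) x = norm (a *\<^sub>R v + b *\<^sub>R w)" by (simp add: dist_norm add.assoc)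
      also have "\<dots> \<le> a * norm v + b * norm w" using that norm_triangle_ineq[of "a *\<^sub>R v" "b *\<^sub>R w"] by simp
      also have "\<dots> \<le> s * (norm v + norm w)"
        using that by (simp add: distrib_left add_mono mult_right_mono)
      finally show ?thesis using elim by simp
    qed
    define g where "g y = f (y + s *\<^sub>R w) - f y" for y
    have dg: "g differentiable (at y)" "dir_deriv u g y = dir_deriv u f (y + s *\<^sub>R w) - dir_deriv u f y"
      if "y + s *\<^sub>R w \<in> S" "y \<in> S" for y u
    proof -
      have "((f \<circ> (\<lambda>y. y + s *\<^sub>R w)) has_derivative ((\<lambda>u. dir_deriv u f (y + s *\<^sub>R w)) \<circ> (\<lambda>u. u))) (at y)"
      proof (rule diff_chain_at)
        show "(f has_derivative (\<lambda>u. dir_deriv u f (y + s *\<^sub>R w))) (at (y + s *\<^sub>R w))"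
          by (rule has_derivative_dir_deriv[OF smooth_on_imp_differentiable[OF f that(1)]])
      qed (auto intro!: derivative_eq_intros)
      hence "(g has_derivative (\<lambda>u. dir_deriv u f (y + s *\<^sub>R w) - dir_deriv u f y)) (at y)"
        unfolding g_def o_def
        by (rule has_derivative_diff[OF _ has_derivative_dir_deriv[OF smooth_on_imp_differentiable[OF f that(2)]]])
      thus "g differentiable (at y)" "dir_deriv u g y = dir_deriv u f (y + s *\<^sub>R w) - dir_deriv u f y"
        by (auto simp: differentiable_def dir_deriv_eq)
    qed
    have sc: "dir_deriv (a *\<^sub>R u) k y = a *\<^sub>R dir_deriv u k y" if "k differentiable (at y)"
      for k :: "'a \<Rightarrow> 'b" and a u y using linear_dir_deriv[OF that] linear_scale by blast
    have inner: "norm (dir_deriv v f (y + s *\<^sub>R w) - dir_deriv v f y - s *\<^sub>R c) \<le> s * e"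
      if "y = x + t *\<^sub>R s *\<^sub>R v" "0 \<le> t" "t \<le> 1" for y t
    proof (rule segment_increment_bound)
      fix r :: real assume r: "0 \<le> r" "r \<le> 1"
      have *: "t * s \<le> s" "r * s \<le> s" using r that elim by (auto simp: mult_left_le_one_le)
      have n: "dist (y + r *\<^sub>R s *\<^sub>R w) x < d"
        using in_ball[of "t * s" "r * s"] r elim that * by simp
      thus d: "dir_deriv v f differentiable at (y + r *\<^sub>R s *\<^sub>R w)"
        using near smooth_on_imp_differentiable smooth_on_dir_deriv f by blast
      have "norm (s *\<^sub>R (dir_deriv w (dir_deriv v f) (y + r *\<^sub>R s *\<^sub>R w) - c)) \<le> s * e"
        using near[OF n] elim by simp
      thus "norm (dir_deriv (s *\<^sub>R w) (dir_deriv v f) (y + r *\<^sub>R s *\<^sub>R w) - s *\<^sub>R c) \<le> s * e"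
        using sc[OF d] by (simp add: scaleR_diff_right)
    qed
    have "norm (g (x + s *\<^sub>R v) - g x - s\<^sup>2 *\<^sub>R c) \<le> s\<^sup>2 * e"
    proof (rule segment_increment_bound)
      fix t :: real assume t: "0 \<le> t" "t \<le> 1"
      have *: "t * s \<le> s" using t elim by (auto simp: mult_left_le_one_le)
      have n: "x + t *\<^sub>R s *\<^sub>R v + s *\<^sub>R w \<in> S" "x + t *\<^sub>R s *\<^sub>R v \<in> S"
        using near in_ball[of "t * s" s] in_ball[of "t * s" 0] t elim * by auto
      show d: "g differentiable at (x + t *\<^sub>R s *\<^sub>R v)" by (rule dg[OF n])
      have "norm (s *\<^sub>R (dir_deriv v f (x + t *\<^sub>R s *\<^sub>R v + s *\<^sub>R w) - dir_deriv v f (x + t *\<^sub>R s *\<^sub>R v) - s *\<^sub>R c))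
          \<le> s * (s * e)"
        using inner[OF refl t] elim by simp
      thus "norm (dir_deriv (s *\<^sub>R v) g (x + t *\<^sub>R s *\<^sub>R v) - s\<^sup>2 *\<^sub>R c) \<le> s\<^sup>2 * e"
        unfolding sc[OF d] unfolding dg(2)[OF n] by (simp add: scaleR_diff_right power2_eq_square mult.assoc)
    qed
    thus ?case by (simp add: g_def c_def algebra_simps)
  qed
qed

text \<open>The second difference is symmetric in \<open>v\<close> and \<open>w\<close>, and its quotient by \<open>s\<^sup>2\<close> approaches both mixed
  derivatives.\<close>

lemma dir_deriv_commute:
  fixes f :: "'a::real_normed_vector \<Rightarrow> 'b::real_normed_vector"
  assumes "open S" "x \<in> S" "smooth_on S f"
  shows "dir_deriv v (dir_deriv w f) x = dir_deriv w (dir_deriv v f) x"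
proof -
  let ?a = "dir_deriv v (dir_deriv w f) x" and ?b = "dir_deriv w (dir_deriv v f) x"
  have "norm (?a - ?b) \<le> 2 * e" if "e > 0" for e
  proof -
    have "\<forall>\<^sub>F s in at_right (0::real). s\<^sup>2 * norm (?a - ?b) \<le> s\<^sup>2 * (2 * e) \<and> s > 0"
      using second_difference_quotient[OF assms that, of v w]
        second_difference_quotient[OF assms that, of w v] eventually_at_right_less[of "0::real"]
    proof eventually_elim
      case (elim s)
      let ?d = "f (x + s *\<^sub>R v + s *\<^sub>R w) - f (x + s *\<^sub>R v) - f (x + s *\<^sub>R w) + f x"
      have "norm (?d - s\<^sup>2 *\<^sub>R ?b) \<le> s\<^sup>2 * e" "norm (?d - s\<^sup>2 *\<^sub>R ?a) \<le> s\<^sup>2 * e"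
        using elim by (simp_all add: algebra_simps)
      hence "norm ((?d - s\<^sup>2 *\<^sub>R ?b) - (?d - s\<^sup>2 *\<^sub>R ?a)) \<le> s\<^sup>2 * e + s\<^sup>2 * e"
        by (meson norm_triangle_le_diff add_mono)
      moreover have "(?d - s\<^sup>2 *\<^sub>R ?b) - (?d - s\<^sup>2 *\<^sub>R ?a) = s\<^sup>2 *\<^sub>R (?a - ?b)" by (simp add: scaleR_diff_right)
      ultimately have "norm (s\<^sup>2 *\<^sub>R (?a - ?b)) \<le> s\<^sup>2 * e + s\<^sup>2 * e" by metis
      hence "s\<^sup>2 * norm (?a - ?b) \<le> s\<^sup>2 * (2 * e)" by (simp add: mult_ac)
      thus ?case using elim by simp
    qed
    then obtain s :: real where "s\<^sup>2 * norm (?a - ?b) \<le> s\<^sup>2 * (2 * e)" "s > 0"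
      using eventually_happens by (metis (mono_tags, lifting) trivial_limit_at_right_real)
    thus ?thesis by simp
  qed
  from this[of "e / 2" for e] have "norm (?a - ?b) \<le> 0 + e" if "e > 0" for e using that by simp
  hence "norm (?a - ?b) \<le> 0" by (rule field_le_epsilon)
  thus ?thesis by simp
qed

section \<open>Flat functions and infinite jets\<close>

definition smooth_at :: "'a::real_normed_vector \<Rightarrow> ('a \<Rightarrow> 'b::real_normed_vector) \<Rightarrow> bool" where
  "smooth_at p f \<longleftrightarrow> (\<exists>W. open W \<and> p \<in> W \<and> smooth_on W f)"

definition flat_at :: "'a::real_normed_vector \<Rightarrow> ('a \<Rightarrow> 'b::real_normed_vector) \<Rightarrow> bool" where
  "flat_at p f \<longleftrightarrow> (\<forall>vs. iter_deriv vs f p = 0)"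

lemma smooth_atI: "open W \<Longrightarrow> p \<in> W \<Longrightarrow> smooth_on W f \<Longrightarrow> smooth_at p f"
  unfolding smooth_at_def by blast

lemma smooth_atE:
  assumes "smooth_at p f" obtains W where "open W" "p \<in> W" "smooth_on W f"
  using assms unfolding smooth_at_def by blast

lemma smooth_at_common:
  assumes "smooth_at p f" "smooth_at p g"
  obtains W where "open W" "p \<in> W" "smooth_on W f" "smooth_on W g"
proof -
  obtain A where A: "open A" "p \<in> A" "smooth_on A f" by (rule smooth_atE[OF assms(1)])
  obtain B where B: "open B" "p \<in> B" "smooth_on B g" by (rule smooth_atE[OF assms(2)])
  show ?thesis
    by (rule that[of "A \<inter> B"]) (use A B smooth_on_subset[OF A(3)] smooth_on_subset[OF B(3)] in auto)
qed

lemma smooth_at_const: "smooth_at p (\<lambda>x. c)"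
  by (rule smooth_atI[of UNIV]) (auto intro: smooth_on_const)

lemma smooth_at_ident: "smooth_at p (\<lambda>x. x)"
  by (rule smooth_atI[of UNIV]) (auto intro: smooth_on_ident)

lemma smooth_at_bounded_linear:
  assumes "bounded_linear L" "smooth_at p f" shows "smooth_at p (\<lambda>x. L (f x))"
proof -
  obtain W where W: "open W" "p \<in> W" "smooth_on W f" by (rule smooth_atE[OF assms(2)])
  show ?thesis by (rule smooth_atI[OF W(1,2) smooth_on_bounded_linear[OF assms(1) W(1,3)]])
qed

lemma smooth_at_bilinear:
  assumes "bounded_bilinear B" "smooth_at p f" "smooth_at p g"
  shows "smooth_at p (\<lambda>x. B (f x) (g x))"
proof -
  obtain W where W: "open W" "p \<in> W" "smooth_on W f" "smooth_on W g"
    by (rule smooth_at_common[OF assms(2,3)])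
  show ?thesis by (rule smooth_atI[OF W(1,2) smooth_on_bilinear[OF assms(1) W(1,3,4)]])
qed

lemma smooth_at_add:
  assumes "smooth_at p f" "smooth_at p g" shows "smooth_at p (\<lambda>x. f x + g x)"
proof -
  obtain W where W: "open W" "p \<in> W" "smooth_on W f" "smooth_on W g"
    by (rule smooth_at_common[OF assms])
  show ?thesis by (rule smooth_atI[OF W(1,2) smooth_on_add[OF W(1,3,4)]])
qed

lemma smooth_at_diff:
  assumes "smooth_at p f" "smooth_at p g" shows "smooth_at p (\<lambda>x. f x - g x)"
proof -
  obtain W where W: "open W" "p \<in> W" "smooth_on W f" "smooth_on W g"
    by (rule smooth_at_common[OF assms])
  show ?thesis by (rule smooth_atI[OF W(1,2) smooth_on_diff[OF W(1,3,4)]])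
qed

lemmas smooth_at_mult = smooth_at_bilinear[OF bounded_bilinear_mult]
lemmas smooth_at_uminus = smooth_at_bounded_linear[OF bounded_linear_minus[OF bounded_linear_ident]]
lemmas smooth_at_cnj = smooth_at_bounded_linear[OF bounded_linear_cnj]
lemmas smooth_at_of_real = smooth_at_bounded_linear[OF bounded_linear_of_real]
lemmas smooth_at_fst = smooth_at_bounded_linear[OF bounded_linear_fst]
lemmas smooth_at_snd = smooth_at_bounded_linear[OF bounded_linear_snd]
lemmas smooth_at_nth = smooth_at_bounded_linear[OF bounded_linear_vec_nth]

lemma smooth_at_sum: "(\<And>i. i \<in> I \<Longrightarrow> smooth_at p (f i)) \<Longrightarrow> smooth_at p (\<lambda>x. \<Sum>i\<in>I. f i x)"
proof (induction I rule: infinite_finite_induct)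
  case (insert i I)
  have "smooth_at p (\<lambda>x. f i x + (\<Sum>i\<in>I. f i x))"
    by (rule smooth_at_add) (use insert in auto)
  thus ?case using insert by simp
qed (simp_all add: smooth_at_const)

lemma smooth_at_dir_deriv: "smooth_at p f \<Longrightarrow> smooth_at p (dir_deriv v f)"
  unfolding smooth_at_def by (auto intro: smooth_on_dir_deriv)

lemma smooth_at_imp_differentiable: "smooth_at p f \<Longrightarrow> f differentiable (at p)"
  unfolding smooth_at_def by (auto intro: smooth_on_imp_differentiable)

lemma smooth_at_compose:
  fixes f :: "'a::real_normed_vector \<Rightarrow> 'b::euclidean_space"
  assumes "smooth_at p f" "smooth_at (f p) g"
  shows "smooth_at p (\<lambda>x. g (f x))"
proof -
  obtain W where W: "open W" "p \<in> W" "smooth_on W f" by (rule smooth_atE[OF assms(1)])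
  obtain V where V: "open V" "f p \<in> V" "smooth_on V g" by (rule smooth_atE[OF assms(2)])
  have "open (f -` V \<inter> W)"
    using continuous_on_open_vimage[OF W(1), of f] smooth_on_imp_continuous_on[OF W(3)] V(1) by metis
  thus ?thesis using W V smooth_on_subset[OF W(3), of "f -` V \<inter> W"]
    by (intro smooth_atI[of "f -` V \<inter> W"] smooth_on_compose[of _ f V g]) auto
qed

lemma smooth_at_cong:
  assumes "smooth_at p f" "open W" "p \<in> W" "\<And>x. x \<in> W \<Longrightarrow> f x = g x"
  shows "smooth_at p g"
proof -
  obtain V where V: "open V" "p \<in> V" "smooth_on V f" by (rule smooth_atE[OF assms(1)])
  have "smooth_on (V \<inter> W) g"
    by (rule smooth_on_cong[of _ f]) (use V assms smooth_on_subset[OF V(3), of "V \<inter> W"] in auto)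
  thus ?thesis using V assms by (intro smooth_atI[of "V \<inter> W"]) auto
qed

subsection \<open>Flat functions\<close>

lemma iter_deriv_Cons: "iter_deriv (v # vs) f = dir_deriv v (iter_deriv vs f)"
  by (simp add: dir_deriv_def)

lemma iter_deriv_snoc: "iter_deriv (vs @ [v]) f = iter_deriv vs (dir_deriv v f)"
  by (induction vs) (simp_all add: dir_deriv_def)

lemma iter_deriv_cong_open:
  assumes "open S" "\<And>x. x \<in> S \<Longrightarrow> f x = g x" "x \<in> S"
  shows "iter_deriv vs f x = iter_deriv vs g x"
  using assms(3)
proof (induction vs arbitrary: x)
  case (Cons v vs)
  show ?case unfolding iter_deriv_Cons
    by (rule dir_deriv_cong_open[OF assms(1) Cons.prems]) (rule Cons.IH)
qed (use assms in simp)

lemma flat_at_cong: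
  assumes "open W" "p \<in> W" "\<And>x. x \<in> W \<Longrightarrow> f x = g x"
  shows "flat_at p f \<longleftrightarrow> flat_at p g"
  unfolding flat_at_def using iter_deriv_cong_open[OF assms(1,3,2)] by simp

lemma flat_at_iff: "flat_at p f \<longleftrightarrow> f p = 0 \<and> (\<forall>v. flat_at p (dir_deriv v f))"
proof (safe)
  show "flat_at p f \<Longrightarrow> f p = 0" unfolding flat_at_def by (drule spec[of _ "[]"]) simp
  show "flat_at p f \<Longrightarrow> flat_at p (dir_deriv v f)" for v
    unfolding flat_at_def iter_deriv_snoc[symmetric] by blast
  assume "f p = 0" "\<forall>v. flat_at p (dir_deriv v f)"
  hence "iter_deriv vs f p = 0" for vs
    by (cases vs rule: rev_cases) (auto simp: flat_at_def iter_deriv_snoc simp del: iter_deriv.simps(2))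
  thus "flat_at p f" by (simp add: flat_at_def)
qed

lemma flat_at_value: "flat_at p f \<Longrightarrow> f p = 0"
  and flat_at_dir_deriv: "flat_at p f \<Longrightarrow> flat_at p (dir_deriv v f)"
  using flat_at_iff by blast+

lemma vanishes_to_infinite_order_iff: "vanishes_to_infinite_order_on S f \<longleftrightarrow> (\<forall>x\<in>S. flat_at x f)"
  unfolding vanishes_to_infinite_order_on_def flat_at_def by blast

lemma iter_deriv_add:
  assumes "open S" "smooth_on S f" "smooth_on S g" "x \<in> S"
  shows "iter_deriv vs (\<lambda>x. f x + g x) x = iter_deriv vs f x + iter_deriv vs g x"
  using assms(2-4)
proof (induction vs arbitrary: f g x rule: rev_induct)
  case (snoc v vs)
  have "iter_deriv vs (dir_deriv v (\<lambda>x. f x + g x)) x = iter_deriv vs (\<lambda>x. dir_deriv v f x + dir_deriv v g x) x"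
    using snoc.prems
    by (intro iter_deriv_cong_open[OF assms(1)] dir_deriv_add) (auto intro: smooth_on_imp_differentiable)
  also have "\<dots> = iter_deriv vs (dir_deriv v f) x + iter_deriv vs (dir_deriv v g) x"
    by (rule snoc.IH[OF smooth_on_dir_deriv[OF snoc.prems(1)] smooth_on_dir_deriv[OF snoc.prems(2)] snoc.prems(3)])
  finally show ?case by (simp only: iter_deriv_snoc)
qed simp

lemma flat_at_add:
  assumes "smooth_at p f" "smooth_at p g" "flat_at p f" "flat_at p g"
  shows "flat_at p (\<lambda>x. f x + g x)"
proof -
  obtain W where "open W" "p \<in> W" "smooth_on W f" "smooth_on W g"
    using smooth_at_common[OF assms(1,2)] by blast
  from iter_deriv_add[OF this(1,3,4,2)] assms show ?thesis by (simp add: flat_at_def)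
qed

lemma iter_deriv_zero: "iter_deriv vs (\<lambda>x. 0) = (\<lambda>x. 0)"
  by (induction vs) auto

lemma flat_at_zero: "flat_at p (\<lambda>x. 0)"
  by (simp add: flat_at_def iter_deriv_zero)

lemma iter_deriv_sum:
  assumes "open S" "\<And>i. i \<in> I \<Longrightarrow> smooth_on S (f i)" "x \<in> S"
  shows "iter_deriv vs (\<lambda>x. \<Sum>i\<in>I. f i x) x = (\<Sum>i\<in>I. iter_deriv vs (f i) x)"
  using assms(2)
proof (induction I rule: infinite_finite_induct)
  case (insert i I)
  have "iter_deriv vs (\<lambda>x. f i x + (\<Sum>i\<in>I. f i x)) x
      = iter_deriv vs (f i) x + iter_deriv vs (\<lambda>x. \<Sum>i\<in>I. f i x) x"
    by (rule iter_deriv_add[OF assms(1) _ _ assms(3)]) (use insert assms(1) in \<open>auto intro: smooth_on_sum\<close>)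
  thus ?case using insert by simp
qed (simp_all add: iter_deriv_zero)

lemma flat_at_bounded_linear:
  assumes "bounded_linear L" "smooth_at p f" "flat_at p f"
  shows "flat_at p (\<lambda>x. L (f x))"
proof -
  obtain W where W: "open W" "p \<in> W" "smooth_on W f" by (rule smooth_atE[OF assms(2)])
  have "iter_deriv vs (\<lambda>x. L (f x)) p = 0" for vs
    using W(3) assms(3)
  proof (induction vs arbitrary: f rule: rev_induct)
    case Nil thus ?case using flat_at_value[OF Nil(2)] linear_simps(3)[OF assms(1)] by simp
  next
    case (snoc v vs)
    have "dir_deriv v (\<lambda>x. L (f x)) x = L (dir_deriv v f x)" if "x \<in> W" for x
      using dir_deriv_eq[OF bounded_linear.has_derivative[OF assms(1) has_derivative_dir_deriv]]
        smooth_on_imp_differentiable[OF snoc.prems(1) that] .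
    hence "iter_deriv vs (dir_deriv v (\<lambda>x. L (f x))) p = iter_deriv vs (\<lambda>x. L (dir_deriv v f x)) p"
      by (intro iter_deriv_cong_open[OF W(1) _ W(2)])
    also have "\<dots> = 0" using snoc by (auto intro: smooth_on_dir_deriv flat_at_dir_deriv)
    finally show ?case by (simp only: iter_deriv_snoc)
  qed
  thus ?thesis by (simp add: flat_at_def)
qed

text \<open>By the product rule a derivative of such a product is a sum of two products, each with a flat
  factor.\<close>

lemma flat_at_bilinear:
  assumes B: "bounded_bilinear B" and "smooth_at p f" "smooth_at p g" "flat_at p f"
  shows "flat_at p (\<lambda>x. B (f x) (g x))"
proof -
  obtain W where W: "open W" "p \<in> W" "smooth_on W f" "smooth_on W g"
    using smooth_at_common[OF assms(2,3)] by blast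
  have "iter_deriv vs (\<lambda>x. B (f x) (g x)) p = 0" for vs
    using W(3,4) assms(4)
  proof (induction vs arbitrary: f g rule: rev_induct)
    case Nil thus ?case using flat_at_value[OF Nil(3)] bounded_bilinear.zero_left[OF B] by simp
  next
    case (snoc v vs)
    have "iter_deriv vs (dir_deriv v (\<lambda>x. B (f x) (g x))) p
        = iter_deriv vs (\<lambda>x. B (f x) (dir_deriv v g x) + B (dir_deriv v f x) (g x)) p"
      using snoc.prems W
      by (intro iter_deriv_cong_open[OF W(1) _ W(2)] dir_deriv_bilinear[OF B])
        (auto intro: smooth_on_imp_differentiable)
    also have "\<dots> = iter_deriv vs (\<lambda>x. B (f x) (dir_deriv v g x)) p
        + iter_deriv vs (\<lambda>x. B (dir_deriv v f x) (g x)) p"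
      using snoc.prems W by (intro iter_deriv_add[OF W(1)] smooth_on_bilinear[OF B] smooth_on_dir_deriv)
    also have "\<dots> = 0"
      using snoc.IH[OF snoc.prems(1) smooth_on_dir_deriv[OF snoc.prems(2)] snoc.prems(3)]
        snoc.IH[OF smooth_on_dir_deriv[OF snoc.prems(1)] snoc.prems(2) flat_at_dir_deriv[OF snoc.prems(3)]]
      by simp
    finally show ?case by (simp only: iter_deriv_snoc)
  qed
  thus ?thesis by (simp add: flat_at_def)
qed

lemmas flat_at_mult = flat_at_bilinear[OF bounded_bilinear_mult]

text \<open>By the chain rule a derivative of a function \<open>\<chi> \<cdot> (g \<circ> f)\<close> with \<open>g\<close> flat is a sum of
  functions of the same kind; the factor \<open>\<chi>\<close> is there to make the induction work.\<close>

lemma flat_at_compose: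
  fixes f :: "'a::real_normed_vector \<Rightarrow> 'b::euclidean_space"
  assumes "smooth_at p f" "smooth_at (f p) g" "flat_at (f p) g"
  shows "flat_at p (\<lambda>x. g (f x))"
proof -
  obtain V where V: "open V" "f p \<in> V" "smooth_on V g" by (rule smooth_atE[OF assms(2)])
  obtain W0 where W0: "open W0" "p \<in> W0" "smooth_on W0 f" by (rule smooth_atE[OF assms(1)])
  define W where "W = f -` V \<inter> W0"
  have W: "open W" "p \<in> W" "smooth_on W f" "f ` W \<subseteq> V"
    using smooth_on_imp_continuous_on[OF W0(3)] W0 V smooth_on_subset[of W0 f W]
      continuous_on_open_vimage[OF W0(1), of f]
    unfolding W_def by auto
  have "iter_deriv vs (\<lambda>x. c x *\<^sub>R g (f x)) p = 0" if "smooth_on W c" for c :: "'a \<Rightarrow> real" and vs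
    using that V(3) assms(3)
  proof (induction vs arbitrary: c g rule: rev_induct)
    case Nil thus ?case using flat_at_value[OF Nil(3)] by simp
  next
    case (snoc v vs)
    define h where "h b x = (c x * (dir_deriv v f x \<bullet> b)) *\<^sub>R dir_deriv b g (f x)" for b x
    have gf: "smooth_on W (\<lambda>x. k (f x))" if "smooth_on V k" for k :: "'b \<Rightarrow> 'c"
      using smooth_on_compose[OF W(3) that W(1) V(1) W(4)] .
    have fb: "smooth_on W (\<lambda>x. c x * (dir_deriv v f x \<bullet> b))" for b
      by (intro smooth_on_mult W snoc.prems
          smooth_on_bounded_linear[OF bounded_linear_inner_left W(1) smooth_on_dir_deriv])
    have d: "dir_deriv v (\<lambda>x. c x *\<^sub>R g (f x)) x = (\<Sum>b\<in>Basis. h b x) + dir_deriv v c x *\<^sub>R g (f x)"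
      if "x \<in> W" for x
    proof -
      have dg: "g differentiable (at (f x))" "f differentiable (at x)" "c differentiable (at x)"
        using that W snoc.prems by (auto intro: smooth_on_imp_differentiable)
      have "dir_deriv v (\<lambda>x. c x *\<^sub>R g (f x)) x
          = c x *\<^sub>R dir_deriv v (\<lambda>x. g (f x)) x + dir_deriv v c x *\<^sub>R g (f x)"
        using that by (intro dir_deriv_bilinear[OF bounded_bilinear_scaleR] dg
            smooth_on_imp_differentiable[OF gf] snoc.prems)
      thus ?thesis using dir_deriv_compose[OF dg(2,1), of v] by (simp add: h_def scaleR_sum_right)
    qed
    have hs: "smooth_on W (h b)" for b
      unfolding h_def using snoc.prems by (intro smooth_on_scaleR W fb gf smooth_on_dir_deriv)
    have hf: "iter_deriv vs (h b) p = 0" for b unfolding h_def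
      by (rule snoc.IH[OF fb smooth_on_dir_deriv[OF snoc.prems(2)] flat_at_dir_deriv[OF snoc.prems(3)]])
    have "iter_deriv vs (dir_deriv v (\<lambda>x. c x *\<^sub>R g (f x))) p
        = iter_deriv vs (\<lambda>x. (\<Sum>b\<in>Basis. h b x) + dir_deriv v c x *\<^sub>R g (f x)) p"
      by (rule iter_deriv_cong_open[OF W(1) d W(2)])
    also have "\<dots> = iter_deriv vs (\<lambda>x. \<Sum>b\<in>Basis. h b x) p + iter_deriv vs (\<lambda>x. dir_deriv v c x *\<^sub>R g (f x)) p"
      using snoc.prems by (intro iter_deriv_add[OF W(1) _ _ W(2)] smooth_on_sum hs smooth_on_scaleR smooth_on_dir_deriv gf W(1))
    also have "\<dots> = 0"
      using snoc.IH[OF smooth_on_dir_deriv[OF snoc.prems(1)] snoc.prems(2,3)]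
      by (simp add: iter_deriv_sum[OF W(1) hs W(2)] hf)
    finally show ?case by (simp only: iter_deriv_snoc)
  qed
  from this[OF smooth_on_const[of W 1]] show ?thesis by (simp add: flat_at_def)
qed

subsection \<open>Wirtinger derivatives\<close>

lemma smooth_at_wirtinger:
  assumes "smooth_at p f" shows "smooth_at p (wirtinger f v)" "smooth_at p (wirtinger_bar f v)"
proof -
  have *: "smooth_at p (dir_deriv w f)" for w by (rule smooth_at_dir_deriv[OF assms])
  have "smooth_at p (\<lambda>x. (dir_deriv v f x - \<i> * dir_deriv (cscale \<i> v) f x) * (1 / 2))"
    "smooth_at p (\<lambda>x. (dir_deriv v f x + \<i> * dir_deriv (cscale \<i> v) f x) * (1 / 2))"
    by (intro smooth_at_mult smooth_at_add smooth_at_diff smooth_at_const *)+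
  thus "smooth_at p (wirtinger f v)" "smooth_at p (wirtinger_bar f v)"
    by (simp_all add: wirtinger_def[abs_def] wirtinger_bar_def[abs_def] dir_deriv_def)
qed

lemma wirtinger_dir_deriv:
  "wirtinger f v x = (dir_deriv v f x - \<i> * dir_deriv (cscale \<i> v) f x) / 2"
  "wirtinger_bar f v x = (dir_deriv v f x + \<i> * dir_deriv (cscale \<i> v) f x) / 2"
  by (simp_all add: wirtinger_def wirtinger_bar_def dir_deriv_def)

lemma dir_deriv_wirtinger: "dir_deriv v f x = wirtinger f v x + wirtinger_bar f v x"
  by (simp add: wirtinger_dir_deriv field_simps)

lemma wirtinger_cong_open:
  assumes "open S" "x \<in> S" "\<And>y. y \<in> S \<Longrightarrow> f y = g y"
  shows "wirtinger f v x = wirtinger g v x" "wirtinger_bar f v x = wirtinger_bar g v x"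
  using dir_deriv_cong_open[OF assms] by (simp_all add: wirtinger_dir_deriv)

lemma wirtinger_add:
  assumes "f differentiable (at x)" "g differentiable (at x)"
  shows "wirtinger (\<lambda>x. f x + g x) v x = wirtinger f v x + wirtinger g v x"
    "wirtinger_bar (\<lambda>x. f x + g x) v x = wirtinger_bar f v x + wirtinger_bar g v x"
  by (simp_all add: wirtinger_dir_deriv dir_deriv_add[OF assms] field_simps)

lemma wirtinger_mult:
  assumes "f differentiable (at x)" "g differentiable (at x)"
  shows "wirtinger (\<lambda>x. f x * g x) v x = wirtinger f v x * g x + f x * wirtinger g v x"
    "wirtinger_bar (\<lambda>x. f x * g x) v x = wirtinger_bar f v x * g x + f x * wirtinger_bar g v x"
  by (simp_all add: wirtinger_dir_deriv dir_deriv_bilinear[OF bounded_bilinear_mult assms] field_simps)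

lemma dir_deriv_cnj:
  assumes "f differentiable (at x)"
  shows "dir_deriv v (\<lambda>x. cnj (f x)) x = cnj (dir_deriv v f x)"
  by (rule dir_deriv_eq[OF has_derivative_cnj[OF has_derivative_dir_deriv[OF assms]]])

lemma wirtinger_cnj:
  assumes "f differentiable (at x)"
  shows "wirtinger (\<lambda>x. cnj (f x)) v x = cnj (wirtinger_bar f v x)"
    "wirtinger_bar (\<lambda>x. cnj (f x)) v x = cnj (wirtinger f v x)"
  by (simp_all add: wirtinger_dir_deriv dir_deriv_cnj[OF assms])

lemma wirtinger_const: "wirtinger (\<lambda>x. c) v = (\<lambda>x. 0)" "wirtinger_bar (\<lambda>x. c) v = (\<lambda>x. 0)"
  by (simp_all add: wirtinger_dir_deriv fun_eq_iff)

lemma flat_at_wirtinger: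
  assumes "smooth_at p f" "flat_at p f"
  shows "flat_at p (wirtinger f v)" "flat_at p (wirtinger_bar f v)"
proof -
  have *: "smooth_at p (dir_deriv w f)" "flat_at p (dir_deriv w f)" for w
    using assms smooth_at_dir_deriv flat_at_dir_deriv by auto
  have "bounded_linear (\<lambda>z::complex. z * (1/2))" "bounded_linear (\<lambda>z::complex. z * (-\<i>/2))"
     "bounded_linear (\<lambda>z::complex. z * (\<i>/2))" by (rule bounded_linear_mult_left)+
  note L = this
  have "flat_at p (\<lambda>x. dir_deriv v f x * (1/2) + dir_deriv (cscale \<i> v) f x * (-\<i>/2))"
    "flat_at p (\<lambda>x. dir_deriv v f x * (1/2) + dir_deriv (cscale \<i> v) f x * (\<i>/2))"
    by (intro flat_at_add smooth_at_mult smooth_at_const flat_at_bounded_linear[OF L(1)]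
      flat_at_bounded_linear[OF L(2)] flat_at_bounded_linear[OF L(3)] *)+
  thus "flat_at p (wirtinger f v)" "flat_at p (wirtinger_bar f v)"
    by (simp_all add: wirtinger_dir_deriv[abs_def] field_simps)
qed

lemma dir_deriv_lincomb:
  fixes f g :: "'a::real_normed_vector \<Rightarrow> complex"
  assumes "f differentiable (at x)" "g differentiable (at x)"
  shows "dir_deriv v (\<lambda>x. (f x + c * g x) / 2) x = (dir_deriv v f x + c * dir_deriv v g x) / 2"
  by (rule dir_deriv_eq)
    (auto intro!: derivative_eq_intros has_derivative_dir_deriv assms)

lemma wirtinger_commute:
  assumes "open S" "x \<in> S" "smooth_on S f"
  shows "wirtinger (wirtinger_bar f w) v x = wirtinger_bar (wirtinger f v) w x"
    "wirtinger (wirtinger f w) v x = wirtinger (wirtinger f v) w x"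
    "wirtinger_bar (wirtinger_bar f w) v x = wirtinger_bar (wirtinger_bar f v) w x"
proof -
  have d: "dir_deriv u f differentiable (at x)" for u
    using assms smooth_on_dir_deriv smooth_on_imp_differentiable by blast
  have 1: "dir_deriv u (wirtinger f w) x = (dir_deriv u (dir_deriv w f) x + (-\<i>) * dir_deriv u (dir_deriv (cscale \<i> w) f) x) / 2"
    for u w unfolding dir_deriv_lincomb[OF d d, symmetric] by (simp add: wirtinger_dir_deriv[abs_def])
  have 2: "dir_deriv u (wirtinger_bar f w) x = (dir_deriv u (dir_deriv w f) x + \<i> * dir_deriv u (dir_deriv (cscale \<i> w) f) x) / 2"
    for u w unfolding dir_deriv_lincomb[OF d d, symmetric] by (simp add: wirtinger_dir_deriv[abs_def])
  note c = dir_deriv_commute[OF assms]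
  show "wirtinger (wirtinger_bar f w) v x = wirtinger_bar (wirtinger f v) w x"
    "wirtinger (wirtinger f w) v x = wirtinger (wirtinger f v) w x"
    "wirtinger_bar (wirtinger_bar f w) v x = wirtinger_bar (wirtinger_bar f v) w x"
    unfolding wirtinger_dir_deriv(1,2)[of "wirtinger f _"] wirtinger_dir_deriv(1,2)[of "wirtinger_bar f _"] 1 2
    by (simp_all add: c[of v w] c[of "cscale \<i> v" w] c[of v "cscale \<i> w"]
        c[of "cscale \<i> v" "cscale \<i> w"] field_simps)
qed

subsection \<open>The ring of infinite jets\<close>

text \<open>Smooth germs at the origin modulo flat ones form a commutative ring, a coordinate-free
  version of the formal power series in the coordinates and their conjugates. The Wirtinger
  derivatives act on it as commuting derivations, and almost holomorphic functions become
  elements that are annihilated by all conjugate derivatives.\<close>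

definition jet_rel :: "((complex^'n::finite) \<times> complex \<Rightarrow> complex) \<Rightarrow> ((complex^'n) \<times> complex \<Rightarrow> complex) \<Rightarrow> bool" where
  "jet_rel f g \<longleftrightarrow> smooth_at 0 f \<and> smooth_at 0 g \<and> flat_at 0 (\<lambda>x. f x - g x)"

lemma jet_rel_refl: "smooth_at 0 f \<Longrightarrow> jet_rel f f"
  by (simp add: jet_rel_def flat_at_zero)

lemma jet_rel_refl': "smooth_at 0 f \<Longrightarrow> f = g \<Longrightarrow> jet_rel f g"
  using jet_rel_refl by blast

lemma jet_relD: "jet_rel f g \<Longrightarrow> smooth_at 0 f" "jet_rel f g \<Longrightarrow> smooth_at 0 g"
  by (auto simp: jet_rel_def)

lemma jet_rel_selfD: "jet_rel f f \<Longrightarrow> smooth_at 0 f"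
  by (rule jet_relD)

lemma flat_at_lincomb:
  fixes f g :: "'a::real_normed_vector \<Rightarrow> complex"
  assumes "smooth_at p f" "smooth_at p g" "flat_at p f" "flat_at p g"
    "smooth_at p a" "smooth_at p b"
  shows "flat_at p (\<lambda>x. f x * a x + g x * b x)"
  by (intro flat_at_add smooth_at_mult flat_at_mult assms)

lemma jet_rel_cong_near:
  assumes "smooth_at 0 f" "open W" "0 \<in> W" "\<And>x. x \<in> W \<Longrightarrow> f x = g x"
  shows "jet_rel f g"
proof -
  have "flat_at 0 (\<lambda>x. f x - g x) \<longleftrightarrow> flat_at 0 (\<lambda>x::(complex^'a) \<times> complex. 0::complex)"
    by (rule flat_at_cong[OF assms(2,3)]) (simp add: assms(4))
  thus ?thesis using smooth_at_cong[OF assms] assms(1) by (simp add: jet_rel_def flat_at_zero)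
qed

lemma jet_rel_trans:
  assumes "jet_rel f g" "jet_rel g h" shows "jet_rel f h"
proof -
  have "flat_at 0 (\<lambda>x. (f x - g x) + (g x - h x))"
    using assms by (intro flat_at_add) (auto simp: jet_rel_def intro: smooth_at_diff)
  thus ?thesis using assms by (simp add: jet_rel_def)
qed

lemma jet_rel_sym:
  assumes "jet_rel f g" shows "jet_rel g f"
proof -
  have "flat_at 0 (\<lambda>x. - (f x - g x))"
    using assms bounded_linear_minus[OF bounded_linear_ident]
    by (intro flat_at_bounded_linear[of uminus]) (auto simp: jet_rel_def intro: smooth_at_diff)
  thus ?thesis using assms by (simp add: jet_rel_def)
qed

lemma jet_rel_add:
  assumes "jet_rel f f'" "jet_rel g g'" shows "jet_rel (\<lambda>x. f x + g x) (\<lambda>x. f' x + g' x)"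
proof -
  have "flat_at 0 (\<lambda>x. (f x - f' x) + (g x - g' x))"
    using assms by (intro flat_at_add smooth_at_diff) (auto simp: jet_rel_def)
  thus ?thesis using assms by (auto simp: jet_rel_def algebra_simps intro: smooth_at_add)
qed

lemma jet_rel_uminus:
  assumes "jet_rel f f'" shows "jet_rel (\<lambda>x. - f x) (\<lambda>x. - f' x)"
proof -
  have "flat_at 0 (\<lambda>x. f' x - f x)" using jet_rel_sym[OF assms] by (simp add: jet_rel_def)
  thus ?thesis using assms by (auto simp: jet_rel_def intro: smooth_at_uminus)
qed

lemma jet_rel_mult:
  assumes "jet_rel f f'" "jet_rel g g'" shows "jet_rel (\<lambda>x. f x * g x) (\<lambda>x. f' x * g' x)"
proof -
  have "flat_at 0 (\<lambda>x. (f x - f' x) * g x + (g x - g' x) * f' x)"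
    using assms by (intro flat_at_lincomb smooth_at_diff) (auto simp: jet_rel_def)
  thus ?thesis using assms by (auto simp: jet_rel_def algebra_simps intro: smooth_at_mult)
qed

lemma jet_rel_cnj:
  assumes "jet_rel f f'" shows "jet_rel (\<lambda>x. cnj (f x)) (\<lambda>x. cnj (f' x))"
proof -
  have "flat_at 0 (\<lambda>x. cnj (f x - f' x))"
    using assms by (intro flat_at_bounded_linear[OF bounded_linear_cnj] smooth_at_diff) (auto simp: jet_rel_def)
  thus ?thesis using assms by (auto simp: jet_rel_def intro: smooth_at_cnj)
qed

lemma wirtinger_diff:
  assumes "f differentiable (at x)" "g differentiable (at x)"
  shows "wirtinger (\<lambda>x. f x - g x) v x = wirtinger f v x - wirtinger g v x"
    "wirtinger_bar (\<lambda>x. f x - g x) v x = wirtinger_bar f v x - wirtinger_bar g v x"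
proof -
  have d: "dir_deriv v (\<lambda>x. f x - g x) x = dir_deriv v f x - dir_deriv v g x" for v
    using dir_deriv_eq[OF has_derivative_diff[OF has_derivative_dir_deriv[OF assms(1)]
        has_derivative_dir_deriv[OF assms(2)]]] .
  show "wirtinger (\<lambda>x. f x - g x) v x = wirtinger f v x - wirtinger g v x"
    "wirtinger_bar (\<lambda>x. f x - g x) v x = wirtinger_bar f v x - wirtinger_bar g v x"
    by (simp_all add: wirtinger_dir_deriv d field_simps)
qed

lemma jet_rel_wirtinger:
  assumes "jet_rel f f'"
  shows "jet_rel (wirtinger f v) (wirtinger f' v)" "jet_rel (wirtinger_bar f v) (wirtinger_bar f' v)"
proof -
  have s: "smooth_at 0 f" "smooth_at 0 f'" and fl: "flat_at 0 (\<lambda>x. f x - f' x)"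
    using assms by (auto simp: jet_rel_def)
  obtain W where W: "open W" "0 \<in> W" "smooth_on W f" "smooth_on W f'" by (rule smooth_at_common[OF s])
  have d: "f differentiable (at x)" "f' differentiable (at x)" if "x \<in> W" for x
    using W(3,4) that by (auto intro: smooth_on_imp_differentiable)
  have "flat_at 0 (wirtinger (\<lambda>x. f x - f' x) v)" "flat_at 0 (wirtinger_bar (\<lambda>x. f x - f' x) v)"
    by (intro flat_at_wirtinger smooth_at_diff s fl)+
  moreover have "wirtinger (\<lambda>x. f x - f' x) v x = wirtinger f v x - wirtinger f' v x"
    "wirtinger_bar (\<lambda>x. f x - f' x) v x = wirtinger_bar f v x - wirtinger_bar f' v x" if "x \<in> W" for x
    by (rule wirtinger_diff[OF d[OF that]])+
  ultimately have "flat_at 0 (\<lambda>x. wirtinger f v x - wirtinger f' v x)"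
    "flat_at 0 (\<lambda>x. wirtinger_bar f v x - wirtinger_bar f' v x)"
    using flat_at_cong[OF W(1,2), of "wirtinger (\<lambda>x. f x - f' x) v" "\<lambda>x. wirtinger f v x - wirtinger f' v x"]
      flat_at_cong[OF W(1,2), of "wirtinger_bar (\<lambda>x. f x - f' x) v" "\<lambda>x. wirtinger_bar f v x - wirtinger_bar f' v x"]
    by simp_all
  thus "jet_rel (wirtinger f v) (wirtinger f' v)" "jet_rel (wirtinger_bar f v) (wirtinger_bar f' v)"
    using s by (auto simp: jet_rel_def intro: smooth_at_wirtinger)
qed

quotient_type 'n jet = "(complex^'n::finite) \<times> complex \<Rightarrow> complex" / partial: jet_rel
proof (rule part_equivpI)
  show "\<exists>f::(complex^'n) \<times> complex \<Rightarrow> complex. jet_rel f f"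
    using jet_rel_refl[OF smooth_at_const] by blast
  show "symp (jet_rel :: ((complex^'n) \<times> complex \<Rightarrow> complex) \<Rightarrow> _)"
    using jet_rel_sym by (auto intro: sympI)
  show "transp (jet_rel :: ((complex^'n) \<times> complex \<Rightarrow> complex) \<Rightarrow> _)"
    using jet_rel_trans by (auto intro: transpI)
qed

instantiation jet :: (finite) comm_ring_1
begin

lift_definition zero_jet :: "'a jet" is "\<lambda>x. 0" by (rule jet_rel_refl[OF smooth_at_const])
lift_definition one_jet :: "'a jet" is "\<lambda>x. 1" by (rule jet_rel_refl[OF smooth_at_const])
lift_definition plus_jet :: "'a jet \<Rightarrow> 'a jet \<Rightarrow> 'a jet" is "\<lambda>f g x. f x + g x" by (rule jet_rel_add)
lift_definition uminus_jet :: "'a jet \<Rightarrow> 'a jet" is "\<lambda>f x. - f x" by (rule jet_rel_uminus)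
lift_definition times_jet :: "'a jet \<Rightarrow> 'a jet \<Rightarrow> 'a jet" is "\<lambda>f g x. f x * g x" by (rule jet_rel_mult)
definition minus_jet :: "'a jet \<Rightarrow> 'a jet \<Rightarrow> 'a jet" where "minus_jet a b = a + - b"

instance
proof
  fix a b c :: "'a jet"
  note sm = smooth_at_add smooth_at_mult smooth_at_uminus smooth_at_const
  show "a + b + c = a + (b + c)" "a + b = b + a" "0 + a = a" "- a + a = 0"
    "a * b * c = a * (b * c)" "a * b = b * a" "1 * a = a" "(a + b) * c = a * c + b * c"
    by (transfer, rule jet_rel_refl', (intro sm; erule jet_rel_selfD), simp add: algebra_simps)+
  show "a - b = a + - b" by (simp add: minus_jet_def)
  show "(0::'a jet) \<noteq> 1"
    by transfer (auto simp: jet_rel_def dest: flat_at_value)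
qed

end

lift_definition jev :: "'n::finite jet \<Rightarrow> complex" is "\<lambda>f. f 0"
proof -
  fix f g :: "(complex^'n) \<times> complex \<Rightarrow> complex" assume "jet_rel f g"
  thus "f 0 = g 0" using flat_at_value[of 0 "\<lambda>x. f x - g x"] by (simp add: jet_rel_def)
qed
lift_definition jconst :: "complex \<Rightarrow> 'n::finite jet" is "\<lambda>c x. c"
  by (rule jet_rel_refl[OF smooth_at_const])
lift_definition jcnj :: "'n::finite jet \<Rightarrow> 'n jet" is "\<lambda>f x. cnj (f x)" by (rule jet_rel_cnj)
lift_definition jD :: "(complex^'n) \<times> complex \<Rightarrow> 'n::finite jet \<Rightarrow> 'n jet" is "\<lambda>v f. wirtinger f v"
  by (rule jet_rel_wirtinger)
lift_definition jDb :: "(complex^'n) \<times> complex \<Rightarrow> 'n::finite jet \<Rightarrow> 'n jet" is "\<lambda>v f. wirtinger_bar f v"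
  by (rule jet_rel_wirtinger)

lemma jev_add: "jev (a + b) = jev a + jev b" by transfer (rule refl)
lemma jev_mult: "jev (a * b) = jev a * jev b" by transfer (rule refl)
lemma jev_uminus: "jev (- a) = - jev a" by transfer (rule refl)
lemma jev_zero: "jev 0 = 0" by transfer (rule refl)
lemma jev_one: "jev 1 = 1" by transfer (rule refl)
lemma jev_const: "jev (jconst c) = c" by transfer (rule refl)
lemma jev_cnj: "jev (jcnj a) = cnj (jev a)" by transfer (rule refl)
lemma jev_diff: "jev (a - b) = jev a - jev b" by (simp only: minus_jet_def jev_add jev_uminus) simp

lemmas jev_simps [simp] = jev_add jev_mult jev_uminus jev_zero jev_one jev_const jev_cnj jev_diff

lemma jcnj_simps [simp]:
  "jcnj (a + b) = jcnj a + jcnj b" "jcnj (a * b) = jcnj a * jcnj b" "jcnj (- a) = - jcnj a"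
  "jcnj (a - b) = jcnj a - jcnj b" "jcnj 0 = 0" "jcnj (jconst c) = jconst (cnj c)" "jcnj (jcnj a) = a"
proof -
  note sm = smooth_at_add smooth_at_mult smooth_at_uminus smooth_at_const smooth_at_cnj
  have 1: "jcnj (a + b) = jcnj a + jcnj b" for a b :: "'a jet"
    by (transfer, rule jet_rel_refl', (intro sm; erule jet_rel_selfD), simp)
  have 2: "jcnj (- a) = - jcnj a" for a :: "'a jet"
    by (transfer, rule jet_rel_refl', (intro sm; erule jet_rel_selfD), simp)
  show "jcnj (a + b) = jcnj a + jcnj b" "jcnj (- a) = - jcnj a" by (rule 1, rule 2)
  show "jcnj (a * b) = jcnj a * jcnj b" "jcnj 0 = 0" "jcnj (jconst c) = jconst (cnj c)" "jcnj (jcnj a) = a"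
    by (transfer, rule jet_rel_refl', (intro sm; erule jet_rel_selfD), simp)+
  show "jcnj (a - b) = jcnj a - jcnj b" by (simp only: minus_jet_def 1 2)
qed

lemma jet_rel_near:
  assumes "jet_rel f f" "jet_rel g g"
    "\<And>x. f differentiable (at x) \<Longrightarrow> g differentiable (at x) \<Longrightarrow> h x = k x"
    "smooth_at 0 h"
  shows "jet_rel h k"
proof -
  obtain W where W: "open W" "0 \<in> W" "smooth_on W f" "smooth_on W g"
    by (rule smooth_at_common[OF jet_rel_selfD[OF assms(1)] jet_rel_selfD[OF assms(2)]])
  show ?thesis
    by (rule jet_rel_cong_near[OF assms(4) W(1,2)], rule assms(3))
      (use W in \<open>auto intro: smooth_on_imp_differentiable\<close>)
qed

lemma jet_rel_wirtinger_add_mult: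
  assumes "jet_rel f f" "jet_rel g g"
  shows "jet_rel (wirtinger (\<lambda>x. f x + g x) v) (\<lambda>x. wirtinger f v x + wirtinger g v x)"
    "jet_rel (wirtinger_bar (\<lambda>x. f x + g x) v) (\<lambda>x. wirtinger_bar f v x + wirtinger_bar g v x)"
    "jet_rel (wirtinger (\<lambda>x. f x * g x) v) (\<lambda>x. wirtinger f v x * g x + f x * wirtinger g v x)"
    "jet_rel (wirtinger_bar (\<lambda>x. f x * g x) v) (\<lambda>x. wirtinger_bar f v x * g x + f x * wirtinger_bar g v x)"
proof -
  note s = jet_rel_selfD[OF assms(1)] jet_rel_selfD[OF assms(2)]
  show "jet_rel (wirtinger (\<lambda>x. f x + g x) v) (\<lambda>x. wirtinger f v x + wirtinger g v x)"
    by (rule jet_rel_near[OF assms], erule (1) wirtinger_add) (intro smooth_at_wirtinger smooth_at_add s)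
  show "jet_rel (wirtinger_bar (\<lambda>x. f x + g x) v) (\<lambda>x. wirtinger_bar f v x + wirtinger_bar g v x)"
    by (rule jet_rel_near[OF assms], erule (1) wirtinger_add) (intro smooth_at_wirtinger smooth_at_add s)
  show "jet_rel (wirtinger (\<lambda>x. f x * g x) v) (\<lambda>x. wirtinger f v x * g x + f x * wirtinger g v x)"
    by (rule jet_rel_near[OF assms], erule (1) wirtinger_mult) (intro smooth_at_wirtinger smooth_at_mult s)
  show "jet_rel (wirtinger_bar (\<lambda>x. f x * g x) v) (\<lambda>x. wirtinger_bar f v x * g x + f x * wirtinger_bar g v x)"
    by (rule jet_rel_near[OF assms], erule (1) wirtinger_mult) (intro smooth_at_wirtinger smooth_at_mult s)
qed

lemma jD_add [simp]: "jD v (a + b) = jD v a + jD v b" "jDb v (a + b) = jDb v a + jDb v b"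
  and jD_mult [simp]: "jD v (a * b) = jD v a * b + a * jD v b" "jDb v (a * b) = jDb v a * b + a * jDb v b"
  by (transfer, erule (1) jet_rel_wirtinger_add_mult)+

lemma jD_cnj: "jD v (jcnj a) = jcnj (jDb v a)" "jDb v (jcnj a) = jcnj (jD v a)"
proof -
  show "jD v (jcnj a) = jcnj (jDb v a)"
    by (transfer, rule jet_rel_near, assumption, assumption, erule wirtinger_cnj,
      intro smooth_at_wirtinger smooth_at_cnj; erule jet_rel_selfD)
  show "jDb v (jcnj a) = jcnj (jD v a)"
    by (transfer, rule jet_rel_near, assumption, assumption, erule wirtinger_cnj,
      intro smooth_at_wirtinger smooth_at_cnj; erule jet_rel_selfD)
qed

lemma jet_rel_wirtinger_commute:
  assumes "jet_rel f f"
  shows "jet_rel (wirtinger (wirtinger_bar f w) v) (wirtinger_bar (wirtinger f v) w)"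
    "jet_rel (wirtinger (wirtinger f w) v) (wirtinger (wirtinger f v) w)"
    "jet_rel (wirtinger_bar (wirtinger_bar f w) v) (wirtinger_bar (wirtinger_bar f v) w)"
proof -
  note s = jet_rel_selfD[OF assms]
  obtain W where W: "open W" "0 \<in> W" "smooth_on W f" by (rule smooth_atE[OF s])
  note c = wirtinger_commute[OF W(1) _ W(3)]
  show "jet_rel (wirtinger (wirtinger_bar f w) v) (wirtinger_bar (wirtinger f v) w)"
    by (rule jet_rel_cong_near[OF _ W(1,2) c(1)]) (intro smooth_at_wirtinger s)
  show "jet_rel (wirtinger (wirtinger f w) v) (wirtinger (wirtinger f v) w)"
    by (rule jet_rel_cong_near[OF _ W(1,2) c(2)]) (intro smooth_at_wirtinger s)
  show "jet_rel (wirtinger_bar (wirtinger_bar f w) v) (wirtinger_bar (wirtinger_bar f v) w)"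
    by (rule jet_rel_cong_near[OF _ W(1,2) c(3)]) (intro smooth_at_wirtinger s)
qed

lemma jD_commute: "jD v (jDb w a) = jDb w (jD v a)" "jD v (jD w a) = jD w (jD v a)"
    "jDb v (jDb w a) = jDb w (jDb v a)"
  by (transfer, erule jet_rel_wirtinger_commute)+

lemma jD_const [simp]: "jD v (jconst c) = 0" "jDb v (jconst c) = 0"
  by (transfer, simp add: wirtinger_const jet_rel_refl smooth_at_const)+

lemma jconst_simps: "jconst 0 = 0" "jconst 1 = 1" "jconst (a + b) = jconst a + jconst b"
  "jconst (a * b) = jconst a * jconst b" "jconst (- a) = - jconst a"
  by (transfer, simp add: jet_rel_refl smooth_at_const)+

lemma jD_zero [simp]: "jD v 0 = 0" "jDb v 0 = 0"
  using jD_const[of v 0] by (simp_all add: jconst_simps)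

lemma jD_uminus [simp]: "jD v (- a) = - jD v a" "jDb v (- a) = - jDb v a"
proof -
  have "jD v (- a) + jD v a = 0" "jDb v (- a) + jDb v a = 0" by (simp_all flip: jD_add)
  thus "jD v (- a) = - jD v a" "jDb v (- a) = - jDb v a" by (simp_all add: eq_neg_iff_add_eq_0)
qed

lemma jD_diff [simp]: "jD v (a - b) = jD v a - jD v b" "jDb v (a - b) = jDb v a - jDb v b"
  by (simp_all only: minus_jet_def jD_add jD_uminus)

lemma jet_sum [simp]:
  "jD v (\<Sum>i\<in>I. f i) = (\<Sum>i\<in>I. jD v (f i))" "jDb v (\<Sum>i\<in>I. f i) = (\<Sum>i\<in>I. jDb v (f i))"
  "jev (\<Sum>i\<in>I. f i) = (\<Sum>i\<in>I. jev (f i))" "jcnj (\<Sum>i\<in>I. f i) = (\<Sum>i\<in>I. jcnj (f i))"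
  by (induction I rule: infinite_finite_induct) simp_all

text \<open>Jets at an arbitrary point are jets at the origin of the translated function, so that all of them
  live in one ring.\<close>

definition jet :: "(complex^'n::finite) \<times> complex \<Rightarrow> ((complex^'n) \<times> complex \<Rightarrow> complex) \<Rightarrow> 'n jet" where
  "jet p f = abs_jet (\<lambda>x. f (p + x))"

lemma smooth_at_shift: "smooth_at 0 (\<lambda>x. f (p + x))" if "smooth_at p f"
  for f :: "'a::euclidean_space \<Rightarrow> 'b::real_normed_vector"
  by (rule smooth_at_compose) (use that in \<open>auto intro: smooth_at_add smooth_at_const smooth_at_ident\<close>)

lemma dir_deriv_shift: "dir_deriv v (\<lambda>x. f (p + x)) = (\<lambda>x. dir_deriv v f (p + x))"
proof
  fix x
  have "((\<lambda>x. f (p + x)) has_derivative D) (at x) \<longleftrightarrow> (f has_derivative D) (at (p + x))" for D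
  proof
    assume *: "((\<lambda>x. f (p + x)) has_derivative D) (at x)"
    have "((\<lambda>y. f (p + (y - p))) has_derivative (\<lambda>h. D h)) (at (p + x))"
      by (rule has_derivative_compose[of "\<lambda>y. y - p" "\<lambda>h. h"]) (use * in \<open>auto intro!: derivative_eq_intros\<close>)
    thus "(f has_derivative D) (at (p + x))" by simp
  next
    assume *: "(f has_derivative D) (at (p + x))"
    show "((\<lambda>x. f (p + x)) has_derivative D) (at x)"
      by (rule has_derivative_compose[of "\<lambda>y. p + y" "\<lambda>h. h"]) (use * in \<open>auto intro!: derivative_eq_intros\<close>)
  qed
  thus "dir_deriv v (\<lambda>x. f (p + x)) x = dir_deriv v f (p + x)"
    by (simp add: dir_deriv_def frechet_derivative_def)
qed

lemma iter_deriv_shift: "iter_deriv vs (\<lambda>x. f (p + x)) = (\<lambda>x. iter_deriv vs f (p + x))"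
  by (induction vs) (simp_all only: iter_deriv_Cons dir_deriv_shift iter_deriv.simps(1))

lemma flat_at_shift: "flat_at 0 (\<lambda>x. f (p + x)) \<longleftrightarrow> flat_at p f"
  by (simp add: flat_at_def iter_deriv_shift)

lemma wirtinger_shift:
  "wirtinger (\<lambda>x. f (p + x)) v = (\<lambda>x. wirtinger f v (p + x))"
  "wirtinger_bar (\<lambda>x. f (p + x)) v = (\<lambda>x. wirtinger_bar f v (p + x))"
  by (simp_all add: wirtinger_dir_deriv fun_eq_iff dir_deriv_shift)

lemma abs_jet_eqI: "jet_rel f g \<Longrightarrow> abs_jet f = abs_jet g"
  by (rule Quotient_rel_abs[OF Quotient_jet])

context
  fixes p :: "(complex^'n::finite) \<times> complex" and f :: "(complex^'n::finite) \<times> complex \<Rightarrow> complex"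
  assumes f: "smooth_at p f"
begin

lemma jev_jet: "jev (jet p f) = f p"
  unfolding jet_def by (subst jev.abs_eq) (simp_all add: jet_rel_refl smooth_at_shift f)

lemma jD_jet: "jD v (jet p f) = jet p (wirtinger f v)" "jDb v (jet p f) = jet p (wirtinger_bar f v)"
  unfolding jet_def
  by (subst jD.abs_eq jDb.abs_eq, simp_all add: jet_rel_refl smooth_at_shift f wirtinger_shift)+

lemma jcnj_jet: "jcnj (jet p f) = jet p (\<lambda>x. cnj (f x))"
  unfolding jet_def by (subst jcnj.abs_eq) (simp_all add: jet_rel_refl smooth_at_shift f)

lemma jet_eq_0_iff: "jet p f = 0 \<longleftrightarrow> flat_at p f"
  unfolding jet_def zero_jet_def map_fun_def id_def o_def
  using Quotient_rel[OF Quotient_jet, of "\<lambda>x. f (p + x)" "\<lambda>x. 0"]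
  by (simp add: jet_rel_def smooth_at_shift[OF f] smooth_at_const flat_at_zero flat_at_shift)

lemma jet_cong: "open W \<Longrightarrow> p \<in> W \<Longrightarrow> (\<And>x. x \<in> W \<Longrightarrow> f x = g x) \<Longrightarrow> jet p f = jet p g"
  unfolding jet_def
  by (rule abs_jet_eqI, rule jet_rel_cong_near[OF smooth_at_shift[OF f], of "(\<lambda>x. p + x) -` W"])
    (auto intro!: open_vimage continuous_intros)

lemma jet_add: "smooth_at p g \<Longrightarrow> jet p (\<lambda>x. f x + g x) = jet p f + jet p g"
  unfolding jet_def by (subst plus_jet.abs_eq) (simp_all add: jet_rel_refl smooth_at_shift f)

lemma jet_mult: "smooth_at p g \<Longrightarrow> jet p (\<lambda>x. f x * g x) = jet p f * jet p g"
  unfolding jet_def by (subst times_jet.abs_eq) (simp_all add: jet_rel_refl smooth_at_shift f)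

lemma jet_uminus: "jet p (\<lambda>x. - f x) = - jet p f"
  unfolding jet_def by (subst uminus_jet.abs_eq) (simp_all add: jet_rel_refl smooth_at_shift f)

end

lemma jet_diff: "smooth_at p f \<Longrightarrow> smooth_at p g \<Longrightarrow> jet p (\<lambda>x. f x - g x) = jet p f - jet p g"
  using jet_add[of p f "\<lambda>x. - g x"] jet_uminus[of p g] smooth_at_uminus[of p g] by simp

lemma jet_const: "jet p (\<lambda>x. c) = jconst c"
  unfolding jet_def jconst_def by simp

lemma jet_sum_fun:
  "(\<And>i. i \<in> I \<Longrightarrow> smooth_at p (f i)) \<Longrightarrow> jet p (\<lambda>x. \<Sum>i\<in>I. f i x) = (\<Sum>i\<in>I. jet p (f i))"
proof (induction I rule: infinite_finite_induct)
  case (insert i I)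
  have "jet p (\<lambda>x. f i x + (\<Sum>i\<in>I. f i x)) = jet p (f i) + jet p (\<lambda>x. \<Sum>i\<in>I. f i x)"
    by (rule jet_add) (use insert in \<open>auto intro!: smooth_at_sum\<close>)
  thus ?case using insert by simp
qed (simp_all add: jet_const jconst_simps)

section \<open>Complex chain rule\<close>

lemma cscale_decomp: "cscale c x = Re c *\<^sub>R x + Im c *\<^sub>R cscale \<i> x"
  by (cases x) (simp add: cscale_def prod_eq_iff vec_eq_iff complex_eq_iff vector_scalar_mult_def)

lemma cscale_cscale: "cscale a (cscale b x) = cscale (a * b) x"
  by (simp add: cscale_def vector_smult_assoc mult.assoc)

lemma linear_cscale: "linear (cscale c)"
  by (rule linearI) (auto simp: cscale_def prod_eq_iff vec_eq_iff vector_scalar_mult_def algebra_simps)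

lemma coordinates_sum:
  "d = (\<Sum>k\<in>UNIV. cscale (fst d $ k) (axis k 1, 0)) + cscale (snd d) (0, 1)"
  for d :: "(complex^'n::finite) \<times> complex"
proof -
  have "(\<Sum>k\<in>UNIV. cscale (fst d $ k) (axis k 1, 0)) = (\<Sum>k\<in>UNIV. (fst d $ k *s axis k 1, 0))"
    by (simp add: cscale_def)
  also have "\<dots> = (\<Sum>k\<in>UNIV. fst d $ k *s axis k 1, 0)" by (simp add: prod_eq_iff fst_sum snd_sum)
  also have "(\<Sum>k\<in>UNIV. fst d $ k *s axis k 1) = fst d" by (rule basis_expansion)
  finally show ?thesis by (simp add: cscale_def)
qed

context
  fixes f :: "(complex^'n::finite) \<times> complex \<Rightarrow> complex" and x
  assumes f: "f differentiable (at x)"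
begin

interpretation D: linear "\<lambda>v. dir_deriv v f x" by (rule linear_dir_deriv[OF f])

lemma wirtinger_cscale:
  "wirtinger f (cscale c v) x = c * wirtinger f v x"
  "wirtinger_bar f (cscale c v) x = cnj c * wirtinger_bar f v x"
proof -
  have 1: "dir_deriv (cscale c v) f x = Re c *\<^sub>R dir_deriv v f x + Im c *\<^sub>R dir_deriv (cscale \<i> v) f x"
    by (subst cscale_decomp) (simp only: D.add D.scale)
  have 2: "cscale \<i> (cscale c v) = Re c *\<^sub>R cscale \<i> v + (- Im c) *\<^sub>R v"
    unfolding cscale_cscale by (subst cscale_decomp)
      (simp add: prod_eq_iff cscale_def vec_eq_iff vector_scalar_mult_def complex_eq_iff)
  have 3: "dir_deriv (cscale \<i> (cscale c v)) f x = Re c *\<^sub>R dir_deriv (cscale \<i> v) f x - Im c *\<^sub>R dir_deriv v f x"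
    unfolding 2 by (simp only: D.add D.scale) simp
  show "wirtinger f (cscale c v) x = c * wirtinger f v x"
    "wirtinger_bar f (cscale c v) x = cnj c * wirtinger_bar f v x"
    unfolding wirtinger_dir_deriv 1 3 by (simp_all add: complex_eq_iff algebra_simps)
qed

lemma wirtinger_add_vec:
  "wirtinger f (u + v) x = wirtinger f u x + wirtinger f v x"
  "wirtinger_bar f (u + v) x = wirtinger_bar f u x + wirtinger_bar f v x"
  unfolding wirtinger_dir_deriv linear_add[OF linear_cscale] D.add by (simp_all add: field_simps)

lemma wirtinger_zero_vec: "wirtinger f 0 x = 0" "wirtinger_bar f 0 x = 0"
  using wirtinger_cscale[of 0 0] by (simp_all add: cscale_def flip: zero_prod_def)

lemma wirtinger_sum_vec:
  "wirtinger f (\<Sum>i\<in>I. u i) x = (\<Sum>i\<in>I. wirtinger f (u i) x)"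
  "wirtinger_bar f (\<Sum>i\<in>I. u i) x = (\<Sum>i\<in>I. wirtinger_bar f (u i) x)"
  by (induction I rule: infinite_finite_induct) (simp_all add: wirtinger_add_vec wirtinger_zero_vec)

lemma wirtinger_coordinates:
  "wirtinger f d x = (\<Sum>k\<in>UNIV. fst d $ k * wirtinger f (axis k 1, 0) x) + snd d * wirtinger f (0, 1) x"
  "wirtinger_bar f d x = (\<Sum>k\<in>UNIV. cnj (fst d $ k) * wirtinger_bar f (axis k 1, 0) x)
      + cnj (snd d) * wirtinger_bar f (0, 1) x"
  by (subst coordinates_sum[of d], simp only: wirtinger_add_vec wirtinger_sum_vec wirtinger_cscale)+

end

lemma dir_deriv_bounded_linear:
  "bounded_linear L \<Longrightarrow> f differentiable (at x) \<Longrightarrow> dir_deriv v (\<lambda>x. L (f x)) x = L (dir_deriv v f x)"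
  using dir_deriv_eq[OF bounded_linear.has_derivative[OF _ has_derivative_dir_deriv]] .

lemma dir_deriv_components:
  fixes h :: "'a::real_normed_vector \<Rightarrow> (complex^'m::finite) \<times> complex"
  assumes "h differentiable (at x)"
  shows "fst (dir_deriv v h x) $ k = dir_deriv v (\<lambda>x. fst (h x) $ k) x"
    "snd (dir_deriv v h x) = dir_deriv v (\<lambda>x. snd (h x)) x"
  using dir_deriv_bounded_linear[OF bounded_linear_compose[OF bounded_linear_vec_nth bounded_linear_fst] assms]
    dir_deriv_bounded_linear[OF bounded_linear_snd assms] by simp_all

text \<open>The chain rule for maps that need not be holomorphic: the conjugate derivatives of \<open>h\<close> enter as
  well.\<close>

lemma wirtinger_compose:
  fixes h :: "(complex^'n::finite) \<times> complex \<Rightarrow> (complex^'m::finite) \<times> complex"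
    and f :: "(complex^'m::finite) \<times> complex \<Rightarrow> complex"
  assumes h: "h differentiable (at x)" and f: "f differentiable (at (h x))"
  shows "wirtinger (\<lambda>x. f (h x)) v x =
      (\<Sum>k\<in>UNIV. wirtinger f (axis k 1, 0) (h x) * wirtinger (\<lambda>x. fst (h x) $ k) v x
          + wirtinger_bar f (axis k 1, 0) (h x) * cnj (wirtinger_bar (\<lambda>x. fst (h x) $ k) v x))
      + wirtinger f (0, 1) (h x) * wirtinger (\<lambda>x. snd (h x)) v x
      + wirtinger_bar f (0, 1) (h x) * cnj (wirtinger_bar (\<lambda>x. snd (h x)) v x)"
    "wirtinger_bar (\<lambda>x. f (h x)) v x =
      (\<Sum>k\<in>UNIV. wirtinger f (axis k 1, 0) (h x) * wirtinger_bar (\<lambda>x. fst (h x) $ k) v x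
          + wirtinger_bar f (axis k 1, 0) (h x) * cnj (wirtinger (\<lambda>x. fst (h x) $ k) v x))
      + wirtinger f (0, 1) (h x) * wirtinger_bar (\<lambda>x. snd (h x)) v x
      + wirtinger_bar f (0, 1) (h x) * cnj (wirtinger (\<lambda>x. snd (h x)) v x)"
proof -
  have D: "dir_deriv u (\<lambda>x. f (h x)) x = dir_deriv (dir_deriv u h x) f (h x)" for u
    using dir_deriv_eq[OF has_derivative_compose[OF has_derivative_dir_deriv[OF h] has_derivative_dir_deriv[OF f]]] .
  have half_sum: "((sum s A + s') + c * (sum r A + r')) / 2 = sum t A + t'"
    if "\<And>k. s k + c * r k = 2 * t k" "s' + c * r' = 2 * t'"
    for s r t :: "'m \<Rightarrow> complex" and A s' r' t' c
  proof -
    have "(sum s A + s') + c * (sum r A + r') = (\<Sum>k\<in>A. s k + c * r k) + (s' + c * r')"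
      by (simp add: sum.distrib sum_distrib_left algebra_simps)
    also have "\<dots> = 2 * (sum t A + t')" by (simp add: that distrib_left flip: sum_distrib_left)
    finally show ?thesis by simp
  qed
  have E: "dir_deriv u (\<lambda>x. f (h x)) x =
      (\<Sum>k\<in>UNIV. dir_deriv u (\<lambda>x. fst (h x) $ k) x * wirtinger f (axis k 1, 0) (h x)
         + cnj (dir_deriv u (\<lambda>x. fst (h x) $ k) x) * wirtinger_bar f (axis k 1, 0) (h x))
      + (dir_deriv u (\<lambda>x. snd (h x)) x * wirtinger f (0, 1) (h x)
      + cnj (dir_deriv u (\<lambda>x. snd (h x)) x) * wirtinger_bar f (0, 1) (h x))" for u
    unfolding D dir_deriv_wirtinger[of "dir_deriv u h x" f] wirtinger_coordinates[OF f, of "dir_deriv u h x"]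
      dir_deriv_components[OF h] by (simp add: sum.distrib algebra_simps)
  have w: "wirtinger g v x = (dir_deriv v g x + (- \<i>) * dir_deriv (cscale \<i> v) g x) / 2" for g
    by (simp add: wirtinger_dir_deriv)
  have i: "dir_deriv (cscale \<i> v) g x = \<i> * (wirtinger g v x - wirtinger_bar g v x)" for g
    by (simp add: wirtinger_dir_deriv field_simps)
  show "wirtinger (\<lambda>x. f (h x)) v x =
      (\<Sum>k\<in>UNIV. wirtinger f (axis k 1, 0) (h x) * wirtinger (\<lambda>x. fst (h x) $ k) v x
          + wirtinger_bar f (axis k 1, 0) (h x) * cnj (wirtinger_bar (\<lambda>x. fst (h x) $ k) v x))
      + wirtinger f (0, 1) (h x) * wirtinger (\<lambda>x. snd (h x)) v x
      + wirtinger_bar f (0, 1) (h x) * cnj (wirtinger_bar (\<lambda>x. snd (h x)) v x)"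
    unfolding w[of "\<lambda>x. f (h x)"] E i unfolding dir_deriv_wirtinger
    by (rule trans[OF half_sum add.assoc[symmetric]]) (simp_all add: algebra_simps)
  show "wirtinger_bar (\<lambda>x. f (h x)) v x =
      (\<Sum>k\<in>UNIV. wirtinger f (axis k 1, 0) (h x) * wirtinger_bar (\<lambda>x. fst (h x) $ k) v x
          + wirtinger_bar f (axis k 1, 0) (h x) * cnj (wirtinger (\<lambda>x. fst (h x) $ k) v x))
      + wirtinger f (0, 1) (h x) * wirtinger_bar (\<lambda>x. snd (h x)) v x
      + wirtinger_bar f (0, 1) (h x) * cnj (wirtinger (\<lambda>x. snd (h x)) v x)"
    unfolding wirtinger_dir_deriv(2)[of "\<lambda>x. f (h x)"] E i unfolding dir_deriv_wirtinger
     
    by (rule trans[OF half_sum add.assoc[symmetric]]) (simp_all add: algebra_simps)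
qed

text \<open>The condition concerns a single point. This is all that the jet at \<open>p\<close> sees, and it is stable
  under composition.\<close>

definition almost_holomorphic_at ::
  "((complex^'n) \<times> complex \<Rightarrow> (complex^'m) \<times> complex) \<Rightarrow> (complex^'n::finite) \<times> complex \<Rightarrow> bool" where
  "almost_holomorphic_at h p \<longleftrightarrow> smooth_at p h \<and>
     (\<forall>k v. flat_at p (wirtinger_bar (\<lambda>x. fst (h x) $ k) v)) \<and>
     (\<forall>v. flat_at p (wirtinger_bar (\<lambda>x. snd (h x)) v))"

lemma almost_holomorphic_at_flat:
  assumes "almost_holomorphic_at h p"
  shows "flat_at p (wirtinger_bar (\<lambda>x. fst (h x) $ k) v)" "flat_at p (wirtinger_bar (\<lambda>x. snd (h x)) v)"
    "wirtinger_bar (\<lambda>x. fst (h x) $ k) v p = 0" "wirtinger_bar (\<lambda>x. snd (h x)) v p = 0"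
    "smooth_at p h"
proof -
  show *: "flat_at p (wirtinger_bar (\<lambda>x. fst (h x) $ k) v)" "flat_at p (wirtinger_bar (\<lambda>x. snd (h x)) v)"
    "smooth_at p h"
    using assms unfolding almost_holomorphic_at_def by blast+
  show "wirtinger_bar (\<lambda>x. fst (h x) $ k) v p = 0" "wirtinger_bar (\<lambda>x. snd (h x)) v p = 0"
    using *(1,2)[THEN flat_at_value] by simp_all
qed

lemma smooth_at_components:
  fixes h :: "'a::real_normed_vector \<Rightarrow> (complex^'m::finite) \<times> complex"
  assumes "smooth_at p h"
  shows "smooth_at p (\<lambda>x. fst (h x) $ k)" "smooth_at p (\<lambda>x. snd (h x))"
  by (intro smooth_at_nth smooth_at_fst smooth_at_snd assms)+

lemma almost_holomorphic_atD:
  assumes "almost_holomorphic_at h p"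
  shows "smooth_at p h" "jDb v (jet p (\<lambda>x. fst (h x) $ k)) = 0" "jDb v (jet p (\<lambda>x. snd (h x))) = 0"
  using almost_holomorphic_at_flat[OF assms]
  by (simp_all add: jD_jet jet_eq_0_iff smooth_at_components smooth_at_wirtinger)

text \<open>The terms of the general chain rule that contain conjugate derivatives of \<open>h\<close> are flat, hence zero
  in the ring of jets; what remains is the chain rule for holomorphic maps.\<close>

lemma jet_compose_chain:
  fixes h :: "(complex^'n::finite) \<times> complex \<Rightarrow> (complex^'m::finite) \<times> complex"
    and f :: "(complex^'m::finite) \<times> complex \<Rightarrow> complex"
  assumes h: "almost_holomorphic_at h p" and f: "smooth_at (h p) f"
  shows "jD v (jet p (\<lambda>x. f (h x))) =
      (\<Sum>k\<in>UNIV. jet p (\<lambda>x. wirtinger f (axis k 1, 0) (h x)) * jD v (jet p (\<lambda>x. fst (h x) $ k)))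
      + jet p (\<lambda>x. wirtinger f (0, 1) (h x)) * jD v (jet p (\<lambda>x. snd (h x)))"
    "jDb v (jet p (\<lambda>x. f (h x))) =
      (\<Sum>k\<in>UNIV. jet p (\<lambda>x. wirtinger_bar f (axis k 1, 0) (h x)) * jcnj (jD v (jet p (\<lambda>x. fst (h x) $ k))))
      + jet p (\<lambda>x. wirtinger_bar f (0, 1) (h x)) * jcnj (jD v (jet p (\<lambda>x. snd (h x))))"
proof -
  note hs = almost_holomorphic_atD[OF h]
  obtain V where V: "open V" "p \<in> V" "smooth_on V h" by (rule smooth_atE[OF hs(1)])
  obtain B where B: "open B" "h p \<in> B" "smooth_on B f" by (rule smooth_atE[OF f])
  define W where "W = h -` B \<inter> V"
  have W: "open W" "p \<in> W"
    using continuous_on_open_vimage[OF V(1), of h] smooth_on_imp_continuous_on[OF V(3)] V B by (auto simp: W_def)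
  have d: "h differentiable (at x)" "f differentiable (at (h x))" if "x \<in> W" for x
    using that V(3) B(3) unfolding W_def by (auto intro: smooth_on_imp_differentiable)
  have fh: "smooth_at p (\<lambda>x. g (h x))" if "smooth_at (h p) g" for g :: "(complex^'m) \<times> complex \<Rightarrow> complex"
    by (rule smooth_at_compose[OF hs(1) that])
  note s = smooth_at_wirtinger fh f smooth_at_components[OF hs(1)]
  note ss = smooth_at_mult smooth_at_add smooth_at_sum smooth_at_cnj s
  have z: "jcnj (jDb v (jet p (\<lambda>x. fst (h x) $ k))) = 0" "jcnj (jDb v (jet p (\<lambda>x. snd (h x)))) = 0" for k
    by (simp_all add: hs)
  have J: "jet p (wirtinger (\<lambda>x. fst (h x) $ k) v) = jD v (jet p (\<lambda>x. fst (h x) $ k))"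
    "jet p (wirtinger_bar (\<lambda>x. fst (h x) $ k) v) = 0"
    "jet p (wirtinger (\<lambda>x. snd (h x)) v) = jD v (jet p (\<lambda>x. snd (h x)))"
    "jet p (wirtinger_bar (\<lambda>x. snd (h x)) v) = 0" for k
    using hs(2)[of v k] hs(3)[of v] by (simp_all add: jD_jet smooth_at_components[OF hs(1)])
  have "jD v (jet p (\<lambda>x. f (h x))) = jet p (wirtinger (\<lambda>x. f (h x)) v)"
    by (rule jD_jet[OF fh[OF f]])
  also have "\<dots> = jet p (\<lambda>x. (\<Sum>k\<in>UNIV. wirtinger f (axis k 1, 0) (h x) * wirtinger (\<lambda>x. fst (h x) $ k) v x
          + wirtinger_bar f (axis k 1, 0) (h x) * cnj (wirtinger_bar (\<lambda>x. fst (h x) $ k) v x))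
      + wirtinger f (0, 1) (h x) * wirtinger (\<lambda>x. snd (h x)) v x
      + wirtinger_bar f (0, 1) (h x) * cnj (wirtinger_bar (\<lambda>x. snd (h x)) v x))"
    by (rule jet_cong[OF smooth_at_wirtinger(1)[OF fh[OF f]] W]) (rule wirtinger_compose[OF d])
  also have "\<dots> = (\<Sum>k\<in>UNIV. jet p (\<lambda>x. wirtinger f (axis k 1, 0) (h x)) * jD v (jet p (\<lambda>x. fst (h x) $ k)))
      + jet p (\<lambda>x. wirtinger f (0, 1) (h x)) * jD v (jet p (\<lambda>x. snd (h x)))"
    by (simp add: jet_add jet_mult jet_sum_fun ss J flip: jcnj_jet)
  finally show "jD v (jet p (\<lambda>x. f (h x))) = \<dots>" .
  have "jDb v (jet p (\<lambda>x. f (h x))) = jet p (wirtinger_bar (\<lambda>x. f (h x)) v)"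
    by (rule jD_jet[OF fh[OF f]])
  also have "\<dots> = jet p (\<lambda>x. (\<Sum>k\<in>UNIV. wirtinger f (axis k 1, 0) (h x) * wirtinger_bar (\<lambda>x. fst (h x) $ k) v x
          + wirtinger_bar f (axis k 1, 0) (h x) * cnj (wirtinger (\<lambda>x. fst (h x) $ k) v x))
      + wirtinger f (0, 1) (h x) * wirtinger_bar (\<lambda>x. snd (h x)) v x
      + wirtinger_bar f (0, 1) (h x) * cnj (wirtinger (\<lambda>x. snd (h x)) v x))"
    by (rule jet_cong[OF smooth_at_wirtinger(2)[OF fh[OF f]] W]) (rule wirtinger_compose[OF d])
  also have "\<dots> = (\<Sum>k\<in>UNIV. jet p (\<lambda>x. wirtinger_bar f (axis k 1, 0) (h x)) * jcnj (jD v (jet p (\<lambda>x. fst (h x) $ k))))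
      + jet p (\<lambda>x. wirtinger_bar f (0, 1) (h x)) * jcnj (jD v (jet p (\<lambda>x. snd (h x))))"
    by (simp add: jet_add jet_mult jet_sum_fun ss J flip: jcnj_jet)
  finally show "jDb v (jet p (\<lambda>x. f (h x))) = \<dots>" .
qed

lemma almost_holomorphic_at_compose:
  fixes h :: "(complex^'n::finite) \<times> complex \<Rightarrow> (complex^'m::finite) \<times> complex"
    and k :: "(complex^'m::finite) \<times> complex \<Rightarrow> (complex^'k::finite) \<times> complex"
  assumes h: "almost_holomorphic_at h p" and k: "almost_holomorphic_at k (h p)"
  shows "almost_holomorphic_at (\<lambda>x. k (h x)) p"
proof -
  note hs = almost_holomorphic_atD[OF h] and ks = almost_holomorphic_atD[OF k]
  have main: "flat_at p (wirtinger_bar (\<lambda>x. f (h x)) v)"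
    if f: "smooth_at (h p) f" "\<And>w. flat_at (h p) (wirtinger_bar f w)" for f :: "(complex^'m) \<times> complex \<Rightarrow> complex" and v
  proof -
    have s: "smooth_at p (\<lambda>x. g (h x))" if "smooth_at (h p) g" for g :: "(complex^'m) \<times> complex \<Rightarrow> complex"
      by (rule smooth_at_compose[OF hs(1) that])
    have "jet p (\<lambda>x. wirtinger_bar f w (h x)) = 0" for w
      using flat_at_compose[OF hs(1) smooth_at_wirtinger(2)[OF f(1)] f(2)]
      by (simp add: jet_eq_0_iff s smooth_at_wirtinger f(1))
    hence "jDb v (jet p (\<lambda>x. f (h x))) = 0" using jet_compose_chain(2)[OF h f(1)] by simp
    thus ?thesis by (simp add: jD_jet s f(1) jet_eq_0_iff smooth_at_wirtinger)
  qed
  have "smooth_at p (\<lambda>x. k (h x))" by (rule smooth_at_compose[OF hs(1) ks(1)])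
  moreover have "flat_at p (wirtinger_bar (\<lambda>x. fst (k (h x)) $ j) v)" for j v
    by (rule main[of "\<lambda>y. fst (k y) $ j"]) (intro smooth_at_components ks almost_holomorphic_at_flat[OF k])+
  moreover have "flat_at p (wirtinger_bar (\<lambda>x. snd (k (h x))) v)" for v
    by (rule main[of "\<lambda>y. snd (k y)"]) (intro smooth_at_components ks almost_holomorphic_at_flat[OF k])+
  ultimately show ?thesis unfolding almost_holomorphic_at_def by blast
qed

text \<open>The (1,0)-part of the image of a (1,0)-vector. For almost holomorphic maps the (0,1)-part is
  zero at \<open>p\<close>, and this is the differential.\<close>

definition pushforward ::
  "((complex^'n) \<times> complex \<Rightarrow> (complex^'m) \<times> complex) \<Rightarrow> (complex^'n::finite) \<times> complex \<Rightarrow> (complex^'n) \<times> complex \<Rightarrow> (complex^'m) \<times> complex" where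
  "pushforward h p v = (\<chi> k. wirtinger (\<lambda>x. fst (h x) $ k) v p, wirtinger (\<lambda>x. snd (h x)) v p)"

lemma pushforward_eq_dir_deriv:
  assumes "almost_holomorphic_at h p" shows "pushforward h p v = dir_deriv v h p"
proof -
  have *: "wirtinger_bar (\<lambda>x. fst (h x) $ k) v p = 0" "wirtinger_bar (\<lambda>x. snd (h x)) v p = 0" for k
    using almost_holomorphic_at_flat[OF assms] by simp_all
  have "h differentiable (at p)" using assms by (auto simp: almost_holomorphic_at_def smooth_at_imp_differentiable)
  from dir_deriv_components[OF this] show ?thesis
    by (simp add: pushforward_def prod_eq_iff vec_eq_iff dir_deriv_wirtinger *)
qed

lemma complex_hessian_jet:
  assumes "smooth_at p f" shows "complex_hessian f p v u = jev (jD v (jDb u (jet p f)))"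
  using assms by (simp add: jD_jet jev_jet smooth_at_wirtinger complex_hessian_def)

lemma wirtinger_compose_at:
  fixes h :: "(complex^'n::finite) \<times> complex \<Rightarrow> (complex^'m::finite) \<times> complex"
    and f :: "(complex^'m::finite) \<times> complex \<Rightarrow> complex"
  assumes h: "almost_holomorphic_at h p" and f: "smooth_at (h p) f"
  shows "wirtinger (\<lambda>x. f (h x)) v p = wirtinger f (pushforward h p v) (h p)"
    "wirtinger_bar (\<lambda>x. f (h x)) v p = wirtinger_bar f (pushforward h p v) (h p)"
proof -
  have *: "wirtinger_bar (\<lambda>x. fst (h x) $ k) v p = 0" "wirtinger_bar (\<lambda>x. snd (h x)) v p = 0" for k
    using almost_holomorphic_at_flat[OF h] by simp_all
  have "h differentiable (at p)" using h by (auto simp: almost_holomorphic_at_def smooth_at_imp_differentiable)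
  note wirtinger_compose[OF this smooth_at_imp_differentiable[OF f], of v]
  thus "wirtinger (\<lambda>x. f (h x)) v p = wirtinger f (pushforward h p v) (h p)"
    "wirtinger_bar (\<lambda>x. f (h x)) v p = wirtinger_bar f (pushforward h p v) (h p)"
    unfolding wirtinger_coordinates[OF smooth_at_imp_differentiable[OF f], of "pushforward h p v"]
    by (simp_all add: * pushforward_def mult.commute)
qed

text \<open>Both derivatives fall on \<open>f\<close>: a second derivative of \<open>h\<close> would have to be a mixed one, and those
  are zero.\<close>

lemma complex_hessian_compose:
  fixes h :: "(complex^'n::finite) \<times> complex \<Rightarrow> (complex^'m::finite) \<times> complex"
    and f :: "(complex^'m::finite) \<times> complex \<Rightarrow> complex"
  assumes h: "almost_holomorphic_at h p" and f: "smooth_at (h p) f"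
  shows "complex_hessian (\<lambda>x. f (h x)) p v u = complex_hessian f (h p) (pushforward h p v) (pushforward h p u)"
proof -
  note hs = almost_holomorphic_atD[OF h]
  have s: "smooth_at p (\<lambda>x. g (h x))" if "smooth_at (h p) g" for g :: "(complex^'m) \<times> complex \<Rightarrow> complex"
    by (rule smooth_at_compose[OF hs(1) that])
  note c = smooth_at_components[OF hs(1)] and fb = smooth_at_wirtinger(2)[OF f]
  have zero: "jD v (jcnj (jD u (jet p (\<lambda>x. fst (h x) $ k)))) = 0" "jD v (jcnj (jD u (jet p (\<lambda>x. snd (h x))))) = 0" for k
    by (simp_all add: jD_cnj hs flip: jD_commute)
  have e: "jev (jD u (jet p (\<lambda>x. fst (h x) $ k))) = fst (pushforward h p u) $ k"
    "jev (jD u (jet p (\<lambda>x. snd (h x)))) = snd (pushforward h p u)" for k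
    by (simp_all add: jD_jet c jev_jet smooth_at_wirtinger pushforward_def)
  have w: "jev (jD v (jet p (\<lambda>x. wirtinger_bar f d (h x)))) = wirtinger (wirtinger_bar f d) (pushforward h p v) (h p)" for d
    using wirtinger_compose_at(1)[OF h fb] by (simp add: jD_jet s fb jev_jet smooth_at_wirtinger)
  have "complex_hessian (\<lambda>x. f (h x)) p v u = jev (jD v (jDb u (jet p (\<lambda>x. f (h x)))))"
    by (rule complex_hessian_jet[OF s[OF f]])
  also have "\<dots> = (\<Sum>k\<in>UNIV. wirtinger (wirtinger_bar f (axis k 1, 0)) (pushforward h p v) (h p) * cnj (fst (pushforward h p u) $ k))
      + wirtinger (wirtinger_bar f (0, 1)) (pushforward h p v) (h p) * cnj (snd (pushforward h p u))"
    unfolding jet_compose_chain(2)[OF h f] by (simp add: zero w e)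
  also have "\<dots> = wirtinger (wirtinger_bar f (pushforward h p u)) (pushforward h p v) (h p)"
  proof -
    obtain W where W: "open W" "h p \<in> W" "smooth_on W f" by (rule smooth_atE[OF f])
    let ?u = "pushforward h p u"
    have "wirtinger (wirtinger_bar f ?u) d (h p) = wirtinger (\<lambda>y. (\<Sum>k\<in>UNIV. cnj (fst ?u $ k) * wirtinger_bar f (axis k 1, 0) y)
      + cnj (snd ?u) * wirtinger_bar f (0, 1) y) d (h p)" for d
      by (rule wirtinger_cong_open[OF W(1,2)], rule wirtinger_coordinates)
        (use W in \<open>auto intro: smooth_on_imp_differentiable\<close>)
    also have "\<dots> d = jev (jD d (jet (h p) (\<lambda>y. (\<Sum>k\<in>UNIV. cnj (fst ?u $ k) * wirtinger_bar f (axis k 1, 0) y)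
      + cnj (snd ?u) * wirtinger_bar f (0, 1) y)))" for d
      by (simp add: jD_jet jev_jet smooth_at_wirtinger smooth_at_add smooth_at_sum smooth_at_mult smooth_at_const fb)
    also have "\<dots> d = (\<Sum>k\<in>UNIV. cnj (fst ?u $ k) * wirtinger (wirtinger_bar f (axis k 1, 0)) d (h p))
      + cnj (snd ?u) * wirtinger (wirtinger_bar f (0, 1)) d (h p)" for d
      by (simp add: jet_add jet_sum_fun jet_mult jet_const smooth_at_wirtinger smooth_at_add smooth_at_sum
          smooth_at_mult smooth_at_const fb) (simp add: jD_jet jev_jet smooth_at_wirtinger fb)
    finally show ?thesis by (simp add: mult.commute)
  qed
  finally show ?thesis by (simp add: complex_hessian_def)
qed

section \<open>The Gauss equation\<close>

definition herm :: "('n::finite \<Rightarrow> real) \<Rightarrow> complex^'n \<Rightarrow> complex^'n \<Rightarrow> complex" where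
  "herm \<epsilon> v w = (\<Sum>k\<in>UNIV. of_real (\<epsilon> k) * (v $ k) * cnj (w $ k))"

lemma herm_add: "herm \<epsilon> (u + v) w = herm \<epsilon> u w + herm \<epsilon> v w" "herm \<epsilon> u (v + w) = herm \<epsilon> u v + herm \<epsilon> u w"
  and herm_diff: "herm \<epsilon> (u - v) w = herm \<epsilon> u w - herm \<epsilon> v w" "herm \<epsilon> u (v - w) = herm \<epsilon> u v - herm \<epsilon> u w"
  and herm_scale: "herm \<epsilon> (c *s u) w = c * herm \<epsilon> u w" "herm \<epsilon> u (c *s w) = cnj c * herm \<epsilon> u w"
  and herm_minus: "herm \<epsilon> (- u) w = - herm \<epsilon> u w" "herm \<epsilon> u (- w) = - herm \<epsilon> u w"
  and herm_zero: "herm \<epsilon> 0 w = 0" "herm \<epsilon> u 0 = 0"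
  by (simp_all add: herm_def algebra_simps sum.distrib sum_subtractf sum_distrib_left sum_negf)

lemma cnj_herm: "cnj (herm \<epsilon> v w) = herm \<epsilon> w v"
  by (simp add: herm_def mult_ac)

lemma herm_self: "herm \<epsilon> v v = of_real (\<Sum>k\<in>UNIV. \<epsilon> k * (cmod (v $ k))\<^sup>2)"
  by (simp add: herm_def complex_norm_square mult.assoc del: of_real_power flip: of_real_power)

lemma herm_axis:
  "herm \<epsilon> (axis \<alpha> a) w = of_real (\<epsilon> \<alpha>) * a * cnj (w $ \<alpha>)"
  "herm \<epsilon> v (axis \<alpha> a) = of_real (\<epsilon> \<alpha>) * (v $ \<alpha>) * cnj a"
  by (simp_all add: herm_def axis_def if_distrib[of cnj] mult_delta_left mult_delta_right cong: if_cong)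

lemma herm_nondegenerate:
  assumes "\<And>k. \<epsilon> k \<noteq> 0" "\<And>w. herm \<epsilon> v w = 0" shows "v = 0"
  using assms(2)[of "axis k 1" for k] assms(1) by (simp add: herm_axis vec_eq_iff)

lemma rho_herm: "of_real (rho \<epsilon> x) = (snd x - cnj (snd x)) * (- \<i> / 2) - herm \<epsilon> (fst x) (fst x)"
  by (simp add: rho_def herm_self complex_eq_iff)

text \<open>Germ version of the situation \<open>rho' \<circ> h = Q rho\<close>: only the behaviour at and near the point \<open>p\<close> of
  the hyperquadric is recorded.\<close>

definition ah_map ::
  "('n::finite \<Rightarrow> real) \<Rightarrow> ('m::finite \<Rightarrow> real) \<Rightarrow> (complex^'n) \<times> complex
    \<Rightarrow> ((complex^'n) \<times> complex \<Rightarrow> (complex^'m) \<times> complex) \<Rightarrow> ((complex^'n) \<times> complex \<Rightarrow> real) \<Rightarrow> bool" where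
  "ah_map \<epsilon> \<epsilon>' p h Q \<longleftrightarrow> almost_holomorphic_at h p \<and> smooth_at p Q \<and> rho \<epsilon> p = 0 \<and>
     (\<exists>W. open W \<and> p \<in> W \<and> (\<forall>x\<in>W. rho \<epsilon>' (h x) = Q x * rho \<epsilon> x))"

definition horizontal :: "('n::finite \<Rightarrow> real) \<Rightarrow> (complex^'n) \<times> complex \<Rightarrow> (complex^'n) \<times> complex \<Rightarrow> bool" where
  "horizontal \<epsilon> p v \<longleftrightarrow> snd v = 2 * \<i> * herm \<epsilon> (fst v) (fst p)"

lemma smooth_at_coordinate: "smooth_at p (\<lambda>x. fst x $ k)" "smooth_at p (\<lambda>x. snd x)"
  by (intro smooth_at_nth smooth_at_fst smooth_at_snd smooth_at_ident)+

lemma wirtinger_coordinate: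
  fixes v :: "(complex^'n::finite) \<times> complex"
  shows "wirtinger (\<lambda>x. fst x $ k) v = (\<lambda>x. fst v $ k)" "wirtinger_bar (\<lambda>x. fst x $ k) v = (\<lambda>x. 0)"
  "wirtinger (\<lambda>x. snd x) v = (\<lambda>x. snd v)" "wirtinger_bar (\<lambda>x. snd x) v = (\<lambda>x. 0)"
proof -
  have "dir_deriv v (\<lambda>x::(complex^'n) \<times> complex. fst x $ k) x = fst v $ k" for x v k
    by (rule dir_deriv_eq) (auto intro!: bounded_linear_imp_has_derivative bounded_linear_compose[OF bounded_linear_vec_nth bounded_linear_fst])
  moreover have "dir_deriv v (\<lambda>x::(complex^'n) \<times> complex. snd x) x = snd v" for x v
    by (rule dir_deriv_eq) (auto intro!: bounded_linear_imp_has_derivative bounded_linear_snd)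
  ultimately show "wirtinger (\<lambda>x. fst x $ k) v = (\<lambda>x. fst v $ k)" "wirtinger_bar (\<lambda>x. fst x $ k) v = (\<lambda>x. 0)"
    "wirtinger (\<lambda>x. snd x) v = (\<lambda>x. snd v)" "wirtinger_bar (\<lambda>x. snd x) v = (\<lambda>x. 0)"
    by (simp_all add: wirtinger_dir_deriv fun_eq_iff cscale_def)
qed

definition rho_jet :: "('n::finite \<Rightarrow> real) \<Rightarrow> (complex^'n) \<times> complex \<Rightarrow> 'n jet" where
  "rho_jet \<epsilon> p = jet p (\<lambda>x. of_real (rho \<epsilon> x))"

lemma rho_jet_eq:
  "rho_jet \<epsilon> p = (jet p (\<lambda>x. snd x) - jcnj (jet p (\<lambda>x. snd x))) * jconst (- \<i> / 2)
    - (\<Sum>k\<in>UNIV. jconst (of_real (\<epsilon> k)) * jet p (\<lambda>x. fst x $ k) * jcnj (jet p (\<lambda>x. fst x $ k)))"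
  unfolding rho_jet_def rho_herm herm_def
  by (simp only: jet_diff jet_mult jet_sum_fun jet_const smooth_at_mult smooth_at_diff smooth_at_sum
      smooth_at_cnj smooth_at_const smooth_at_coordinate jcnj_jet)

lemma jD_coordinate:
  "jD v (jet p (\<lambda>x. fst x $ k)) = jconst (fst v $ k)" "jDb v (jet p (\<lambda>x. fst x $ k)) = 0"
  "jD v (jet p (\<lambda>x. snd x)) = jconst (snd v)" "jDb v (jet p (\<lambda>x. snd x)) = 0"
  by (simp_all add: jD_jet smooth_at_coordinate wirtinger_coordinate jet_const jconst_simps)

lemma jconst_sum: "jconst (\<Sum>i\<in>I. f i) = (\<Sum>i\<in>I. jconst (f i))"
  by (induction I rule: infinite_finite_induct) (simp_all add: jconst_simps)

lemma jD_rho_jet: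
  "jD v (jDb w (rho_jet \<epsilon> p)) = - jconst (herm \<epsilon> (fst v) (fst w))"
  "jD v (jD w (rho_jet \<epsilon> p)) = 0" "jDb v (jDb w (rho_jet \<epsilon> p)) = 0"
  unfolding rho_jet_eq
  by (simp_all add: jD_coordinate jD_cnj herm_def jconst_sum jconst_simps mult_ac)

lemma jev_rho_jet:
  "jev (rho_jet \<epsilon> p) = of_real (rho \<epsilon> p)"
  "jev (jD v (rho_jet \<epsilon> p)) = - \<i> / 2 * (snd v - 2 * \<i> * herm \<epsilon> (fst v) (fst p))"
  "jev (jDb v (rho_jet \<epsilon> p)) = cnj (jev (jD v (rho_jet \<epsilon> p)))"
proof -
  have "jcnj (rho_jet \<epsilon> p) = rho_jet \<epsilon> p"
    unfolding rho_jet_eq by (simp add: algebra_simps jconst_simps)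
  thus "jev (jDb v (rho_jet \<epsilon> p)) = cnj (jev (jD v (rho_jet \<epsilon> p)))"
    by (metis jD_cnj(2) jev_cnj)
  show "jev (rho_jet \<epsilon> p) = of_real (rho \<epsilon> p)"
    unfolding rho_jet_def rho_herm herm_def
    by (subst jev_jet) (intro smooth_at_mult smooth_at_diff smooth_at_sum
      smooth_at_cnj smooth_at_const smooth_at_coordinate refl)+
  show "jev (jD v (rho_jet \<epsilon> p)) = - \<i> / 2 * (snd v - 2 * \<i> * herm \<epsilon> (fst v) (fst p))"
    unfolding rho_jet_eq
    by (simp add: jD_coordinate jD_cnj herm_def jev_jet smooth_at_coordinate algebra_simps)
qed

locale ah_map_at =
  fixes \<epsilon> :: "'n::finite \<Rightarrow> real" and \<epsilon>' :: "'m::finite \<Rightarrow> real" and p :: "(complex^'n) \<times> complex"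
    and h :: "(complex^'n) \<times> complex \<Rightarrow> (complex^'m) \<times> complex" and Q :: "(complex^'n) \<times> complex \<Rightarrow> real"
  assumes ah: "ah_map \<epsilon> \<epsilon>' p h Q"
begin

definition F :: "'m \<Rightarrow> 'n jet" where "F k = jet p (\<lambda>x. fst (h x) $ k)"
definition G :: "'n jet" where "G = jet p (\<lambda>x. snd (h x))"
definition q :: "'n jet" where "q = jet p (\<lambda>x. of_real (Q x))"
abbreviation r :: "'n jet" where "r \<equiv> rho_jet \<epsilon> p"

lemma hol: "almost_holomorphic_at h p" and smooth_Q: "smooth_at p Q" and rho_p: "rho \<epsilon> p = 0"
  using ah by (auto simp: ah_map_def)

lemma smooth_components: "smooth_at p h" "smooth_at p (\<lambda>x. fst (h x) $ k)" "smooth_at p (\<lambda>x. snd (h x))"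
  "smooth_at p (\<lambda>x. of_real (Q x) :: complex)"
  using almost_holomorphic_atD(1)[OF hol] smooth_at_components smooth_at_of_real[OF smooth_Q] by auto

lemma jDb_FG [simp]: "jDb v (F k) = 0" "jDb v G = 0"
  by (simp_all add: F_def G_def almost_holomorphic_atD(2,3)[OF hol])

lemma cnj_q [simp]: "jcnj q = q"
  by (simp add: q_def jcnj_jet smooth_components)

text \<open>The identity between the defining functions in the ring of jets. All relations between the
  derivatives of the map and those of \<open>Q\<close> arise by differentiating it.\<close>

lemma mapping_equation:
  "(G - jcnj G) * jconst (- \<i> / 2) - (\<Sum>k\<in>UNIV. jconst (of_real (\<epsilon>' k)) * F k * jcnj (F k)) = q * r"
proof -
  have rho_smooth: "smooth_at p (\<lambda>x. of_real (rho \<epsilon> x) :: complex)"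
    unfolding rho_herm herm_def by (intro smooth_at_mult smooth_at_diff smooth_at_sum
      smooth_at_cnj smooth_at_const smooth_at_coordinate)
  obtain W where W: "open W" "p \<in> W" "\<forall>x\<in>W. rho \<epsilon>' (h x) = Q x * rho \<epsilon> x" using ah by (auto simp: ah_map_def)
  have "(G - jcnj G) * jconst (- \<i> / 2) - (\<Sum>k\<in>UNIV. jconst (of_real (\<epsilon>' k)) * F k * jcnj (F k))
      = jet p (\<lambda>x. of_real (rho \<epsilon>' (h x)))"
    unfolding rho_herm herm_def
    by (simp only: F_def G_def jet_diff jet_mult jet_sum_fun jet_const smooth_at_mult smooth_at_diff smooth_at_sum
      smooth_at_cnj smooth_at_const smooth_components jcnj_jet)
  also have "\<dots> = jet p (\<lambda>x. of_real (Q x) * of_real (rho \<epsilon> x))"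
    by (rule jet_cong[symmetric, OF _ W(1,2)]) (use W(3) in \<open>auto intro: smooth_at_mult smooth_components rho_smooth\<close>)
  also have "\<dots> = q * r" by (simp add: q_def rho_jet_def jet_mult smooth_components rho_smooth)
  finally show ?thesis .
qed

text \<open>The values at \<open>p\<close> that appear when the mapping equation is differentiated: \<open>lam\<close> for the
  derivatives of \<open>rho\<close>, \<open>D1\<close>, \<open>D2\<close> and \<open>D3\<close> for those of the first components of the map, \<open>q1\<close>,
  \<open>q2\<close> and \<open>q11\<close> for those of \<open>Q\<close>.\<close>

definition lam :: "(complex^'n) \<times> complex \<Rightarrow> complex" where "lam v = jev (jD v r)"
definition D1 :: "(complex^'n) \<times> complex \<Rightarrow> complex^'m" where "D1 v = (\<chi> k. jev (jD v (F k)))"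
definition D2 :: "(complex^'n) \<times> complex \<Rightarrow> (complex^'n) \<times> complex \<Rightarrow> complex^'m" where
  "D2 u v = (\<chi> k. jev (jD u (jD v (F k))))"
definition D3 :: "(complex^'n) \<times> complex \<Rightarrow> (complex^'n) \<times> complex \<Rightarrow> (complex^'n) \<times> complex \<Rightarrow> complex^'m" where
  "D3 t u v = (\<chi> k. jev (jD t (jD u (jD v (F k)))))"
definition q1 :: "(complex^'n) \<times> complex \<Rightarrow> complex" where "q1 v = jev (jD v q)"
definition q2 :: "(complex^'n) \<times> complex \<Rightarrow> (complex^'n) \<times> complex \<Rightarrow> complex" where "q2 u v = jev (jD u (jD v q))"
definition q11 :: "(complex^'n) \<times> complex \<Rightarrow> (complex^'n) \<times> complex \<Rightarrow> complex" where "q11 v w = jev (jD v (jDb w q))"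

lemma lam_eq: "lam v = - \<i> / 2 * (snd v - 2 * \<i> * herm \<epsilon> (fst v) (fst p))"
  by (simp add: lam_def jev_rho_jet)

lemma lam_horizontal: "horizontal \<epsilon> p v \<Longrightarrow> lam v = 0"
  by (simp add: lam_eq horizontal_def)

lemma jev_q: "jev q = of_real (Q p)" by (simp add: q_def jev_jet smooth_components)

lemma jev_jDb_q: "jev (jDb v q) = cnj (q1 v)"
  unfolding q1_def by (metis jD_cnj(2) jev_cnj cnj_q)

lemma cnj_q11: "cnj (q11 v w) = q11 w v"
  unfolding q11_def by (metis jD_cnj jev_cnj cnj_q jD_commute(1))

lemmas jet_calc = jD_rho_jet jD_commute(1)[symmetric] jD_cnj

lemma jev_r: "jev r = 0" "jev (jDb w r) = cnj (lam w)"
  by (simp_all add: jev_rho_jet rho_p lam_def)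

text \<open>The identities below are named after the numbers of unconjugated and conjugated derivatives that
  are applied to the mapping equation. At \<open>p\<close> the function \<open>rho\<close> vanishes and its only second
  derivatives are the mixed ones, so that few terms of the product rule for \<open>Q rho\<close> survive; on the
  left-hand side the conjugate derivatives reach only the conjugated factors.\<close>

lemma identity_1:
  "of_real (Q p) * lam v = - \<i> / 2 * jev (jD v G) - herm \<epsilon>' (D1 v) (fst (h p))"
  using arg_cong[OF mapping_equation, of "\<lambda>a. jev (jD v a)"]
  by (simp add: jet_calc jev_r jev_q lam_def[symmetric] herm_def D1_def F_def[symmetric] algebra_simps
     flip: jev_jet[OF smooth_components(2)])

lemma identity_11:
  "herm \<epsilon>' (D1 v) (D1 w) = of_real (Q p) * herm \<epsilon> (fst v) (fst w) - q1 v * cnj (lam w) - cnj (q1 w) * lam v"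
  using arg_cong[OF mapping_equation, of "\<lambda>a. jev (jDb w (jD v a))"]
  by (simp add: jet_calc jev_r jev_q lam_def[symmetric] q1_def[symmetric] jev_jDb_q herm_def D1_def algebra_simps)

lemma identity_21:
  "herm \<epsilon>' (D2 u v) (D1 w) = q1 u * herm \<epsilon> (fst v) (fst w) + q1 v * herm \<epsilon> (fst u) (fst w)
     - q2 u v * cnj (lam w) - q11 u w * lam v - q11 v w * lam u"
  using arg_cong[OF mapping_equation, of "\<lambda>a. jev (jDb w (jD u (jD v a)))"]
  by (simp add: jet_calc jev_r jev_q lam_def[symmetric] q1_def[symmetric] q2_def[symmetric] q11_def[symmetric] jev_jDb_q herm_def D1_def D2_def algebra_simps)

lemma identity_22:
  assumes "horizontal \<epsilon> p t" "horizontal \<epsilon> p u" "horizontal \<epsilon> p v" "horizontal \<epsilon> p w"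
  shows "herm \<epsilon>' (D2 t u) (D2 v w) = q11 t v * herm \<epsilon> (fst u) (fst w) + q11 u v * herm \<epsilon> (fst t) (fst w)
     + q11 t w * herm \<epsilon> (fst u) (fst v) + q11 u w * herm \<epsilon> (fst t) (fst v)"
  using arg_cong[OF mapping_equation, of "\<lambda>a. jev (jDb v (jDb w (jD t (jD u a))))"] assms[THEN lam_horizontal]
  by (simp add: jet_calc jev_r jev_q lam_def[symmetric] q1_def[symmetric] q2_def[symmetric] q11_def[symmetric] jev_jDb_q herm_def D1_def D2_def algebra_simps)

end

subsection \<open>The Hessian of the logarithm\<close>

definition log_hessian ::
  "((complex^'n::finite) \<times> complex \<Rightarrow> real) \<Rightarrow> (complex^'n) \<times> complex \<Rightarrow> (complex^'n) \<times> complex \<Rightarrow> (complex^'n) \<times> complex \<Rightarrow> complex" where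
  "log_hessian Q p v u = complex_hessian (\<lambda>x. of_real (ln \<bar>Q x\<bar>)) p v u"

lemma dir_deriv_ln_abs:
  fixes Q :: "'a::real_normed_vector \<Rightarrow> real"
  assumes "Q differentiable (at x)" "Q x \<noteq> 0"
  shows "(\<lambda>x. ln \<bar>Q x\<bar>) differentiable (at x)" "dir_deriv v (\<lambda>x. ln \<bar>Q x\<bar>) x = dir_deriv v Q x * inverse (Q x)"
proof -
  have 1: "((\<lambda>t. ln \<bar>t\<bar>) has_derivative (\<lambda>s. s * inverse (Q x))) (at (Q x))"
  proof (cases "Q x > 0")
    case True
    have "((\<lambda>t. ln t) has_derivative (\<lambda>s. s * inverse (Q x))) (at (Q x))"
      using True by (auto intro!: derivative_eq_intros)
    thus ?thesis
      by (rule has_derivative_transform_within_open[of _ _ _ _ "{0<..}"]) (use True in auto)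
  next
    case False
    hence neg: "Q x < 0" using assms(2) by simp
    have "((\<lambda>t. ln (- t)) has_derivative (\<lambda>s. s * inverse (Q x))) (at (Q x))"
      using neg by (auto intro!: derivative_eq_intros simp: field_simps)
    thus ?thesis
      by (rule has_derivative_transform_within_open[of _ _ _ _ "{..<0}"]) (use neg in auto)
  qed
  have 2: "((\<lambda>x. ln \<bar>Q x\<bar>) has_derivative (\<lambda>v. dir_deriv v Q x * inverse (Q x))) (at x)"
    by (rule has_derivative_compose[OF has_derivative_dir_deriv[OF assms(1)] 1])
  show "(\<lambda>x. ln \<bar>Q x\<bar>) differentiable (at x)" using 2 by (auto simp: differentiable_def)
  show "dir_deriv v (\<lambda>x. ln \<bar>Q x\<bar>) x = dir_deriv v Q x * inverse (Q x)" by (rule dir_deriv_eq[OF 2])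
qed

lemma nonzero_neighbourhood:
  fixes Q :: "'a::real_normed_vector \<Rightarrow> real"
  assumes "smooth_at p Q" "Q p \<noteq> 0"
  obtains W where "open W" "p \<in> W" "smooth_on W Q" "\<And>x. x \<in> W \<Longrightarrow> Q x \<noteq> 0"
proof -
  obtain W where W: "open W" "p \<in> W" "smooth_on W Q" by (rule smooth_atE[OF assms(1)])
  have "open (Q -` (- {0}) \<inter> W)"
    using continuous_on_open_vimage[OF W(1), of Q] smooth_on_imp_continuous_on[OF W(3)]
    by (metis open_Compl closed_singleton)
  thus ?thesis
    by (rule that) (use W assms(2) smooth_on_subset[OF W(3), of "Q -` (- {0}) \<inter> W"] in auto)
qed

lemma smooth_at_ln_abs:
  fixes Q :: "'a::real_normed_vector \<Rightarrow> real"
  assumes "smooth_at p Q" "Q p \<noteq> 0"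
  shows "smooth_at p (\<lambda>x. ln \<bar>Q x\<bar>)"
proof -
  obtain W where W: "open W" "p \<in> W" "smooth_on W Q" "\<And>x. x \<in> W \<Longrightarrow> Q x \<noteq> 0"
    by (rule nonzero_neighbourhood[OF assms]) (rule that)
  note d = smooth_on_imp_differentiable[OF W(3)]
  have "smooth_on W (dir_deriv v (\<lambda>x. ln \<bar>Q x\<bar>))" for v
  proof (rule smooth_on_cong[OF W(1)])
    show "smooth_on W (\<lambda>x. dir_deriv v Q x * inverse (Q x))"
      by (intro smooth_on_mult W smooth_on_inverse smooth_on_dir_deriv)
  qed (simp add: dir_deriv_ln_abs(2)[OF d W(4)])
  hence "smooth_on W (\<lambda>x. ln \<bar>Q x\<bar>)"
    using dir_deriv_ln_abs(1)[OF d W(4)] smooth_on_iff_dir_deriv by blast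
  thus ?thesis by (rule smooth_atI[OF W(1,2)])
qed

text \<open>The logarithm enters only through the identity \<open>\<partial>Q = Q \<partial>log |Q|\<close> in the ring of jets.\<close>

lemma jet_ln_abs:
  fixes Q :: "(complex^'n::finite) \<times> complex \<Rightarrow> real"
  assumes "smooth_at p Q" "Q p \<noteq> 0"
  shows "jD v (jet p (\<lambda>x. of_real (Q x))) = jet p (\<lambda>x. of_real (Q x)) * jD v (jet p (\<lambda>x. of_real (ln \<bar>Q x\<bar>)))"
    "jDb v (jet p (\<lambda>x. of_real (Q x))) = jet p (\<lambda>x. of_real (Q x)) * jDb v (jet p (\<lambda>x. of_real (ln \<bar>Q x\<bar>)))"
proof -
  obtain W where W: "open W" "p \<in> W" "smooth_on W Q" "\<And>x. x \<in> W \<Longrightarrow> Q x \<noteq> 0"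
    by (rule nonzero_neighbourhood[OF assms]) (rule that)
  note d = smooth_on_imp_differentiable[OF W(3)]
  note s = smooth_at_of_real[OF assms(1)] smooth_at_of_real[OF smooth_at_ln_abs[OF assms]]
  have r: "dir_deriv u (\<lambda>x. of_real (f x) :: complex) x = of_real (dir_deriv u f x)"
    if "f differentiable (at x)" for u x and f :: "(complex^'n) \<times> complex \<Rightarrow> real"
    by (rule dir_deriv_bounded_linear[OF bounded_linear_of_real that])
  have *: "dir_deriv u (\<lambda>x. of_real (Q x) :: complex) x = of_real (Q x) * dir_deriv u (\<lambda>x. of_real (ln \<bar>Q x\<bar>) :: complex) x"
    if "x \<in> W" for u x
  proof -
    note l = dir_deriv_ln_abs[OF d[OF that] W(4)[OF that]]
    have "dir_deriv u Q x = Q x * dir_deriv u (\<lambda>x. ln \<bar>Q x\<bar>) x"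
      using W(4)[OF that] by (simp add: l(2))
    thus ?thesis by (simp only: r[OF d[OF that]] r[OF l(1)] of_real_mult[symmetric])
  qed
  have "wirtinger (\<lambda>x. of_real (Q x)) v x = of_real (Q x) * wirtinger (\<lambda>x. of_real (ln \<bar>Q x\<bar>)) v x"
    "wirtinger_bar (\<lambda>x. of_real (Q x)) v x = of_real (Q x) * wirtinger_bar (\<lambda>x. of_real (ln \<bar>Q x\<bar>)) v x"
    if "x \<in> W" for x by (simp_all add: wirtinger_dir_deriv *[OF that] field_simps)
  from jet_cong[OF smooth_at_wirtinger(1)[OF s(1)] W(1,2) this(1)]
    jet_cong[OF smooth_at_wirtinger(2)[OF s(1)] W(1,2) this(2)]
  show "jD v (jet p (\<lambda>x. of_real (Q x))) = jet p (\<lambda>x. of_real (Q x)) * jD v (jet p (\<lambda>x. of_real (ln \<bar>Q x\<bar>)))"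
    "jDb v (jet p (\<lambda>x. of_real (Q x))) = jet p (\<lambda>x. of_real (Q x)) * jDb v (jet p (\<lambda>x. of_real (ln \<bar>Q x\<bar>)))"
    by (simp_all add: jD_jet s jet_mult smooth_at_wirtinger)
qed

lemma complex_hessian_add:
  assumes "smooth_at p f" "smooth_at p g"
  shows "complex_hessian (\<lambda>x. f x + g x) p v u = complex_hessian f p v u + complex_hessian g p v u"
  by (simp add: complex_hessian_jet smooth_at_add assms jet_add)

lemma complex_hessian_cong:
  assumes "smooth_at p f" "open W" "p \<in> W" "\<And>x. x \<in> W \<Longrightarrow> f x = g x"
  shows "complex_hessian f p v u = complex_hessian g p v u"
  using complex_hessian_jet[OF assms(1)] complex_hessian_jet[OF smooth_at_cong[OF assms]] jet_cong[OF assms] by simp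

lemma complex_hessian_sesquilinear:
  assumes "smooth_at p f"
  shows "complex_hessian f p (u + v) w = complex_hessian f p u w + complex_hessian f p v w"
    "complex_hessian f p u (v + w) = complex_hessian f p u v + complex_hessian f p u w"
    "complex_hessian f p (cscale c u) w = c * complex_hessian f p u w"
    "complex_hessian f p u (cscale c w) = cnj c * complex_hessian f p u w"
proof -
  obtain W where W: "open W" "p \<in> W" "smooth_on W f" by (rule smooth_atE[OF assms])
  have *: "complex_hessian f p u w = wirtinger_bar (wirtinger f u) w p" for u w
    unfolding complex_hessian_def by (rule wirtinger_commute(1)[OF W])
  note d = smooth_at_imp_differentiable[OF smooth_at_wirtinger(1)[OF assms]]
    smooth_at_imp_differentiable[OF smooth_at_wirtinger(2)[OF assms]]
  show "complex_hessian f p (u + v) w = complex_hessian f p u w + complex_hessian f p v w"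
    "complex_hessian f p (cscale c u) w = c * complex_hessian f p u w"
    by (simp_all add: complex_hessian_def wirtinger_add_vec wirtinger_cscale d)
  show "complex_hessian f p u (v + w) = complex_hessian f p u v + complex_hessian f p u w"
    "complex_hessian f p u (cscale c w) = cnj c * complex_hessian f p u w"
    by (simp_all add: * wirtinger_add_vec wirtinger_cscale d)
qed

text \<open>The unique (1,0)-vector over \<open>v\<close> that is tangent to the hyperquadric.\<close>

definition horizontal_lift :: "('n::finite \<Rightarrow> real) \<Rightarrow> (complex^'n) \<times> complex \<Rightarrow> complex^'n \<Rightarrow> (complex^'n) \<times> complex" where
  "horizontal_lift \<epsilon> p v = (v, 2 * \<i> * herm \<epsilon> v (fst p))"

lemma horizontal_horizontal_lift: "horizontal \<epsilon> p (horizontal_lift \<epsilon> p v)"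
  and fst_horizontal_lift [simp]: "fst (horizontal_lift \<epsilon> p v) = v"
  and horizontal_lift_fst: "horizontal \<epsilon> p u \<Longrightarrow> horizontal_lift \<epsilon> p (fst u) = u"
  by (auto simp: horizontal_def horizontal_lift_def prod_eq_iff)

lemma horizontal_lift_add: "horizontal_lift \<epsilon> p (u + v) = horizontal_lift \<epsilon> p u + horizontal_lift \<epsilon> p v"
  and horizontal_lift_scale: "horizontal_lift \<epsilon> p (c *s u) = cscale c (horizontal_lift \<epsilon> p u)"
  by (simp_all add: horizontal_lift_def cscale_def herm_add herm_scale algebra_simps)

lemma frame_horizontal_lift: "frame \<epsilon> \<alpha> p = horizontal_lift \<epsilon> p (axis \<alpha> 1)"
  by (simp add: frame_def horizontal_lift_def herm_axis)

definition sesq :: "complex^'n^'n \<Rightarrow> complex^'n::finite \<Rightarrow> complex^'n \<Rightarrow> complex" where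
  "sesq M v w = (\<Sum>\<alpha>\<in>UNIV. \<Sum>\<beta>\<in>UNIV. v $ \<alpha> * cnj (w $ \<beta>) * M $ \<alpha> $ \<beta>)"

lemma sesq_add: "sesq M (u + v) w = sesq M u w + sesq M v w" "sesq M u (v + w) = sesq M u v + sesq M u w"
  and sesq_scale: "sesq M (c *s u) w = c * sesq M u w" "sesq M u (c *s w) = cnj c * sesq M u w"
  by (simp_all add: sesq_def algebra_simps sum.distrib sum_distrib_left)

lemma sesq_axis: "sesq M (axis \<alpha> 1) (axis \<beta> 1) = M $ \<alpha> $ \<beta>"
  by (simp add: sesq_def axis_def if_distrib[of cnj] mult_delta_left mult_delta_right cong: if_cong)

lemma sesq_expand:
  fixes B :: "complex^'n::finite \<Rightarrow> complex^'n \<Rightarrow> complex"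
  assumes add: "\<And>u v w. B (u + v) w = B u w + B v w" "\<And>u v w. B u (v + w) = B u v + B u w"
    and scale: "\<And>c u w. B (c *s u) w = c * B u w" "\<And>c u w. B u (c *s w) = cnj c * B u w"
  shows "B v w = sesq (\<chi> \<alpha> \<beta>. B (axis \<alpha> 1) (axis \<beta> 1)) v w"
proof -
  have z: "B 0 w = 0" "B u 0 = 0" for u w using scale(1)[of 0 0 w] scale(2)[of u 0 0] by simp_all
  have s1: "B (\<Sum>i\<in>I. f i) w = (\<Sum>i\<in>I. B (f i) w)" for I and f :: "'n \<Rightarrow> complex^'n" and w
    by (induction I rule: infinite_finite_induct) (simp_all add: z add)
  have s2: "B u (\<Sum>i\<in>I. f i) = (\<Sum>i\<in>I. B u (f i))" for I and f :: "'n \<Rightarrow> complex^'n" and u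
    by (induction I rule: infinite_finite_induct) (simp_all add: z add)
  have "B v w = B (\<Sum>\<alpha>\<in>UNIV. v $ \<alpha> *s axis \<alpha> 1) (\<Sum>\<beta>\<in>UNIV. w $ \<beta> *s axis \<beta> 1)"
    by (simp only: basis_expansion)
  hence "B v w = (\<Sum>\<beta>\<in>UNIV. \<Sum>\<alpha>\<in>UNIV. v $ \<alpha> * cnj (w $ \<beta>) * B (axis \<alpha> 1) (axis \<beta> 1))"
    by (simp add: s1 s2 scale sum_distrib_left mult_ac)
  also have "\<dots> = (\<Sum>\<alpha>\<in>UNIV. \<Sum>\<beta>\<in>UNIV. v $ \<alpha> * cnj (w $ \<beta>) * B (axis \<alpha> 1) (axis \<beta> 1))"
    by (rule sum.swap)
  finally show ?thesis by (simp add: sesq_def)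
qed

text \<open>Where \<open>\<parallel>v\<parallel>\<^sup>2\<close> vanishes, \<open>sesq M v v\<close> is a limit of its values at nearby vectors with nonzero
  square, so that it is zero for all \<open>v\<close>; polarization does the rest.\<close>

lemma sesq_zero:
  fixes \<epsilon> :: "'n::finite \<Rightarrow> real"
  assumes "\<And>k. \<epsilon> k \<noteq> 0" and prod: "\<And>v. herm \<epsilon> v v * sesq M v v = 0"
  shows "M = 0"
proof -
  have diag: "sesq M v v = 0" for v
  proof -
    define e :: "complex^'n" where "e = axis undefined 1"
    define b where "b = \<epsilon> undefined"
    have b: "herm \<epsilon> e e = of_real b" "b \<noteq> 0" using assms(1) by (auto simp: e_def b_def herm_axis)
    define a where "a = 2 * Re (herm \<epsilon> v e)"
    show ?thesis
    proof (cases "herm \<epsilon> v v = 0")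
      case True
      have h: "herm \<epsilon> (v + of_real t *s e) (v + of_real t *s e) = of_real (t * (a + b * t))" for t
      proof -
        have "herm \<epsilon> (v + of_real t *s e) (v + of_real t *s e)
           = of_real t * (herm \<epsilon> v e + cnj (herm \<epsilon> v e)) + of_real t * of_real t * of_real b"
          by (simp add: herm_add herm_scale True b cnj_herm algebra_simps)
        thus ?thesis by (simp add: complex_add_cnj a_def algebra_simps)
      qed
      have "\<forall>\<^sub>F t in at_right (0::real). a + b * t \<noteq> 0"
      proof (cases "a = 0")
        case True
        thus ?thesis using b(2) eventually_at_right_less[of "0::real"] by (auto elim: eventually_mono)
      next
        case False
        have "((\<lambda>t. a + b * t) \<longlongrightarrow> a + b * 0) (at_right 0)" by (intro tendsto_intros)
        thus ?thesis using False by (intro tendsto_imp_eventually_ne) auto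
      qed
      hence "\<forall>\<^sub>F t in at_right (0::real). sesq M v v + of_real t * (sesq M v e + sesq M e v + of_real t * sesq M e e) = 0"
        using eventually_at_right_less[of "0::real"]
      proof eventually_elim
        case (elim t)
        have "herm \<epsilon> (v + of_real t *s e) (v + of_real t *s e) \<noteq> 0" unfolding h using elim by (simp only: of_real_eq_0_iff) simp
        hence "sesq M (v + of_real t *s e) (v + of_real t *s e) = 0" using prod by (metis mult_eq_0_iff)
        thus ?case by (simp add: sesq_add sesq_scale algebra_simps)
      qed
      hence "((\<lambda>t. sesq M v v + of_real t * (sesq M v e + sesq M e v + of_real t * sesq M e e)) \<longlongrightarrow> 0) (at_right 0)"
        by (rule tendsto_eventually)
      moreover have "((\<lambda>t. sesq M v v + of_real t * (sesq M v e + sesq M e v + of_real t * sesq M e e)) \<longlongrightarrow>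
          sesq M v v + of_real 0 * (sesq M v e + sesq M e v + of_real 0 * sesq M e e)) (at_right 0)"
        by (intro tendsto_intros)
      ultimately have "0 = sesq M v v + of_real 0 * (sesq M v e + sesq M e v + of_real 0 * sesq M e e)"
        by (intro tendsto_unique) auto
      thus ?thesis by simp
    next
      case False thus ?thesis using prod[of v] by simp
    qed
  qed
  have "sesq M v w = 0" for v w
  proof -
    have "sesq M v w + sesq M w v = 0" using diag[of "v + w"] by (simp add: sesq_add diag add.commute)
    moreover have "- \<i> * sesq M v w + \<i> * sesq M w v = 0"
      using diag[of "v + \<i> *s w"] by (simp add: sesq_add sesq_scale diag)
    ultimately show ?thesis by (simp add: complex_eq_iff)
  qed
  thus ?thesis using sesq_axis[of M] by (simp add: vec_eq_iff)
qed

definition ahlfors_matrix :: "('n::finite \<Rightarrow> real) \<Rightarrow> ((complex^'n) \<times> complex \<Rightarrow> real) \<Rightarrow> (complex^'n) \<times> complex \<Rightarrow> complex^'n^'n" where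
  "ahlfors_matrix \<epsilon> Q p = (\<chi> \<alpha> \<beta>. log_hessian Q p (frame \<epsilon> \<alpha> p) (frame \<epsilon> \<beta> p))"

lemma log_hessian_sesq:
  assumes "smooth_at p Q" "Q p \<noteq> 0"
  shows "log_hessian Q p (horizontal_lift \<epsilon> p v) (horizontal_lift \<epsilon> p w) = sesq (ahlfors_matrix \<epsilon> Q p) v w"
  unfolding ahlfors_matrix_def frame_horizontal_lift log_hessian_def
  by (rule sesq_expand)
    (simp_all add: horizontal_lift_add horizontal_lift_scale complex_hessian_sesquilinear
      smooth_at_of_real[OF smooth_at_ln_abs[OF assms]])

context ah_map_at
begin

text \<open>The identity \<open>\<partial>Q = Q \<partial>log |Q|\<close> differentiated once more; multiplying by \<open>Q\<^sup>2\<close> avoids denominators.\<close>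

lemma log_hessian_eq:
  assumes "Q p \<noteq> 0"
  shows "of_real (Q p) * of_real (Q p) * log_hessian Q p v w = of_real (Q p) * q11 v w - q1 v * cnj (q1 w)"
proof -
  let ?L = "jet p (\<lambda>x. complex_of_real (ln \<bar>Q x\<bar>))"
  note s = smooth_at_of_real[OF smooth_at_ln_abs[OF smooth_Q assms]]
  note e = jet_ln_abs[OF smooth_Q assms, folded q_def]
  have "q11 v w = q1 v * jev (jDb w ?L) + of_real (Q p) * log_hessian Q p v w"
    unfolding q11_def e(2)[of w] log_hessian_def complex_hessian_jet[OF s] by (simp add: q1_def jev_q)
  moreover have "cnj (q1 w) = of_real (Q p) * jev (jDb w ?L)"
    using arg_cong[OF e(2), of jev w] by (simp add: jev_jDb_q jev_q)
  ultimately show ?thesis by (simp add: algebra_simps)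
qed

lemma fst_pushforward: "fst (pushforward h p v) = D1 v"
  by (simp add: pushforward_def D1_def F_def jD_jet smooth_components jev_jet smooth_at_wirtinger)

lemma horizontal_pushforward:
  assumes "horizontal \<epsilon> p v" shows "horizontal \<epsilon>' (h p) (pushforward h p v)"
proof -
  have "snd (pushforward h p v) = jev (jD v G)"
    by (simp add: pushforward_def G_def jD_jet smooth_components jev_jet smooth_at_wirtinger)
  thus ?thesis using identity_1[of v] lam_horizontal[OF assms]
    by (simp add: horizontal_def fst_pushforward field_simps)
qed

lemma D_linear:
  "D1 (u + v) = D1 u + D1 v" "D1 (cscale c v) = c *s D1 v"
proof -
  note d = smooth_at_imp_differentiable[OF smooth_components(2)]
  show "D1 (u + v) = D1 u + D1 v" "D1 (cscale c v) = c *s D1 v"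
    by (simp_all add: vec_eq_iff D1_def F_def jD_jet smooth_components jev_jet smooth_at_wirtinger
        wirtinger_add_vec[OF d] wirtinger_cscale[OF d])
qed

lemma D1_isometry:
  "herm \<epsilon>' (D1 (horizontal_lift \<epsilon> p v)) (D1 (horizontal_lift \<epsilon> p w)) = of_real (Q p) * herm \<epsilon> v w"
  using identity_11[of "horizontal_lift \<epsilon> p v" "horizontal_lift \<epsilon> p w"]
  by (simp add: lam_horizontal horizontal_horizontal_lift)

lemma D2_tangential:
  "herm \<epsilon>' (D2 (horizontal_lift \<epsilon> p v) (horizontal_lift \<epsilon> p v)) (D1 (horizontal_lift \<epsilon> p w))
    = 2 * q1 (horizontal_lift \<epsilon> p v) * herm \<epsilon> v w"
  using identity_21[of "horizontal_lift \<epsilon> p v" "horizontal_lift \<epsilon> p v" "horizontal_lift \<epsilon> p w"]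
  by (simp add: lam_horizontal horizontal_horizontal_lift)

text \<open>On horizontal vectors the first derivatives of \<open>rho\<close> vanish, so two of the four derivatives must
  form a mixed derivative of \<open>rho\<close> and the other two fall on \<open>Q\<close>. Geometrically, the left-hand side
  is the square of the second fundamental form up to tangential terms.\<close>

lemma gauss_equation:
  "herm \<epsilon>' (D2 (horizontal_lift \<epsilon> p v) (horizontal_lift \<epsilon> p v)) (D2 (horizontal_lift \<epsilon> p v) (horizontal_lift \<epsilon> p v))
    = 4 * q11 (horizontal_lift \<epsilon> p v) (horizontal_lift \<epsilon> p v) * herm \<epsilon> v v"
  using identity_22[of "horizontal_lift \<epsilon> p v" "horizontal_lift \<epsilon> p v" "horizontal_lift \<epsilon> p v" "horizontal_lift \<epsilon> p v"]
  by (simp add: horizontal_horizontal_lift)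

end

text \<open>In equal dimensions the second derivatives are tangential, so that the second fundamental
  form vanishes and the Gauss equation leaves no room for a nonzero Ahlfors derivative.\<close>

lemma ahlfors_matrix_equidimensional:
  fixes \<epsilon> \<epsilon>' :: "'n::finite \<Rightarrow> real"
  assumes ah: "ah_map \<epsilon> \<epsilon>' p h Q" and "\<And>k. \<epsilon> k \<noteq> 0" "\<And>k. \<epsilon>' k \<noteq> 0" "Q p \<noteq> 0"
  shows "ahlfors_matrix \<epsilon> Q p = 0"
proof (rule sesq_zero[OF assms(2)])
  interpret ah_map_at \<epsilon> \<epsilon>' p h Q by unfold_locales (rule ah)
  fix v
  let ?L = "horizontal_lift \<epsilon> p"
  define T where "T v = D1 (?L v)" for v
  have T: "T (u + v) = T u + T v" "T (c *s v) = c *s T v" for u v c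
    by (simp_all add: T_def horizontal_lift_add horizontal_lift_scale D_linear)
  have "linear T"
    by (rule linearI) (use T(1) T(2)[of "of_real r" for r] in \<open>auto simp: scaleR_vec_def vector_scalar_mult_def scaleR_conv_of_real\<close>)
  moreover have "inj T"
  proof (rule linear_injective_0[OF \<open>linear T\<close>, THEN iffD2], intro allI impI)
    fix v assume "T v = 0"
    hence "herm \<epsilon> v w = 0" for w using D1_isometry[of v w] assms(4) by (simp add: T_def herm_zero)
    thus "v = 0" by (rule herm_nondegenerate[OF assms(2)])
  qed
  ultimately have "surj T" by (rule linear_inj_imp_surj)
  define d where "d = D2 (?L v) (?L v) - (2 * q1 (?L v) / of_real (Q p)) *s T v"
  have "herm \<epsilon>' d (T w) = 0" for w
    using D2_tangential[of v w] D1_isometry[of v w] assms(4) by (simp add: d_def herm_diff herm_scale T_def)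
  hence "herm \<epsilon>' d w = 0" for w using surjD[OF \<open>surj T\<close>, of w] by auto
  hence "d = 0" by (rule herm_nondegenerate[OF assms(3)])
  hence D2: "D2 (?L v) (?L v) = (2 * q1 (?L v) / of_real (Q p)) *s T v" by (simp add: d_def)
  have "of_real (Q p) * (4 * q11 (?L v) (?L v) * herm \<epsilon> v v) = 4 * q1 (?L v) * cnj (q1 (?L v)) * herm \<epsilon> v v"
    using gauss_equation[of v] D1_isometry[of v v] assms(4) unfolding D2
    by (auto simp: herm_scale T_def field_simps)
  hence "(of_real (Q p) * q11 (?L v) (?L v) - q1 (?L v) * cnj (q1 (?L v))) * herm \<epsilon> v v = 0"
    by (auto simp: algebra_simps)
  hence "of_real (Q p) * of_real (Q p) * log_hessian Q p (?L v) (?L v) * herm \<epsilon> v v = 0"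
    using log_hessian_eq[OF assms(4), of "?L v" "?L v"] by simp
  thus "herm \<epsilon> v v * sesq (ahlfors_matrix \<epsilon> Q p) v v = 0"
    using assms(4) log_hessian_sesq[OF smooth_Q assms(4), of \<epsilon> v v] by auto
qed

lemma ah_map_compose:
  assumes h: "ah_map \<epsilon> \<epsilon>' p h Q" and k: "ah_map \<epsilon>' \<epsilon>'' (h p) k Q'"
  shows "ah_map \<epsilon> \<epsilon>'' p (\<lambda>x. k (h x)) (\<lambda>x. Q' (h x) * Q x)"
proof -
  have hh: "almost_holomorphic_at h p" "almost_holomorphic_at k (h p)" "smooth_at p Q" "smooth_at (h p) Q'"
    using h k by (auto simp: ah_map_def)
  have sh: "smooth_at p h" using almost_holomorphic_atD(1)[OF hh(1)] .
  obtain A where A: "open A" "p \<in> A" "\<forall>x\<in>A. rho \<epsilon>' (h x) = Q x * rho \<epsilon> x" using h by (auto simp: ah_map_def)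
  obtain B where B: "open B" "h p \<in> B" "\<forall>x\<in>B. rho \<epsilon>'' (k x) = Q' x * rho \<epsilon>' x" using k by (auto simp: ah_map_def)
  obtain V where V: "open V" "p \<in> V" "smooth_on V h" by (rule smooth_atE[OF sh])
  have "open (h -` B \<inter> V)" using continuous_on_open_vimage[OF V(1), of h] smooth_on_imp_continuous_on[OF V(3)] B by blast
  hence "open (h -` B \<inter> V \<inter> A) \<and> p \<in> h -` B \<inter> V \<inter> A \<and>
      (\<forall>x\<in>h -` B \<inter> V \<inter> A. rho \<epsilon>'' (k (h x)) = Q' (h x) * Q x * rho \<epsilon> x)"
    using A B V by auto
  moreover have "smooth_at p (\<lambda>x. Q' (h x) * Q x)"
    by (intro smooth_at_mult hh smooth_at_compose[OF sh])
  ultimately show ?thesis using almost_holomorphic_at_compose[OF hh(1,2)] h unfolding ah_map_def by blast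
qed

text \<open>The quotients multiply, their logarithms add, and the Hessian of the second one is pulled back.\<close>

lemma log_hessian_compose:
  assumes h: "ah_map \<epsilon> \<epsilon>' p h Q" and k: "ah_map \<epsilon>' \<epsilon>'' (h p) k Q'" and nz: "Q p \<noteq> 0" "Q' (h p) \<noteq> 0"
  shows "log_hessian (\<lambda>x. Q' (h x) * Q x) p v w
    = log_hessian Q' (h p) (pushforward h p v) (pushforward h p w) + log_hessian Q p v w"
proof -
  have hh: "almost_holomorphic_at h p" "smooth_at p Q" "smooth_at (h p) Q'"
    using h k by (auto simp: ah_map_def)
  have sh: "smooth_at p h" using almost_holomorphic_atD(1)[OF hh(1)] .
  have s: "smooth_at p (\<lambda>x. of_real (ln \<bar>Q x\<bar>) :: complex)" "smooth_at (h p) (\<lambda>x. of_real (ln \<bar>Q' x\<bar>) :: complex)"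
    by (intro smooth_at_of_real smooth_at_ln_abs hh nz)+
  have sQ: "smooth_at p (\<lambda>x. Q' (h x) * Q x)"
    by (intro smooth_at_mult hh smooth_at_compose[OF sh])
  obtain W where W: "open W" "p \<in> W" "\<And>x. x \<in> W \<Longrightarrow> Q' (h x) * Q x \<noteq> 0"
    by (rule nonzero_neighbourhood[OF sQ]) (use nz in auto)
  have "log_hessian (\<lambda>x. Q' (h x) * Q x) p v w
      = complex_hessian (\<lambda>x. of_real (ln \<bar>Q' (h x)\<bar>) + of_real (ln \<bar>Q x\<bar>)) p v w"
    unfolding log_hessian_def
  proof (rule complex_hessian_cong[symmetric, OF _ W(1,2)])
    show "smooth_at p (\<lambda>x. complex_of_real (ln \<bar>Q' (h x)\<bar>) + complex_of_real (ln \<bar>Q x\<bar>))"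
      by (intro smooth_at_add s smooth_at_compose[OF sh s(2)])
    show "complex_of_real (ln \<bar>Q' (h x)\<bar>) + complex_of_real (ln \<bar>Q x\<bar>) = complex_of_real (ln \<bar>Q' (h x) * Q x\<bar>)"
      if "x \<in> W" for x using W(3)[OF that] by (simp add: abs_mult ln_mult)
  qed
  also have "\<dots> = complex_hessian (\<lambda>x. of_real (ln \<bar>Q' (h x)\<bar>)) p v w + log_hessian Q p v w"
    unfolding log_hessian_def by (intro complex_hessian_add s smooth_at_compose[OF sh s(2)])
  also have "complex_hessian (\<lambda>x. of_real (ln \<bar>Q' (h x)\<bar>)) p v w
      = log_hessian Q' (h p) (pushforward h p v) (pushforward h p w)"
    unfolding log_hessian_def by (rule complex_hessian_compose[OF hh(1) s(2)])
  finally show ?thesis .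
qed

section \<open>Weighted orders of vanishing\<close>

definition wt :: "(complex^'n::finite) \<times> complex \<Rightarrow> real" where
  "wt x = norm (fst x) + sqrt (cmod (snd x))"

lemma wt_nonneg: "0 \<le> wt x" by (simp add: wt_def)

lemma wt_bounds: "norm (fst x) \<le> wt x" "cmod (snd x) \<le> (wt x)\<^sup>2"
proof -
  show "norm (fst x) \<le> wt x" by (simp add: wt_def)
  have "cmod (snd x) = (sqrt (cmod (snd x)))\<^sup>2" by simp
  also have "\<dots> \<le> (wt x)\<^sup>2" by (intro power_mono) (auto simp: wt_def)
  finally show "cmod (snd x) \<le> (wt x)\<^sup>2" .
qed

text \<open>All derivatives at the origin of weight less than \<open>k\<close> vanish, a derivative in \<open>z\<close> counting once
  and a derivative in \<open>w\<close> twice.\<close>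

fun wt_flat :: "nat \<Rightarrow> ((complex^'n::finite) \<times> complex \<Rightarrow> complex) \<Rightarrow> bool" where
  "wt_flat 0 f = True"
| "wt_flat (Suc 0) f = (f 0 = 0)"
| "wt_flat (Suc (Suc k)) f = (f 0 = 0 \<and> (\<forall>z. wt_flat (Suc k) (dir_deriv (z, 0) f))
      \<and> (\<forall>w. wt_flat k (dir_deriv (0, w) f)))"

lemma wt_dilate: "0 \<le> t \<Longrightarrow> wt (t *\<^sub>R z, t\<^sup>2 *\<^sub>R w) = t * wt (z, w)"
  by (simp add: wt_def real_sqrt_mult algebra_simps)

lemma norm_dilate: "0 \<le> t \<Longrightarrow> t \<le> 1 \<Longrightarrow> norm (t *\<^sub>R z, t\<^sup>2 *\<^sub>R w) \<le> norm (z, w)"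
proof -
  assume t: "0 \<le> t" "t \<le> 1"
  have "t * norm z \<le> norm z" "t\<^sup>2 * norm w \<le> norm w"
    using t by (auto intro!: mult_left_le_one_le simp: power_le_one)
  thus ?thesis by (auto simp: norm_Pair t intro!: real_sqrt_le_mono add_mono power_mono)
qed

lemma dilation_derivative:
  assumes "f differentiable (at (t *\<^sub>R z, t\<^sup>2 *\<^sub>R w))"
  shows "((\<lambda>t. f (t *\<^sub>R z, t\<^sup>2 *\<^sub>R w)) has_vector_derivative
    dir_deriv (z, 0) f (t *\<^sub>R z, t\<^sup>2 *\<^sub>R w) + (2 * t) *\<^sub>R dir_deriv (0, w) f (t *\<^sub>R z, t\<^sup>2 *\<^sub>R w)) (at t)"
proof -
  let ?x = "(t *\<^sub>R z, t\<^sup>2 *\<^sub>R w)"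
  have "((\<lambda>t. (t *\<^sub>R z, t\<^sup>2 *\<^sub>R w)) has_derivative (\<lambda>s. (s *\<^sub>R z, (2 * t * s) *\<^sub>R w))) (at t)"
    by (auto intro!: derivative_eq_intros)
  from has_derivative_compose[OF this has_derivative_dir_deriv[OF assms]]
  have *: "((\<lambda>t. f (t *\<^sub>R z, t\<^sup>2 *\<^sub>R w)) has_derivative (\<lambda>s. dir_deriv (s *\<^sub>R z, (2 * t * s) *\<^sub>R w) f ?x)) (at t)" .
  interpret linear "\<lambda>v. dir_deriv v f ?x" by (rule linear_dir_deriv[OF assms])
  have "dir_deriv (s *\<^sub>R z, (2 * t * s) *\<^sub>R w) f ?x = s *\<^sub>R (dir_deriv (z, 0) f ?x + (2 * t) *\<^sub>R dir_deriv (0, w) f ?x)" for s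
  proof -
    have "(s *\<^sub>R z, (2 * t * s) *\<^sub>R w) = s *\<^sub>R (z, 0) + (2 * t * s) *\<^sub>R (0, w)" by simp
    hence "dir_deriv (s *\<^sub>R z, (2 * t * s) *\<^sub>R w) f ?x = s *\<^sub>R dir_deriv (z, 0) f ?x + (2 * t * s) *\<^sub>R dir_deriv (0, w) f ?x"
      by (simp only: add scale)
    thus ?thesis by (simp add: scaleR_add_right mult.commute mult.left_commute)
  qed
  thus ?thesis using * by (simp add: has_vector_derivative_def)
qed

text \<open>The estimate follows by integrating along the curves \<open>t \<mapsto> (t z, t\<^sup>2 w)\<close>: the derivative is
  \<open>D\<^sub>z f + 2 t D\<^sub>w f\<close>, and the two terms gain one and two orders, respectively.\<close>

lemma wt_flat_bound:
  assumes "smooth_at 0 f" "wt_flat k f"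
  shows "\<exists>C\<ge>0. \<forall>\<^sub>F x in nhds 0. cmod (f x) \<le> C * wt x ^ k"
  using assms
proof (induction k f rule: wt_flat.induct)
  case (1 f)
  have "isCont f 0" using 1 by (intro differentiable_imp_continuous_within smooth_at_imp_differentiable)
  hence "\<forall>\<^sub>F x in nhds 0. cmod (f x) < cmod (f 0) + 1"
    unfolding isCont_def tendsto_at_iff_tendsto_nhds by (intro order_tendstoD(2)[OF tendsto_norm]) auto
  hence "\<forall>\<^sub>F x in nhds 0. cmod (f x) \<le> (cmod (f 0) + 1) * wt x ^ 0" by (auto elim: eventually_mono)
  thus ?case by (intro exI[of _ "cmod (f 0) + 1"]) auto
next
  case (2 f)
  have "f differentiable (at 0)" by (rule smooth_at_imp_differentiable[OF 2(1)])
  then obtain D where D: "(f has_derivative D) (at 0)" by (auto simp: differentiable_def)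
  obtain K where K: "K > 0" "\<And>x. norm (D x) \<le> norm x * K"
    using bounded_linear.pos_bounded[OF has_derivative_bounded_linear[OF D]] by blast
  have "\<forall>\<^sub>F x in nhds 0. norm (f x - f 0 - D (x - 0)) \<le> 1 * norm (x - 0)"
    using D unfolding has_derivative_within_alt eventually_nhds_metric
    by (metis UNIV_I dist_norm zero_less_one)
  moreover have "\<forall>\<^sub>F x in nhds (0::(complex^'a) \<times> complex). norm x < 1"
    unfolding eventually_nhds_metric by (intro exI[of _ 1]) auto
  ultimately have "\<forall>\<^sub>F x in nhds 0. cmod (f x) \<le> (2 * (K + 1)) * wt x ^ Suc 0"
  proof eventually_elim
    case (elim x)
    have w: "cmod (snd x) \<le> 1" using elim norm_snd_le[of "snd x" "fst x"] by simp
    have "cmod (snd x) \<le> sqrt (cmod (snd x))" using w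
      by (metis norm_ge_zero real_le_rsqrt power2_eq_square mult_left_le)
    moreover have "norm x \<le> norm (fst x) + norm (snd x)" using norm_Pair_le[of "fst x" "snd x"] by simp
    ultimately have n: "norm x \<le> wt x" by (simp add: wt_def)
    have "cmod (f x) \<le> norm (f x - D x) + norm (D x)" by (metis norm_triangle_sub add.commute)
    also have "\<dots> \<le> norm x + norm x * K" using elim K 2 by (intro add_mono) auto
    also have "\<dots> = (K + 1) * norm x" by (simp add: algebra_simps)
    also have "\<dots> \<le> (2 * (K + 1)) * wt x" using n K wt_nonneg[of x] by (intro mult_mono) auto
    finally show ?case by simp
  qed
  thus ?case using K by (intro exI[of _ "2 * (K + 1)"]) auto
next
  case (3 k f)
  define dz where "dz b = dir_deriv (b, 0) f" for b
  define dw where "dw w = dir_deriv (0, w) f" for w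
  have s: "smooth_at 0 (dz b)" "smooth_at 0 (dw w)" for b w
    unfolding dz_def dw_def by (intro smooth_at_dir_deriv 3)+
  have "\<exists>C\<ge>0. \<forall>\<^sub>F x in nhds 0. cmod (dz b x) \<le> C * wt x ^ Suc k" for b
    unfolding dz_def by (rule 3(1)) (use s(1)[of b] 3 in \<open>auto simp: dz_def\<close>)
  then obtain C where C: "\<And>b. C b \<ge> 0" "\<And>b. \<forall>\<^sub>F x in nhds 0. cmod (dz b x) \<le> C b * wt x ^ Suc k" by metis
  have "\<exists>C\<ge>0. \<forall>\<^sub>F x in nhds 0. cmod (dw b x) \<le> C * wt x ^ k" for b
    unfolding dw_def by (rule 3(2)) (use s(2)[of b] 3 in \<open>auto simp: dw_def\<close>)
  then obtain E where E: "\<And>b. E b \<ge> 0" "\<And>b. \<forall>\<^sub>F x in nhds 0. cmod (dw b x) \<le> E b * wt x ^ k" by metis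
  have "\<forall>\<^sub>F x in nhds 0. \<forall>b\<in>Basis. cmod (dz b x) \<le> C b * wt x ^ Suc k"
    by (intro eventually_ball_finite finite_Basis ballI C)
  moreover have "\<forall>\<^sub>F x in nhds 0. \<forall>b\<in>Basis. cmod (dw b x) \<le> E b * wt x ^ k"
    by (intro eventually_ball_finite finite_Basis ballI E)
  moreover obtain W where W: "open W" "0 \<in> W" "smooth_on W f" by (rule smooth_atE[OF 3(3)])
  have "\<forall>\<^sub>F x in nhds 0. x \<in> W" using W eventually_nhds by blast
  ultimately have "\<forall>\<^sub>F x in nhds 0. (\<forall>b\<in>Basis. cmod (dz b x) \<le> C b * wt x ^ Suc k) \<and>
      (\<forall>b\<in>Basis. cmod (dw b x) \<le> E b * wt x ^ k) \<and> x \<in> W" by (intro eventually_conj)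
  then obtain r where r: "r > 0" "\<And>x b. norm x < r \<Longrightarrow> b \<in> Basis \<Longrightarrow> cmod (dz b x) \<le> C b * wt x ^ Suc k"
      "\<And>x b. norm x < r \<Longrightarrow> b \<in> Basis \<Longrightarrow> cmod (dw b x) \<le> E b * wt x ^ k" "\<And>x. norm x < r \<Longrightarrow> x \<in> W"
    unfolding eventually_nhds_metric by (auto simp: dist_norm)
  define K where "K = sum C Basis + 2 * sum E Basis"
  have K0: "K \<ge> 0" unfolding K_def by (intro add_nonneg_nonneg mult_nonneg_nonneg sum_nonneg C E) auto
  have "cmod (f x) \<le> K * wt x ^ Suc (Suc k)" if x: "norm x < r" for x
  proof -
    obtain z w where zw: "x = (z, w)" by (cases x)
    define c where "c t = (t *\<^sub>R z, t\<^sup>2 *\<^sub>R w)" for t :: real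
    define N where "N = wt x"
    have N: "N \<ge> 0" by (simp add: N_def wt_nonneg)
    have bnd: "cmod (dz z (c t) + (2 * t) *\<^sub>R dw w (c t)) \<le> K * N ^ Suc (Suc k)" if t: "0 \<le> t" "t \<le> 1" for t
    proof -
      have nc: "norm (c t) < r" using norm_dilate[OF t, of z w] x by (simp add: c_def zw)
      have wc: "wt (c t) \<le> N" unfolding c_def wt_dilate[OF t(1)] N_def zw
        using t by (intro mult_left_le_one_le wt_nonneg)
      have df: "f differentiable (at (c t))" using r(4)[OF nc] W(3) smooth_on_imp_differentiable by blast
      interpret linear "\<lambda>v. dir_deriv v f (c t)" by (rule linear_dir_deriv[OF df])
      have lz: "linear (\<lambda>z. dz z (c t))" "linear (\<lambda>z. dw z (c t))"
        unfolding dz_def dw_def using linear_compose[OF _ linear_axioms, of "\<lambda>z. (z, 0)"]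
          linear_compose[OF _ linear_axioms, of "\<lambda>w. (0, w)"] by (auto simp: o_def linear_iff)
      have "dz z (c t) = (\<Sum>b\<in>Basis. (z \<bullet> b) *\<^sub>R dz b (c t))"
        using linear_sum[OF lz(1), of "\<lambda>b. (z \<bullet> b) *\<^sub>R b" Basis] linear_scale[OF lz(1)] by (simp add: euclidean_representation)
      also have "cmod \<dots> \<le> (\<Sum>b\<in>Basis. N * (C b * N ^ Suc k))"
      proof (rule sum_norm_le)
        fix b :: "complex^'a" assume b: "b \<in> Basis"
        have "\<bar>z \<bullet> b\<bar> \<le> N" using Basis_le_norm[OF b, of z] wt_bounds(1)[of x] by (simp add: N_def zw)
        moreover have "cmod (dz b (c t)) \<le> C b * N ^ Suc k"
          using r(2)[OF nc b] C(1)[of b] wc wt_nonneg[of "c t"]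
          by (meson order_trans mult_left_mono power_mono)
        ultimately show "cmod ((z \<bullet> b) *\<^sub>R dz b (c t)) \<le> N * (C b * N ^ Suc k)"
          using C(1)[of b] N by (simp only: norm_scaleR) (intro mult_mono, auto)
      qed
      finally have 1: "cmod (dz z (c t)) \<le> sum C Basis * N ^ Suc (Suc k)"
        by (simp add: sum_distrib_right sum_distrib_left mult_ac)
      have "dw w (c t) = (\<Sum>b\<in>Basis. (w \<bullet> b) *\<^sub>R dw b (c t))"
        using linear_sum[OF lz(2), of "\<lambda>b. (w \<bullet> b) *\<^sub>R b" Basis] linear_scale[OF lz(2)] by (simp add: euclidean_representation)
      also have "cmod \<dots> \<le> (\<Sum>b\<in>Basis. N\<^sup>2 * (E b * N ^ k))"
      proof (rule sum_norm_le)
        fix b :: complex assume b: "b \<in> Basis"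
        have "\<bar>w \<bullet> b\<bar> \<le> N\<^sup>2" using Basis_le_norm[OF b, of w] wt_bounds(2)[of x] by (simp add: N_def zw)
        moreover have "cmod (dw b (c t)) \<le> E b * N ^ k"
          using r(3)[OF nc b] E(1)[of b] wc wt_nonneg[of "c t"]
          by (meson order_trans mult_left_mono power_mono)
        ultimately show "cmod ((w \<bullet> b) *\<^sub>R dw b (c t)) \<le> N\<^sup>2 * (E b * N ^ k)"
          using E(1)[of b] N by (simp only: norm_scaleR) (intro mult_mono, auto)
      qed
      finally have "cmod (dw w (c t)) \<le> sum E Basis * N ^ Suc (Suc k)"
        by (simp add: sum_distrib_right sum_distrib_left mult_ac power2_eq_square)
      hence "\<bar>2 * t\<bar> * cmod (dw w (c t)) \<le> 2 * (sum E Basis * N ^ Suc (Suc k))"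
        using t by (intro mult_mono) auto
      hence 2: "cmod ((2 * t) *\<^sub>R dw w (c t)) \<le> 2 * (sum E Basis * N ^ Suc (Suc k))" by simp
      have "cmod (dz z (c t) + (2 * t) *\<^sub>R dw w (c t)) \<le> sum C Basis * N ^ Suc (Suc k) + 2 * (sum E Basis * N ^ Suc (Suc k))"
        using norm_triangle_ineq add_mono[OF 1 2] order_trans by blast
      also have "\<dots> = K * N ^ Suc (Suc k)" by (simp only: K_def) algebra
      finally show ?thesis .
    qed
    have "norm (f (c 1) - f (c 0)) \<le> (K * N ^ Suc (Suc k)) * norm (1 - 0 :: real)"
    proof (rule differentiable_bound[of "{0..1}" "\<lambda>t. f (c t)" "\<lambda>t s. s *\<^sub>R (dz z (c t) + (2 * t) *\<^sub>R dw w (c t))"])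
      fix t :: real assume t: "t \<in> {0..1}"
      have "norm (c t) < r" using norm_dilate[of t z w] x t by (simp add: c_def zw)
      hence df: "f differentiable (at (t *\<^sub>R z, t\<^sup>2 *\<^sub>R w))"
        using r(4) W(3) smooth_on_imp_differentiable by (fastforce simp: c_def)
      show "((\<lambda>t. f (c t)) has_derivative (\<lambda>s. s *\<^sub>R (dz z (c t) + (2 * t) *\<^sub>R dw w (c t)))) (at t within {0..1})"
        using dilation_derivative[OF df] unfolding c_def dz_def dw_def has_vector_derivative_def
        by (rule has_derivative_at_withinI)
      show "onorm (\<lambda>s. s *\<^sub>R (dz z (c t) + (2 * t) *\<^sub>R dw w (c t))) \<le> K * N ^ Suc (Suc k)"
      proof (rule onorm_le)
        fix s :: real
        have "cmod (dz z (c t) + (2 * t) *\<^sub>R dw w (c t)) \<le> K * N ^ Suc (Suc k)" using bnd t by simp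
        thus "norm (s *\<^sub>R (dz z (c t) + (2 * t) *\<^sub>R dw w (c t))) \<le> K * N ^ Suc (Suc k) * norm s"
          using mult_left_mono[of _ _ "\<bar>s\<bar>"] by (simp only: norm_scaleR real_norm_def mult.commute[of _ "\<bar>s\<bar>"])
      qed
    qed auto
    thus ?thesis using 3(4) by (simp add: c_def zw N_def flip: zero_prod_def)
  qed
  hence "\<forall>\<^sub>F x in nhds 0. cmod (f x) \<le> K * wt x ^ Suc (Suc k)"
    unfolding eventually_nhds_metric using r(1) by (auto simp: dist_norm)
  thus ?case using K0 by blast
qed

lemma wt_flat_imp_O_wt:
  assumes "smooth_at 0 f" "wt_flat k f" shows "O_wt \<epsilon> k f"
proof -
  obtain C where "\<forall>\<^sub>F x in nhds 0. cmod (f x) \<le> C * wt x ^ k" using wt_flat_bound[OF assms] by blast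
  hence "\<forall>\<^sub>F x in at 0 within hyperquadric \<epsilon>. cmod (f x) \<le> C * wt x ^ k"
    by (simp add: eventually_at_filter eventually_mono)
  hence "(\<lambda>x. cmod (f x)) \<in> O[at 0 within hyperquadric \<epsilon>](\<lambda>x. wt x ^ k)"
    by (intro bigoI[of _ C]) (auto elim!: eventually_mono simp: wt_nonneg)
  thus ?thesis by (simp add: O_wt_def wt_def)
qed

fun jet_wt_flat :: "nat \<Rightarrow> 'n::finite jet \<Rightarrow> bool" where
  "jet_wt_flat 0 J = True"
| "jet_wt_flat (Suc 0) J = (jev J = 0)"
| "jet_wt_flat (Suc (Suc k)) J = (jev J = 0 \<and> (\<forall>z. jet_wt_flat (Suc k) (jD (z, 0) J))
      \<and> (\<forall>w. jet_wt_flat k (jD (0, w) J)))"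

lemma jet_dir_deriv: "smooth_at p f \<Longrightarrow> jet p (dir_deriv v f) = jD v (jet p f) + jDb v (jet p f)"
proof -
  assume f: "smooth_at p f"
  have "dir_deriv v f = (\<lambda>x. wirtinger f v x + wirtinger_bar f v x)"
    using dir_deriv_wirtinger by blast
  thus ?thesis by (simp add: jD_jet f jet_add smooth_at_wirtinger)
qed

lemma jet_wt_flat_imp:
  assumes "smooth_at 0 f" "\<And>v. jDb v (jet 0 f) = 0" "jet_wt_flat k (jet 0 f)"
  shows "wt_flat k f"
  using assms
proof (induction k f rule: wt_flat.induct)
  case (3 k f)
  have d: "jet 0 (dir_deriv v f) = jD v (jet 0 f)" for v by (simp add: jet_dir_deriv 3)
  have b: "jDb u (jet 0 (dir_deriv v f)) = 0" for u v by (simp add: d 3(4) flip: jD_commute(1))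
  show ?case using 3 d b jev_jet[OF 3(3)] by (auto intro: smooth_at_dir_deriv)
qed (auto simp: jev_jet)

lemma O_wt_jet:
  "smooth_at 0 f \<Longrightarrow> (\<And>v. jDb v (jet 0 f) = 0) \<Longrightarrow> jet_wt_flat k (jet 0 f) \<Longrightarrow> O_wt \<epsilon> k f"
  by (intro wt_flat_imp_O_wt jet_wt_flat_imp)

subsection \<open>From weighted estimates to jets\<close>

lemma vector_derivative_estimate:
  fixes g :: "real \<Rightarrow> complex"
  assumes "(g has_vector_derivative s) (at 0)" "e > 0"
  obtains d where "d > 0" "\<And>t. \<bar>t\<bar> < d \<Longrightarrow> norm (g t - g 0 - t *\<^sub>R s) \<le> e * \<bar>t\<bar>"
proof -
  have "\<forall>e>0. \<exists>d>0. \<forall>y\<in>UNIV. norm (y - 0) < d \<longrightarrow> norm (g y - g 0 - (y - 0) *\<^sub>R s) \<le> e * norm (y - 0)"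
    using assms(1) unfolding has_vector_derivative_def has_derivative_within_alt by blast
  then obtain d where "d > 0" "\<forall>y\<in>UNIV. norm (y - 0) < d \<longrightarrow> norm (g y - g 0 - (y - 0) *\<^sub>R s) \<le> e * norm (y - 0)"
    using assms(2) by blast
  thus ?thesis by (intro that[of d]) auto
qed

text \<open>A function that is bounded by a multiple of \<open>t\<^sup>3\<close> for \<open>t > 0\<close> has a trivial Taylor polynomial of
  order two.\<close>

lemma cubic_bound_derivatives:
  fixes g :: "real \<Rightarrow> complex"
  assumes d: "d > 0" "\<And>t. 0 \<le> t \<Longrightarrow> t < d \<Longrightarrow> (g has_vector_derivative g1 t) (at t)"
    and g1: "(g1 has_vector_derivative s) (at 0)" and bd: "\<And>t. 0 < t \<Longrightarrow> t < d \<Longrightarrow> cmod (g t) \<le> C * t ^ 3"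
  shows "g1 0 = 0" "s = 0"
proof -
  have small: "norm c \<le> e" if e: "e > 0" and c: "\<And>t. 0 < t \<Longrightarrow> t < d' \<Longrightarrow> norm c \<le> e / 2 + \<bar>C\<bar> * t" "d' > 0" for c :: complex and e d'
  proof -
    define t where "t = min (d' / 2) (e / (2 * (\<bar>C\<bar> + 1)))"
    have t: "0 < t" "t < d'" using e c(2) by (auto simp: t_def add_pos_nonneg)
    have "t * (2 * (\<bar>C\<bar> + 1)) \<le> e" using t_def by (simp add: pos_le_divide_eq[symmetric] add_pos_nonneg)
    hence "\<bar>C\<bar> * t \<le> e / 2" using t(1) by (simp add: algebra_simps)
    thus ?thesis using c(1)[OF t] by simp
  qed
  have cont: "isCont g 0" using d(2)[of 0] d(1) has_vector_derivative_continuous by blast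
  have g0: "g 0 = 0"
  proof -
    have "(g \<longlongrightarrow> g 0) (at_right 0)" using cont isCont_def tendsto_mono at_le by (metis subset_UNIV)
    moreover have "(g \<longlongrightarrow> 0) (at_right 0)"
    proof (rule Lim_null_comparison)
      show "\<forall>\<^sub>F t in at_right 0. norm (g t) \<le> C * t ^ 3"
        using eventually_at_right_real[OF d(1)] by eventually_elim (use bd in auto)
      show "((\<lambda>t. C * t ^ 3) \<longlongrightarrow> 0) (at_right 0)" by (auto intro!: tendsto_eq_intros)
    qed
    ultimately show ?thesis by (rule tendsto_unique[OF trivial_limit_at_right_real])
  qed
  show g10: "g1 0 = 0"
  proof -
    have le: "norm (g1 0) \<le> e" if e: "e > 0" for e
    proof -
      obtain d1 where d1: "d1 > 0" "\<And>t. \<bar>t\<bar> < d1 \<Longrightarrow> norm (g t - g 0 - t *\<^sub>R g1 0) \<le> e / 2 * \<bar>t\<bar>"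
        using vector_derivative_estimate[OF d(2)[of 0], of "e / 2"] d(1) e by auto
      have "norm (g1 0) \<le> e / 2 + \<bar>C\<bar> * t" if t: "0 < t" "t < min 1 (min d d1)" for t
      proof -
        have "norm (t *\<^sub>R g1 0) \<le> norm (g t) + norm (g t - g 0 - t *\<^sub>R g1 0)"
          using norm_triangle_ineq4[of "g t" "g t - g 0 - t *\<^sub>R g1 0"] by (simp add: g0)
        also have "\<dots> \<le> C * t ^ 3 + e / 2 * t" using bd[of t] d1(2)[of t] t by auto
        also have "\<dots> \<le> t * (\<bar>C\<bar> * t) + t * (e / 2)"
        proof -
          have "t ^ 3 \<le> t * t" using t by (simp add: power3_eq_cube mult_left_le_one_le)
          hence "C * t ^ 3 \<le> \<bar>C\<bar> * (t * t)" using t by (intro mult_mono) auto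
          thus ?thesis by (simp add: mult_ac)
        qed
        finally have "t * norm (g1 0) \<le> t * (e / 2 + \<bar>C\<bar> * t)" using t by (simp add: algebra_simps)
        thus ?thesis using t by simp
      qed
      note b = this
      show ?thesis by (rule small[OF e b, where d' = "min 1 (min d d1)"]) (use d d1 in auto)
    qed
    have "norm (g1 0) \<le> 0"
    proof (rule field_le_epsilon)
      fix e :: real assume "e > 0"
      from le[OF this] show "norm (g1 0) \<le> 0 + e" by linarith
    qed
    thus ?thesis by simp
  qed
  have le: "norm (s / 2) \<le> e" if e: "e > 0" for e
  proof -
    obtain d1 where d1: "d1 > 0" "\<And>t. \<bar>t\<bar> < d1 \<Longrightarrow> norm (g1 t - g1 0 - t *\<^sub>R s) \<le> e / 2 * \<bar>t\<bar>"
      using vector_derivative_estimate[OF g1, of "e / 2"] e by auto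
    have "norm (s / 2) \<le> e / 2 + \<bar>C\<bar> * t" if t: "0 < t" "t < min d d1" for t
    proof -
      have "norm ((g t - (t\<^sup>2 / 2) *\<^sub>R s) - (g 0 - (0\<^sup>2 / 2) *\<^sub>R s)) \<le> (e / 2 * t) * norm (t - 0)"
      proof (rule differentiable_bound[of "{0..t}" "\<lambda>r. g r - (r\<^sup>2 / 2) *\<^sub>R s" "\<lambda>r x. x *\<^sub>R (g1 r - r *\<^sub>R s)"])
        fix r assume r: "r \<in> {0..t}"
        have "((\<lambda>r. g r - (r\<^sup>2 / 2) *\<^sub>R s) has_vector_derivative (g1 r - r *\<^sub>R s)) (at r)"
          by (intro has_vector_derivative_diff d(2)) (use r t in \<open>auto intro!: derivative_eq_intros\<close>)
        thus "((\<lambda>r. g r - (r\<^sup>2 / 2) *\<^sub>R s) has_derivative (\<lambda>x. x *\<^sub>R (g1 r - r *\<^sub>R s))) (at r within {0..t})"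
          unfolding has_vector_derivative_def by (rule has_derivative_at_withinI)
        have "norm (g1 r - r *\<^sub>R s) \<le> e / 2 * r" using d1(2)[of r] r t by (simp add: g10)
        also have "\<dots> \<le> e / 2 * t" using r e by (intro mult_left_mono) auto
        finally have *: "norm (g1 r - r *\<^sub>R s) \<le> e / 2 * t" .
        show "onorm (\<lambda>x. x *\<^sub>R (g1 r - r *\<^sub>R s)) \<le> e / 2 * t"
        proof (rule onorm_le)
          fix x :: real
          show "norm (x *\<^sub>R (g1 r - r *\<^sub>R s)) \<le> e / 2 * t * norm x"
            using mult_left_mono[OF *, of "\<bar>x\<bar>"] by (simp only: norm_scaleR real_norm_def mult_ac abs_ge_zero)
        qed
      qed (use t in auto)
      hence *: "norm (g t - (t\<^sup>2 / 2) *\<^sub>R s) \<le> e / 2 * t\<^sup>2" using t by (simp add: g0 power2_eq_square)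
      have "norm ((t\<^sup>2 / 2) *\<^sub>R s) \<le> norm (g t) + norm (g t - (t\<^sup>2 / 2) *\<^sub>R s)"
        using norm_triangle_ineq4[of "g t" "g t - (t\<^sup>2 / 2) *\<^sub>R s"] by simp
      also have "\<dots> \<le> \<bar>C\<bar> * t ^ 3 + e / 2 * t\<^sup>2"
      proof -
        have "C * t ^ 3 \<le> \<bar>C\<bar> * t ^ 3" using t by (intro mult_right_mono) auto
        moreover have "cmod (g t) \<le> C * t ^ 3" using bd[of t] t by simp
        ultimately show ?thesis using * by linarith
      qed
      finally have "t\<^sup>2 * norm (s / 2) \<le> t\<^sup>2 * (e / 2 + \<bar>C\<bar> * t)"
        by (simp add: algebra_simps power2_eq_square power3_eq_cube norm_divide)
      thus ?thesis using t by simp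
    qed
    note b = this
      show ?thesis by (rule small[OF e b, where d' = "min d d1"]) (use d d1 in auto)
  qed
  have "norm (s / 2) \<le> 0"
  proof (rule field_le_epsilon)
    fix e :: real assume "e > 0"
    from le[OF this] show "norm (s / 2) \<le> 0 + e" by linarith
  qed
  thus "s = 0" by simp
qed

text \<open>The estimate is available on the hyperquadric only. The curves \<open>t \<mapsto> (t z, t\<^sup>2 \<omega>)\<close> with
  \<open>Im \<omega> = \<parallel>z\<parallel>\<^sup>2\<close> stay in it, and the second derivative of \<open>f\<close> along them is \<open>D\<^sub>z D\<^sub>z f + 2 D\<^sub>\<omega> f\<close>.
  The choice \<open>z = 0\<close> isolates the second term, and then arbitrary \<open>z\<close> give the first.\<close>

lemma O_wt_3_derivatives:
  fixes f :: "(complex^'n::finite) \<times> complex \<Rightarrow> complex"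
  assumes f: "smooth_at 0 f" "\<And>v. jDb v (jet 0 f) = 0" and O: "O_wt \<epsilon> 3 f"
  shows "jev (jD (z, 0) (jet 0 f)) = 0" "jev (jD (0, w) (jet 0 f)) = 0"
    "jev (jD (z, 0) (jD (z, 0) (jet 0 f))) = 0"
proof -
  have jd: "jet 0 (dir_deriv v f) = jD v (jet 0 f)" for v by (simp add: jet_dir_deriv f)
  have jd2: "jet 0 (dir_deriv u (dir_deriv v f)) = jD u (jD v (jet 0 f))" for u v
    by (simp add: jet_dir_deriv smooth_at_dir_deriv f jd flip: jD_commute(1))
  have e1: "dir_deriv v f 0 = jev (jD v (jet 0 f))" for v
    using jev_jet[OF smooth_at_dir_deriv[OF f(1)]] by (metis jd)
  have e2: "dir_deriv u (dir_deriv v f) 0 = jev (jD u (jD v (jet 0 f)))" for u v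
    using jev_jet[OF smooth_at_dir_deriv[OF smooth_at_dir_deriv[OF f(1)]]] by (metis jd2)
  obtain W where W: "open W" "0 \<in> W" "smooth_on W f" by (rule smooth_atE[OF f(1)])
  from O obtain C where C: "C > 0" "\<forall>\<^sub>F x in at 0 within hyperquadric \<epsilon>. cmod (f x) \<le> C * wt x ^ 3"
    unfolding O_wt_def by (elim landau_o.bigE) (auto simp: wt_def)
  then obtain r0 where r0: "r0 > 0" "\<And>x. x \<in> hyperquadric \<epsilon> \<Longrightarrow> x \<noteq> 0 \<Longrightarrow> norm x < r0 \<Longrightarrow> cmod (f x) \<le> C * wt x ^ 3"
    unfolding eventually_at by (auto simp: dist_norm)
  obtain r1 where r1: "r1 > 0" "ball 0 r1 \<subseteq> W" using W openE by blast
  have key: "dir_deriv (z, 0) f 0 = 0 \<and>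
      dir_deriv (z, 0) (dir_deriv (z, 0) f) 0 + 2 *\<^sub>R dir_deriv (0, \<omega>) f 0 = 0"
    if om: "Im \<omega> = (\<Sum>k\<in>UNIV. \<epsilon> k * (cmod (z $ k))\<^sup>2)" and nz: "(z, \<omega>) \<noteq> 0" for z :: "complex^'n" and \<omega>
  proof -
    define c where "c t = (t *\<^sub>R z, t\<^sup>2 *\<^sub>R \<omega>)" for t :: real
    have hyp: "c t \<in> hyperquadric \<epsilon>" for t
      by (simp add: c_def hyperquadric_def rho_def om sum_distrib_left power_mult_distrib mult_ac)
    define d where "d = min 1 (min r0 r1 / (norm (z, \<omega>) + 1))"
    have d: "d > 0" using r0 r1 by (auto simp: d_def add_nonneg_pos)
    have nc: "norm (c t) < min r0 r1" if t: "0 \<le> t" "t < d" for t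
    proof -
      have t1: "t \<le> 1" using t by (simp add: d_def)
      have "norm (c t) = t * norm (z, t *\<^sub>R \<omega>)"
      proof -
        have "c t = t *\<^sub>R (z, t *\<^sub>R \<omega>)" by (simp add: c_def power2_eq_square)
        thus ?thesis using t by (simp only: norm_scaleR)
      qed
      also have "norm (z, t *\<^sub>R \<omega>) \<le> norm (z, \<omega>)"
        using t t1 by (auto simp: norm_Pair intro!: real_sqrt_le_mono power_mono mult_left_le_one_le)
      finally have "norm (c t) \<le> t * (norm (z, \<omega>) + 1)" using t by (simp add: mult_left_mono order_trans[OF _ mult_left_mono[of _ "norm (z, \<omega>) + 1"]])
      also have "\<dots> < min r0 r1"
      proof -
        have "t < min r0 r1 / (norm (z, \<omega>) + 1)" using t by (simp add: d_def)
        thus ?thesis by (simp add: pos_less_divide_eq add_nonneg_pos)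
      qed
      finally show ?thesis .
    qed
    define g1 where "g1 t = dir_deriv (z, 0) f (c t) + (2 * t) *\<^sub>R dir_deriv (0, \<omega>) f (c t)" for t
    have "((\<lambda>t. f (c t)) has_vector_derivative g1 t) (at t)" if t: "0 \<le> t" "t < d" for t
    proof -
      have "c t \<in> W" using nc[OF t] r1 by auto
      hence "f differentiable (at (t *\<^sub>R z, t\<^sup>2 *\<^sub>R \<omega>))" using W(3) smooth_on_imp_differentiable unfolding c_def by blast
      from dilation_derivative[OF this] show ?thesis by (simp add: g1_def c_def)
    qed
    moreover have "(g1 has_vector_derivative (dir_deriv (z, 0) (dir_deriv (z, 0) f) 0 + 2 *\<^sub>R dir_deriv (0, \<omega>) f 0)) (at 0)"
    proof -
      have "dir_deriv v f differentiable (at ((0::real) *\<^sub>R z, 0\<^sup>2 *\<^sub>R \<omega>))" for v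
        using smooth_at_imp_differentiable[OF smooth_at_dir_deriv[OF f(1), of v]] by (simp add: zero_prod_def)
      note dd = dilation_derivative[OF this]
      have 1: "((\<lambda>t. dir_deriv (z, 0) f (c t)) has_vector_derivative dir_deriv (z, 0) (dir_deriv (z, 0) f) 0) (at 0)"
        using dd[of "(z, 0)"] by (simp add: c_def flip: zero_prod_def)
      have 2: "((\<lambda>t. dir_deriv (0, \<omega>) f (c t)) has_vector_derivative dir_deriv (z, 0) (dir_deriv (0, \<omega>) f) 0) (at 0)"
        using dd[of "(0, \<omega>)"] by (simp add: c_def flip: zero_prod_def)
      have 3: "((\<lambda>t::real. 2 * t) has_field_derivative 2) (at 0)" by (auto intro!: derivative_eq_intros)
      from has_vector_derivative_add[OF 1 has_vector_derivative_scaleR[OF 3 2]]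
      show ?thesis by (simp add: g1_def[abs_def] c_def flip: zero_prod_def)
    qed
    moreover have "cmod (f (c t)) \<le> (C * wt (z, \<omega>) ^ 3) * t ^ 3" if t: "0 < t" "t < d" for t
    proof -
      have "c t \<noteq> 0" using nz t by (auto simp: c_def zero_prod_def)
      from r0(2)[OF hyp this] nc[of t] t have "cmod (f (c t)) \<le> C * wt (c t) ^ 3" by auto
      also have "wt (c t) = t * wt (z, \<omega>)" unfolding c_def by (rule wt_dilate) (use t in simp)
      finally show ?thesis by (simp add: power_mult_distrib mult_ac)
    qed
    ultimately have "g1 0 = 0" "dir_deriv (z, 0) (dir_deriv (z, 0) f) 0 + 2 *\<^sub>R dir_deriv (0, \<omega>) f 0 = 0"
      using cubic_bound_derivatives[OF d, of "\<lambda>t. f (c t)" g1] by blast+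
    thus ?thesis by (simp add: g1_def c_def flip: zero_prod_def)
  qed
  have "jev (jD (0, 1) (jet 0 f)) = 0"
  proof -
    have "dir_deriv (0, 0) (dir_deriv (0, 0) f) 0 + 2 *\<^sub>R dir_deriv (0, 1) f 0 = 0" using key[of 1 0] by (simp add: prod_eq_iff)
    moreover have "dir_deriv (0, 0) (dir_deriv (0, 0) f) 0 = 0"
      using linear_0[OF linear_dir_deriv[OF smooth_at_imp_differentiable[OF smooth_at_dir_deriv[OF f(1)]]]]
      by (simp add: zero_prod_def)
    ultimately show ?thesis by (simp add: e1)
  qed
  moreover have "jD (0, w) (jet 0 f) = jconst w * jD (0, 1) (jet 0 f)" for w
  proof -
    have c: "(0, w) = cscale w (0, 1)" by (simp add: cscale_def)
    obtain V where V: "open V" "0 \<in> V" "smooth_on V f" by (rule smooth_atE[OF f(1)])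
    have "jet 0 (wirtinger f (0, w)) = jet 0 (\<lambda>x. w * wirtinger f (0, 1) x)"
      unfolding c by (rule jet_cong[OF smooth_at_wirtinger(1)[OF f(1)] V(1,2)])
        (rule wirtinger_cscale[OF smooth_on_imp_differentiable[OF V(3)]])
    thus ?thesis by (simp add: jD_jet f jet_mult smooth_at_const smooth_at_wirtinger jet_const)
  qed
  ultimately show w0: "jev (jD (0, w) (jet 0 f)) = 0" for w by (metis jev_mult mult_zero_right)
  have "jev (jD (z, 0) (jet 0 f)) = 0 \<and> jev (jD (z, 0) (jD (z, 0) (jet 0 f))) = 0"
  proof -
    \<comment> \<open>The real part 1 keeps the curve away from the origin for \<open>z = 0\<close> as well.\<close>
    define \<omega> where "\<omega> = Complex 1 (\<Sum>k\<in>UNIV. \<epsilon> k * (cmod (z $ k))\<^sup>2)"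
    have "(z, \<omega>) \<noteq> 0" by (auto simp: \<omega>_def zero_prod_def complex_eq_iff)
    from key[OF _ this] have "dir_deriv (z, 0) f 0 = 0"
      "dir_deriv (z, 0) (dir_deriv (z, 0) f) 0 + 2 *\<^sub>R dir_deriv (0, \<omega>) f 0 = 0" by (auto simp: \<omega>_def)
    thus ?thesis by (simp add: e1 e2 w0)
  qed
  thus "jev (jD (z, 0) (jet 0 f)) = 0" "jev (jD (z, 0) (jD (z, 0) (jet 0 f))) = 0" by blast+
qed

section \<open>Invariance of the quotient and of the rank\<close>

lemma dir_deriv_line:
  assumes "f differentiable (at p)"
  shows "((\<lambda>t. f (p + t *\<^sub>R v)) has_vector_derivative dir_deriv v f p) (at 0)"
proof -
  have "((\<lambda>t. p + t *\<^sub>R v) has_derivative (\<lambda>s. s *\<^sub>R v)) (at 0)" by (auto intro!: derivative_eq_intros)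
  from has_derivative_compose[OF this, of f "\<lambda>v. dir_deriv v f p"] has_derivative_dir_deriv[OF assms]
  have "((\<lambda>t. f (p + t *\<^sub>R v)) has_derivative (\<lambda>s. dir_deriv (s *\<^sub>R v) f p)) (at 0)" by simp
  thus ?thesis using linear_scale[OF linear_dir_deriv[OF assms]] by (simp add: has_vector_derivative_def)
qed

lemma rho_line: "rho \<epsilon> (p + t *\<^sub>R (0, 1)) = rho \<epsilon> p"
  by (simp add: rho_def)

text \<open>The line in the direction of \<open>Re w\<close> stays in the hyperquadric, so the derivative along it is
  determined by the values there.\<close>

lemma dir_deriv_eq_on_hyperquadric:
  assumes "h differentiable (at p)" "k differentiable (at p)" "rho \<epsilon> p = 0" "open W" "p \<in> W"
    "\<And>x. x \<in> W \<Longrightarrow> x \<in> hyperquadric \<epsilon> \<Longrightarrow> h x = k x"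
  shows "dir_deriv (0, 1) h p = dir_deriv (0, 1) k p"
proof -
  let ?c = "\<lambda>t::real. p + t *\<^sub>R (0, 1)"
  have "open (?c -` W)" by (intro open_vimage assms continuous_intros)
  hence "((\<lambda>t. k (?c t)) has_vector_derivative dir_deriv (0, 1) h p) (at 0)"
  proof (rule has_vector_derivative_transform_within_open[OF dir_deriv_line[OF assms(1)]])
    show "0 \<in> ?c -` W" using assms(5) by (simp del: scaleR_Pair)
    show "h (?c t) = k (?c t)" if "t \<in> ?c -` W" for t
      using assms(6)[of "?c t"] that assms(3) by (simp only: vimage_eq hyperquadric_def mem_Collect_eq rho_line)
  qed
  thus ?thesis using vector_derivative_unique_at[OF _ dir_deriv_line[OF assms(2)]] by blast
qed

context ah_map_at
begin

lemma Q_eq: "of_real (Q p) = snd (pushforward h p (0, 1)) - 2 * \<i> * herm \<epsilon>' (fst (pushforward h p (0, 1))) (fst (h p))"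
proof -
  have "jev (jD (0, 1) G) = snd (pushforward h p (0, 1))"
    by (simp add: pushforward_def G_def jD_jet smooth_components jev_jet smooth_at_wirtinger)
  moreover have "lam (0, 1) = - \<i> / 2" by (simp add: lam_eq herm_zero)
  ultimately have "of_real (Q p) * (- \<i> / 2) = - \<i> / 2 * snd (pushforward h p (0, 1))
      - herm \<epsilon>' (fst (pushforward h p (0, 1))) (fst (h p))"
    using identity_1[of "(0, 1)"] by (simp only: fst_pushforward)
  hence "2 * \<i> * (of_real (Q p) * (- \<i> / 2)) = 2 * \<i> * (- \<i> / 2 * snd (pushforward h p (0, 1))
      - herm \<epsilon>' (fst (pushforward h p (0, 1))) (fst (h p)))" by (rule arg_cong)
  thus ?thesis by (simp add: algebra_simps)
qed

end

text \<open>By the preceding formula the value of \<open>Q\<close> is read off from the derivative along \<open>Re w\<close>, hence from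
  the map on the hyperquadric. In particular its sign is a property of the CR map and not of the
  extension.\<close>

lemma Q_determined:
  assumes h: "ah_map \<epsilon> \<epsilon>' p h Q" and k: "ah_map \<epsilon> \<epsilon>' p k Q'" and W: "open W" "p \<in> W"
    "\<And>x. x \<in> W \<Longrightarrow> x \<in> hyperquadric \<epsilon> \<Longrightarrow> h x = k x"
  shows "Q p = Q' p"
proof -
  interpret h: ah_map_at \<epsilon> \<epsilon>' p h Q by unfold_locales (rule h)
  interpret k: ah_map_at \<epsilon> \<epsilon>' p k Q' by unfold_locales (rule k)
  have "dir_deriv (0, 1) h p = dir_deriv (0, 1) k p"
    by (rule dir_deriv_eq_on_hyperquadric[OF _ _ h.rho_p W])
      (intro smooth_at_imp_differentiable h.smooth_components k.smooth_components)+
  hence "pushforward h p (0, 1) = pushforward k p (0, 1)"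
    by (simp add: pushforward_eq_dir_deriv h.hol k.hol)
  moreover have "h p = k p" using W h.rho_p by (auto simp: hyperquadric_def)
  ultimately have "complex_of_real (Q p) = of_real (Q' p)" by (simp add: h.Q_eq k.Q_eq)
  thus ?thesis by simp
qed

lemma ah_map_id: "rho \<epsilon> p = 0 \<Longrightarrow> ah_map \<epsilon> \<epsilon> p (\<lambda>x. x) (\<lambda>x. 1)"
  by (auto simp: ah_map_def almost_holomorphic_at_def smooth_at_ident smooth_at_const wirtinger_coordinate flat_at_zero)

text \<open>The composite agrees with the identity, whose quotient is 1, and quotients of composites multiply.\<close>

lemma Q_nonzero_of_inverse:
  assumes h: "ah_map \<epsilon> \<epsilon>' p h Q" and k: "ah_map \<epsilon>' \<epsilon> (h p) k Q'" and W: "open W" "p \<in> W"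
    "\<And>x. x \<in> W \<Longrightarrow> x \<in> hyperquadric \<epsilon> \<Longrightarrow> k (h x) = x"
  shows "Q p \<noteq> 0" "Q' (h p) \<noteq> 0"
proof -
  have "rho \<epsilon> p = 0" using h by (simp add: ah_map_def)
  from Q_determined[OF ah_map_compose[OF h k] ah_map_id[OF this] W] have "Q' (h p) * Q p = 1" by simp
  thus "Q p \<noteq> 0" "Q' (h p) \<noteq> 0" by auto
qed

subsection \<open>Ranks of complex matrices\<close>

lemma row_matrix_mult: "row i (A ** B) = row i A v* B"
  for A :: "complex^'k^'m" and B :: "complex^'n^'k"
  by (simp add: row_def matrix_matrix_mult_def vector_matrix_mult_def vec_eq_iff mult.commute)

lemma rank_mult_le_right: "rank (A ** B) \<le> rank B" for A :: "complex^'k^'m" and B :: "complex^'n^'k"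
proof -
  have "row i (A ** B) \<in> vec.span (rows B)" for i
  proof -
    have "row i (A ** B) = (\<Sum>j\<in>UNIV. row i A $ j *s row j B)"
      unfolding row_matrix_mult by (simp add: vec_eq_iff vector_matrix_mult_def row_def mult.commute)
    moreover have "\<dots> \<in> vec.span (rows B)"
      by (intro vec.span_sum vec.span_scale vec.span_base) (auto simp: rows_def)
    ultimately show ?thesis by simp
  qed
  hence "rows (A ** B) \<subseteq> vec.span (rows B)" by (auto simp: rows_def)
  thus ?thesis unfolding row_rank_def_gen by (metis vec.dim_span vec.dim_subset)
qed

lemma rank_mult_le_left: "rank (A ** B) \<le> rank A" for A :: "complex^'k^'m" and B :: "complex^'n^'k"
proof -
  have "rows (A ** B) = (\<lambda>r. r v* B) ` rows A"
    by (auto simp: rows_def row_matrix_mult)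
  moreover have "Vector_Spaces.linear (*s) (*s) (\<lambda>r. r v* B)"
    unfolding transpose_matrix_vector[symmetric] by (rule matrix_vector_mul_linear_gen)
  ultimately show ?thesis unfolding row_rank_def_gen using vec.dim_image_le by metis
qed

text \<open>On basis vectors the hypothesis says that \<open>N\<close> is the product of \<open>M\<close> with two matrices formed from
  the vectors \<open>T (axis \<alpha> 1)\<close>.\<close>

lemma rank_sesq_le:
  fixes M :: "complex^'n^'n" and N :: "complex^'k^'k"
  assumes N: "\<And>v w. sesq N v w = sesq M (T v) (T w)"
  shows "rank N \<le> rank M"
proof -
  define G where "G = (\<chi> \<alpha> i. T (axis \<alpha> 1) $ i)"
  define G' where "G' = (\<chi> j \<beta>. cnj (T (axis \<beta> 1) $ j))"
  have "N = G ** M ** G'"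
  proof -
    have "N $ \<alpha> $ \<beta> = (G ** M ** G') $ \<alpha> $ \<beta>" for \<alpha> \<beta>
    proof -
      have "N $ \<alpha> $ \<beta> = sesq M (T (axis \<alpha> 1)) (T (axis \<beta> 1))" using N by (metis sesq_axis)
      also have "\<dots> = (\<Sum>j\<in>UNIV. \<Sum>i\<in>UNIV. G $ \<alpha> $ i * M $ i $ j * G' $ j $ \<beta>)"
        unfolding sesq_def by (subst sum.swap) (simp add: G_def G'_def mult_ac)
      finally show ?thesis by (simp add: matrix_matrix_mult_def sum_distrib_right)
    qed
    thus ?thesis by (simp add: vec_eq_iff)
  qed
  thus ?thesis using rank_mult_le_left[of "G ** M" G'] rank_mult_le_right[of G M] by simp
qed

lemma rank_sesq_eq:
  fixes M N :: "complex^'n^'n"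
  assumes N: "\<And>v w. sesq N v w = sesq M (T v) (T w)" and "surj T"
  shows "rank N = rank M"
proof (rule antisym)
  show "rank N \<le> rank M" by (rule rank_sesq_le[OF N])
  have "sesq M v w = sesq N (inv T v) (inv T w)" for v w by (simp add: N surj_f_inv_f[OF assms(2)])
  thus "rank M \<le> rank N" by (rule rank_sesq_le)
qed

lemma rank_scale_columns:
  fixes A :: "complex^'n^'n"
  assumes "\<And>\<beta>. e \<beta> * e \<beta> = 1"
  shows "rank (\<chi> \<alpha> \<beta>. A $ \<alpha> $ \<beta> * e \<beta>) = rank A"
proof -
  define D :: "complex^'n^'n" where "D = (\<chi> \<alpha> \<beta>. if \<alpha> = \<beta> then e \<beta> else 0)"
  have *: "B ** D = (\<chi> \<alpha> \<beta>. B $ \<alpha> $ \<beta> * e \<beta>)" for B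
    by (simp add: vec_eq_iff matrix_matrix_mult_def D_def mult_delta_right)
  have "A = (\<chi> \<alpha> \<beta>. A $ \<alpha> $ \<beta> * e \<beta>) ** D" by (simp add: * vec_eq_iff mult.assoc assms)
  hence "rank A \<le> rank (\<chi> \<alpha> \<beta>. A $ \<alpha> $ \<beta> * e \<beta>)" by (metis rank_mult_le_left)
  moreover have "rank (\<chi> \<alpha> \<beta>. A $ \<alpha> $ \<beta> * e \<beta>) \<le> rank A" using rank_mult_le_left[of A D] by (simp add: *)
  ultimately show ?thesis by simp
qed

subsection \<open>The Ahlfors matrix of a map in normal form\<close>

lemma O_wt_mono:
  assumes "O_wt \<epsilon> k f" "j \<le> k" shows "O_wt \<epsilon> j f"
proof -
  have "isCont wt (0 :: (complex^'a) \<times> complex)" unfolding wt_def[abs_def] by (intro continuous_intros)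
  hence "(wt \<longlongrightarrow> 0) (at (0 :: (complex^'a) \<times> complex))" by (simp add: isCont_def wt_def)
  hence "\<forall>\<^sub>F x in at (0 :: (complex^'a) \<times> complex). wt x < 1" by (rule order_tendstoD) simp
  hence "\<forall>\<^sub>F x in at 0 within hyperquadric \<epsilon>. wt x < 1" by (simp add: eventually_at_filter eventually_mono)
  hence "\<forall>\<^sub>F x in at 0 within hyperquadric \<epsilon>. norm (wt x ^ k) \<le> 1 * norm (wt x ^ j)"
    by eventually_elim (use assms(2) in \<open>auto simp: wt_nonneg intro!: power_decreasing\<close>)
  hence "(\<lambda>x. wt x ^ k) \<in> O[at 0 within hyperquadric \<epsilon>](\<lambda>x. wt x ^ j)" by (rule bigoI)
  thus ?thesis using assms(1) landau_o.big_trans unfolding O_wt_def wt_def by blast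
qed

lemma O_wt_cong:
  assumes "open W" "0 \<in> W" "\<And>x. x \<in> W \<Longrightarrow> x \<in> hyperquadric \<epsilon> \<Longrightarrow> f x = g x"
  shows "O_wt \<epsilon> k f \<longleftrightarrow> O_wt \<epsilon> k g"
proof -
  have "\<forall>\<^sub>F x in at 0 within hyperquadric \<epsilon>. cmod (f x) = cmod (g x)"
    unfolding eventually_at_topological using assms by metis
  thus ?thesis unfolding O_wt_def by (rule landau_o.big.in_cong)
qed

text \<open>The estimates in the normal form determine the derivatives of \<open>F\<close> that enter the Gauss equation.
  Comparing it with the quadratic identity of the normal form shows that two Hermitian forms agree
  after multiplication by \<open>\<parallel>z\<parallel>\<^sup>2\<close>, a factor that \<open>sesq_zero\<close> removes.\<close>

lemma normal_form_ahlfors_matrix: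
  fixes \<epsilon> :: "'n::finite \<Rightarrow> real" and \<epsilon>' :: "'m::finite \<Rightarrow> real"
  assumes ah: "ah_map \<epsilon> \<epsilon>' 0 F Q" and eps: "\<And>k. \<epsilon> k \<noteq> 0"
    and W: "open W" "0 \<in> W" "\<And>x. x \<in> W \<Longrightarrow> x \<in> hyperquadric \<epsilon> \<Longrightarrow> F x = G x"
    and nf: "normal_form \<epsilon> \<epsilon>' \<sigma> G A B"
  shows "Q 0 = 1" "ahlfors_matrix \<epsilon> Q 0 = (\<chi> \<alpha> \<beta>. A $ \<alpha> $ \<beta> * of_real (\<epsilon> \<beta>))"
proof -
  interpret F: ah_map_at \<epsilon> \<epsilon>' 0 F Q by unfold_locales (rule ah)
  let ?Z = "\<lambda>k. jet 0 (\<lambda>x::(complex^'n) \<times> complex. fst x $ k)"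
  let ?w = "jet 0 (\<lambda>x::(complex^'n) \<times> complex. snd x)"
  have s\<sigma>: "inj \<sigma>" "\<epsilon>' (\<sigma> \<alpha>) = \<epsilon> \<alpha>" for \<alpha> using nf by (auto simp: normal_form_def)
  have jz: "jev (?Z k) = 0" "jev ?w = 0" for k by (simp_all add: jev_jet smooth_at_coordinate)
  have jev2: "jev (2 :: 'n jet) = 2" using jev_add[of "1 :: 'n jet" 1] by simp
  have key: "jev (jD (z, 0) (F.F k)) = jev (jD (z, 0) P) \<and> jev (jD (0, w) (F.F k)) = jev (jD (0, w) P)
      \<and> jev (jD (z, 0) (jD (z, 0) (F.F k))) = jev (jD (z, 0) (jD (z, 0) P))"
    if P: "P = jet 0 f" "smooth_at 0 f" "\<And>v. jDb v P = 0" and O: "O_wt \<epsilon> j (\<lambda>x. fst (G x) $ k - f x)" "3 \<le> j"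
    for P f z w k j
  proof -
    let ?f = "\<lambda>x. fst (F x) $ k - f x"
    have "O_wt \<epsilon> 3 ?f" using O_wt_mono[OF O] O_wt_cong[OF W(1,2), of \<epsilon> ?f "\<lambda>x. fst (G x) $ k - f x"] W(3) by auto
    moreover have s: "smooth_at 0 ?f" by (intro smooth_at_diff F.smooth_components P)
    moreover have j: "jet 0 ?f = F.F k - P" by (simp add: jet_diff F.smooth_components P F.F_def)
    moreover have "jDb v (jet 0 ?f) = 0" for v by (simp add: j P(3))
    ultimately have "jev (jD (z, 0) (F.F k - P)) = 0" "jev (jD (0, w) (F.F k - P)) = 0"
      "jev (jD (z, 0) (jD (z, 0) (F.F k - P))) = 0"
      using O_wt_3_derivatives(1)[of ?f \<epsilon> z] O_wt_3_derivatives(2)[of ?f \<epsilon> w] O_wt_3_derivatives(3)[of ?f \<epsilon> z] by auto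
    thus ?thesis by simp
  qed
  have sig: "jev (jD (z, 0) (F.F (\<sigma> \<alpha>))) = z $ \<alpha> \<and> jev (jD (0, w) (F.F (\<sigma> \<alpha>))) = 0
      \<and> jev (jD (z, 0) (jD (z, 0) (F.F (\<sigma> \<alpha>)))) = 0" for \<alpha> z w
  proof -
    let ?f = "\<lambda>x::(complex^'n) \<times> complex. fst x $ \<alpha> + (\<Sum>i\<in>UNIV. \<i> / 2 * A $ i $ \<alpha> * fst x $ i) * snd x"
    define P where "P = ?Z \<alpha> + (\<Sum>i\<in>UNIV. jconst (\<i> / 2 * A $ i $ \<alpha>) * ?Z i) * ?w"
    have s: "smooth_at 0 ?f" by (intro smooth_at_add smooth_at_mult smooth_at_sum smooth_at_const smooth_at_coordinate)
    have 1: "P = jet 0 ?f" unfolding P_def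
      by (simp only: jet_add jet_mult jet_sum_fun jet_const smooth_at_add smooth_at_mult smooth_at_sum smooth_at_const smooth_at_coordinate)
    have 2: "jDb v P = 0" for v by (simp add: P_def jD_coordinate)
    have 3: "O_wt \<epsilon> 4 (\<lambda>x. fst (G x) $ \<sigma> \<alpha> - ?f x)"
      using nf by (simp add: normal_form_def vector_matrix_mult_def sum_distrib_left mult_ac)
    show ?thesis using key[OF 1 s 2 3, of z w] by (simp add: P_def jD_coordinate jz)
  qed
  have oth: "jev (jD (z, 0) (F.F l)) = 0 \<and> jev (jD (0, w) (F.F l)) = 0
      \<and> jev (jD (z, 0) (jD (z, 0) (F.F l))) = 2 * quadratic_form (B l) z" if l: "l \<notin> range \<sigma>" for l z w
  proof -
    let ?f = "\<lambda>x::(complex^'n) \<times> complex. \<Sum>i\<in>UNIV. \<Sum>j\<in>UNIV. B l $ i $ j * fst x $ i * fst x $ j"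
    define P where "P = (\<Sum>i\<in>UNIV. \<Sum>j\<in>UNIV. jconst (B l $ i $ j) * ?Z i * ?Z j)"
    have s: "smooth_at 0 ?f" by (intro smooth_at_add smooth_at_mult smooth_at_sum smooth_at_const smooth_at_coordinate)
    have 1: "P = jet 0 ?f" unfolding P_def
      by (simp only: jet_add jet_mult jet_sum_fun jet_const smooth_at_add smooth_at_mult smooth_at_sum smooth_at_const smooth_at_coordinate)
    have 2: "jDb v P = 0" for v by (simp add: P_def jD_coordinate)
    have 3: "O_wt \<epsilon> 3 (\<lambda>x. fst (G x) $ l - ?f x)"
      using nf l by (simp add: normal_form_def quadratic_form_def)
    show ?thesis using key[OF 1 s 2 3, of z w]
      by (simp add: P_def jD_coordinate jz quadratic_form_def sum_distrib_left jev2 mult_ac)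
  qed
  have lift: "horizontal_lift \<epsilon> 0 v = (v, 0)" for v by (simp add: horizontal_lift_def herm_zero)
  have split: "(\<Sum>k\<in>UNIV. f k) = (\<Sum>\<alpha>\<in>UNIV. f (\<sigma> \<alpha>)) + (\<Sum>l\<in>- range \<sigma>. f l)" for f :: "'m \<Rightarrow> complex"
  proof -
    have "(\<Sum>k\<in>UNIV. f k) = (\<Sum>k\<in>range \<sigma>. f k) + (\<Sum>l\<in>- range \<sigma>. f l)"
      using sum.union_disjoint[of "range \<sigma>" "- range \<sigma>" f] by (simp add: Un_commute)
    thus ?thesis by (simp add: sum.reindex s\<sigma>(1))
  qed
  show Q1: "Q 0 = 1"
  proof -
    let ?e = "axis undefined 1 :: complex^'n"
    have "herm \<epsilon>' (F.D1 (?e, 0)) (F.D1 (?e, 0)) = herm \<epsilon> ?e ?e"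
      unfolding herm_def[of \<epsilon>'] split by (simp add: F.D1_def sig oth s\<sigma>(2) herm_def)
    hence "of_real (\<epsilon> undefined) = complex_of_real (Q 0) * of_real (\<epsilon> undefined)"
      using F.D1_isometry[of ?e ?e] by (simp add: lift herm_axis)
    thus ?thesis using eps[of undefined] by (metis mult_cancel_right1 of_real_eq_0_iff of_real_eq_1_iff)
  qed
  have DT: "F.D1 (0, 1) = 0"
  proof -
    have "jev (jD (0, 1) (F.F k)) = 0" for k by (cases "k \<in> range \<sigma>") (auto simp: sig oth)
    thus ?thesis by (simp add: F.D1_def vec_eq_iff)
  qed
  have q1: "F.q1 (v, 0) = 0" for v
    using F.identity_11[of "(v, 0)" "(0, 1)"] by (simp add: DT herm_zero F.lam_eq)
  have "ahlfors_matrix \<epsilon> Q 0 - (\<chi> \<alpha> \<beta>. A $ \<alpha> $ \<beta> * of_real (\<epsilon> \<beta>)) = 0"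
  proof (rule sesq_zero[OF eps])
    fix v
    have e1: "F.q11 (v, 0) (v, 0) = sesq (ahlfors_matrix \<epsilon> Q 0) v v"
      using F.log_hessian_eq[of "(v, 0)" "(v, 0)"] log_hessian_sesq[OF F.smooth_Q, of \<epsilon> v v]
      by (simp add: Q1 q1 lift)
    have e2: "herm \<epsilon>' (F.D2 (v, 0) (v, 0)) (F.D2 (v, 0) (v, 0))
        = 4 * of_real (\<Sum>l\<in>- range \<sigma>. \<epsilon>' l * (cmod (quadratic_form (B l) v))\<^sup>2)"
      unfolding herm_def split
      by (simp add: F.D2_def sig oth complex_norm_square sum_distrib_left mult_ac del: of_real_power flip: of_real_power)
    have e3: "of_real (\<Sum>l\<in>- range \<sigma>. \<epsilon>' l * (cmod (quadratic_form (B l) v))\<^sup>2)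
        = (\<Sum>\<alpha>\<in>UNIV. of_real (\<epsilon> \<alpha>) * cnj (v $ \<alpha>) * (v v* A) $ \<alpha>) * herm \<epsilon> v v"
      using nf unfolding normal_form_def herm_self by metis
    have e4: "(\<Sum>\<alpha>\<in>UNIV. of_real (\<epsilon> \<alpha>) * cnj (v $ \<alpha>) * (v v* A) $ \<alpha>)
        = sesq (\<chi> \<alpha> \<beta>. A $ \<alpha> $ \<beta> * of_real (\<epsilon> \<beta>)) v v"
      unfolding sesq_def by (subst sum.swap) (simp add: vector_matrix_mult_def sum_distrib_left mult_ac)
    have "4 * complex_of_real (\<Sum>l\<in>- range \<sigma>. \<epsilon>' l * (cmod (quadratic_form (B l) v))\<^sup>2)
        = 4 * (F.q11 (v, 0) (v, 0) * herm \<epsilon> v v)"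
      using F.gauss_equation[of v] e2 unfolding lift by (metis mult.assoc)
    hence "complex_of_real (\<Sum>l\<in>- range \<sigma>. \<epsilon>' l * (cmod (quadratic_form (B l) v))\<^sup>2)
        = F.q11 (v, 0) (v, 0) * herm \<epsilon> v v" by (simp del: of_real_sum)
    hence "sesq (\<chi> \<alpha> \<beta>. A $ \<alpha> $ \<beta> * of_real (\<epsilon> \<beta>)) v v * herm \<epsilon> v v
        = sesq (ahlfors_matrix \<epsilon> Q 0) v v * herm \<epsilon> v v" unfolding e1 e3 e4 .
    hence "herm \<epsilon> v v * sesq (ahlfors_matrix \<epsilon> Q 0) v v
        = herm \<epsilon> v v * sesq (\<chi> \<alpha> \<beta>. A $ \<alpha> $ \<beta> * of_real (\<epsilon> \<beta>)) v v"
      by (simp only: mult.commute[of "herm \<epsilon> v v"])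
    thus "herm \<epsilon> v v * sesq (ahlfors_matrix \<epsilon> Q 0 - (\<chi> \<alpha> \<beta>. A $ \<alpha> $ \<beta> * of_real (\<epsilon> \<beta>))) v v = 0"
      by (simp add: sesq_def algebra_simps sum_subtractf)
  qed
  thus "ahlfors_matrix \<epsilon> Q 0 = (\<chi> \<alpha> \<beta>. A $ \<alpha> $ \<beta> * of_real (\<epsilon> \<beta>))" by simp
qed

lemma surj_D1_equidimensional:
  fixes \<epsilon> \<epsilon>' :: "'n::finite \<Rightarrow> real"
  assumes ah: "ah_map \<epsilon> \<epsilon>' p h Q" and "\<And>k. \<epsilon> k \<noteq> 0" "Q p \<noteq> 0"
  shows "surj (\<lambda>v. fst (pushforward h p (horizontal_lift \<epsilon> p v)))"
proof -
  interpret ah_map_at \<epsilon> \<epsilon>' p h Q by unfold_locales (rule ah)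
  define T where "T v = D1 (horizontal_lift \<epsilon> p v)" for v
  have T: "T (u + v) = T u + T v" "T (c *s v) = c *s T v" for u v c
    by (simp_all add: T_def horizontal_lift_add horizontal_lift_scale D_linear)
  have "linear T"
    by (rule linearI) (use T(1) T(2)[of "of_real r" for r] in \<open>auto simp: scaleR_vec_def vector_scalar_mult_def scaleR_conv_of_real\<close>)
  moreover have "inj T"
  proof (rule linear_injective_0[OF \<open>linear T\<close>, THEN iffD2], intro allI impI)
    fix v assume "T v = 0"
    hence "herm \<epsilon> v w = 0" for w using D1_isometry[of v w] assms(3) by (simp add: T_def herm_zero)
    thus "v = 0" by (rule herm_nondegenerate[OF assms(2)])
  qed
  ultimately have "surj T" by (rule linear_inj_imp_surj)
  thus ?thesis by (simp add: T_def[abs_def] fst_pushforward)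
qed

text \<open>Composition with automorphisms changes the Ahlfors matrix by an invertible change of
  frame only, because the automorphisms themselves have vanishing Ahlfors matrix.\<close>

lemma rank_ahlfors_matrix_invariant:
  fixes \<epsilon> :: "'n::finite \<Rightarrow> real" and \<epsilon>' :: "'m::finite \<Rightarrow> real"
  assumes eps: "\<And>k. \<epsilon> k \<noteq> 0" "\<And>k. \<epsilon>' k \<noteq> 0"
    and g: "ah_map \<epsilon> \<epsilon> a g Qg" "Qg a \<noteq> 0" and h: "ah_map \<epsilon> \<epsilon>' (g a) h Q" "Q (g a) \<noteq> 0"
    and k: "ah_map \<epsilon>' \<epsilon>' (h (g a)) k Qk" "Qk (h (g a)) \<noteq> 0"
  defines "F \<equiv> \<lambda>x. k (h (g x))" and "QF \<equiv> \<lambda>x. Qk (h (g x)) * (Q (g x) * Qg x)"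
  shows "ah_map \<epsilon> \<epsilon>' a F QF" "rank (ahlfors_matrix \<epsilon> QF a) = rank (ahlfors_matrix \<epsilon> Q (g a))"
proof -
  have hg: "ah_map \<epsilon> \<epsilon>' a (\<lambda>x. h (g x)) (\<lambda>x. Q (g x) * Qg x)" by (rule ah_map_compose[OF g(1) h(1)])
  show F: "ah_map \<epsilon> \<epsilon>' a F QF" unfolding F_def QF_def by (rule ah_map_compose[OF hg k(1)])
  define T where "T v = fst (pushforward g a (horizontal_lift \<epsilon> a v))" for v
  have smooth: "smooth_at a Qg" "smooth_at (g a) Q" "smooth_at (h (g a)) Qk" "smooth_at a QF"
    using g h k F by (auto simp: ah_map_def)
  have lift: "\<exists>u'. pushforward f x (horizontal_lift e x v) = horizontal_lift e' (f x) u' \<and> u' = fst (pushforward f x (horizontal_lift e x v))"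
    if "ah_map e e' x f q" for e :: "'i::finite \<Rightarrow> real" and e' :: "'j::finite \<Rightarrow> real" and f q x v
    using horizontal_lift_fst[OF ah_map_at.horizontal_pushforward[OF ah_map_at.intro[OF that] horizontal_horizontal_lift]] by metis
  have nz: "Q (g a) * Qg a \<noteq> 0" using g h by simp
  have "sesq (ahlfors_matrix \<epsilon> QF a) v w = sesq (ahlfors_matrix \<epsilon> Q (g a)) (T v) (T w)" for v w
  proof -
    let ?v = "horizontal_lift \<epsilon> a v" and ?w = "horizontal_lift \<epsilon> a w"
    obtain v' w' where vw: "pushforward (\<lambda>x. h (g x)) a ?v = horizontal_lift \<epsilon>' (h (g a)) v'"
      "pushforward (\<lambda>x. h (g x)) a ?w = horizontal_lift \<epsilon>' (h (g a)) w'" using lift[OF hg] by metis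
    have gv: "pushforward g a (horizontal_lift \<epsilon> a v) = horizontal_lift \<epsilon> (g a) (T v)" for v
      using lift[OF g(1), of v] by (auto simp: T_def)
    have "sesq (ahlfors_matrix \<epsilon> QF a) v w = log_hessian QF a ?v ?w"
      by (rule log_hessian_sesq[symmetric]) (use smooth g h k in \<open>auto simp: QF_def\<close>)
    also have "\<dots> = log_hessian Qk (h (g a)) (pushforward (\<lambda>x. h (g x)) a ?v) (pushforward (\<lambda>x. h (g x)) a ?w)
        + log_hessian (\<lambda>x. Q (g x) * Qg x) a ?v ?w"
      unfolding QF_def by (rule log_hessian_compose[OF hg k(1) nz k(2)])
    also have "log_hessian Qk (h (g a)) (pushforward (\<lambda>x. h (g x)) a ?v) (pushforward (\<lambda>x. h (g x)) a ?w) = 0"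
      unfolding vw using log_hessian_sesq[OF smooth(3) k(2), of \<epsilon>' v' w']
        ahlfors_matrix_equidimensional[OF k(1) eps(2) eps(2) k(2)] by (simp add: sesq_def)
    also have "log_hessian (\<lambda>x. Q (g x) * Qg x) a ?v ?w
        = log_hessian Q (g a) (pushforward g a ?v) (pushforward g a ?w) + log_hessian Qg a ?v ?w"
      by (rule log_hessian_compose[OF g(1) h(1) g(2) h(2)])
    also have "log_hessian Qg a ?v ?w = 0"
      using log_hessian_sesq[OF smooth(1) g(2), of \<epsilon> v w]
        ahlfors_matrix_equidimensional[OF g(1) eps(1) eps(1) g(2)] by (simp add: sesq_def)
    also have "log_hessian Q (g a) (pushforward g a ?v) (pushforward g a ?w) = sesq (ahlfors_matrix \<epsilon> Q (g a)) (T v) (T w)"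
      unfolding gv by (rule log_hessian_sesq[OF smooth(2) h(2)])
    finally show ?thesis by simp
  qed
  moreover have "surj T" unfolding T_def[abs_def] by (rule surj_D1_equidimensional[OF g(1) eps(1) g(2)])
  ultimately show "rank (ahlfors_matrix \<epsilon> QF a) = rank (ahlfors_matrix \<epsilon> Q (g a))" by (rule rank_sesq_eq)
qed

section \<open>Cutoff functions\<close>

text \<open>The powers of \<open>1/t\<close> are there to make the family closed under differentiation.\<close>

definition flat_exp :: "nat \<Rightarrow> real \<Rightarrow> real" where
  "flat_exp m t = (if t > 0 then inverse t ^ m * exp (- inverse t) else 0)"

lemma flat_exp_tendsto: "(flat_exp m \<longlongrightarrow> 0) (at 0)"
proof -
  have "((\<lambda>t::real. inverse t ^ m / exp (inverse t)) \<longlongrightarrow> 0) (at_right 0)"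
    by (rule filterlim_compose[OF tendsto_power_div_exp_0 filterlim_inverse_at_top_right])
  moreover have "\<forall>\<^sub>F t in at_right (0::real). inverse t ^ m / exp (inverse t) = flat_exp m t"
    using eventually_at_right_less[of "0::real"] by eventually_elim (simp add: flat_exp_def exp_minus divide_inverse)
  ultimately have "(flat_exp m \<longlongrightarrow> 0) (at_right 0)" by (rule Lim_transform_eventually)
  moreover have "(flat_exp m \<longlongrightarrow> 0) (at_left 0)"
  proof (rule tendsto_eventually)
    show "\<forall>\<^sub>F t in at_left 0. flat_exp m t = 0"
      using eventually_at_left_real[of "-1" "0::real"] by (auto simp: flat_exp_def elim: eventually_mono)
  qed
  ultimately show ?thesis by (simp add: filterlim_split_at)
qed

lemma flat_exp_derivative:
  "(flat_exp m has_real_derivative (- real m * flat_exp (m + 1) t + flat_exp (m + 2) t)) (at t)"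
proof -
  consider "t > 0" | "t < 0" | "t = 0" by linarith
  thus ?thesis
  proof cases
    case 1
    have "((\<lambda>t. inverse t ^ m * exp (- inverse t)) has_real_derivative
        (- real m * (inverse t ^ (m + 1) * exp (- inverse t)) + inverse t ^ (m + 2) * exp (- inverse t))) (at t)"
    proof -
      have i: "((\<lambda>t. inverse t) has_real_derivative - (inverse t ^ 2)) (at t)"
        using 1 by (auto intro!: derivative_eq_intros simp: power2_eq_square)
      have "((\<lambda>t. inverse t ^ m) has_real_derivative (- real m * inverse t ^ (m + 1))) (at t)"
      proof (cases m)
        case (Suc n)
        from DERIV_power_Suc[OF i, of n] show ?thesis by (simp add: Suc power2_eq_square algebra_simps)
      qed simp
      moreover have "((\<lambda>t. exp (- inverse t)) has_real_derivative (exp (- inverse t) * inverse t ^ 2)) (at t)"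
        by (rule derivative_eq_intros DERIV_minus[OF i] refl)+ simp
      ultimately have "((\<lambda>t. inverse t ^ m * exp (- inverse t)) has_real_derivative
        (- real m * inverse t ^ (m + 1) * exp (- inverse t) + exp (- inverse t) * inverse t ^ 2 * inverse t ^ m)) (at t)"
        by (rule DERIV_mult)
      thus ?thesis by (simp add: power2_eq_square algebra_simps)
    qed
    hence "((\<lambda>t. inverse t ^ m * exp (- inverse t)) has_real_derivative
        (- real m * flat_exp (m + 1) t + flat_exp (m + 2) t)) (at t)" using 1 by (simp add: flat_exp_def)
    thus ?thesis
      by (rule has_field_derivative_transform_within_open[of _ _ _ "{0<..}"]) (use 1 in \<open>auto simp: flat_exp_def\<close>)
  next
    case 2
    have "((\<lambda>t. 0) has_real_derivative (- real m * flat_exp (m + 1) t + flat_exp (m + 2) t)) (at t)"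
      using 2 by (simp add: flat_exp_def)
    thus ?thesis
      by (rule has_field_derivative_transform_within_open[of _ _ _ "{..<0}"]) (use 2 in \<open>auto simp: flat_exp_def\<close>)
  next
    case 3
    have "\<forall>\<^sub>F h in at 0. flat_exp (m + 1) h = (flat_exp m (0 + h) - flat_exp m 0) / h"
      by (auto simp: flat_exp_def eventually_at_filter divide_inverse)
    from Lim_transform_eventually[OF flat_exp_tendsto this] have "(flat_exp m has_real_derivative 0) (at 0)"
      unfolding DERIV_def by simp
    thus ?thesis using 3 by (simp add: flat_exp_def)
  qed
qed

lemma smooth_on_flat_exp: "smooth_on UNIV (flat_exp m)"
proof -
  have "Ck_on k UNIV (flat_exp m)" for k m
  proof (induction k arbitrary: m)
    case 0
    show ?case using DERIV_isCont[OF flat_exp_derivative[of m]] by (simp add: continuous_at_imp_continuous_on)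
  next
    case (Suc k)
    have hd: "(flat_exp m has_derivative (\<lambda>v. (- real m * flat_exp (m + 1) t + flat_exp (m + 2) t) * v)) (at t)" for t
      using flat_exp_derivative by (simp add: has_field_derivative_def)
    have "dir_deriv v (flat_exp m) = (\<lambda>t. flat_exp (m + 1) t * (- real m * v) + flat_exp (m + 2) t * v)" for v
      by (rule ext, subst dir_deriv_eq[OF hd]) (simp add: algebra_simps)
    moreover have "Ck_on k UNIV (\<lambda>t. flat_exp (m + 1) t * (- real m * v) + flat_exp (m + 2) t * v)" for v
      by (intro Ck_on_add Ck_on_bilinear[OF open_UNIV bounded_bilinear_mult] Ck_on_const open_UNIV Suc.IH)
    ultimately show ?case using hd by (auto simp: Ck_on_Suc_dir differentiable_def)
  qed
  thus ?thesis by (simp add: smooth_on_def)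
qed

text \<open>The quotient \<open>A / (A + B)\<close>, where \<open>A\<close> is positive exactly inside the large ball and \<open>B\<close> exactly
  outside the small one.\<close>

lemma smooth_cutoff:
  fixes p :: "'a::euclidean_space"
  assumes "r > 0"
  obtains u :: "'a \<Rightarrow> real" where "smooth_on UNIV u" "\<And>x. dist x p \<le> r \<Longrightarrow> u x = 1" "\<And>x. dist x p \<ge> 2 * r \<Longrightarrow> u x = 0"
proof
  define T where "T x = (x - p) \<bullet> (x - p)" for x
  define A where "A x = flat_exp 0 (4 * r\<^sup>2 - T x)" for x
  define B where "B x = flat_exp 0 (T x - r\<^sup>2)" for x
  have T: "smooth_on UNIV T" unfolding T_def
    by (intro smooth_on_bilinear[OF bounded_bilinear_inner] smooth_on_diff smooth_on_ident smooth_on_const) auto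
  have AB: "smooth_on UNIV A" "smooth_on UNIV B" unfolding A_def B_def
    by (intro smooth_on_compose[OF _ smooth_on_flat_exp] smooth_on_diff smooth_on_const T; simp)+
  have nn: "A x \<ge> 0" "B x \<ge> 0" for x by (auto simp: A_def B_def flat_exp_def)
  have "A x + B x \<noteq> 0" for x
  proof (cases "T x < 4 * r\<^sup>2")
    case True
    hence "A x > 0" by (simp add: A_def flat_exp_def)
    thus ?thesis using nn[of x] by linarith
  next
    case False
    hence "T x > r\<^sup>2" using assms by (smt (verit) zero_less_power)
    hence "B x > 0" by (simp add: B_def flat_exp_def)
    thus ?thesis using nn[of x] by linarith
  qed
  note nz = this
  show "smooth_on UNIV (\<lambda>x. A x * inverse (A x + B x))"
    by (intro smooth_on_mult smooth_on_inverse smooth_on_add AB nz open_UNIV)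
  have Td: "T x = (dist x p)\<^sup>2" for x by (simp add: T_def dist_norm power2_norm_eq_inner)
  show "A x * inverse (A x + B x) = 1" if "dist x p \<le> r" for x
  proof -
    have "T x \<le> r\<^sup>2" unfolding Td using that by (intro power_mono) auto
    hence "B x = 0" by (simp add: B_def flat_exp_def)
    thus ?thesis using nz[of x] by simp
  qed
  show "A x * inverse (A x + B x) = 0" if "dist x p \<ge> 2 * r" for x
  proof -
    have "(2 * r)\<^sup>2 \<le> T x" unfolding Td using that assms by (intro power_mono) auto
    thus ?thesis by (simp add: A_def flat_exp_def power_mult_distrib)
  qed
qed

lemma smooth_on_Un:
  assumes "open S" "open T" "smooth_on S f" "smooth_on T f"
  shows "smooth_on (S \<union> T) f"
proof -
  have "Ck_on k (S \<union> T) f" if "Ck_on k S f" "Ck_on k T f" for k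
    using that
  proof (induction k arbitrary: f)
    case 0 thus ?case using continuous_on_open_Un[OF assms(1,2)] by simp
  next
    case (Suc k) thus ?case by (auto simp: Ck_on_Suc_dir)
  qed
  thus ?thesis using assms by (simp add: smooth_on_def)
qed

text \<open>Test functions are bounded together with all their derivatives, which makes the series of the
  discrete continuation below converge.\<close>

definition test_fun :: "('a::euclidean_space \<Rightarrow> complex) \<Rightarrow> bool" where
  "test_fun f \<longleftrightarrow> smooth_on UNIV f \<and> (\<exists>R. \<forall>x. R < norm x \<longrightarrow> f x = 0)"

lemma test_fun_dir_deriv: "test_fun f \<Longrightarrow> test_fun (dir_deriv v f)"
proof -
  assume f: "test_fun f"
  then obtain R where R: "\<And>x. R < norm x \<Longrightarrow> f x = 0" by (auto simp: test_fun_def)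
  have op: "open {x::'a. R < norm x}" by (intro open_Collect_less continuous_intros)
  have "dir_deriv v f x = 0" if "R < norm x" for x
    using dir_deriv_cong_open[OF op, of x f "\<lambda>x. 0" v] that R by simp
  thus ?thesis using f by (auto simp: test_fun_def intro: smooth_on_dir_deriv)
qed

lemma test_fun_bounded: assumes "test_fun f" obtains B where "B \<ge> 0" "\<And>x. cmod (f x) \<le> B"
proof -
  obtain R where R: "\<And>x. R < norm x \<Longrightarrow> f x = 0" using assms by (auto simp: test_fun_def)
  have "continuous_on (cball 0 R) f" using assms smooth_on_imp_continuous_on continuous_on_subset
    unfolding test_fun_def by blast
  hence "bounded (f ` cball 0 R)" by (intro compact_imp_bounded compact_continuous_image) auto
  then obtain B where B: "\<forall>y\<in>f ` cball 0 R. cmod y \<le> B" unfolding bounded_iff by blast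
  have "cmod (f x) \<le> max B 0" for x
  proof (cases "x \<in> cball 0 R")
    case True
    hence "cmod (f x) \<le> B" using B by blast
    thus ?thesis by simp
  qed (use R[of x] in auto)
  thus ?thesis by (intro that[of "max B 0"]) auto
qed

lemma test_fun_add: "test_fun f \<Longrightarrow> test_fun g \<Longrightarrow> test_fun (\<lambda>x. f x + g x)"
proof -
  assume fg: "test_fun f" "test_fun g"
  then obtain R S where "\<And>x. R < norm x \<Longrightarrow> f x = 0" "\<And>x. S < norm x \<Longrightarrow> g x = 0"
    unfolding test_fun_def by blast
  hence "\<forall>x. max R S < norm x \<longrightarrow> f x + g x = 0" by auto
  moreover have "smooth_on UNIV (\<lambda>x. f x + g x)" using fg by (auto simp: test_fun_def intro: smooth_on_add)
  ultimately show ?thesis unfolding test_fun_def by blast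
qed

lemma test_fun_mult: "smooth_on UNIV f \<Longrightarrow> test_fun g \<Longrightarrow> test_fun (\<lambda>x. f x * g x)"
  unfolding test_fun_def by (auto intro: smooth_on_mult)

lemma test_fun_extension:
  fixes f :: "'a::euclidean_space \<Rightarrow> complex"
  assumes "open S" "smooth_on S f" "cball p (2 * r) \<subseteq> S" "r > 0"
  obtains g where "test_fun g" "\<And>x. x \<in> ball p r \<Longrightarrow> g x = f x"
proof -
  obtain u :: "'a \<Rightarrow> real" where u: "smooth_on UNIV u" "\<And>x. dist x p \<le> r \<Longrightarrow> u x = 1" "\<And>x. dist x p \<ge> 2 * r \<Longrightarrow> u x = 0"
    using smooth_cutoff[OF assms(4)] by blast
  define g where "g x = (if x \<in> S then u x *\<^sub>R f x else 0)" for x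
  have "smooth_on S g"
    by (rule smooth_on_cong[OF assms(1), of "\<lambda>x. u x *\<^sub>R f x"])
      (auto simp: g_def intro: smooth_on_scaleR assms smooth_on_subset[OF u(1)])
  moreover have "smooth_on (- cball p (2 * r)) g"
    by (rule smooth_on_cong[of _ "\<lambda>x. 0"])
      (auto simp: g_def u(3) dist_commute smooth_on_const)
  ultimately have "smooth_on (S \<union> - cball p (2 * r)) g" by (intro smooth_on_Un assms(1)) auto
  moreover have "S \<union> - cball p (2 * r) = UNIV" using assms(3) by auto
  moreover have "g x = 0" if "norm p + 2 * r < norm x" for x
  proof -
    have "norm x \<le> norm p + dist x p" by (metis dist_norm norm_triangle_sub add.commute dist_commute norm_minus_commute)
    thus ?thesis using that by (simp add: g_def u(3))
  qed
  ultimately have "test_fun g" unfolding test_fun_def by metis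
  moreover have "g x = f x" if "x \<in> ball p r" for x
  proof -
    have "x \<in> S" using that assms(3,4) by (force simp: dist_commute)
    thus ?thesis using u(2)[of x] that by (simp add: g_def dist_commute)
  qed
  ultimately show ?thesis by (rule that)
qed

section \<open>A discrete measure with the moments of a point mass at the imaginary unit\<close>

text \<open>The sequences describe the complex measure with weights \<open>a k\<close> at the real points \<open>b k\<close>; all of its
  moments are required to converge absolutely.\<close>

definition rapid :: "(nat \<Rightarrow> real) \<Rightarrow> (nat \<Rightarrow> complex) \<Rightarrow> bool" where
  "rapid b a \<longleftrightarrow> (\<forall>j. summable (\<lambda>k. cmod (a k) * \<bar>b k\<bar> ^ j))"

text \<open>With \<open>b k = 4^(4 k)\<close> the number \<open>4^(theta_exp j k)\<close> is \<open>(b k)^j\<close> times \<open>4^(2 k (1 - k))\<close>, a term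
  of the \<open>j\<close>-th moment.\<close>

definition theta_exp :: "nat \<Rightarrow> int \<Rightarrow> real" where
  "theta_exp j k = of_int (2 * k * (2 * int j + 1 - k))"

definition theta_sign :: "int \<Rightarrow> real" where "theta_sign k = (if even k then 1 else -1)"

lemma int_decode_bound: "n \<le> 2 * nat \<bar>int_decode n\<bar> + 1"
  by (auto simp: int_decode_def sum_decode_def)

lemma theta_exp_bound: "theta_exp j (int_decode n) \<le> 1 + 2 * (real j + 1)\<^sup>2 - real n"
proof -
  define k where "k = int_decode n"
  define x where "x = \<bar>real_of_int k\<bar>"
  have "int n \<le> 2 * \<bar>k\<bar> + 1" using int_decode_bound[of n] unfolding k_def by linarith
  hence "real_of_int (int n) \<le> real_of_int (2 * \<bar>k\<bar> + 1)" by (simp only: of_int_le_iff)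
  hence "real n \<le> 2 * x + 1" by (simp add: x_def)
  moreover have "theta_exp j k \<le> 2 * (2 * real j + 1) * x - 2 * x\<^sup>2"
  proof -
    have "theta_exp j k = 2 * (2 * real j + 1) * real_of_int k - 2 * (real_of_int k)\<^sup>2"
      by (simp add: theta_exp_def power2_eq_square algebra_simps)
    moreover have "real_of_int k \<le> x" "(real_of_int k)\<^sup>2 = x\<^sup>2" by (auto simp: x_def)
    ultimately show ?thesis by (simp add: mult_left_mono)
  qed
  moreover have "0 \<le> 2 * (x - (real j + 1))\<^sup>2" by simp
  ultimately show ?thesis unfolding k_def[symmetric] by (simp add: power2_eq_square algebra_simps)
qed

lemma theta_summable: "summable (\<lambda>n. 4 powr theta_exp j (int_decode n))"
proof (rule summable_comparison_test')
  show "summable (\<lambda>n. 4 powr (1 + 2 * (real j + 1)\<^sup>2) * (1 / 4 :: real) ^ n)"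
    by (intro summable_mult summable_geometric) auto
  fix n :: nat
  have "4 powr theta_exp j (int_decode n) \<le> 4 powr (1 + 2 * (real j + 1)\<^sup>2 - real n)"
    by (rule powr_mono[OF theta_exp_bound]) simp
  also have "\<dots> = 4 powr (1 + 2 * (real j + 1)\<^sup>2) * (1 / 4) ^ n"
    by (simp add: powr_diff powr_realpow power_divide)
  finally show "norm (4 powr theta_exp j (int_decode n)) \<le> 4 powr (1 + 2 * (real j + 1)\<^sup>2) * (1 / 4) ^ n" by simp
qed

text \<open>The exponents are symmetric and the signs antisymmetric under \<open>k \<mapsto> 2 j + 1 - k\<close>; these are
  the zeros of a theta function.\<close>

lemma theta_sum_zero: "(\<lambda>n. theta_sign (int_decode n) * 4 powr theta_exp j (int_decode n)) sums 0"
proof -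
  define g where "g n = theta_sign (int_decode n) * 4 powr theta_exp j (int_decode n)" for n
  have ng: "norm (g n) = 4 powr theta_exp j (int_decode n)" for n by (simp add: g_def theta_sign_def)
  have "summable (\<lambda>n. norm (g n))" unfolding ng by (rule theta_summable)
  hence so: "g summable_on UNIV" by (rule norm_summable_imp_summable_on)
  define f where "f n = int_encode (2 * int j + 1 - int_decode n)" for n
  have f: "bij_betw f UNIV UNIV" unfolding f_def
    by (rule bij_betw_byWitness[where f' = "\<lambda>n. int_encode (2 * int j + 1 - int_decode n)"]) auto
  have "g (f n) = - g n" for n
    by (auto simp: g_def f_def theta_sign_def theta_exp_def algebra_simps)
  hence "infsum g UNIV = infsum (\<lambda>n. - g n) UNIV"
    using infsum_reindex_bij_betw[OF f, of g] by simp
  hence "infsum g UNIV = 0" by (simp add: infsum_uminus)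
  hence "(g has_sum 0) UNIV" using so by (metis has_sum_infsum)
  thus ?thesis using has_sum_imp_sums unfolding g_def by blast
qed

text \<open>These bounds keep the zeroth moment in \<open>imaginary_moments\<close> away from zero: the term at \<open>k = 0\<close>,
  which is \<open>1/2\<close>, dominates the sum of all others, which is at most \<open>1/3\<close>.\<close>

lemma theta_tail_bound:
  assumes "n \<ge> 1"
  shows "4 powr theta_exp 0 (int_decode n) / ((4 powr (4 * of_int (int_decode n)))\<^sup>2 + 1) \<le> (1 / 4) ^ n"
proof (cases "n = 2")
  case True
  have "int_decode 2 = 1" by (simp add: int_decode_def sum_decode_def)
  thus ?thesis using True by (simp add: theta_exp_def power2_eq_square field_simps)
next
  case False
  define k where "k = int_decode n"
  have "int n \<le> 2 * k * (k - 1)"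
  proof (cases "even n")
    case True
    then obtain m where m: "n = 2 * m" by blast
    hence "k = int m" "m \<ge> 2" using False assms by (auto simp: k_def int_decode_def sum_decode_def)
    hence "2 * int m * 1 \<le> 2 * k * (k - 1)" by (intro mult_mono) auto
    thus ?thesis using m by simp
  next
    case odd: False
    then obtain m where m: "n = 2 * m + 1" by (metis oddE)
    hence k: "k = - int m - 1" by (auto simp: k_def int_decode_def sum_decode_def)
    show ?thesis unfolding m k by (simp add: algebra_simps)
  qed
  hence "real_of_int (int n) \<le> real_of_int (2 * k * (k - 1))" by (simp only: of_int_le_iff)
  hence "theta_exp 0 k \<le> - real n" by (simp add: theta_exp_def algebra_simps)
  have "4 powr theta_exp 0 k / ((4 powr (4 * of_int k))\<^sup>2 + 1) \<le> 4 powr theta_exp 0 k / 1"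
    by (intro divide_left_mono) (auto simp: add_pos_pos)
  also have "\<dots> \<le> 4 powr (- real n)" using powr_mono[OF \<open>theta_exp 0 k \<le> - real n\<close>, of 4] by simp
  also have "\<dots> = (1 / 4) ^ n" unfolding powr_minus by (subst powr_realpow) (simp_all add: power_one_over inverse_eq_divide)
  finally show ?thesis by (simp add: k_def)
qed

text \<open>Dividing a sequence with vanishing moments by \<open>b - \<i>\<close> makes the moments geometric with
  ratio \<open>\<i>\<close>.\<close>

lemma imaginary_moments:
  obtains b a where "rapid b a" "\<And>j. (\<Sum>k. a k * of_real (b k) ^ j) = \<i> ^ j"
proof -
  define b :: "nat \<Rightarrow> real" where "b n = 4 powr (4 * of_int (int_decode n))" for n
  define c :: "nat \<Rightarrow> real" where "c n = theta_sign (int_decode n) * 4 powr theta_exp 0 (int_decode n)" for n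
  define a where "a n = of_real (c n) / (of_real (b n) - \<i>)" for n
  have cb: "c n * b n ^ j = theta_sign (int_decode n) * 4 powr theta_exp j (int_decode n)" for n j
  proof -
    have "b n ^ j = 4 powr (real j * (4 * of_int (int_decode n)))" unfolding b_def by (metis powr_power mult.commute zero_neq_numeral)
    thus ?thesis by (simp add: c_def theta_exp_def algebra_simps flip: powr_add)
  qed
  have nz: "of_real (b n) - \<i> \<noteq> 0" for n by (simp add: complex_eq_iff)
  have dl: "1 \<le> cmod (of_real (b n) - \<i>)" for n using abs_Im_le_cmod[of "of_real (b n) - \<i>"] by simp
  have b0: "b n > 0" for n by (simp add: b_def)
  have an: "cmod (a n) * \<bar>b n\<bar> ^ j \<le> 4 powr theta_exp j (int_decode n)" for n j
  proof -
    have "cmod (a n) \<le> \<bar>c n\<bar>" unfolding a_def norm_divide using dl[of n] by (simp add: divide_le_eq mult_le_cancel_left1)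
    hence "cmod (a n) * \<bar>b n\<bar> ^ j \<le> \<bar>c n\<bar> * \<bar>b n\<bar> ^ j" by (intro mult_right_mono) auto
    also have "\<dots> = \<bar>c n * b n ^ j\<bar>" by (simp add: abs_mult power_abs)
    also have "\<dots> = 4 powr theta_exp j (int_decode n)" unfolding cb by (simp add: theta_sign_def abs_mult)
    finally show ?thesis .
  qed
  have rap: "rapid b a" unfolding rapid_def
    by (intro allI summable_comparison_test'[OF theta_summable]) (use an in \<open>auto simp: abs_mult\<close>)
  have sm: "summable (\<lambda>n. a n * of_real (b n) ^ j)" for j
    by (rule summable_norm_cancel) (use rap in \<open>simp add: rapid_def norm_mult norm_power\<close>)
  define m where "m j = (\<Sum>n. a n * of_real (b n) ^ j)" for j
  have "m (Suc j) = \<i> * m j" for j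
  proof -
    have "a n * of_real (b n) ^ Suc j - \<i> * (a n * of_real (b n) ^ j) = of_real (c n * b n ^ j)" for n
    proof -
      have "a n * of_real (b n) ^ Suc j - \<i> * (a n * of_real (b n) ^ j) = (a n * (of_real (b n) - \<i>)) * of_real (b n) ^ j"
        by (simp add: algebra_simps)
      also have "a n * (of_real (b n) - \<i>) = of_real (c n)" using nz by (simp add: a_def)
      finally show ?thesis by simp
    qed
    moreover have "(\<lambda>n. complex_of_real (c n * b n ^ j)) sums of_real 0"
      unfolding cb by (rule sums_of_real[OF theta_sum_zero])
    ultimately have "(\<lambda>n. a n * of_real (b n) ^ Suc j - \<i> * (a n * of_real (b n) ^ j)) sums 0" by simp
    moreover have "(\<lambda>n. a n * of_real (b n) ^ Suc j - \<i> * (a n * of_real (b n) ^ j)) sums (m (Suc j) - \<i> * m j)"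
      unfolding m_def by (intro sums_diff sums_mult summable_sums sm)
    ultimately show ?thesis using sums_unique2 by fastforce
  qed
  hence mj: "m j = \<i> ^ j * m 0" for j by (induction j) auto
  \<comment> \<open>The imaginary part of the zeroth moment is the sum of \<open>c n / ((b n)\<^sup>2 + 1)\<close>, which its first term dominates.\<close>
  have "m 0 \<noteq> 0"
  proof -
    define t where "t n = c n / ((b n)\<^sup>2 + 1)" for n
    have Im: "Im (a n) = t n" for n
      by (simp add: a_def t_def Im_divide complex_eq_iff power2_eq_square)
    have "(\<lambda>n. Im (a n)) sums Im (m 0)" using sm[of 0] unfolding m_def by (auto intro!: sums_Im summable_sums)
    hence S: "t sums Im (m 0)" by (simp add: Im)
    have tn: "\<bar>t (Suc n)\<bar> \<le> (1 / 4) ^ Suc n" for n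
    proof -
      have "\<bar>t (Suc n)\<bar> = 4 powr theta_exp 0 (int_decode (Suc n)) / ((b (Suc n))\<^sup>2 + 1)"
        by (simp add: t_def c_def theta_sign_def abs_mult abs_divide add_nonneg_pos)
      thus ?thesis using theta_tail_bound[of "Suc n"] by (simp add: b_def)
    qed
    have geo: "(\<lambda>n. (1 / 4 :: real) ^ Suc n) sums (1 / 3)"
      using sums_mult[OF geometric_sums[of "1/4 :: real"], of "1/4"] by simp
    have "(\<lambda>n. t (Suc n)) sums (Im (m 0) - t 0)" using S by (simp add: sums_Suc_iff)
    hence neg: "(\<lambda>n. - t (Suc n)) sums (- (Im (m 0) - t 0))" by (rule sums_minus)
    have le: "- t (Suc n) \<le> (1 / 4) ^ Suc n" for n using tn[of n] by linarith
    have "- (Im (m 0) - t 0) \<le> 1 / 3" by (rule sums_le[OF le neg geo])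
    moreover have "t 0 = 1 / 2" by (simp add: t_def c_def b_def int_decode_def sum_decode_def theta_sign_def theta_exp_def)
    ultimately show ?thesis by auto
  qed
  note m0 = this
  show ?thesis
  proof (rule that[of b "\<lambda>n. a n / m 0"])
    have "summable (\<lambda>k. inverse (cmod (m 0)) * (cmod (a k) * \<bar>b k\<bar> ^ j))" for j
      using rap by (intro summable_mult) (simp add: rapid_def)
    thus "rapid b (\<lambda>n. a n / m 0)" by (simp add: rapid_def norm_mult norm_inverse divide_inverse mult_ac)
    show "(\<Sum>k. a k / m 0 * of_real (b k) ^ j) = \<i> ^ j" for j
    proof -
      have "(\<Sum>k. a k / m 0 * of_real (b k) ^ j) = (\<Sum>k. inverse (m 0) * (a k * of_real (b k) ^ j))"
        by (simp add: divide_inverse mult_ac)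
      also have "\<dots> = inverse (m 0) * m j" unfolding m_def by (rule suminf_mult[OF sm])
      finally show ?thesis using m0 mj[of j] by simp
    qed
  qed
qed

section \<open>Almost analytic continuation in one variable\<close>

text \<open>The last variable is complexified: a function of \<open>(z, u)\<close> with \<open>u\<close> real is continued to
  \<open>(z, u + i t)\<close> as \<open>\<Sum> a\<^sub>k \<phi>(z, u + b\<^sub>k t)\<close>. If the sequence \<open>a\<close> has moments \<open>i\<^sup>j\<close>, the formal
  Taylor series in \<open>t\<close> is that of \<open>\<phi>(z, u + i t)\<close>.\<close>

definition squeeze :: "real \<Rightarrow> (complex^'n::finite) \<times> complex \<Rightarrow> (complex^'n) \<times> complex" where
  "squeeze b x = (fst x, complex_of_real (Re (snd x) + b * Im (snd x)))"

definition discrete_continuation ::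
  "(nat \<Rightarrow> real) \<Rightarrow> (nat \<Rightarrow> complex) \<Rightarrow> ((complex^'n::finite) \<times> complex \<Rightarrow> complex) \<Rightarrow> (complex^'n) \<times> complex \<Rightarrow> complex" where
  "discrete_continuation b a f x = (\<Sum>k. a k * f (squeeze (b k) x))"

lemma linear_squeeze: "linear (squeeze b)"
  by (rule linearI) (auto simp: squeeze_def algebra_simps scaleR_conv_of_real)

lemma squeeze_decomp:
  "squeeze b h = (fst h, of_real (Re (snd h))) + (b * Im (snd h)) *\<^sub>R (0, 1)"
  by (simp add: squeeze_def scaleR_conv_of_real)

lemma norm_squeeze: "norm (squeeze b h) \<le> (2 + \<bar>b\<bar>) * norm h"
proof -
  have "norm (squeeze b h) \<le> norm (fst h) + \<bar>Re (snd h) + b * Im (snd h)\<bar>"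
    unfolding squeeze_def using norm_Pair_le[of "fst h" "complex_of_real (Re (snd h) + b * Im (snd h))"]
    by (simp only: norm_of_real)
  also have "\<dots> \<le> norm (fst h) + (\<bar>Re (snd h)\<bar> + \<bar>b\<bar> * \<bar>Im (snd h)\<bar>)"
    using abs_triangle_ineq[of "Re (snd h)" "b * Im (snd h)"] by (simp add: abs_mult)
  also have "\<dots> \<le> norm h + (norm h + \<bar>b\<bar> * norm h)"
  proof -
    have "\<bar>Re (snd h)\<bar> \<le> norm h" "\<bar>Im (snd h)\<bar> \<le> norm h" "norm (fst h) \<le> norm h"
      using abs_Re_le_cmod[of "snd h"] abs_Im_le_cmod[of "snd h"] norm_snd_le[of "snd h" "fst h"] norm_fst_le[of "fst h" "snd h"]
      by auto
    thus ?thesis by (intro add_mono mult_left_mono) auto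
  qed
  finally show ?thesis by (simp add: algebra_simps)
qed

lemma rapid_shift: "rapid b a \<Longrightarrow> rapid b (\<lambda>k. a k * of_real (b k))"
proof -
  assume r: "rapid b a"
  have "summable (\<lambda>k. cmod (a k) * \<bar>b k\<bar> ^ Suc j)" for j using r unfolding rapid_def by blast
  thus ?thesis by (simp add: rapid_def norm_mult mult_ac)
qed

lemma rapid_scale: "rapid b a \<Longrightarrow> rapid b (\<lambda>k. c * a k)"
  by (simp add: rapid_def norm_mult mult.assoc summable_mult)

lemma rapid_add: "rapid b a \<Longrightarrow> rapid b a' \<Longrightarrow> rapid b (\<lambda>k. a k + a' k)"
proof -
  assume r: "rapid b a" "rapid b a'"
  have "summable (\<lambda>k. cmod (a k + a' k) * \<bar>b k\<bar> ^ j)" for j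
  proof (rule summable_comparison_test')
    show "summable (\<lambda>k. cmod (a k) * \<bar>b k\<bar> ^ j + cmod (a' k) * \<bar>b k\<bar> ^ j)"
      using r by (intro summable_add) (auto simp: rapid_def)
    show "norm (cmod (a n + a' n) * \<bar>b n\<bar> ^ j) \<le> cmod (a n) * \<bar>b n\<bar> ^ j + cmod (a' n) * \<bar>b n\<bar> ^ j" for n
      using norm_triangle_ineq[of "a n" "a' n"]
      by (simp add: abs_mult flip: distrib_right) (intro mult_right_mono, auto)
  qed
  thus ?thesis by (simp add: rapid_def)
qed

lemma rapid_summable:
  assumes "rapid b a" "test_fun f" shows "summable (\<lambda>k. a k * f (squeeze (b k) x))"
proof -
  obtain B where B: "B \<ge> 0" "\<And>x. cmod (f x) \<le> B" using test_fun_bounded[OF assms(2)] by blast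
  have "summable (\<lambda>k. cmod (a k) * \<bar>b k\<bar> ^ 0)" using assms(1) unfolding rapid_def by blast
  hence "summable (\<lambda>k. cmod (a k) * B)" by (simp add: summable_mult2)
  thus ?thesis
    by (rule summable_comparison_test') (auto simp: norm_mult intro!: mult_left_mono B)
qed

lemma test_fun_derivative_bound:
  fixes f :: "'a::euclidean_space \<Rightarrow> complex"
  assumes "test_fun f" obtains K where "K \<ge> 0" "\<And>u y. cmod (dir_deriv u f y) \<le> K * norm u"
proof -
  have "\<exists>B\<ge>0. \<forall>x. cmod (dir_deriv b f x) \<le> B" for b
    using test_fun_bounded[OF test_fun_dir_deriv[OF assms, of b]] by metis
  then obtain B where B: "\<And>b. B b \<ge> 0" "\<And>b x. cmod (dir_deriv b f x) \<le> B b" by metis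
  have d: "f differentiable (at y)" for y using assms smooth_on_imp_differentiable by (auto simp: test_fun_def)
  show ?thesis
  proof
    show "sum B Basis \<ge> 0" by (intro sum_nonneg B)
    fix u y
    have "cmod (dir_deriv u f y) \<le> (\<Sum>b\<in>Basis. norm u * B b)"
    proof (subst dir_deriv_basis[OF d], rule sum_norm_le)
      fix b :: 'a assume b: "b \<in> Basis"
      have "\<bar>u \<bullet> b\<bar> \<le> norm u" by (rule Basis_le_norm[OF b])
      thus "cmod ((u \<bullet> b) *\<^sub>R dir_deriv b f y) \<le> norm u * B b"
        using B by (simp only: norm_scaleR) (intro mult_mono, auto)
    qed
    thus "cmod (dir_deriv u f y) \<le> sum B Basis * norm u" by (simp add: sum_distrib_left mult.commute)
  qed
qed

text \<open>Termwise differentiation, justified by the uniform bounds on the derivatives of a test function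
  and the summability of the moments.\<close>

lemma discrete_continuation_has_derivative:
  fixes f :: "(complex^'n::finite) \<times> complex \<Rightarrow> complex"
  assumes r: "rapid b a" and f: "test_fun f"
  shows "(discrete_continuation b a f has_derivative
      (\<lambda>h. discrete_continuation b a (dir_deriv (fst h, of_real (Re (snd h))) f) x
        + of_real (Im (snd h)) * discrete_continuation b (\<lambda>k. a k * of_real (b k)) (dir_deriv (0, 1) f) x)) (at x)"
proof -
  define F where "F n x = a n * f (squeeze (b n) x)" for n x
  define F' where "F' n x h = a n * dir_deriv (squeeze (b n) h) f (squeeze (b n) x)" for n x h
  obtain K where K: "K \<ge> 0" "\<And>u y. cmod (dir_deriv u f y) \<le> K * norm u" using test_fun_derivative_bound[OF f] by blast
  have d: "f differentiable (at y)" for y using f smooth_on_imp_differentiable by (auto simp: test_fun_def)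
  define t where "t n = cmod (a n) * (K * (2 + \<bar>b n\<bar>))" for n
  have bd: "cmod (F' n x h) \<le> t n * norm h" for n x h
  proof -
    have "cmod (F' n x h) \<le> cmod (a n) * (K * norm (squeeze (b n) h))"
      unfolding F'_def norm_mult by (intro mult_left_mono K) auto
    also have "\<dots> \<le> cmod (a n) * (K * ((2 + \<bar>b n\<bar>) * norm h))"
      by (intro mult_left_mono norm_squeeze K) auto
    finally show ?thesis by (simp add: t_def mult_ac)
  qed
  have st: "summable t"
  proof -
    have "summable (\<lambda>k. cmod (a k) * \<bar>b k\<bar> ^ 0)" "summable (\<lambda>k. cmod (a k) * \<bar>b k\<bar> ^ 1)" using r unfolding rapid_def by blast+
    hence "summable (\<lambda>n. (2 * K) * (cmod (a n) * \<bar>b n\<bar> ^ 0) + K * (cmod (a n) * \<bar>b n\<bar> ^ 1))"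
      by (intro summable_add summable_mult)
    thus ?thesis by (simp add: t_def[abs_def] algebra_simps)
  qed
  have sF': "summable (\<lambda>n. F' n x h)" for x h
    by (rule summable_comparison_test'[OF summable_mult2[OF st, of "norm h"]]) (rule bd)
  define g' where "g' x h = (\<Sum>n. F' n x h)" for x h
  have der: "(F n has_derivative F' n x) (at x within UNIV)" for n x
  proof -
    have "((\<lambda>x. f (squeeze (b n) x)) has_derivative (\<lambda>h. dir_deriv (squeeze (b n) h) f (squeeze (b n) x))) (at x)"
      by (rule has_derivative_compose[OF linear_imp_has_derivative[OF linear_squeeze] has_derivative_dir_deriv[OF d]])
    thus ?thesis unfolding F_def[abs_def] F'_def[abs_def] by (rule has_derivative_mult_right)
  qed
  have unif: "\<forall>\<^sub>F n in sequentially. \<forall>x\<in>UNIV. \<forall>h. norm (sum (\<lambda>i. F' i x h) {..<n} - g' x h) \<le> e * norm h" if e: "e > 0" for e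
  proof -
    obtain N where N: "\<And>n. n \<ge> N \<Longrightarrow> norm (\<Sum>i. t (i + n)) < e" using suminf_exist_split[OF e st] by blast
    have "norm (sum (\<lambda>i. F' i x h) {..<n} - g' x h) \<le> e * norm h" if n: "n \<ge> N" for n x h
    proof -
      have "g' x h = (\<Sum>i. F' (i + n) x h) + sum (\<lambda>i. F' i x h) {..<n}"
        unfolding g'_def by (rule suminf_split_initial_segment[OF sF'])
      hence "norm (sum (\<lambda>i. F' i x h) {..<n} - g' x h) = norm (\<Sum>i. F' (i + n) x h)" by (simp add: norm_minus_commute)
      also have "\<dots> \<le> (\<Sum>i. t (i + n) * norm h)"
      proof (rule norm_suminf_le)
        show "summable (\<lambda>i. t (i + n) * norm h)" by (intro summable_mult2) (simp add: summable_iff_shift st)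
      qed (rule bd)
      also have "\<dots> = (\<Sum>i. t (i + n)) * norm h"
        by (rule suminf_mult2[symmetric]) (simp add: summable_iff_shift st)
      also have "\<dots> \<le> e * norm h" using N[OF n] by (intro mult_right_mono) auto
      finally show ?thesis .
    qed
    thus ?thesis unfolding eventually_sequentially by blast
  qed
  have "(\<lambda>n. F n 0) sums (\<Sum>n. F n 0)" unfolding F_def by (intro summable_sums rapid_summable r f)
  from has_derivative_series[OF convex_UNIV der unif UNIV_I this]
  obtain g where g: "\<And>x. (\<lambda>n. F n x) sums g x" "\<And>x. (g has_derivative g' x) (at x)" by auto
  have "g = discrete_continuation b a f"
    using sums_unique[OF g(1)] by (auto simp: F_def discrete_continuation_def fun_eq_iff)
  moreover have "g' x = (\<lambda>h. discrete_continuation b a (dir_deriv (fst h, of_real (Re (snd h))) f) x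
        + of_real (Im (snd h)) * discrete_continuation b (\<lambda>k. a k * of_real (b k)) (dir_deriv (0, 1) f) x)"
  proof
    fix h :: "(complex^'n) \<times> complex"
    let ?u = "(fst h, complex_of_real (Re (snd h)))"
    have "F' n x h = a n * dir_deriv ?u f (squeeze (b n) x)
        + of_real (Im (snd h)) * (a n * of_real (b n) * dir_deriv (0, 1) f (squeeze (b n) x))" for n
    proof -
      interpret linear "\<lambda>v. dir_deriv v f (squeeze (b n) x)" by (rule linear_dir_deriv[OF d])
      show ?thesis unfolding F'_def squeeze_decomp[of _ h] add scale by (simp add: scaleR_conv_of_real algebra_simps)
    qed
    moreover have "summable (\<lambda>n. a n * dir_deriv ?u f (squeeze (b n) x))"
      "summable (\<lambda>n. a n * of_real (b n) * dir_deriv (0, 1) f (squeeze (b n) x))"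
      by (intro rapid_summable r rapid_shift test_fun_dir_deriv f)+
    ultimately show "g' x h = discrete_continuation b a (dir_deriv ?u f) x
        + of_real (Im (snd h)) * discrete_continuation b (\<lambda>k. a k * of_real (b k)) (dir_deriv (0, 1) f) x"
      unfolding g'_def discrete_continuation_def
      by (simp add: suminf_add summable_mult flip: suminf_mult)
  qed
  ultimately show ?thesis using g(2)[of x] by (simp only:)
qed

lemma dir_deriv_discrete_continuation:
  assumes "rapid b a" "test_fun f"
  shows "dir_deriv v (discrete_continuation b a f) = (\<lambda>x. discrete_continuation b a (dir_deriv (fst v, of_real (Re (snd v))) f) x
        + discrete_continuation b (\<lambda>k. of_real (Im (snd v)) * (a k * of_real (b k))) (dir_deriv (0, 1) f) x)"
proof
  fix x
  have "of_real (Im (snd v)) * discrete_continuation b (\<lambda>k. a k * of_real (b k)) (dir_deriv (0, 1) f) x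
      = discrete_continuation b (\<lambda>k. of_real (Im (snd v)) * (a k * of_real (b k))) (dir_deriv (0, 1) f) x"
    unfolding discrete_continuation_def
    by (subst suminf_mult[OF rapid_summable[OF rapid_shift[OF assms(1)] test_fun_dir_deriv[OF assms(2)]], symmetric])
      (simp only: mult.assoc)
  thus "dir_deriv v (discrete_continuation b a f) x = discrete_continuation b a (dir_deriv (fst v, of_real (Re (snd v))) f) x
        + discrete_continuation b (\<lambda>k. of_real (Im (snd v)) * (a k * of_real (b k))) (dir_deriv (0, 1) f) x"
    by (subst dir_deriv_eq[OF discrete_continuation_has_derivative[OF assms]]) simp
qed

lemma smooth_discrete_continuation:
  assumes "rapid b a" "test_fun f" shows "smooth_on UNIV (discrete_continuation b a f)"
proof -
  have "Ck_on k UNIV (discrete_continuation b a f)" if "rapid b a" "test_fun f" for k a f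
    using that
  proof (induction k arbitrary: a f)
    case 0
    have "isCont (discrete_continuation b a f) x" for x
      by (rule has_derivative_continuous[OF discrete_continuation_has_derivative[OF 0]])
    thus ?case by (simp add: continuous_at_imp_continuous_on)
  next
    case (Suc k)
    have "Ck_on k UNIV (dir_deriv v (discrete_continuation b a f))" for v
      unfolding dir_deriv_discrete_continuation[OF Suc.prems]
      by (intro Ck_on_add open_UNIV Suc.IH rapid_scale rapid_shift test_fun_dir_deriv Suc.prems)
    moreover have "discrete_continuation b a f differentiable (at x)" for x
      using discrete_continuation_has_derivative[OF Suc.prems] unfolding differentiable_def by blast
    ultimately show ?case by (simp add: Ck_on_Suc_dir)
  qed
  thus ?thesis using assms by (subst smooth_on_def) blast
qed

lemma discrete_continuation_real:
  assumes "Im (snd x) = 0" shows "discrete_continuation b a f x = (\<Sum>k. a k * f x)"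
proof -
  have "squeeze c x = x" for c using assms by (simp add: squeeze_def prod_eq_iff complex_eq_iff)
  thus ?thesis by (simp add: discrete_continuation_def)
qed

lemma rapid_summable_moment: "rapid b a \<Longrightarrow> summable (\<lambda>k. a k * of_real (b k) ^ j)"
  by (rule summable_norm_cancel) (simp add: rapid_def norm_mult norm_power)

text \<open>A derivative at a point of the real locus is a sum of products of a moment with a derivative of
  \<open>f\<close>, and one of the two factors vanishes throughout.\<close>

lemma flat_discrete_continuation:
  assumes "rapid b a" "test_fun f" "Im (snd x) = 0"
    and "(\<forall>j. (\<Sum>k. a k * of_real (b k) ^ j) = 0) \<or> flat_at x f"
  shows "flat_at x (discrete_continuation b a f)"
proof -
  have "iter_deriv vs (discrete_continuation b a f) x = 0" for vs
    using assms(1,2,4)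
  proof (induction vs arbitrary: a f rule: rev_induct)
    case Nil
    have s: "summable a" using rapid_summable_moment[OF Nil(1), of 0] by simp
    have "discrete_continuation b a f x = (\<Sum>k. a k) * f x"
      unfolding discrete_continuation_real[OF assms(3)] by (rule suminf_mult2[OF s, symmetric])
    moreover have "(\<Sum>k. a k) = 0 \<or> f x = 0" using Nil(3) flat_at_value by (metis (no_types, lifting) mult.right_neutral power_0 suminf_cong)
    ultimately show ?case by auto
  next
    case (snoc v vs)
    let ?f1 = "dir_deriv (fst v, complex_of_real (Re (snd v))) f" and ?f2 = "dir_deriv (0, 1) f"
    let ?a = "\<lambda>k. of_real (Im (snd v)) * (a k * of_real (b k))"
    note r = rapid_scale[OF rapid_shift[OF snoc.prems(1)], of "of_real (Im (snd v))"]
      and t = test_fun_dir_deriv[OF snoc.prems(2)]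
    have m: "(\<forall>j. (\<Sum>k. ?a k * of_real (b k) ^ j) = 0) \<or> flat_at x ?f2"
    proof (cases "flat_at x f")
      case False
      hence z: "(\<Sum>k. a k * of_real (b k) ^ Suc j) = 0" for j using snoc.prems(3) by blast
      have "(\<Sum>k. ?a k * of_real (b k) ^ j) = of_real (Im (snd v)) * (\<Sum>k. a k * of_real (b k) ^ Suc j)" for j
        by (subst suminf_mult[OF rapid_summable_moment[OF snoc.prems(1)], symmetric]) (simp add: mult_ac)
      thus ?thesis unfolding z by simp
    qed (simp add: flat_at_dir_deriv)
    have "iter_deriv vs (dir_deriv v (discrete_continuation b a f)) x
        = iter_deriv vs (discrete_continuation b a ?f1) x + iter_deriv vs (discrete_continuation b ?a ?f2) x"
      unfolding dir_deriv_discrete_continuation[OF snoc.prems(1,2)]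
      by (rule iter_deriv_add[OF open_UNIV]) (auto intro: smooth_discrete_continuation snoc.prems r t)
    also have "iter_deriv vs (discrete_continuation b ?a ?f2) x = 0" by (rule snoc.IH[OF r t m])
    also have "iter_deriv vs (discrete_continuation b a ?f1) x = 0"
      by (rule snoc.IH[OF snoc.prems(1) t]) (use snoc.prems(3) flat_at_dir_deriv in blast)
    finally show ?case by (simp only: iter_deriv_snoc) simp
  qed
  thus ?thesis by (simp add: flat_at_def)
qed

section \<open>Division by a defining function\<close>

definition shrink :: "real \<Rightarrow> (complex^'n::finite) \<times> complex \<Rightarrow> (complex^'n) \<times> complex" where
  "shrink s y = (fst y, complex_of_real (Re (snd y)) + \<i> * complex_of_real (s * Im (snd y)))"

lemma linear_shrink: "linear (shrink s)"
  by (rule linearI) (auto simp: shrink_def algebra_simps scaleR_conv_of_real)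

lemma shrink_decomp: "shrink s h = (fst h, of_real (Re (snd h))) + (s * Im (snd h)) *\<^sub>R (0, \<i>)"
  by (simp add: shrink_def scaleR_conv_of_real mult_ac)

text \<open>The weight \<open>c\<close> makes the class stable under differentiation, which produces a factor \<open>s\<close> from the
  last variable.\<close>

definition shrink_integral :: "(real \<Rightarrow> real) \<Rightarrow> ((complex^'n::finite) \<times> complex \<Rightarrow> real) \<Rightarrow> (complex^'n) \<times> complex \<Rightarrow> real" where
  "shrink_integral c f y = integral (cbox 0 1) (\<lambda>s. c s * f (shrink s y))"

lemma continuous_on_shrink: "continuous_on UNIV f \<Longrightarrow> continuous_on A (\<lambda>x. f (shrink (snd x) (fst x)))"
  by (rule continuous_on_compose2[of UNIV f]) (auto simp: shrink_def intro!: continuous_intros)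

lemma shrink_integral_has_derivative:
  fixes f :: "(complex^'n::finite) \<times> complex \<Rightarrow> real"
  assumes f: "smooth_on UNIV f" and c: "continuous_on UNIV c"
  shows "(shrink_integral c f has_derivative (\<lambda>h. shrink_integral c (dir_deriv (fst h, of_real (Re (snd h))) f) x
      + Im (snd h) * shrink_integral (\<lambda>s. c s * s) (dir_deriv (0, \<i>) f) x)) (at x)"
proof -
  have d: "f differentiable (at y)" for y using smooth_on_imp_differentiable[OF f] by simp
  have cf: "continuous_on UNIV (dir_deriv v f)" "continuous_on UNIV f" for v
    by (intro smooth_on_imp_continuous_on smooth_on_dir_deriv f)+
  define D where "D t x h = c t * dir_deriv (shrink t h) f (shrink t x)" for t x h
  have D: "D t x h = c t * dir_deriv (fst h, of_real (Re (snd h))) f (shrink t x)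
      + Im (snd h) * ((c t * t) * dir_deriv (0, \<i>) f (shrink t x))" for t x h
  proof -
    interpret linear "\<lambda>v. dir_deriv v f (shrink t x)" by (rule linear_dir_deriv[OF d])
    show ?thesis unfolding D_def shrink_decomp[of _ h] add scale by (simp add: algebra_simps)
  qed
  have lin: "linear (D t x)" for t x
  proof -
    interpret linear "\<lambda>v. dir_deriv v f (shrink t x)" by (rule linear_dir_deriv[OF d])
    show ?thesis unfolding D_def
      by (rule linearI) (simp_all add: linear_add[OF linear_shrink] linear_scale[OF linear_shrink] add scale algebra_simps)
  qed
  define L where "L x t = (\<Sum>b\<in>Basis. D t x b *\<^sub>R blinfun_inner_right b)" for x t
  have L: "blinfun_apply (L x t) h = D t x h" for x t h
  proof -
    have "D t x h = D t x (\<Sum>b\<in>Basis. (h \<bullet> b) *\<^sub>R b)" by (simp add: euclidean_representation)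
    also have "\<dots> = (\<Sum>b\<in>Basis. (h \<bullet> b) * D t x b)" by (simp add: linear_sum[OF lin] linear_scale[OF lin])
    finally show ?thesis by (simp add: L_def blinfun.sum_left blinfun.scaleR_left inner_commute mult.commute)
  qed
  have cD: "continuous_on A (\<lambda>(x, t). D t x h)" for A h
    unfolding D split_beta
    by (intro continuous_intros continuous_on_shrink cf continuous_on_compose2[OF c]) auto
  have cL: "continuous_on A (\<lambda>(x, t). L x t)" for A
    using cD unfolding L_def split_beta by (intro continuous_intros) (simp add: split_beta)
  have cLt: "continuous_on (cbox 0 1) (L x)" for x
    by (rule continuous_on_compose2[OF cL[of UNIV], of _ "\<lambda>t. (x, t)", simplified]) (auto intro!: continuous_intros)
  have cs: "continuous_on A (\<lambda>s. shrink s x)" for A and x :: "(complex^'n) \<times> complex"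
    by (auto simp: shrink_def intro!: continuous_intros)
  have int: "(\<lambda>s. e s * g (shrink s x)) integrable_on cbox 0 1" if "continuous_on UNIV e" "continuous_on UNIV g" for e x and g :: "(complex^'n) \<times> complex \<Rightarrow> real"
    by (intro integrable_continuous continuous_intros continuous_on_compose2[OF that(2) cs] continuous_on_subset[OF that(1)]) auto
  have der: "((\<lambda>x. integral (cbox 0 1) (\<lambda>t. c t * f (shrink t x))) has_derivative integral (cbox 0 1) (L x)) (at x within UNIV)"
  proof (rule leibniz_rule)
    fix x :: "(complex^'n) \<times> complex" and t :: real
    have "((\<lambda>x. f (shrink t x)) has_derivative (\<lambda>h. dir_deriv (shrink t h) f (shrink t x))) (at x)"
      by (rule has_derivative_compose[OF linear_imp_has_derivative[OF linear_shrink] has_derivative_dir_deriv[OF d]])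
    hence "((\<lambda>x. c t * f (shrink t x)) has_derivative D t x) (at x)"
      unfolding D_def[abs_def] by (rule has_derivative_mult_right)
    moreover have "blinfun_apply (L x t) = D t x" using L by blast
    ultimately show "((\<lambda>x. c t * f (shrink t x)) has_derivative blinfun_apply (L x t)) (at x within UNIV)" by simp
  qed (use int[OF c cf(2)] cL in auto)
  have "blinfun_apply (integral (cbox 0 1) (L x)) h = shrink_integral c (dir_deriv (fst h, of_real (Re (snd h))) f) x
      + Im (snd h) * shrink_integral (\<lambda>s. c s * s) (dir_deriv (0, \<i>) f) x" for h
  proof -
    have "blinfun_apply (integral (cbox 0 1) (L x)) h = integral (cbox 0 1) (\<lambda>t. blinfun_apply (L x t) h)"
      by (rule blinfun_apply_integral[OF integrable_continuous[OF cLt]])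
    also have "\<dots> = integral (cbox 0 1) (\<lambda>t. c t * dir_deriv (fst h, of_real (Re (snd h))) f (shrink t x)
        + Im (snd h) * ((c t * t) * dir_deriv (0, \<i>) f (shrink t x)))" by (simp only: L D)
    also have "\<dots> = shrink_integral c (dir_deriv (fst h, of_real (Re (snd h))) f) x
      + Im (snd h) * shrink_integral (\<lambda>s. c s * s) (dir_deriv (0, \<i>) f) x"
    proof -
      have i1: "(\<lambda>t. c t * dir_deriv (fst h, of_real (Re (snd h))) f (shrink t x)) integrable_on cbox 0 1"
        by (rule int[OF c cf(1)])
      have i2: "(\<lambda>t. (c t * t) * dir_deriv (0, \<i>) f (shrink t x)) integrable_on cbox 0 1"
        by (rule int[OF _ cf(1)]) (intro continuous_intros c)
      have i3: "(\<lambda>t. Im (snd h) * ((c t * t) * dir_deriv (0, \<i>) f (shrink t x))) integrable_on cbox 0 1"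
        by (rule integrable_on_mult_right[OF i2])
      show ?thesis unfolding shrink_integral_def by (subst integral_add[OF i1 i3]) simp
    qed
    finally show ?thesis .
  qed
  hence "blinfun_apply (integral (cbox 0 1) (L x)) = (\<lambda>h. shrink_integral c (dir_deriv (fst h, of_real (Re (snd h))) f) x
      + Im (snd h) * shrink_integral (\<lambda>s. c s * s) (dir_deriv (0, \<i>) f) x)" by blast
  moreover have "(\<lambda>x. integral (cbox 0 1) (\<lambda>t. c t * f (shrink t x))) = shrink_integral c f"
    by (simp add: shrink_integral_def fun_eq_iff)
  ultimately show ?thesis using der by (simp only:)
qed

lemma smooth_shrink_integral:
  assumes "smooth_on UNIV f" "continuous_on UNIV c"
  shows "smooth_on UNIV (shrink_integral c f)"
proof -
  have "Ck_on k UNIV (shrink_integral c f)" if "smooth_on UNIV f" "continuous_on UNIV c" for k c f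
    using that
  proof (induction k arbitrary: c f)
    case 0
    have "isCont (shrink_integral c f) x" for x
      by (rule has_derivative_continuous[OF shrink_integral_has_derivative[OF 0]])
    thus ?case by (simp add: continuous_at_imp_continuous_on)
  next
    case (Suc k)
    note h = shrink_integral_has_derivative[OF Suc.prems]
    have "Ck_on k UNIV (dir_deriv v (shrink_integral c f))" for v
    proof -
      have "dir_deriv v (shrink_integral c f) = (\<lambda>x. shrink_integral c (dir_deriv (fst v, of_real (Re (snd v))) f) x
          + Im (snd v) * shrink_integral (\<lambda>s. c s * s) (dir_deriv (0, \<i>) f) x)"
        by (rule ext, rule dir_deriv_eq[OF h])
      thus ?thesis using Suc.prems
        by (auto intro!: Ck_on_add Ck_on_bilinear[OF open_UNIV bounded_bilinear_mult] Ck_on_const Suc.IH smooth_on_dir_deriv continuous_intros)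
    qed
    moreover have "shrink_integral c f differentiable (at x)" for x
      using h unfolding differentiable_def by blast
    ultimately show ?case by (simp add: Ck_on_Suc_dir)
  qed
  thus ?thesis using assms by (subst smooth_on_def) blast
qed

text \<open>The fundamental theorem of calculus on the segment from the real locus to \<open>y\<close>. If \<open>f\<close> vanishes on
  the real locus, this divides it by the imaginary part of the last variable.\<close>

lemma hadamard_division:
  fixes f :: "(complex^'n::finite) \<times> complex \<Rightarrow> real"
  assumes f: "smooth_on UNIV f"
  shows "f y = f (fst y, of_real (Re (snd y))) + Im (snd y) * shrink_integral (\<lambda>s. 1) (dir_deriv (0, \<i>) f) y"
proof -
  have d: "f differentiable (at y)" for y using smooth_on_imp_differentiable[OF f] by simp
  have hv: "((\<lambda>s. f (shrink s y)) has_vector_derivative Im (snd y) * dir_deriv (0, \<i>) f (shrink s y)) (at s within {0..1})" for s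
  proof -
    have "((\<lambda>s. shrink s y) has_derivative (\<lambda>h. (h * Im (snd y)) *\<^sub>R (0, \<i>))) (at s)"
      unfolding shrink_def by (auto intro!: derivative_eq_intros simp: scaleR_conv_of_real mult_ac)
    from has_derivative_compose[OF this has_derivative_dir_deriv[OF d]]
    have "((\<lambda>s. f (shrink s y)) has_derivative (\<lambda>h. dir_deriv ((h * Im (snd y)) *\<^sub>R (0, \<i>)) f (shrink s y))) (at s)" .
    hence "((\<lambda>s. f (shrink s y)) has_derivative (\<lambda>h. h *\<^sub>R (Im (snd y) * dir_deriv (0, \<i>) f (shrink s y)))) (at s)"
      using linear_scale[OF linear_dir_deriv[OF d]] by (simp add: mult.assoc del: scaleR_Pair)
    thus ?thesis by (simp add: has_vector_derivative_def has_derivative_at_withinI)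
  qed
  have "((\<lambda>s. Im (snd y) * dir_deriv (0, \<i>) f (shrink s y)) has_integral (f (shrink 1 y) - f (shrink 0 y))) {0..1}"
    by (rule fundamental_theorem_of_calculus) (use hv in auto)
  hence "integral {0..1} (\<lambda>s. Im (snd y) * dir_deriv (0, \<i>) f (shrink s y)) = f (shrink 1 y) - f (shrink 0 y)"
    by (rule integral_unique)
  moreover have "shrink 1 y = y" "shrink 0 y = (fst y, of_real (Re (snd y)))"
    by (auto simp: shrink_def prod_eq_iff complex_eq_iff)
  ultimately show ?thesis by (simp add: shrink_integral_def)
qed

section \<open>Almost holomorphic extension of CR maps\<close>

lemma smooth_on_herm: "open S \<Longrightarrow> smooth_on S (\<lambda>x::(complex^'n::finite) \<times> complex. herm \<epsilon> v (fst x))"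
  and smooth_on_herm': "open S \<Longrightarrow> smooth_on S (\<lambda>x::(complex^'n) \<times> complex. herm \<epsilon> (fst x) (fst x))"
  unfolding herm_def
  by (intro smooth_on_sum smooth_on_mult smooth_on_const smooth_on_cnj smooth_on_nth smooth_on_fst smooth_on_ident; assumption)+

lemma rho_eq_Re: "rho \<epsilon> x = Im (snd x) - Re (herm \<epsilon> (fst x) (fst x))"
  by (simp add: rho_def herm_self)

lemma smooth_on_rho: "open S \<Longrightarrow> smooth_on S (rho \<epsilon>)"
  unfolding rho_eq_Re[abs_def]
  by (intro smooth_on_diff smooth_on_Im smooth_on_Re smooth_on_snd smooth_on_ident smooth_on_herm')

lemma dir_deriv_rho: "dir_deriv v (rho \<epsilon>) p = Im (snd v) - 2 * Re (herm \<epsilon> (fst v) (fst p))"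
proof -
  have s: "smooth_at p (\<lambda>x. of_real (rho \<epsilon> x) :: complex)"
    by (rule smooth_at_of_real[OF smooth_atI[OF open_UNIV UNIV_I smooth_on_rho[OF open_UNIV]]])
  have "complex_of_real (dir_deriv v (rho \<epsilon>) p) = dir_deriv v (\<lambda>x. of_real (rho \<epsilon> x)) p"
    by (rule dir_deriv_bounded_linear[OF bounded_linear_of_real
        smooth_on_imp_differentiable[OF smooth_on_rho[OF open_UNIV] UNIV_I], symmetric])
  also have "\<dots> = jev (jD v (rho_jet \<epsilon> p)) + jev (jDb v (rho_jet \<epsilon> p))"
    by (simp add: dir_deriv_wirtinger rho_jet_def jD_jet s jev_jet smooth_at_wirtinger)
  also have "\<dots> = of_real (Im (snd v) - 2 * Re (herm \<epsilon> (fst v) (fst p)))"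
    unfolding jev_rho_jet by (simp add: complex_eq_iff algebra_simps)
  finally show ?thesis by (simp only: of_real_eq_iff)
qed

lemma discrete_continuation_add:
  assumes "rapid b a" "test_fun f" "test_fun g"
  shows "discrete_continuation b a (\<lambda>x. f x + g x) x = discrete_continuation b a f x + discrete_continuation b a g x"
  unfolding discrete_continuation_def
  by (simp add: distrib_left suminf_add rapid_summable assms)

lemma discrete_continuation_mult:
  assumes "rapid b a" "test_fun f" "\<And>k. c (squeeze (b k) x) = c x"
  shows "discrete_continuation b a (\<lambda>x. c x * f x) x = c x * discrete_continuation b a f x"
proof -
  have "discrete_continuation b a (\<lambda>x. c x * f x) x = (\<Sum>k. c x * (a k * f (squeeze (b k) x)))"
    by (simp add: discrete_continuation_def assms(3) mult_ac)
  also have "\<dots> = c x * discrete_continuation b a f x"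
    unfolding discrete_continuation_def by (rule suminf_mult[OF rapid_summable[OF assms(1,2)]])
  finally show ?thesis .
qed

text \<open>Coordinates in which the defining function is the imaginary part of the last variable and the
  hyperquadric is flat.\<close>

definition straighten :: "('n::finite \<Rightarrow> real) \<Rightarrow> (complex^'n) \<times> complex \<Rightarrow> (complex^'n) \<times> complex" where
  "straighten \<epsilon> x = (fst x, complex_of_real (Re (snd x)) + \<i> * complex_of_real (rho \<epsilon> x))"

lemma smooth_on_straighten: "open S \<Longrightarrow> smooth_on S (straighten \<epsilon>)"
  unfolding straighten_def
  by (intro smooth_on_Pair smooth_on_add smooth_on_mult smooth_on_const smooth_on_of_real smooth_on_Re
      smooth_on_snd smooth_on_fst smooth_on_ident smooth_on_rho)

lemma dir_deriv_straighten:
  "dir_deriv v (straighten \<epsilon>) x = (fst v, complex_of_real (Re (snd v)) + \<i> * complex_of_real (dir_deriv v (rho \<epsilon>) x))"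
proof (rule dir_deriv_eq)
  have "(rho \<epsilon> has_derivative (\<lambda>v. dir_deriv v (rho \<epsilon>) x)) (at x)"
    by (rule has_derivative_dir_deriv[OF smooth_on_imp_differentiable[OF smooth_on_rho[OF open_UNIV] UNIV_I]])
  note of_real_d = bounded_linear.has_derivative[OF bounded_linear_of_real]
  show "(straighten \<epsilon> has_derivative (\<lambda>v. (fst v, complex_of_real (Re (snd v)) + \<i> * complex_of_real (dir_deriv v (rho \<epsilon>) x)))) (at x)"
    unfolding straighten_def
    by (intro has_derivative_Pair has_derivative_add has_derivative_mult_right of_real_d
        bounded_linear.has_derivative[OF bounded_linear_Re] has_derivative_fst has_derivative_snd has_derivative_ident) fact
qed

text \<open>The real horizontal vector over \<open>v\<close> in the coordinates \<open>(z, u)\<close> of the hyperquadric.\<close>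

definition CR_lift :: "('n::finite \<Rightarrow> real) \<Rightarrow> (complex^'n) \<times> complex \<Rightarrow> complex^'n \<Rightarrow> (complex^'n) \<times> complex" where
  "CR_lift \<epsilon> y v = (v, complex_of_real (- 2 * Im (herm \<epsilon> v (fst y))))"

lemma dir_deriv_real_part:
  assumes "f differentiable (at y)"
  shows "dir_deriv (v, complex_of_real t) f y = dir_deriv (v, 0) f y + t *\<^sub>R dir_deriv (0, 1) f y"
proof -
  have "(v, complex_of_real t) = (v, 0) + t *\<^sub>R (0, 1)" by (simp add: scaleR_conv_of_real)
  thus ?thesis using linear_add[OF linear_dir_deriv[OF assms]] linear_scale[OF linear_dir_deriv[OF assms]] by metis
qed

text \<open>In the straightened coordinates the conjugate derivative of the continuation is a combination of
  two other continuations. One is that of the function obtained from \<open>f\<close> by the tangential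
  Cauchy--Riemann operator, which vanishes near the point. The other is formed with the weights
  \<open>a k (b k - i)\<close>, all of whose moments vanish. Both are flat on the hyperquadric.\<close>

lemma wirtinger_bar_continuation_flat:
  assumes r: "rapid b a" and m: "\<And>j. (\<Sum>k. a k * of_real (b k) ^ j) = \<i> ^ j" and f: "test_fun f"
    and CR: "\<And>y v. y \<in> B \<Longrightarrow> dir_deriv (CR_lift \<epsilon> y (\<i> *s v)) f y = \<i> * dir_deriv (CR_lift \<epsilon> y v) f y"
    and B: "open B" and x: "rho \<epsilon> x = 0" "straighten \<epsilon> x \<in> B"
  shows "flat_at x (wirtinger_bar (\<lambda>x. discrete_continuation b a f (straighten \<epsilon> x)) v)"
proof -
  have df: "f differentiable (at y)" for y using f smooth_on_imp_differentiable by (auto simp: test_fun_def)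
  define fu where "fu = dir_deriv (0, 1) f"
  define fz where "fz z = dir_deriv (z, 0) f" for z
  have t: "test_fun fu" "test_fun (fz z)" for z unfolding fu_def fz_def by (intro test_fun_dir_deriv f)+
  define n where "n k = a k * of_real (b k) + (- \<i>) * a k" for k
  have rn: "rapid b n" unfolding n_def by (intro rapid_add rapid_shift rapid_scale r)
  have mn: "(\<Sum>k. n k * of_real (b k) ^ j) = 0" for j
  proof -
    have s: "summable (\<lambda>k. a k * of_real (b k) ^ j)" for j by (rule rapid_summable_moment[OF r])
    have "(\<Sum>k. n k * of_real (b k) ^ j) = (\<Sum>k. a k * of_real (b k) ^ Suc j + (- \<i>) * (a k * of_real (b k) ^ j))"
      by (simp add: n_def algebra_simps)
    also have "\<dots> = \<i> ^ Suc j + (- \<i>) * \<i> ^ j"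
      using suminf_add[OF s[of "Suc j"] summable_mult[OF s[of j], of "- \<i>"]] suminf_mult[OF s[of j], of "- \<i>"]
      by (simp only: m)
    finally show ?thesis by simp
  qed
  define hv where "hv y = herm \<epsilon> (fst v) (fst y)" for y :: "(complex^'a) \<times> complex"
  define \<psi> where "\<psi> y = (fz (fst v) y + \<i> * fz (\<i> *s fst v) y) + (- 2 * \<i> * cnj (hv y)) * fu y" for y
  have sh: "smooth_on UNIV (\<lambda>y. cnj (hv y))" unfolding hv_def by (intro smooth_on_cnj smooth_on_herm open_UNIV)
  have t2: "test_fun (\<lambda>y. \<i> * fz (\<i> *s fst v) y)" "test_fun (\<lambda>y. (- 2 * \<i> * cnj (hv y)) * fu y)"
    by (intro test_fun_mult smooth_on_const smooth_on_mult sh t open_UNIV)+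
  have t1: "test_fun (\<lambda>y. fz (fst v) y + \<i> * fz (\<i> *s fst v) y)" by (intro test_fun_add t t2)
  have t\<psi>: "test_fun \<psi>" unfolding \<psi>_def by (intro test_fun_add t1 t2)
  define U where "U y = discrete_continuation b a fu y" for y
  define V where "V y = discrete_continuation b (\<lambda>k. a k * of_real (b k)) fu y" for y
  define P where "P z y = discrete_continuation b a (fz z) y" for z y
  define F where "F x = discrete_continuation b a f (straighten \<epsilon> x)" for x
  have D: "dir_deriv w F x = P (fst w) (straighten \<epsilon> x) + of_real (Re (snd w)) * U (straighten \<epsilon> x)
      + of_real (dir_deriv w (rho \<epsilon>) x) * V (straighten \<epsilon> x)" for w x
  proof -
    let ?y = "straighten \<epsilon> x" and ?w = "dir_deriv w (straighten \<epsilon>) x"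
    have ds: "straighten \<epsilon> differentiable (at x)"
      by (rule smooth_on_imp_differentiable[OF smooth_on_straighten[OF open_UNIV] UNIV_I])
    have "dir_deriv w F x = discrete_continuation b a (dir_deriv (fst ?w, of_real (Re (snd ?w))) f) ?y
        + of_real (Im (snd ?w)) * V ?y"
      unfolding F_def V_def fu_def
      using dir_deriv_eq[OF has_derivative_compose[OF has_derivative_dir_deriv[OF ds] discrete_continuation_has_derivative[OF r f]]] .
    also have "dir_deriv (fst ?w, of_real (Re (snd ?w))) f = (\<lambda>y. fz (fst w) y + of_real (Re (snd w)) * fu y)"
      by (simp add: dir_deriv_straighten fun_eq_iff dir_deriv_real_part[OF df] fz_def fu_def scaleR_conv_of_real)
    also have "discrete_continuation b a (\<lambda>y. fz (fst w) y + of_real (Re (snd w)) * fu y) ?y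
        = P (fst w) ?y + of_real (Re (snd w)) * U ?y"
      unfolding P_def U_def
      by (simp add: discrete_continuation_add discrete_continuation_mult[where c = "\<lambda>_. of_real (Re (snd w))"] r t test_fun_mult smooth_on_const)
    finally show ?thesis by (simp add: dir_deriv_straighten)
  qed
  have N: "discrete_continuation b n fu y = V y + (- \<i>) * U y" for y
  proof -
    have s: "summable (\<lambda>k. a k * fu (squeeze (b k) y))" by (rule rapid_summable[OF r t(1)])
    have "discrete_continuation b n fu y = (\<Sum>k. a k * of_real (b k) * fu (squeeze (b k) y) + (- \<i>) * (a k * fu (squeeze (b k) y)))"
      by (simp add: discrete_continuation_def n_def algebra_simps)
    also have "\<dots> = V y + (- \<i>) * U y"
      unfolding V_def U_def discrete_continuation_def
      using suminf_add[OF rapid_summable[OF rapid_shift[OF r] t(1)] summable_mult[OF s, of "- \<i>"]] suminf_mult[OF s, of "- \<i>"]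
      by (simp only:)
    finally show ?thesis .
  qed
  have Psi: "discrete_continuation b a \<psi> y = P (fst v) y + \<i> * P (\<i> *s fst v) y + (- 2 * \<i> * cnj (hv y)) * U y" for y
  proof -
    have "hv (squeeze c y) = hv y" for c by (simp add: hv_def squeeze_def)
    thus ?thesis unfolding \<psi>_def P_def U_def
      by (simp only: discrete_continuation_add[OF r t1 t2(2)] discrete_continuation_add[OF r t(2) t2(1)]
          discrete_continuation_mult[OF r t(2), where c = "\<lambda>_. \<i>"]
          discrete_continuation_mult[OF r t(1), where c = "\<lambda>y. - 2 * \<i> * cnj (hv y)"])
  qed
  define c where "c x = \<i> * cnj (snd v) - 2 * cnj (hv x)" for x
  have hs: "hv (straighten \<epsilon> x) = hv x" for x by (simp add: hv_def straighten_def)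
  have "wirtinger_bar F v x = (1 / 2) * discrete_continuation b a \<psi> (straighten \<epsilon> x)
      + ((1 / 2) * c x) * discrete_continuation b n fu (straighten \<epsilon> x)" for x
  proof -
    have d: "dir_deriv v (rho \<epsilon>) x = Im (snd v) - 2 * Re (hv x)"
      "dir_deriv (cscale \<i> v) (rho \<epsilon>) x = Re (snd v) + 2 * Im (hv x)"
      by (simp_all add: dir_deriv_rho hv_def cscale_def herm_scale)
    show ?thesis unfolding wirtinger_dir_deriv(2) D d N Psi c_def hs
      by (simp add: cscale_def complex_eq_iff field_simps)
  qed
  hence eq: "wirtinger_bar F v = (\<lambda>x. (1 / 2) * discrete_continuation b a \<psi> (straighten \<epsilon> x)
      + ((1 / 2) * c x) * discrete_continuation b n fu (straighten \<epsilon> x))" by blast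
  have im: "Im (snd (straighten \<epsilon> x)) = 0" using x by (simp add: straighten_def)
  have "\<psi> y = 0" if "y \<in> B" for y
  proof -
    have "dir_deriv (CR_lift \<epsilon> y (fst v)) f y + \<i> * dir_deriv (CR_lift \<epsilon> y (\<i> *s fst v)) f y = 0"
      by (simp add: CR[OF that])
    thus ?thesis unfolding CR_lift_def dir_deriv_real_part[OF df] \<psi>_def fz_def fu_def hv_def herm_scale
      by (simp add: complex_eq_iff scaleR_conv_of_real algebra_simps)
  qed
  hence "flat_at (straighten \<epsilon> x) \<psi>" using flat_at_cong[OF B x(2), of \<psi> "\<lambda>_. 0"] flat_at_zero by blast
  hence fl: "flat_at (straighten \<epsilon> x) (discrete_continuation b a \<psi>)" "flat_at (straighten \<epsilon> x) (discrete_continuation b n fu)"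
    using flat_discrete_continuation[OF r t\<psi> im] flat_discrete_continuation[OF rn t(1) im] mn by blast+
  have ss: "smooth_at x (straighten \<epsilon>)" by (rule smooth_atI[OF open_UNIV UNIV_I smooth_on_straighten[OF open_UNIV]])
  have sd: "smooth_at (straighten \<epsilon> x) (discrete_continuation b a \<psi>)" "smooth_at (straighten \<epsilon> x) (discrete_continuation b n fu)"
    by (rule smooth_atI[OF open_UNIV UNIV_I smooth_discrete_continuation]; fact)+
  have sc: "smooth_at x (\<lambda>x. (1 / 2) * c x)" unfolding c_def
    by (intro smooth_at_mult smooth_at_diff smooth_at_const smooth_atI[OF open_UNIV UNIV_I sh])
  note k = smooth_at_compose[OF ss sd(1)] smooth_at_compose[OF ss sd(2)]
    flat_at_compose[OF ss sd(1) fl(1)] flat_at_compose[OF ss sd(2) fl(2)]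
  have "flat_at x (\<lambda>x. discrete_continuation b a \<psi> (straighten \<epsilon> x) * (1 / 2)
      + discrete_continuation b n fu (straighten \<epsilon> x) * ((1 / 2) * c x))"
    by (rule flat_at_lincomb[OF k smooth_at_const sc])
  thus ?thesis using eq unfolding F_def by (simp add: mult.commute)
qed

definition parametrize :: "('n::finite \<Rightarrow> real) \<Rightarrow> (complex^'n) \<times> complex \<Rightarrow> (complex^'n) \<times> complex" where
  "parametrize \<epsilon> y = (fst y, complex_of_real (Re (snd y)) + \<i> * complex_of_real (Re (herm \<epsilon> (fst y) (fst y)) + Im (snd y)))"

lemma smooth_on_parametrize: "open S \<Longrightarrow> smooth_on S (parametrize \<epsilon>)"
  unfolding parametrize_def
  by (intro smooth_on_Pair smooth_on_add smooth_on_mult smooth_on_const smooth_on_of_real smooth_on_Re smooth_on_Im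
      smooth_on_snd smooth_on_fst smooth_on_ident smooth_on_herm')

lemma rho_parametrize: "rho \<epsilon> (parametrize \<epsilon> y) = Im (snd y)"
  by (simp add: rho_eq_Re parametrize_def)

lemma parametrize_straighten: "parametrize \<epsilon> (straighten \<epsilon> x) = x" "straighten \<epsilon> (parametrize \<epsilon> y) = y"
proof -
  show "parametrize \<epsilon> (straighten \<epsilon> x) = x"
    by (simp add: parametrize_def straighten_def rho_eq_Re prod_eq_iff complex_eq_iff)
  show "straighten \<epsilon> (parametrize \<epsilon> y) = y"
    unfolding straighten_def rho_parametrize by (simp add: parametrize_def prod_eq_iff complex_eq_iff)
qed

lemma complex_tangent_iff: "v \<in> complex_tangent \<epsilon> x \<longleftrightarrow> snd v = 2 * \<i> * herm \<epsilon> (fst v) (fst x)"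
proof -
  have r: "w \<in> real_tangent \<epsilon> x \<longleftrightarrow> Im (snd w) - 2 * Re (herm \<epsilon> (fst w) (fst x)) = 0" for w
    unfolding real_tangent_def using dir_deriv_rho[of w \<epsilon> x] by (simp add: dir_deriv_def)
  show ?thesis
    unfolding complex_tangent_def mem_Collect_eq r
    by (auto simp: cscale_def herm_scale complex_eq_iff)
qed

lemma real_tangent_iff: "w \<in> real_tangent \<epsilon> x \<longleftrightarrow> Im (snd w) = 2 * Re (herm \<epsilon> (fst w) (fst x))"
  unfolding real_tangent_def using dir_deriv_rho[of w \<epsilon> x] by (simp add: dir_deriv_def)

text \<open>The map \<open>\<pi>\<close> below is the projection to the hyperquadric along \<open>Im w\<close>. Composing with it
  turns a CR map into a smooth map on an open set to which the discrete continuation applies.\<close>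

theorem almost_holomorphic_extension_exists:
  fixes \<epsilon> :: "'n::finite \<Rightarrow> real" and \<epsilon>' :: "'m::finite \<Rightarrow> real"
  assumes U: "openin (top_of_set (hyperquadric \<epsilon>)) U" and H: "CR_map_on \<epsilon> \<epsilon>' U H" and p: "p \<in> U"
  shows "\<exists>W h Q. almost_holomorphic_extension \<epsilon> \<epsilon>' U H p W h Q"
proof -
  obtain T where T: "open T" "U = hyperquadric \<epsilon> \<inter> T" using U by (auto simp: openin_open)
  have "locally_smooth_on U H" using H by (simp add: CR_map_on_def)
  hence "\<exists>W g. open W \<and> p \<in> W \<and> smooth_on W g \<and> (\<forall>x\<in>U \<inter> W. g x = H x)"
    unfolding locally_smooth_on_def using p by (rule bspec)
  then obtain W0 g where W0: "open W0" "p \<in> W0" "smooth_on W0 g" and W0': "\<forall>x\<in>U \<inter> W0. g x = H x"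
    by (elim exE conjE)
  define \<pi> where "\<pi> y = (fst y, complex_of_real (Re (snd y)) + \<i> * complex_of_real (Re (herm \<epsilon> (fst y) (fst y))))"
    for y :: "(complex^'n) \<times> complex"
  have s\<pi>: "smooth_on UNIV \<pi>" unfolding \<pi>_def
    by (intro smooth_on_Pair smooth_on_add smooth_on_mult smooth_on_const smooth_on_of_real smooth_on_Re
      smooth_on_snd smooth_on_fst smooth_on_ident smooth_on_herm' open_UNIV)
  have \<pi>hyp: "\<pi> y \<in> hyperquadric \<epsilon>" for y by (simp add: hyperquadric_def rho_eq_Re \<pi>_def)
  define S where "S = \<pi> -` (W0 \<inter> T)"
  have S: "open S" unfolding S_def
    using continuous_on_open_vimage[OF open_UNIV, of \<pi>] smooth_on_imp_continuous_on[OF s\<pi>] W0(1) T(1) by auto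
  have inU: "\<pi> y \<in> U \<inter> W0" if "y \<in> S" for y using that \<pi>hyp T by (auto simp: S_def)
  define f where "f y = g (\<pi> y)" for y
  have fH: "f y = H (\<pi> y)" if "y \<in> S" for y unfolding f_def by (rule bspec[OF W0' inU[OF that]])
  have sf: "smooth_on S f" unfolding f_def
    by (rule smooth_on_compose[OF smooth_on_subset[OF s\<pi>] W0(3) S W0(1)]) (auto simp: S_def)
  have CRf: "dir_deriv (CR_lift \<epsilon> y (\<i> *s v)) f y = cscale \<i> (dir_deriv (CR_lift \<epsilon> y v) f y)" if y: "y \<in> S" for y v
  proof -
    obtain D where D: "(H has_derivative D) (at (\<pi> y) within U)"
      "\<And>v. v \<in> complex_tangent \<epsilon> (\<pi> y) \<Longrightarrow> D (cscale \<i> v) = cscale \<i> (D v)"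
      using H inU[OF y] unfolding CR_map_on_def by blast
    define E where "E v = dir_deriv v \<pi> y" for v
    have E: "(\<pi> has_derivative E) (at y within S)" unfolding E_def
      by (rule has_derivative_at_withinI[OF has_derivative_dir_deriv[OF smooth_on_imp_differentiable[OF s\<pi> UNIV_I]]])
    have "(H has_derivative D) (at (\<pi> y) within \<pi> ` S)"
      by (rule has_derivative_subset[OF D(1)]) (use inU in auto)
    from diff_chain_within[OF E this] have "((H \<circ> \<pi>) has_derivative (D \<circ> E)) (at y)"
      by (simp add: at_within_open[OF y S])
    hence "(f has_derivative (D \<circ> E)) (at y)"
      by (rule has_derivative_transform_within_open[OF _ S y]) (simp add: fH)
    hence df: "dir_deriv w f y = D (E w)" for w by (simp add: dir_deriv_eq)
    have Ev: "E w = (fst w, complex_of_real (Re (snd w)) + \<i> * complex_of_real (2 * Re (herm \<epsilon> (fst w) (fst y))))" for w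
    proof -
      have 1: "\<pi> = (\<lambda>y. (fst y, complex_of_real (Re (snd y)) + \<i> * complex_of_real (Im (snd y) - rho \<epsilon> y)))"
        by (auto simp: \<pi>_def rho_eq_Re fun_eq_iff)
      have rd: "(rho \<epsilon> has_derivative (\<lambda>v. dir_deriv v (rho \<epsilon>) y)) (at y)"
        by (rule has_derivative_dir_deriv[OF smooth_on_imp_differentiable[OF smooth_on_rho[OF open_UNIV] UNIV_I]])
      have "(\<pi> has_derivative (\<lambda>w. (fst w, complex_of_real (Re (snd w)) + \<i> * complex_of_real (Im (snd w) - dir_deriv w (rho \<epsilon>) y)))) (at y)"
        unfolding 1
        by (intro has_derivative_Pair has_derivative_add has_derivative_diff has_derivative_mult_right bounded_linear.has_derivative[OF bounded_linear_of_real]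
          bounded_linear.has_derivative[OF bounded_linear_Re] bounded_linear.has_derivative[OF bounded_linear_Im]
          has_derivative_fst has_derivative_snd has_derivative_ident rd)
      from dir_deriv_eq[OF this, of w] show ?thesis by (simp add: E_def dir_deriv_rho)
    qed
    have lift: "E (CR_lift \<epsilon> y w) = (w, 2 * \<i> * herm \<epsilon> w (fst (\<pi> y)))" for w
      unfolding Ev CR_lift_def by (simp add: \<pi>_def prod_eq_iff complex_eq_iff)
    have "E (CR_lift \<epsilon> y v) \<in> complex_tangent \<epsilon> (\<pi> y)" unfolding complex_tangent_iff lift by simp
    moreover have "E (CR_lift \<epsilon> y (\<i> *s v)) = cscale \<i> (E (CR_lift \<epsilon> y v))"
      unfolding lift by (simp add: cscale_def herm_scale)
    ultimately show ?thesis by (simp add: df D(2))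
  qed
  define p0 where "p0 = straighten \<epsilon> p"
  have rp: "rho \<epsilon> p = 0" using p T by (auto simp: hyperquadric_def)
  have "\<pi> p0 = p" using rp by (simp add: \<pi>_def p0_def straighten_def rho_eq_Re prod_eq_iff complex_eq_iff)
  hence p0S: "p0 \<in> S" using W0(2) p T by (simp add: S_def)
  then obtain r0 where r0: "r0 > 0" "cball p0 r0 \<subseteq> S" using S open_contains_cball by blast
  define r where "r = r0 / 2"
  have r: "r > 0" "cball p0 (2 * r) \<subseteq> S" using r0 by (auto simp: r_def)
  have bS: "ball p0 r \<subseteq> S" using r by (auto simp: subset_iff)
  have comp: "smooth_on S (\<lambda>y. fst (f y) $ k)" "smooth_on S (\<lambda>y. snd (f y))" for k
    by (intro smooth_on_nth smooth_on_fst smooth_on_snd sf S)+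
  have "\<exists>F. test_fun F \<and> (\<forall>x\<in>ball p0 r. F x = fst (f x) $ k)" for k
    using test_fun_extension[OF S comp(1) r(2,1)] by metis
  then obtain Fz where Fz: "\<And>k. test_fun (Fz k)" "\<And>k x. x \<in> ball p0 r \<Longrightarrow> Fz k x = fst (f x) $ k" by metis
  obtain Fw where Fw: "test_fun Fw" "\<And>x. x \<in> ball p0 r \<Longrightarrow> Fw x = snd (f x)"
    using test_fun_extension[OF S comp(2) r(2,1)] by metis
  obtain b a where ab: "rapid b a" "\<And>j. (\<Sum>k. a k * of_real (b k) ^ j) = \<i> ^ j" by (rule imaginary_moments) (rule that)
  have df: "f differentiable (at y)" if "y \<in> S" for y using smooth_on_imp_differentiable[OF sf that] .
  have CR: "dir_deriv (CR_lift \<epsilon> y (\<i> *s v)) (Fz k) y = \<i> * dir_deriv (CR_lift \<epsilon> y v) (Fz k) y"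
    "dir_deriv (CR_lift \<epsilon> y (\<i> *s v)) Fw y = \<i> * dir_deriv (CR_lift \<epsilon> y v) Fw y" if y: "y \<in> ball p0 r" for y v k
  proof -
    have yS: "y \<in> S" using y bS by auto
    have 1: "dir_deriv w (Fz k) y = fst (dir_deriv w f y) $ k" "dir_deriv w Fw y = snd (dir_deriv w f y)" for w
      unfolding dir_deriv_components[OF df[OF yS]]
      by (rule dir_deriv_cong_open[OF open_ball y]; simp add: Fz Fw)+
    show "dir_deriv (CR_lift \<epsilon> y (\<i> *s v)) (Fz k) y = \<i> * dir_deriv (CR_lift \<epsilon> y v) (Fz k) y"
      "dir_deriv (CR_lift \<epsilon> y (\<i> *s v)) Fw y = \<i> * dir_deriv (CR_lift \<epsilon> y v) Fw y"
      unfolding 1 CRf[OF yS] by (simp_all add: cscale_def)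
  qed
  define h where "h x = (\<chi> k. discrete_continuation b a (Fz k) (straighten \<epsilon> x), discrete_continuation b a Fw (straighten \<epsilon> x))" for x
  have sh: "smooth_on UNIV h" unfolding h_def
    by (intro smooth_on_Pair smooth_on_vec_lambda open_UNIV
        smooth_on_compose[OF smooth_on_straighten[OF open_UNIV] smooth_discrete_continuation[OF ab(1)]] Fz Fw) auto
  define W where "W = straighten \<epsilon> -` ball p0 r"
  have W: "open W" "p \<in> W" unfolding W_def
    using continuous_on_open_vimage[OF open_UNIV, of "straighten \<epsilon>"] smooth_on_imp_continuous_on[OF smooth_on_straighten[OF open_UNIV]] r(1)
    by (auto simp: p0_def)
  have st\<pi>: "\<pi> (straighten \<epsilon> x) = x" if "rho \<epsilon> x = 0" for x
    using that by (simp add: \<pi>_def straighten_def rho_eq_Re prod_eq_iff complex_eq_iff)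
  have WU: "x \<in> U \<and> h x = H x" if "x \<in> W" "rho \<epsilon> x = 0" for x
  proof -
    let ?y = "straighten \<epsilon> x"
    have y: "?y \<in> ball p0 r" using that by (simp add: W_def)
    hence yS: "?y \<in> S" using bS by auto
    have im: "Im (snd ?y) = 0" using that by (simp add: straighten_def)
    have s: "summable a" using rapid_summable_moment[OF ab(1), of 0] by simp
    have a1: "(\<Sum>k. a k) = 1" using ab(2)[of 0] by simp
    have "discrete_continuation b a F ?y = F ?y" for F
      unfolding discrete_continuation_real[OF im] suminf_mult2[OF s, symmetric] a1 by simp
    hence "h x = f ?y" using Fz(2)[OF y] Fw(2)[OF y] by (simp add: h_def prod_eq_iff vec_eq_iff)
    also have "\<dots> = H x" unfolding fH[OF yS] st\<pi>[OF that(2)] ..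
    finally show ?thesis using inU[OF yS] st\<pi>[OF that(2)] by simp
  qed
  \<comment> \<open>In straightened coordinates the pulled back defining function vanishes for \<open>Im = 0\<close> and can be divided by \<open>Im\<close>.\<close>
  define R where "R y = rho \<epsilon>' (h (parametrize \<epsilon> y))" for y
  have sR: "smooth_on UNIV R" unfolding R_def
    by (rule smooth_on_compose[OF smooth_on_compose[OF smooth_on_parametrize[OF open_UNIV] sh] smooth_on_rho[OF open_UNIV]]) auto
  define Q where "Q x = shrink_integral (\<lambda>s. 1) (dir_deriv (0, \<i>) R) (straighten \<epsilon> x)" for x
  have sQ: "smooth_on UNIV Q" unfolding Q_def
    by (rule smooth_on_compose[OF smooth_on_straighten[OF open_UNIV] smooth_shrink_integral[OF smooth_on_dir_deriv[OF sR]]]) auto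
  have "rho \<epsilon>' (h x) = Q x * rho \<epsilon> x" if x: "x \<in> W" for x
  proof -
    let ?y = "straighten \<epsilon> x"
    define y0 where "y0 = (fst ?y, complex_of_real (Re (snd ?y)))"
    have "dist p0 y0 \<le> dist p0 ?y"
    proof -
      have ip: "Im (snd p0) = 0" using rp by (simp add: p0_def straighten_def)
      have "dist (snd p0) (snd y0) = \<bar>Re (snd p0) - Re (snd ?y)\<bar>"
        by (simp add: dist_norm y0_def cmod_def ip)
      also have "\<dots> \<le> dist (snd p0) (snd ?y)" using abs_Re_le_cmod[of "snd p0 - snd ?y"] by (simp add: dist_norm)
      finally show ?thesis by (auto simp: dist_prod_def y0_def intro!: real_sqrt_le_mono add_mono power_mono)
    qed
    hence "y0 \<in> ball p0 r" using x by (simp add: W_def)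
    hence "parametrize \<epsilon> y0 \<in> W" by (simp add: W_def parametrize_straighten)
    moreover have r0: "rho \<epsilon> (parametrize \<epsilon> y0) = 0" by (simp add: rho_parametrize y0_def)
    ultimately have "h (parametrize \<epsilon> y0) = H (parametrize \<epsilon> y0)" "parametrize \<epsilon> y0 \<in> U" using WU by blast+
    hence "R y0 = 0" using H unfolding R_def CR_map_on_def hyperquadric_def by auto
    moreover have "R ?y = R y0 + Im (snd ?y) * Q x"
      unfolding Q_def y0_def by (rule hadamard_division[OF sR])
    moreover have "R ?y = rho \<epsilon>' (h x)" by (simp add: R_def parametrize_straighten)
    moreover have "Im (snd ?y) = rho \<epsilon> x" by (simp add: straighten_def)
    ultimately show ?thesis by simp
  qed
  moreover have "vanishes_to_infinite_order_on (U \<inter> W) (wirtinger_bar (\<lambda>x. fst (h x) $ k) v)" for k v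
    unfolding vanishes_to_infinite_order_iff h_def
    by (auto intro!: wirtinger_bar_continuation_flat[OF ab Fz(1) CR(1) open_ball] simp: W_def T hyperquadric_def)
  moreover have "vanishes_to_infinite_order_on (U \<inter> W) (wirtinger_bar (\<lambda>x. snd (h x)) v)" for v
    unfolding vanishes_to_infinite_order_iff h_def
    by (auto intro!: wirtinger_bar_continuation_flat[OF ab Fw(1) CR(2) open_ball] simp: W_def T hyperquadric_def)
  moreover have "\<forall>x\<in>U \<inter> W. h x = H x" using WU T by (auto simp: hyperquadric_def)
  ultimately have "almost_holomorphic_extension \<epsilon> \<epsilon>' U H p W h Q"
    unfolding almost_holomorphic_extension_def using W smooth_on_subset[OF sh] smooth_on_subset[OF sQ] by blast
  thus ?thesis by blast
qed

section \<open>Automorphisms of hyperquadrics\<close>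

text \<open>Holomorphic maps on open sets that multiply the defining functions; all explicit automorphisms
  used below are of this kind.\<close>

definition transfer_map ::
  "('n::finite \<Rightarrow> real) \<Rightarrow> ('m::finite \<Rightarrow> real) \<Rightarrow> ((complex^'n) \<times> complex) set
    \<Rightarrow> ((complex^'n) \<times> complex \<Rightarrow> (complex^'m) \<times> complex) \<Rightarrow> ((complex^'n) \<times> complex \<Rightarrow> real) \<Rightarrow> bool" where
  "transfer_map \<epsilon> \<epsilon>' A f c \<longleftrightarrow> open A \<and> smooth_on A f \<and> smooth_on A c \<and>
     (\<forall>x\<in>A. \<forall>v. dir_deriv (cscale \<i> v) f x = cscale \<i> (dir_deriv v f x)) \<and>
     (\<forall>x\<in>A. rho \<epsilon>' (f x) = c x * rho \<epsilon> x)"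

lemma transfer_mapD:
  assumes "transfer_map \<epsilon> \<epsilon>' A f c"
  shows "open A" "smooth_on A f" "smooth_on A c" "x \<in> A \<Longrightarrow> f differentiable (at x)"
    "x \<in> A \<Longrightarrow> dir_deriv (cscale \<i> v) f x = cscale \<i> (dir_deriv v f x)"
    "x \<in> A \<Longrightarrow> rho \<epsilon>' (f x) = c x * rho \<epsilon> x"
proof -
  show "open A" "smooth_on A f" "smooth_on A c" using assms unfolding transfer_map_def by simp_all
  thus "x \<in> A \<Longrightarrow> f differentiable (at x)" using smooth_on_imp_differentiable by blast
  show "x \<in> A \<Longrightarrow> dir_deriv (cscale \<i> v) f x = cscale \<i> (dir_deriv v f x)"
    using assms unfolding transfer_map_def by blast
  show "x \<in> A \<Longrightarrow> rho \<epsilon>' (f x) = c x * rho \<epsilon> x" using assms unfolding transfer_map_def by blast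
qed

lemma transfer_map_ah_map:
  assumes f: "transfer_map \<epsilon> \<epsilon>' A f c" and p: "p \<in> A" "rho \<epsilon> p = 0"
  shows "ah_map \<epsilon> \<epsilon>' p f c"
proof -
  note t = transfer_mapD[OF f]
  have "wirtinger_bar (\<lambda>x. fst (f x) $ k) v x = 0 \<and> wirtinger_bar (\<lambda>x. snd (f x)) v x = 0" if "x \<in> A" for k v x
    unfolding wirtinger_dir_deriv dir_deriv_components[OF t(4)[OF that], symmetric] t(5)[OF that]
    by (simp add: cscale_def flip: mult.assoc)
  hence fl: "flat_at p (wirtinger_bar (\<lambda>x. fst (f x) $ k) v)" "flat_at p (wirtinger_bar (\<lambda>x. snd (f x)) v)" for k v
    by (subst flat_at_cong[OF t(1) p(1), of _ "\<lambda>x. 0"]; simp add: flat_at_zero)+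
  show ?thesis unfolding ah_map_def almost_holomorphic_at_def
  proof (intro conjI allI fl)
    show "smooth_at p f" "smooth_at p c" by (rule smooth_atI[OF t(1) p(1)]; fact)+
    show "\<exists>W. open W \<and> p \<in> W \<and> (\<forall>x\<in>W. rho \<epsilon>' (f x) = c x * rho \<epsilon> x)" using t(1,6) p(1) by blast
  qed (rule p(2))
qed

text \<open>Differentiating \<open>rho' \<circ> f = c rho\<close> where \<open>rho\<close> vanishes.\<close>

lemma transfer_map_tangent:
  assumes f: "transfer_map \<epsilon> \<epsilon>' A f c" and x: "x \<in> A" "rho \<epsilon> x = 0" and v: "v \<in> real_tangent \<epsilon> x"
  shows "dir_deriv v f x \<in> real_tangent \<epsilon>' (f x)"
proof -
  note t = transfer_mapD[OF f]
  have d: "rho e differentiable (at y)" for e :: "'k::finite \<Rightarrow> real" and y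
    by (rule smooth_on_imp_differentiable[OF smooth_on_rho[OF open_UNIV] UNIV_I])
  have cd: "c differentiable (at x)" by (rule smooth_on_imp_differentiable[OF t(3) x(1)])
  have "((\<lambda>y. rho \<epsilon>' (f y)) has_derivative (\<lambda>v. dir_deriv (dir_deriv v f x) (rho \<epsilon>') (f x))) (at x)"
    using diff_chain_at[OF has_derivative_dir_deriv[OF t(4)[OF x(1)]] has_derivative_dir_deriv[OF d]]
    by (simp add: o_def)
  hence "dir_deriv (dir_deriv v f x) (rho \<epsilon>') (f x) = dir_deriv v (\<lambda>y. rho \<epsilon>' (f y)) x" by (simp add: dir_deriv_eq)
  also have "\<dots> = dir_deriv v (\<lambda>y. c y * rho \<epsilon> y) x"
    by (rule dir_deriv_cong_open[OF t(1) x(1)]) (rule t(6))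
  also have "\<dots> = 0" unfolding dir_deriv_bilinear[OF bounded_bilinear_mult cd d]
    using x(2) v by (simp add: real_tangent_def dir_deriv_def)
  finally show ?thesis by (simp add: real_tangent_def dir_deriv_def)
qed

lemma transfer_map_CR:
  assumes f: "transfer_map \<epsilon> \<epsilon>' A f c" and V: "V \<subseteq> A \<inter> hyperquadric \<epsilon>" and fg: "\<And>x. x \<in> V \<Longrightarrow> f x = g x"
  shows "CR_map_on \<epsilon> \<epsilon>' V g"
proof -
  note t = transfer_mapD[OF f]
  have V': "x \<in> A" "rho \<epsilon> x = 0" if "x \<in> V" for x using V that by (auto simp: hyperquadric_def)
  have "locally_smooth_on V g" unfolding locally_smooth_on_def using t(1,2) V' fg by blast
  moreover have "g ` V \<subseteq> hyperquadric \<epsilon>'" using t(6)[OF V'(1)] V'(2) fg by (auto simp: hyperquadric_def)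
  moreover have "\<exists>D. (g has_derivative D) (at x within V) \<and> (\<forall>v\<in>complex_tangent \<epsilon> x.
      D v \<in> complex_tangent \<epsilon>' (g x) \<and> D (cscale \<i> v) = cscale \<i> (D v))" if x: "x \<in> V" for x
  proof (intro exI conjI ballI)
    show "(g has_derivative (\<lambda>v. dir_deriv v f x)) (at x within V)"
      using has_derivative_transform[OF x, of g f] fg
        has_derivative_at_withinI[OF has_derivative_dir_deriv[OF t(4)[OF V'(1)[OF x]]]] by force
    fix v assume v: "v \<in> complex_tangent \<epsilon> x"
    show "dir_deriv v f x \<in> complex_tangent \<epsilon>' (g x)"
      using v transfer_map_tangent[OF f V'[OF x]] unfolding complex_tangent_def fg[OF x, symmetric] mem_Collect_eq
        t(5)[OF V'(1)[OF x], symmetric] by simp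
    show "dir_deriv (cscale \<i> v) f x = cscale \<i> (dir_deriv v f x)" by (rule t(5)[OF V'(1)[OF x]])
  qed
  ultimately show ?thesis unfolding CR_map_on_def by blast
qed

lemma transfer_map_compose:
  assumes f: "transfer_map \<epsilon> \<epsilon>' A f c" and g: "transfer_map \<epsilon>' \<epsilon>'' B g d"
  shows "transfer_map \<epsilon> \<epsilon>'' (A \<inter> f -` B) (\<lambda>x. g (f x)) (\<lambda>x. d (f x) * c x)"
proof -
  note t = transfer_mapD[OF f] and u = transfer_mapD[OF g]
  have op: "open (A \<inter> f -` B)"
    using continuous_on_open_vimage[OF t(1), of f] smooth_on_imp_continuous_on[OF t(2)] u(1) by (auto simp: Int_commute)
  have sf: "smooth_on (A \<inter> f -` B) f" by (rule smooth_on_subset[OF t(2)]) auto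
  have im: "f ` (A \<inter> f -` B) \<subseteq> B" by auto
  have chain: "dir_deriv v (\<lambda>x. g (f x)) x = dir_deriv (dir_deriv v f x) g (f x)" if "x \<in> A" "f x \<in> B" for v x
    using diff_chain_at[OF has_derivative_dir_deriv[OF t(4)[OF that(1)]] has_derivative_dir_deriv[OF u(4)[OF that(2)]]]
    by (simp add: o_def dir_deriv_eq)
  show ?thesis unfolding transfer_map_def
  proof (intro conjI ballI allI)
    show "smooth_on (A \<inter> f -` B) (\<lambda>x. g (f x))" by (rule smooth_on_compose[OF sf u(2) op u(1) im])
    show "smooth_on (A \<inter> f -` B) (\<lambda>x. d (f x) * c x)"
      by (intro smooth_on_mult[OF op smooth_on_compose[OF sf u(3) op u(1) im]] smooth_on_subset[OF t(3)]) auto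
  qed (auto simp: op chain t(5,6) u(5,6))
qed

definition transfer_pair ::
  "('n::finite \<Rightarrow> real) \<Rightarrow> ((complex^'n) \<times> complex) set \<Rightarrow> ((complex^'n) \<times> complex) set
    \<Rightarrow> ((complex^'n) \<times> complex \<Rightarrow> (complex^'n) \<times> complex) \<Rightarrow> ((complex^'n) \<times> complex \<Rightarrow> (complex^'n) \<times> complex) \<Rightarrow> bool" where
  "transfer_pair \<epsilon> A B f g \<longleftrightarrow> (\<exists>c. transfer_map \<epsilon> \<epsilon> A f c) \<and> (\<exists>d. transfer_map \<epsilon> \<epsilon> B g d) \<and>
     f ` A \<subseteq> B \<and> g ` B \<subseteq> A \<and> (\<forall>x\<in>A. g (f x) = x) \<and> (\<forall>y\<in>B. f (g y) = y)"

lemma transfer_pair_sym: "transfer_pair \<epsilon> A B f g \<Longrightarrow> transfer_pair \<epsilon> B A g f"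
  by (auto simp: transfer_pair_def)

lemma transfer_pair_compose:
  assumes f: "transfer_pair \<epsilon> A B f f'" and g: "transfer_pair \<epsilon> C D g g'"
  shows "transfer_pair \<epsilon> (A \<inter> f -` C) (D \<inter> g' -` B) (\<lambda>x. g (f x)) (\<lambda>y. f' (g' y))"
proof -
  have ex: "(\<exists>c. transfer_map \<epsilon> \<epsilon> A f c) \<and> (\<exists>d. transfer_map \<epsilon> \<epsilon> B f' d)"
    "(\<exists>c. transfer_map \<epsilon> \<epsilon> C g c) \<and> (\<exists>d. transfer_map \<epsilon> \<epsilon> D g' d)"
    using f g unfolding transfer_pair_def by simp_all
  have "\<exists>c. transfer_map \<epsilon> \<epsilon> (A \<inter> f -` C) (\<lambda>x. g (f x)) c"
    using ex by (elim exE conjE) (rule exI, rule transfer_map_compose; assumption)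
  moreover have "\<exists>d. transfer_map \<epsilon> \<epsilon> (D \<inter> g' -` B) (\<lambda>y. f' (g' y)) d"
    using ex by (elim exE conjE) (rule exI, rule transfer_map_compose; assumption)
  ultimately show ?thesis using f g unfolding transfer_pair_def by (simp add: image_subset_iff)
qed

lemma transfer_pair_automorphism:
  assumes P: "transfer_pair \<epsilon> A B f g"
  shows "local_CR_automorphism \<epsilon> (A \<inter> hyperquadric \<epsilon>) f"
    "\<And>y. y \<in> B \<Longrightarrow> rho \<epsilon> y = 0 \<Longrightarrow> inv_into (A \<inter> hyperquadric \<epsilon>) f y = g y"
proof -
  let ?V = "A \<inter> hyperquadric \<epsilon>"
  obtain c d where c: "transfer_map \<epsilon> \<epsilon> A f c" and d: "transfer_map \<epsilon> \<epsilon> B g d" using P by (auto simp: transfer_pair_def)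
  have fg: "x \<in> A \<Longrightarrow> f x \<in> B \<and> g (f x) = x" "x \<in> B \<Longrightarrow> g x \<in> A \<and> f (g x) = x" for x
    using P by (auto simp: transfer_pair_def)
  have inj: "inj_on f ?V" by (rule inj_on_inverseI[of _ g]) (simp add: fg)
  have im: "f ` ?V = B \<inter> hyperquadric \<epsilon>"
  proof (intro equalityI subsetI)
    fix y assume "y \<in> f ` ?V"
    thus "y \<in> B \<inter> hyperquadric \<epsilon>" using fg transfer_mapD(6)[OF c] by (auto simp: hyperquadric_def)
  next
    fix y assume y: "y \<in> B \<inter> hyperquadric \<epsilon>"
    hence "g y \<in> ?V" using fg transfer_mapD(6)[OF d] by (auto simp: hyperquadric_def)
    thus "y \<in> f ` ?V" using fg(2)[of y] y by force
  qed
  show inv: "inv_into ?V f y = g y" if "y \<in> B" "rho \<epsilon> y = 0" for y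
  proof (rule inv_into_f_eq[OF inj])
    show "g y \<in> ?V" using that fg transfer_mapD(6)[OF d] by (auto simp: hyperquadric_def)
  qed (use that fg in auto)
  have "openin (top_of_set (hyperquadric \<epsilon>)) (S \<inter> hyperquadric \<epsilon>)" if "open S" for S
    using that by (simp add: openin_open Int_commute) blast
  thus "local_CR_automorphism \<epsilon> ?V f" unfolding local_CR_automorphism_def im
    using inj transfer_map_CR[OF c, of ?V f] transfer_map_CR[OF d, of "B \<inter> hyperquadric \<epsilon>" "inv_into ?V f"] inv
      transfer_mapD(1)[OF c] transfer_mapD(1)[OF d] by (auto simp: hyperquadric_def)
qed

subsection \<open>Three families of automorphisms\<close>

lemma transfer_map_affine:
  assumes L: "bounded_linear L" "\<And>v. L (cscale \<i> v) = cscale \<i> (L v)"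
    and rho: "\<And>x. rho \<epsilon>' (L x + b) = c * rho \<epsilon> x"
  shows "transfer_map \<epsilon> \<epsilon>' UNIV (\<lambda>x. L x + b) (\<lambda>x. c)"
proof -
  have "((\<lambda>x. L x + b) has_derivative L) (at x)" for x
    using has_derivative_add[OF bounded_linear_imp_has_derivative[OF L(1)] has_derivative_const] by simp
  hence "dir_deriv v (\<lambda>x. L x + b) x = L v" for v x by (rule dir_deriv_eq)
  thus ?thesis unfolding transfer_map_def using L(2) rho
    by (auto intro!: smooth_on_const smooth_on_add smooth_on_bounded_linear[OF L(1)] smooth_on_ident)
qed

text \<open>Translations of the Heisenberg group, which is simply transitive on the hyperquadric.\<close>

definition translate :: "('n::finite \<Rightarrow> real) \<Rightarrow> (complex^'n) \<times> complex \<Rightarrow> (complex^'n) \<times> complex \<Rightarrow> (complex^'n) \<times> complex" where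
  "translate \<epsilon> p x = (fst x, snd x + 2 * \<i> * herm \<epsilon> (fst x) (fst p)) + p"

lemma linearI_complex:
  fixes L :: "(complex^'n::finite) \<times> complex \<Rightarrow> (complex^'m::finite) \<times> complex"
  assumes "\<And>u v. L (u + v) = L u + L v" "\<And>c v. L (cscale c v) = cscale c (L v)"
  shows "bounded_linear L"
proof -
  have s: "r *\<^sub>R x = cscale (of_real r) x" for r and x :: "(complex^'k::finite) \<times> complex"
    by (simp add: cscale_def prod_eq_iff vec_eq_iff) (simp add: scaleR_conv_of_real)
  have "linear L" by (rule linearI) (simp_all add: assms s)
  thus ?thesis by (simp add: linear_conv_bounded_linear)
qed

lemma transfer_map_translate:
  assumes "rho \<epsilon> p = 0" shows "transfer_map \<epsilon> \<epsilon> UNIV (translate \<epsilon> p) (\<lambda>x. 1)"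
  unfolding translate_def
proof (rule transfer_map_affine)
  let ?L = "\<lambda>x. (fst x, snd x + 2 * \<i> * herm \<epsilon> (fst x) (fst p))"
  show "bounded_linear ?L" by (rule linearI_complex) (simp_all add: cscale_def herm_add herm_scale algebra_simps)
  show "?L (cscale \<i> v) = cscale \<i> (?L v)" for v by (simp add: cscale_def herm_scale algebra_simps)
  fix x
  have "complex_of_real (rho \<epsilon> (?L x + p)) = of_real (rho \<epsilon> x) + of_real (rho \<epsilon> p)"
    unfolding rho_herm by (simp add: herm_add cnj_herm field_simps)
  thus "rho \<epsilon> (?L x + p) = 1 * rho \<epsilon> x" unfolding assms by simp
qed

lemma transfer_pair_translate:
  assumes p: "rho \<epsilon> p = 0"
  obtains p' where "rho \<epsilon> p' = 0" "transfer_pair \<epsilon> UNIV UNIV (translate \<epsilon> p) (translate \<epsilon> p')"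
proof -
  define p' where "p' = (- fst p, - snd p + 2 * \<i> * herm \<epsilon> (fst p) (fst p))"
  have "complex_of_real (rho \<epsilon> p') = - of_real (rho \<epsilon> p)"
    unfolding rho_herm p'_def by (simp add: herm_minus cnj_herm field_simps)
  hence p': "rho \<epsilon> p' = 0" using p by simp
  from transfer_map_translate[OF this] transfer_map_translate[OF p]
  have "transfer_pair \<epsilon> UNIV UNIV (translate \<epsilon> p) (translate \<epsilon> p')" unfolding transfer_pair_def
    by (simp add: translate_def p'_def herm_add herm_diff herm_minus prod_eq_iff algebra_simps; blast)
  thus ?thesis by (rule that[OF p'])
qed

definition isometry :: "('n::finite \<Rightarrow> real) \<Rightarrow> (complex^'n \<Rightarrow> complex^'n) \<Rightarrow> bool" where
  "isometry \<epsilon> T \<longleftrightarrow> (\<forall>u v. T (u + v) = T u + T v) \<and> (\<forall>c v. T (c *s v) = c *s T v) \<and>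
     (\<forall>u v. herm \<epsilon> (T u) (T v) = herm \<epsilon> u v)"

lemma isometryD:
  assumes "isometry \<epsilon> T"
  shows "T (u + v) = T u + T v" "T (c *s v) = c *s T v" "herm \<epsilon> (T u) (T v) = herm \<epsilon> u v" "T 0 = 0"
    "T (u - v) = T u - T v"
proof -
  show "T (u + v) = T u + T v" "T (c *s v) = c *s T v" "herm \<epsilon> (T u) (T v) = herm \<epsilon> u v" for u v c
    using assms by (auto simp: isometry_def)
  note * = this
  show "T 0 = 0" using *(2)[of 0 0] by simp
  show "T (u - v) = T u - T v" using *(1)[of "u - v" v] by simp
qed

lemma isometry_compose: "isometry \<epsilon> S \<Longrightarrow> isometry \<epsilon> T \<Longrightarrow> isometry \<epsilon> (\<lambda>x. S (T x))"
  by (simp add: isometry_def)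

lemma isometry_inverse:
  assumes T: "isometry \<epsilon> T" and eps: "\<And>k. \<epsilon> k \<noteq> 0"
  obtains T' where "isometry \<epsilon> T'" "\<And>x. T' (T x) = x" "\<And>x. T (T' x) = x"
proof -
  note t = isometryD[OF T]
  have lin: "linear T" by (rule linearI)
    (use t(1) t(2)[of "of_real r" for r] in \<open>auto simp: scaleR_vec_def vector_scalar_mult_def scaleR_conv_of_real\<close>)
  have "inj T"
  proof (rule linear_injective_0[OF lin, THEN iffD2], intro allI impI)
    fix v assume "T v = 0"
    hence "herm \<epsilon> v w = 0" for w using t(3)[of v w] by (simp add: herm_zero)
    thus "v = 0" by (rule herm_nondegenerate[OF eps])
  qed
  moreover from this have "surj T" by (rule linear_inj_imp_surj[OF lin])
  ultimately have i: "inv T (T x) = x" "T (inv T x) = x" for x by (simp_all add: surj_f_inv_f)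
  have "isometry \<epsilon> (inv T)" unfolding isometry_def
  proof (intro conjI allI)
    fix u v c
    show "inv T (u + v) = inv T u + inv T v" using i(1)[of "inv T u + inv T v"] by (simp add: t i(2))
    show "inv T (c *s v) = c *s inv T v" using i(1)[of "c *s inv T v"] by (simp add: t i(2))
    show "herm \<epsilon> (inv T u) (inv T v) = herm \<epsilon> u v" using t(3)[of "inv T u" "inv T v"] by (simp add: i(2))
  qed
  thus ?thesis using that i by blast
qed

definition dilate :: "(complex^'n \<Rightarrow> complex^'n) \<Rightarrow> real \<Rightarrow> (complex^'n) \<times> complex \<Rightarrow> (complex^'n) \<times> complex" where
  "dilate T s x = (of_real s *s T (fst x), of_real (s * s) * snd x)"

lemma bounded_linear_dilate: "isometry \<epsilon> T \<Longrightarrow> bounded_linear (dilate T s)"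
  by (rule linearI_complex) (simp_all add: dilate_def isometryD cscale_def vec_eq_iff algebra_simps)

lemma transfer_map_dilate:
  assumes "isometry \<epsilon> T" shows "transfer_map \<epsilon> \<epsilon> UNIV (dilate T s) (\<lambda>x. s * s)"
proof -
  note t = isometryD[OF assms]
  have "transfer_map \<epsilon> \<epsilon> UNIV (\<lambda>x. dilate T s x + 0) (\<lambda>x. s * s)"
  proof (rule transfer_map_affine)
    show "bounded_linear (dilate T s)" by (rule bounded_linear_dilate[OF assms])
    show "dilate T s (cscale \<i> v) = cscale \<i> (dilate T s v)" for v by (simp add: dilate_def t cscale_def vec_eq_iff)
    fix x
    have "complex_of_real (rho \<epsilon> (dilate T s x + 0)) = of_real (s * s * rho \<epsilon> x)"
      unfolding of_real_mult rho_herm by (simp add: dilate_def herm_scale t algebra_simps)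
    thus "rho \<epsilon> (dilate T s x + 0) = s * s * rho \<epsilon> x" by (simp only: of_real_eq_iff)
  qed
  thus ?thesis by simp
qed

lemma transfer_pair_dilate:
  assumes T: "isometry \<epsilon> T" and eps: "\<And>k. \<epsilon> k \<noteq> 0" and s: "s \<noteq> 0"
  shows "\<exists>g. transfer_pair \<epsilon> UNIV UNIV (dilate T s) g"
proof -
  obtain T' where T': "isometry \<epsilon> T'" "\<And>x. T' (T x) = x" "\<And>x. T (T' x) = x" by (rule isometry_inverse[OF T eps]) (rule that)
  have "transfer_pair \<epsilon> UNIV UNIV (dilate T s) (dilate T' (inverse s))"
    unfolding transfer_pair_def using transfer_map_dilate[OF T] transfer_map_dilate[OF T'(1)] s
    by (auto simp: dilate_def isometryD[OF T] isometryD[OF T'(1)] T' prod_eq_iff vec_eq_iff field_simps)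
  thus ?thesis by blast
qed

text \<open>Automorphisms that fix the origin and induce the identity on the complex tangent space there. The
  vector \<open>a\<close> shifts the image of the transverse direction, and \<open>r\<close> changes the second derivative in
  this direction.\<close>

definition proj_denom :: "('n::finite \<Rightarrow> real) \<Rightarrow> complex^'n \<Rightarrow> real \<Rightarrow> (complex^'n) \<times> complex \<Rightarrow> complex" where
  "proj_denom \<epsilon> a r x = 1 - (2 * \<i> * herm \<epsilon> (fst x) a + (of_real r + \<i> * herm \<epsilon> a a) * snd x)"

definition proj_map :: "('n::finite \<Rightarrow> real) \<Rightarrow> complex^'n \<Rightarrow> real \<Rightarrow> (complex^'n) \<times> complex \<Rightarrow> (complex^'n) \<times> complex" where
  "proj_map \<epsilon> a r x = cscale (inverse (proj_denom \<epsilon> a r x)) (fst x + snd x *s a, snd x)"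

lemma bounded_bilinear_cscale: "bounded_bilinear (cscale :: complex \<Rightarrow> (complex^'n::finite) \<times> complex \<Rightarrow> _)"
proof -
  have "bounded_linear (\<lambda>c. cscale c x)" for x :: "(complex^'n) \<times> complex"
  proof -
    have "linear (\<lambda>c. cscale c x)"
      by (rule linearI) (simp_all add: cscale_def vec_eq_iff algebra_simps)
    thus ?thesis by (simp add: linear_conv_bounded_linear)
  qed
  moreover have "bounded_linear (cscale c :: (complex^'n) \<times> complex \<Rightarrow> _)" for c
    using linear_cscale linear_conv_bounded_linear by blast
  ultimately have "bilinear (cscale :: complex \<Rightarrow> (complex^'n) \<times> complex \<Rightarrow> _)"
    by (simp add: bilinear_def linear_conv_bounded_linear)
  thus ?thesis by (simp add: bilinear_conv_bounded_bilinear)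
qed

lemma transfer_map_proj_map:
  "transfer_map \<epsilon> \<epsilon> {x. proj_denom \<epsilon> a r x \<noteq> 0} (proj_map \<epsilon> a r)
     (\<lambda>x. Re (inverse (proj_denom \<epsilon> a r x) * cnj (inverse (proj_denom \<epsilon> a r x))))"
proof -
  let ?A = "{x. proj_denom \<epsilon> a r x \<noteq> 0}"
  define \<delta> where "\<delta> x = 2 * \<i> * herm \<epsilon> (fst x) a + (of_real r + \<i> * herm \<epsilon> a a) * snd x" for x
  define N where "N x = (fst x + snd x *s a, snd x)" for x
  have N: "bounded_linear N" "N (cscale \<i> v) = cscale \<i> (N v)" for v
    by (rule linearI_complex) (simp_all add: N_def cscale_def vec_eq_iff algebra_simps)
  have "bounded_linear (\<lambda>x. (\<chi> k. \<delta> x, 0) :: (complex^'n) \<times> complex)"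
    by (rule linearI_complex) (simp_all add: \<delta>_def cscale_def herm_add herm_scale vec_eq_iff algebra_simps)
  hence "bounded_linear (\<lambda>x. fst ((\<chi> k. \<delta> x, 0) :: (complex^'n) \<times> complex) $ undefined)"
    by (intro bounded_linear_compose[OF bounded_linear_vec_nth bounded_linear_compose[OF bounded_linear_fst]])
  hence \<delta>: "bounded_linear \<delta>" by simp
  have \<delta>i: "\<delta> (cscale \<i> v) = \<i> * \<delta> v" for v by (simp add: \<delta>_def cscale_def herm_scale algebra_simps)
  have d: "proj_denom \<epsilon> a r x = 1 - \<delta> x" for x by (simp add: proj_denom_def \<delta>_def)
  have "continuous_on UNIV (\<lambda>x. 1 - \<delta> x)" by (intro continuous_intros linear_continuous_on \<delta>)
  hence op: "open ?A" unfolding d using open_Collect_neq[of "\<lambda>x. 1 - \<delta> x" "\<lambda>x. 0"] by (simp add: continuous_on_const)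
  have si: "smooth_on ?A (\<lambda>x. inverse (proj_denom \<epsilon> a r x))" unfolding d
    by (intro smooth_on_inverse op[unfolded d] smooth_on_diff smooth_on_const smooth_on_bounded_linear[OF \<delta>] smooth_on_ident) auto
  show ?thesis unfolding transfer_map_def
  proof (intro conjI ballI allI op)
    show "smooth_on ?A (proj_map \<epsilon> a r)" unfolding proj_map_def
      using smooth_on_bilinear[OF bounded_bilinear_cscale op si smooth_on_bounded_linear[OF N(1) op smooth_on_ident]] by (simp add: N_def)
    show "smooth_on ?A (\<lambda>x. Re (inverse (proj_denom \<epsilon> a r x) * cnj (inverse (proj_denom \<epsilon> a r x))))"
      by (intro smooth_on_Re smooth_on_mult smooth_on_cnj op si)
    fix x v assume x: "x \<in> ?A"
    have "((\<lambda>x. 1 - \<delta> x) has_derivative (\<lambda>v. 0 - \<delta> v)) (at x)"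
      by (intro has_derivative_diff has_derivative_const bounded_linear_imp_has_derivative \<delta>)
    from Deriv.has_derivative_inverse[OF _ this] x
    have "((\<lambda>x. inverse (1 - \<delta> x)) has_derivative (\<lambda>v. - (inverse (1 - \<delta> x) * (0 - \<delta> v) * inverse (1 - \<delta> x)))) (at x)"
      by (simp add: d)
    from bounded_bilinear.FDERIV[OF bounded_bilinear_cscale this bounded_linear_imp_has_derivative[OF N(1)]]
    have "(proj_map \<epsilon> a r has_derivative (\<lambda>v. cscale (inverse (1 - \<delta> x)) (N v)
      + cscale (- (inverse (1 - \<delta> x) * (0 - \<delta> v) * inverse (1 - \<delta> x))) (N x))) (at x)"
      by (simp only: proj_map_def[abs_def] N_def d)
    hence "dir_deriv v (proj_map \<epsilon> a r) x = cscale (inverse (1 - \<delta> x)) (N v)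
      + cscale (- (inverse (1 - \<delta> x) * (0 - \<delta> v) * inverse (1 - \<delta> x))) (N x)" for v by (rule dir_deriv_eq)
    thus "dir_deriv (cscale \<i> v) (proj_map \<epsilon> a r) x = cscale \<i> (dir_deriv v (proj_map \<epsilon> a r) x)"
      by (simp add: N(2) \<delta>i) (simp add: cscale_def vec_eq_iff algebra_simps)
  next
    fix x assume x: "x \<in> ?A"
    define e where "e = proj_denom \<epsilon> a r x"
    define z w where "z = fst x" and "w = snd x"
    have e: "e \<noteq> 0" "cnj e \<noteq> 0" using x by (simp_all add: e_def)
    have ee: "e = 1 - (2 * \<i> * herm \<epsilon> z a + (of_real r + \<i> * herm \<epsilon> a a) * w)"
      by (simp add: e_def proj_denom_def z_def w_def)
    hence ce: "cnj e = 1 - (- 2 * \<i> * herm \<epsilon> a z + (of_real r - \<i> * herm \<epsilon> a a) * cnj w)" by (simp add: cnj_herm)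
    have inner: "(w * cnj e - cnj w * e) * (- \<i> / 2)
        - (herm \<epsilon> z z + cnj w * herm \<epsilon> z a + w * herm \<epsilon> a z + w * cnj w * herm \<epsilon> a a) = of_real (rho \<epsilon> x)"
      unfolding rho_herm z_def[symmetric] w_def[symmetric] ce unfolding ee by (simp add: field_simps)
    have "complex_of_real (rho \<epsilon> (proj_map \<epsilon> a r x)) = (inverse e * w - cnj (inverse e * w)) * (- \<i> / 2)
        - inverse e * cnj (inverse e) * (herm \<epsilon> z z + cnj w * herm \<epsilon> z a + w * herm \<epsilon> a z + w * cnj w * herm \<epsilon> a a)"
      unfolding rho_herm by (simp add: proj_map_def cscale_def herm_scale herm_add e_def[symmetric] z_def[symmetric] w_def[symmetric] algebra_simps)
    also have "\<dots> = inverse e * cnj (inverse e) * ((w * cnj e - cnj w * e) * (- \<i> / 2)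
        - (herm \<epsilon> z z + cnj w * herm \<epsilon> z a + w * herm \<epsilon> a z + w * cnj w * herm \<epsilon> a a))"
      using e by (simp add: field_simps)
    also have "\<dots> = inverse e * cnj (inverse e) * of_real (rho \<epsilon> x)"
      by (subst inner) simp
    also have "inverse e * cnj (inverse e) = of_real (Re (inverse e * cnj (inverse e)))"
      by (simp add: complex_eq_iff)
    finally show "rho \<epsilon> (proj_map \<epsilon> a r x) = Re (inverse (proj_denom \<epsilon> a r x) * cnj (inverse (proj_denom \<epsilon> a r x))) * rho \<epsilon> x"
      unfolding e_def[symmetric] of_real_mult[symmetric] of_real_eq_iff .
  qed
qed

lemma proj_map_inverse:
  assumes "proj_denom \<epsilon> a r x \<noteq> 0"
  shows "proj_denom \<epsilon> (- a) (- r) (proj_map \<epsilon> a r x) = inverse (proj_denom \<epsilon> a r x)"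
    "proj_map \<epsilon> (- a) (- r) (proj_map \<epsilon> a r x) = x"
proof -
  define e where "e = proj_denom \<epsilon> a r x"
  have e: "e \<noteq> 0" using assms by (simp add: e_def)
  have e2: "proj_denom \<epsilon> (- a) (- r) (proj_map \<epsilon> a r x)
      = inverse e * (e + (2 * \<i> * (herm \<epsilon> (fst x) a + snd x * herm \<epsilon> a a) + (of_real r - \<i> * herm \<epsilon> a a) * snd x))"
    using e unfolding proj_denom_def[of _ "- a"] proj_map_def e_def[symmetric]
    by (simp add: cscale_def herm_scale herm_add herm_minus algebra_simps)
  also have "e + (2 * \<i> * (herm \<epsilon> (fst x) a + snd x * herm \<epsilon> a a) + (of_real r - \<i> * herm \<epsilon> a a) * snd x) = 1"
    by (simp add: e_def proj_denom_def algebra_simps)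
  finally show i: "proj_denom \<epsilon> (- a) (- r) (proj_map \<epsilon> a r x) = inverse (proj_denom \<epsilon> a r x)" by (simp add: e_def)
  show "proj_map \<epsilon> (- a) (- r) (proj_map \<epsilon> a r x) = x"
    unfolding proj_map_def[of _ "- a"] i e_def[symmetric]
    using e by (simp add: proj_map_def e_def[symmetric] cscale_def prod_eq_iff vec_eq_iff field_simps)
qed

lemma transfer_pair_proj_map:
  "transfer_pair \<epsilon> {x. proj_denom \<epsilon> a r x \<noteq> 0} {x. proj_denom \<epsilon> (- a) (- r) x \<noteq> 0} (proj_map \<epsilon> a r) (proj_map \<epsilon> (- a) (- r))"
  unfolding transfer_pair_def
  using transfer_map_proj_map proj_map_inverse[of \<epsilon> a r] proj_map_inverse[of \<epsilon> "- a" "- r"] by auto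

section \<open>Witt's extension theorem\<close>

text \<open>The complex reflection along \<open>a = x - w\<close> whose coefficient is chosen so that \<open>x\<close> goes to \<open>w\<close>; it
  preserves the form because \<open>x\<close> and \<open>w\<close> have equal squares.\<close>

lemma quasi_reflection:
  assumes xw: "herm \<epsilon> x x = herm \<epsilon> w w" "herm \<epsilon> x x \<noteq> herm \<epsilon> x w"
  obtains R where "isometry \<epsilon> R" "R x = w" "\<And>y. herm \<epsilon> y x = 0 \<Longrightarrow> herm \<epsilon> y w = 0 \<Longrightarrow> R y = y"
proof -
  define a where "a = x - w"
  define d where "d = herm \<epsilon> x a"
  define R where "R y = y - (herm \<epsilon> y a / d) *s a" for y
  have d: "d \<noteq> 0" "cnj d \<noteq> 0" using xw(2) by (simp_all add: d_def a_def herm_diff)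
  have dd: "herm \<epsilon> a a = d + cnj d" using xw(1) by (simp add: d_def a_def herm_diff cnj_herm)
  have "isometry \<epsilon> R" unfolding isometry_def
  proof (intro conjI allI)
    fix u v c
    show "R (u + v) = R u + R v" "R (c *s v) = c *s R v"
      by (simp_all add: R_def herm_add herm_scale vec_eq_iff add_divide_distrib algebra_simps)
    have "herm \<epsilon> (R u) (R v) = herm \<epsilon> u v - cnj (herm \<epsilon> v a) / cnj d * herm \<epsilon> u a - herm \<epsilon> u a / d * cnj (herm \<epsilon> v a)
        + (herm \<epsilon> u a / d) * (cnj (herm \<epsilon> v a) / cnj d) * herm \<epsilon> a a"
      by (simp add: R_def herm_diff herm_scale cnj_herm algebra_simps)
    also have "\<dots> = herm \<epsilon> u v" unfolding dd using d by (simp add: field_simps)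
    finally show "herm \<epsilon> (R u) (R v) = herm \<epsilon> u v" .
  qed
  moreover have "R x = w" using d by (simp add: R_def d_def[symmetric]) (simp add: a_def)
  moreover have "R y = y" if "herm \<epsilon> y x = 0" "herm \<epsilon> y w = 0" for y
    using that by (simp add: R_def a_def herm_diff)
  ultimately show ?thesis by (rule that)
qed

lemma isometry_id: "isometry \<epsilon> (\<lambda>x. x)" by (simp add: isometry_def)

text \<open>The reflection to \<open>axis k 1\<close> or the one to \<open>axis k (- 1)\<close> exists, since the form cannot take the
  same nonzero value on both pairs. In the second case another reflection corrects the sign.\<close>

lemma reflect_to_axis:
  assumes x: "herm \<epsilon> x x = of_real (\<epsilon> k)" "\<epsilon> k \<noteq> 0"
  obtains R where "isometry \<epsilon> R" "R x = axis k 1" "\<And>y. herm \<epsilon> y x = 0 \<Longrightarrow> y $ k = 0 \<Longrightarrow> R y = y"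
proof (cases "herm \<epsilon> x x = herm \<epsilon> x (axis k 1)")
  case False
  obtain R where "isometry \<epsilon> R" "R x = axis k 1" "\<And>y. herm \<epsilon> y x = 0 \<Longrightarrow> herm \<epsilon> y (axis k 1) = 0 \<Longrightarrow> R y = y"
    by (rule quasi_reflection[of \<epsilon> x "axis k 1"]) (use False x that in \<open>auto simp: herm_axis\<close>)
  thus ?thesis using that by (simp add: herm_axis)
next
  case True
  obtain R where R: "isometry \<epsilon> R" "R x = axis k (- 1)" "\<And>y. herm \<epsilon> y x = 0 \<Longrightarrow> herm \<epsilon> y (axis k (- 1)) = 0 \<Longrightarrow> R y = y"
    by (rule quasi_reflection[of \<epsilon> x "axis k (- 1)"]) (use True x that in \<open>auto simp: herm_axis\<close>)
  obtain S where S: "isometry \<epsilon> S" "S (axis k (- 1)) = axis k 1"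
    "\<And>y. herm \<epsilon> y (axis k (- 1)) = 0 \<Longrightarrow> herm \<epsilon> y (axis k 1) = 0 \<Longrightarrow> S y = y"
    by (rule quasi_reflection[of \<epsilon> "axis k (- 1)" "axis k 1"]) (use x that in \<open>auto simp: herm_axis\<close>)
  show ?thesis
  proof (rule that)
    show "isometry \<epsilon> (\<lambda>y. S (R y))" by (rule isometry_compose[OF S(1) R(1)])
    show "S (R x) = axis k 1" by (simp add: R S)
    show "S (R y) = y" if "herm \<epsilon> y x = 0" "y $ k = 0" for y using R(3) S(3) that by (simp add: herm_axis)
  qed
qed

lemma exists_coordinate_of_sign:
  fixes x :: "complex^'m::finite"
  assumes x: "herm \<epsilon> x x = of_real s" and s: "s = -1 \<or> s = 1" and eps: "\<And>k. \<epsilon> k = -1 \<or> \<epsilon> k = 1"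
  obtains k where "\<epsilon> k = s" "x $ k \<noteq> 0"
proof (rule ccontr)
  assume "\<not> thesis"
  hence k: "x $ k \<noteq> 0 \<Longrightarrow> \<epsilon> k = - s" for k using that eps[of k] s by auto
  have "s * s = s * (\<Sum>k\<in>UNIV. \<epsilon> k * (cmod (x $ k))\<^sup>2)" using x unfolding herm_self of_real_eq_iff by simp
  also have "\<dots> = (\<Sum>k\<in>UNIV. s * (\<epsilon> k * (cmod (x $ k))\<^sup>2))" by (rule sum_distrib_left)
  also have "\<dots> \<le> 0"
  proof (rule sum_nonpos)
    fix i
    show "s * (\<epsilon> i * (cmod (x $ i))\<^sup>2) \<le> 0" using k[of i] s by (cases "x $ i = 0") auto
  qed
  finally show False using s by auto
qed

text \<open>Pseudo-orthonormal vectors are moved to coordinate axes one at a time. The image \<open>x\<close> of the next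
  vector is orthogonal to the axes already used, so a coordinate of the right sign is found among
  the remaining ones, and the reflection that moves \<open>x\<close> there fixes the axes already used.\<close>

lemma Witt_extension:
  fixes \<epsilon> :: "'n::finite \<Rightarrow> real" and \<epsilon>' :: "'m::finite \<Rightarrow> real" and E :: "'n \<Rightarrow> complex^'m"
  assumes eps: "\<And>k. \<epsilon> k = -1 \<or> \<epsilon> k = 1" "\<And>k. \<epsilon>' k = -1 \<or> \<epsilon>' k = 1"
    and E: "\<And>\<alpha> \<beta>. herm \<epsilon>' (E \<alpha>) (E \<beta>) = (if \<alpha> = \<beta> then of_real (\<epsilon> \<alpha>) else 0)"
  obtains T \<sigma> where "isometry \<epsilon>' T" "inj \<sigma>" "\<And>\<alpha>. \<epsilon>' (\<sigma> \<alpha>) = \<epsilon> \<alpha>" "\<And>\<alpha>. T (E \<alpha>) = axis (\<sigma> \<alpha>) 1"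
proof -
  have nz: "\<epsilon>' k \<noteq> 0" for k using eps(2)[of k] by auto
  have "\<exists>T \<sigma>. isometry \<epsilon>' T \<and> inj_on \<sigma> S \<and> (\<forall>\<alpha>\<in>S. \<epsilon>' (\<sigma> \<alpha>) = \<epsilon> \<alpha> \<and> T (E \<alpha>) = axis (\<sigma> \<alpha>) 1)" for S :: "'n set"
  proof (induction S rule: finite_induct[OF finite])
    case 1
    show ?case using isometry_id by auto
  next
    case (2 \<beta> S)
    then obtain T \<sigma> where T: "isometry \<epsilon>' T" "inj_on \<sigma> S" "\<And>\<alpha>. \<alpha> \<in> S \<Longrightarrow> \<epsilon>' (\<sigma> \<alpha>) = \<epsilon> \<alpha>"
      "\<And>\<alpha>. \<alpha> \<in> S \<Longrightarrow> T (E \<alpha>) = axis (\<sigma> \<alpha>) 1" by blast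
    define x where "x = T (E \<beta>)"
    have xx: "herm \<epsilon>' x x = of_real (\<epsilon> \<beta>)" by (simp add: x_def isometryD[OF T(1)] E)
    have xs: "herm \<epsilon>' (axis (\<sigma> \<alpha>) 1) x = 0" if "\<alpha> \<in> S" for \<alpha>
      using that 2(2) by (auto simp: x_def T(4)[symmetric] isometryD[OF T(1)] E)
    hence xs': "x $ \<sigma> \<alpha> = 0" if "\<alpha> \<in> S" for \<alpha> using that nz by (simp add: herm_axis)
    obtain k where k: "\<epsilon>' k = \<epsilon> \<beta>" "x $ k \<noteq> 0" by (rule exists_coordinate_of_sign[OF xx eps(1) eps(2)]) (rule that)
    have kS: "k \<noteq> \<sigma> \<alpha>" if "\<alpha> \<in> S" for \<alpha> using xs'[OF that] k(2) by auto
    obtain R where R: "isometry \<epsilon>' R" "R x = axis k 1" "\<And>y. herm \<epsilon>' y x = 0 \<Longrightarrow> y $ k = 0 \<Longrightarrow> R y = y"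
      by (rule reflect_to_axis[of \<epsilon>' x k]) (use xx k nz that in auto)
    have "inj_on (\<sigma>(\<beta> := k)) (insert \<beta> S)" using T(2) 2(2) kS by (auto simp: inj_on_def)
    moreover have "R (T (E \<alpha>)) = axis ((\<sigma>(\<beta> := k)) \<alpha>) 1" if "\<alpha> \<in> insert \<beta> S" for \<alpha>
    proof (cases "\<alpha> = \<beta>")
      case False
      hence a: "\<alpha> \<in> S" using that by simp
      show ?thesis using False R(3)[OF xs[OF a]] kS[OF a] by (simp add: T(4)[OF a] axis_def)
    qed (simp add: x_def[symmetric] R)
    moreover have "\<epsilon>' ((\<sigma>(\<beta> := k)) \<alpha>) = \<epsilon> \<alpha>" if "\<alpha> \<in> insert \<beta> S" for \<alpha> using that T(3) k(1) by auto
    ultimately show ?case using isometry_compose[OF R(1) T(1)] by blast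
  qed
  from this[of UNIV] show ?thesis using that by auto
qed

section \<open>Normalized maps are in normal form\<close>

lemma jD_vec:
  fixes J :: "'n::finite jet"
  shows "jD (u + v) J = jD u J + jD v J" "jD (cscale c v) J = jconst c * jD v J"
proof -
  show "jD (u + v) J = jD u J + jD v J"
  proof (transfer fixing: u v)
    fix f :: "(complex^'n) \<times> complex \<Rightarrow> complex" assume f: "jet_rel f f"
    show "jet_rel (wirtinger f (u + v)) (\<lambda>x. wirtinger f u x + wirtinger f v x)"
      by (rule jet_rel_near[OF f f wirtinger_add_vec(1) smooth_at_wirtinger(1)[OF jet_relD(1)[OF f]]])
  qed
  show "jD (cscale c v) J = jconst c * jD v J"
  proof (transfer fixing: c v)
    fix f :: "(complex^'n) \<times> complex \<Rightarrow> complex" assume f: "jet_rel f f"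
    show "jet_rel (wirtinger f (cscale c v)) (\<lambda>x. c * wirtinger f v x)"
      by (rule jet_rel_near[OF f f wirtinger_cscale(1) smooth_at_wirtinger(1)[OF jet_relD(1)[OF f]]])
  qed
qed

lemma jD_zero_vec: "jD 0 J = 0"
  using jD_vec(2)[of 0 0 J] by (simp add: cscale_def jconst_simps flip: zero_prod_def)

lemma jD_sum_vec: "jD (\<Sum>i\<in>I. v i) J = (\<Sum>i\<in>I. jD (v i) J)"
  by (induction I rule: infinite_finite_induct) (simp_all add: jD_zero_vec jD_vec)

lemma horizontal_sum: "(z, 0) = (\<Sum>i\<in>UNIV. cscale (z $ i) (axis i 1, 0))"
  using coordinates_sum[of "(z, 0)"] by (simp add: cscale_def zero_prod_def[symmetric])

lemma jD_horizontal: "jD (z, 0) J = (\<Sum>i\<in>UNIV. jconst (z $ i) * jD (axis i 1, 0) J)"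
  by (subst horizontal_sum) (simp only: jD_sum_vec jD_vec)

lemma jD_vertical: "jD (0, w) J = jconst w * jD (0, 1) J"
  using jD_vec(2)[of w "(0, 1)" J] by (simp add: cscale_def)

text \<open>What remains to be assumed after composition with automorphisms of the target: first derivatives
  as in the normal form, and a second derivative of the last component without real part.\<close>

locale normalized_map = ah_map_at \<epsilon> \<epsilon>' "0 :: (complex^'n) \<times> complex" h Q
  for \<epsilon> :: "'n::finite \<Rightarrow> real" and \<epsilon>' :: "'m::finite \<Rightarrow> real" and h Q +
  fixes \<sigma> :: "'n \<Rightarrow> 'm"
  assumes eps: "\<And>k. \<epsilon> k = -1 \<or> \<epsilon> k = 1" and h0: "h 0 = 0" and Q0: "Q 0 = 1"
    and \<sigma>: "inj \<sigma>" "\<And>\<alpha>. \<epsilon>' (\<sigma> \<alpha>) = \<epsilon> \<alpha>"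
    and D1_axis: "\<And>\<alpha>. D1 (axis \<alpha> 1, 0) = axis (\<sigma> \<alpha>) 1" and D1_T: "D1 (0, 1) = 0"
    and Re_G_TT: "Re (jev (jD (0, 1) (jD (0, 1) G))) = 0"
begin

definition A :: "complex^'n^'n" where
  "A = (\<chi> \<alpha> \<beta>. q11 (axis \<alpha> 1, 0) (axis \<beta> 1, 0) * of_real (\<epsilon> \<beta>))"

definition B :: "'m \<Rightarrow> complex^'n^'n" where
  "B l = (\<chi> i j. jev (jD (axis i 1, 0) (jD (axis j 1, 0) (F l))) / 2)"

lemma lam0: "lam v = - \<i> / 2 * snd v"
  by (simp add: lam_eq herm_zero)

lemma jev_FG0: "jev (F k) = 0" "jev G = 0"
  by (simp_all add: F_def G_def jev_jet smooth_components h0)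

lemma eps_square: "complex_of_real (\<epsilon> k) * of_real (\<epsilon> k) = 1" "\<epsilon> k \<noteq> 0"
  using eps[of k] by auto

lemma F1:
  "jev (jD (z, 0) (F (\<sigma> \<alpha>))) = z $ \<alpha>" "jev (jD (0, w) (F k)) = 0"
  "l \<notin> range \<sigma> \<Longrightarrow> jev (jD (z, 0) (F l)) = 0"
proof -
  have a: "jev (jD (axis i 1, 0) (F k)) = axis (\<sigma> i) 1 $ k" for i k
    using D1_axis[of i] by (simp add: D1_def vec_eq_iff)
  show "jev (jD (0, w) (F k)) = 0" unfolding jD_vertical[of w] using D1_T by (simp add: D1_def vec_eq_iff)
  have e: "jev (jD (z, 0) (F k)) = (\<Sum>i\<in>UNIV. z $ i * (if k = \<sigma> i then 1 else 0))" for k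
    unfolding jD_horizontal[of z] by (simp add: a) (simp add: axis_def)
  show "jev (jD (z, 0) (F (\<sigma> \<alpha>))) = z $ \<alpha>" unfolding e using \<sigma>(1) by (simp add: inj_eq mult_delta_right)
  show "l \<notin> range \<sigma> \<Longrightarrow> jev (jD (z, 0) (F l)) = 0" unfolding e by (intro sum.neutral) auto
qed

lemma herm_tangent: "herm \<epsilon>' v (D1 (axis \<beta> 1, 0)) = of_real (\<epsilon> \<beta>) * v $ \<sigma> \<beta>"
  by (simp add: D1_axis herm_axis \<sigma>)

lemma G1: "jev (jD v G) = snd v"
  using identity_1[of v] by (simp add: lam0 h0 Q0 herm_zero)

lemma G2: "jev (jD u (jD v G)) = q1 u * snd v + q1 v * snd u"
proof -
  have "\<i> * jev (jD u (jD v G)) = \<i> * (q1 u * snd v) + \<i> * (q1 v * snd u)"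
    using arg_cong[OF mapping_equation, of "\<lambda>a. jev (jD u (jD v a))"]
    by (simp add: jet_calc jev_r jev_q jev_FG0 lam_def[symmetric] q1_def[symmetric]) (simp add: lam0 field_simps)
  hence "\<i> * jev (jD u (jD v G)) = \<i> * (q1 u * snd v + q1 v * snd u)" by (simp only: distrib_left)
  thus ?thesis by (simp only: mult_cancel_left) simp
qed

lemma G3: "jev (jD t (jD u (jD v G))) = q2 t u * snd v + q2 t v * snd u + q2 u v * snd t"
proof -
  have "\<i> * (2 * jev (jD t (jD u (jD v G))))
      = \<i> * (2 * (q2 t u * snd v)) + \<i> * (2 * (q2 t v * snd u)) + \<i> * (2 * (q2 u v * snd t))"
    using arg_cong[OF mapping_equation, of "\<lambda>a. jev (jD t (jD u (jD v a)))"]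
    by (simp add: jet_calc jev_r jev_q jev_FG0 lam_def[symmetric] q2_def[symmetric]) (simp add: lam0 field_simps)
  hence "\<i> * (2 * jev (jD t (jD u (jD v G)))) = \<i> * (2 * (q2 t u * snd v + q2 t v * snd u + q2 u v * snd t))"
    by (simp only: distrib_left)
  thus ?thesis by (simp only: mult_cancel_left) simp
qed

lemma G4: "jev (jD (s, 0) (jD (t, 0) (jD (u, 0) (jD (v, 0) G)))) = 0"
  using arg_cong[OF mapping_equation, of "\<lambda>a. jev (jD (s, 0) (jD (t, 0) (jD (u, 0) (jD (v, 0) a))))"]
  by (simp add: jet_calc jev_r jev_q jev_FG0 lam_def[symmetric]) (simp add: lam0 field_simps)

text \<open>The first components have no derivative along \<open>w\<close>; this kills the derivatives of \<open>Q\<close> in the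
  tangential directions and the imaginary part of that along \<open>w\<close>. The real part of the latter is
  half the quantity assumed to vanish.\<close>

lemma q1_zero: "q1 (z, 0) = 0" "q1 (0, w) = 0"
proof -
  show "q1 (z, 0) = 0"
    using identity_11[of "(z, 0)" "(0, 1)"] by (simp add: D1_T herm_zero lam0)
  have "Im (q1 (0, 1)) = 0"
    using identity_11[of "(0, 1)" "(0, 1)"] by (simp add: D1_T herm_zero lam0 complex_eq_iff)
  moreover have "Re (q1 (0, 1)) = 0" using Re_G_TT G2[of "(0, 1)" "(0, 1)"] by simp
  ultimately have "q1 (0, 1) = 0" by (simp add: complex_eq_iff)
  thus "q1 (0, w) = 0" by (simp add: q1_def jD_vertical[of w])
qed

lemma q2_zero: "q2 (u, 0) (v, 0) = 0"
  using identity_21[of "(u, 0)" "(v, 0)" "(0, 1)"] by (simp add: D1_T herm_zero lam0 q1_zero)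

lemma F2: "jev (jD (u, 0) (jD (v, 0) (F (\<sigma> \<alpha>)))) = 0"
proof -
  have "herm \<epsilon>' (D2 (u, 0) (v, 0)) (D1 (axis \<alpha> 1, 0)) = 0"
    using identity_21[of "(u, 0)" "(v, 0)" "(axis \<alpha> 1, 0)"] by (simp add: lam0 q1_zero)
  thus ?thesis by (simp add: herm_tangent D2_def eps_square)
qed

text \<open>All third derivatives of \<open>F\<close> in tangential directions are orthogonal to the image of the frame,
  because the second derivatives of \<open>Q\<close> of this type vanish.\<close>

lemma F3: "jev (jD (t, 0) (jD (u, 0) (jD (v, 0) (F (\<sigma> \<alpha>))))) = 0"
proof -
  have "herm \<epsilon>' (D3 (t, 0) (u, 0) (v, 0)) (D1 (axis \<alpha> 1, 0)) = 0"
    using arg_cong[OF mapping_equation, of "\<lambda>a. jev (jDb (axis \<alpha> 1, 0) (jD (t, 0) (jD (u, 0) (jD (v, 0) a))))"]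
    by (simp add: jet_calc jev_r jev_q jev_FG0 lam_def[symmetric] q2_def[symmetric] q2_zero herm_def D1_def D3_def)
       (simp add: lam0)
  thus ?thesis by (simp add: herm_tangent D3_def eps_square)
qed

lemma q11_A: "q11 (z, 0) (axis \<beta> 1, 0) = (z v* A) $ \<beta> * of_real (\<epsilon> \<beta>)"
proof -
  have "q11 (z, 0) (axis \<beta> 1, 0) = (\<Sum>i\<in>UNIV. z $ i * q11 (axis i 1, 0) (axis \<beta> 1, 0))"
    unfolding q11_def jD_horizontal[of z] by simp
  thus ?thesis by (simp add: vector_matrix_mult_def A_def sum_distrib_left sum_distrib_right mult_ac eps_square(1)[symmetric] del: of_real_mult)
     (simp add: eps_square mult.left_commute[of _ "complex_of_real (\<epsilon> \<beta>)"] flip: mult.assoc)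
qed

text \<open>This is where the matrix of the normal form appears: the derivative of weight three is dual to the
  mixed second derivatives of \<open>Q\<close>, that is, to the Ahlfors matrix.\<close>

lemma F2_mixed:
  "jev (jD (z, 0) (jD (0, w) (F (\<sigma> \<alpha>)))) = \<i> / 2 * (z v* A) $ \<alpha> * w"
  "jev (jD (0, w) (jD (z, 0) (F (\<sigma> \<alpha>)))) = \<i> / 2 * (z v* A) $ \<alpha> * w"
proof -
  have "herm \<epsilon>' (D2 (z, 0) (0, 1)) (D1 (axis \<alpha> 1, 0)) = \<i> / 2 * q11 (z, 0) (axis \<alpha> 1, 0)"
    using identity_21[of "(z, 0)" "(0, 1)" "(axis \<alpha> 1, 0)"] by (simp add: lam0 q1_zero herm_zero)
  hence "of_real (\<epsilon> \<alpha>) * (jev (jD (z, 0) (jD (0, 1) (F (\<sigma> \<alpha>))))) = of_real (\<epsilon> \<alpha>) * (\<i> / 2 * (z v* A) $ \<alpha>)"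
    by (simp add: herm_tangent D2_def q11_A)
  hence "jev (jD (z, 0) (jD (0, 1) (F (\<sigma> \<alpha>)))) = \<i> / 2 * (z v* A) $ \<alpha>" using eps_square(2)[of \<alpha>] by simp
  thus 1: "jev (jD (z, 0) (jD (0, w) (F (\<sigma> \<alpha>)))) = \<i> / 2 * (z v* A) $ \<alpha> * w"
    by (simp add: jD_vertical[of w])
  show "jev (jD (0, w) (jD (z, 0) (F (\<sigma> \<alpha>)))) = \<i> / 2 * (z v* A) $ \<alpha> * w" using 1 by (simp add: jD_commute(2))
qed

lemma F2_normal: "jev (jD (u, 0) (jD (z, 0) (F l))) = 2 * (\<Sum>i\<in>UNIV. \<Sum>j\<in>UNIV. B l $ i $ j * u $ i * z $ j)"
  unfolding jD_horizontal[of u] jD_horizontal[of z] by (simp add: B_def sum_distrib_left mult_ac)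

text \<open>The Gauss equation at the origin, in which the tangential part of the second derivatives is zero.\<close>

lemma B_identity:
  "(\<Sum>\<alpha>\<in>UNIV. of_real (\<epsilon> \<alpha>) * cnj (z $ \<alpha>) * (z v* A) $ \<alpha>) * of_real (\<Sum>k\<in>UNIV. \<epsilon> k * (cmod (z $ k))\<^sup>2)
    = of_real (\<Sum>l\<in>- range \<sigma>. \<epsilon>' l * (cmod (quadratic_form (B l) z))\<^sup>2)"
proof -
  have split: "(\<Sum>k\<in>UNIV. f k) = (\<Sum>\<alpha>\<in>UNIV. f (\<sigma> \<alpha>)) + (\<Sum>l\<in>- range \<sigma>. f l)" for f :: "'m \<Rightarrow> complex"
  proof -
    have "(\<Sum>k\<in>UNIV. f k) = (\<Sum>k\<in>range \<sigma>. f k) + (\<Sum>l\<in>- range \<sigma>. f l)"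
      using sum.union_disjoint[of "range \<sigma>" "- range \<sigma>" f] by (simp add: Un_commute)
    thus ?thesis by (simp add: sum.reindex \<sigma>(1))
  qed
  have lift: "horizontal_lift \<epsilon> 0 v = (v, 0)" for v by (simp add: horizontal_lift_def herm_zero)
  have zz: "q11 (z, 0) (z, 0) = (\<Sum>\<alpha>\<in>UNIV. of_real (\<epsilon> \<alpha>) * cnj (z $ \<alpha>) * (z v* A) $ \<alpha>)"
  proof -
    have "q11 (z, 0) (z, 0) = (\<Sum>\<beta>\<in>UNIV. z $ \<beta> * q11 (axis \<beta> 1, 0) (z, 0))"
      unfolding q11_def by (subst jD_horizontal) simp
    from arg_cong[OF this, of cnj]
    show ?thesis by (simp add: cnj_q11 q11_A mult_ac)
  qed
  have d: "D2 (z, 0) (z, 0) $ \<sigma> \<alpha> = 0" "l \<notin> range \<sigma> \<Longrightarrow> D2 (z, 0) (z, 0) $ l = 2 * quadratic_form (B l) z" for \<alpha> l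
    by (simp only: D2_def vec_lambda_beta F2) (simp only: D2_def vec_lambda_beta F2_normal quadratic_form_def)
  have "herm \<epsilon>' (D2 (z, 0) (z, 0)) (D2 (z, 0) (z, 0))
      = 4 * of_real (\<Sum>l\<in>- range \<sigma>. \<epsilon>' l * (cmod (quadratic_form (B l) z))\<^sup>2)"
    unfolding herm_def split
    by (simp add: d complex_norm_square sum_distrib_left mult_ac del: of_real_power flip: of_real_power)
  hence "4 * complex_of_real (\<Sum>l\<in>- range \<sigma>. \<epsilon>' l * (cmod (quadratic_form (B l) z))\<^sup>2) = 4 * (q11 (z, 0) (z, 0) * herm \<epsilon> z z)"
    using gauss_equation[of z] unfolding lift by (metis mult.assoc)
  thus ?thesis unfolding zz herm_self by simp
qed

text \<open>Every derivative of low weight that the normal form excludes has been shown to vanish, and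
  vanishing jets give the weighted estimates.\<close>

theorem normal_form: "normal_form \<epsilon> \<epsilon>' \<sigma> h A B"
  unfolding normal_form_def
proof (intro conjI allI impI \<sigma> B_identity)
  let ?Z = "\<lambda>k. jet 0 (\<lambda>x::(complex^'n) \<times> complex. fst x $ k)"
  let ?w = "jet 0 (\<lambda>x::(complex^'n) \<times> complex. snd x)"
  have jz: "jev (?Z k) = 0" "jev ?w = 0" for k by (simp_all add: jev_jet smooth_at_coordinate)
  note sm = smooth_at_add smooth_at_mult smooth_at_sum smooth_at_const smooth_at_coordinate
  fix \<alpha>
  show "O_wt \<epsilon> 4 (\<lambda>x. fst (h x) $ \<sigma> \<alpha> - (fst x $ \<alpha> + \<i> / 2 * (fst x v* A) $ \<alpha> * snd x))"
  proof -
    let ?f = "\<lambda>x::(complex^'n) \<times> complex. fst x $ \<alpha> + (\<Sum>i\<in>UNIV. \<i> / 2 * A $ i $ \<alpha> * fst x $ i) * snd x"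
    define P where "P = ?Z \<alpha> + (\<Sum>i\<in>UNIV. jconst (\<i> / 2 * A $ i $ \<alpha>) * ?Z i) * ?w"
    have s: "smooth_at 0 ?f" by (intro sm)
    have P: "jet 0 ?f = P" unfolding P_def by (simp only: jet_add jet_mult jet_sum_fun jet_const sm)
    have j: "jet 0 (\<lambda>x. fst (h x) $ \<sigma> \<alpha> - ?f x) = F (\<sigma> \<alpha>) - P"
      by (simp only: jet_diff smooth_components s P F_def)
    have A: "(\<Sum>i\<in>UNIV. \<i> / 2 * A $ i $ \<alpha> * z $ i) = \<i> / 2 * (z v* A) $ \<alpha>" for z
      by (simp add: vector_matrix_mult_def sum_distrib_left mult_ac)
    have "O_wt \<epsilon> 4 (\<lambda>x. fst (h x) $ \<sigma> \<alpha> - ?f x)"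
    proof (rule O_wt_jet)
      show "smooth_at 0 (\<lambda>x. fst (h x) $ \<sigma> \<alpha> - ?f x)" by (intro smooth_at_diff smooth_components s)
      show "jDb v (jet 0 (\<lambda>x. fst (h x) $ \<sigma> \<alpha> - ?f x)) = 0" for v unfolding j by (simp add: P_def jD_coordinate)
      show "jet_wt_flat 4 (jet 0 (\<lambda>x. fst (h x) $ \<sigma> \<alpha> - ?f x))"
        unfolding j by (simp add: eval_nat_numeral P_def jD_coordinate jz jev_FG0 F1 F2 F3 F2_mixed A del: times_divide_eq_left)
    qed
    thus ?thesis unfolding A .
  qed
next
  fix l assume l: "l \<notin> range \<sigma>"
  let ?Z = "\<lambda>k. jet 0 (\<lambda>x::(complex^'n) \<times> complex. fst x $ k)"
  have jz: "jev (?Z k) = 0" for k by (simp_all add: jev_jet smooth_at_coordinate)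
  note sm = smooth_at_add smooth_at_mult smooth_at_sum smooth_at_const smooth_at_coordinate
  have B_sym: "B l $ i $ j = B l $ j $ i" for i j by (simp add: B_def jD_commute(2))
  let ?f = "\<lambda>x::(complex^'n) \<times> complex. \<Sum>i\<in>UNIV. \<Sum>j\<in>UNIV. B l $ i $ j * fst x $ i * fst x $ j"
  define P where "P = (\<Sum>i\<in>UNIV. \<Sum>j\<in>UNIV. jconst (B l $ i $ j) * ?Z i * ?Z j)"
  have s: "smooth_at 0 ?f" by (intro sm)
  have P: "jet 0 ?f = P" unfolding P_def by (simp only: jet_add jet_mult jet_sum_fun jet_const sm)
  have j: "jet 0 (\<lambda>x. fst (h x) $ l - ?f x) = F l - P"
    by (simp only: jet_diff smooth_components s P F_def)
  have P2: "jev (jD (u, 0) (jD (z, 0) P)) = 2 * (\<Sum>i\<in>UNIV. \<Sum>j\<in>UNIV. B l $ i $ j * u $ i * z $ j)" for u z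
  proof -
    have "jev (jD (u, 0) (jD (z, 0) P)) = (\<Sum>i\<in>UNIV. \<Sum>j\<in>UNIV. B l $ i $ j * u $ i * z $ j)
        + (\<Sum>i\<in>UNIV. \<Sum>j\<in>UNIV. B l $ i $ j * z $ i * u $ j)"
      by (simp add: P_def jD_coordinate jz sum.distrib mult_ac)
    also have "(\<Sum>i\<in>UNIV. \<Sum>j\<in>UNIV. B l $ i $ j * z $ i * u $ j) = (\<Sum>i\<in>UNIV. \<Sum>j\<in>UNIV. B l $ i $ j * u $ i * z $ j)"
      by (subst sum.swap) (simp add: B_sym mult_ac)
    finally show ?thesis by simp
  qed
  have P1: "jev P = 0" "jev (jD v P) = 0" "jDb v P = 0" for v by (simp_all add: P_def jD_coordinate jz)
  have "O_wt \<epsilon> 3 (\<lambda>x. fst (h x) $ l - ?f x)"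
  proof (rule O_wt_jet)
    show "smooth_at 0 (\<lambda>x. fst (h x) $ l - ?f x)" by (intro smooth_at_diff smooth_components s)
    show "jDb v (jet 0 (\<lambda>x. fst (h x) $ l - ?f x)) = 0" for v unfolding j by (simp add: P1)
    show "jet_wt_flat 3 (jet 0 (\<lambda>x. fst (h x) $ l - ?f x))"
      unfolding j by (simp add: eval_nat_numeral P1 P2 jev_FG0 F1 l F2_normal)
  qed
  thus "O_wt \<epsilon> 3 (\<lambda>x. fst (h x) $ l - quadratic_form (B l) (fst x))" by (simp add: quadratic_form_def)
next
  let ?w = "jet 0 (\<lambda>x::(complex^'n) \<times> complex. snd x)"
  have j: "jet 0 (\<lambda>x. snd (h x) - snd x) = G - ?w"
    by (simp add: jet_diff smooth_components smooth_at_coordinate G_def)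
  show "O_wt \<epsilon> 5 (\<lambda>x. snd (h x) - snd x)"
  proof (rule O_wt_jet)
    show "smooth_at 0 (\<lambda>x. snd (h x) - snd x)" by (intro smooth_at_diff smooth_components smooth_at_coordinate)
    show "jDb v (jet 0 (\<lambda>x. snd (h x) - snd x)) = 0" for v unfolding j by (simp add: jD_coordinate)
    show "jet_wt_flat 5 (jet 0 (\<lambda>x. snd (h x) - snd x))"
      unfolding j by (simp add: eval_nat_numeral jD_coordinate jev_jet smooth_at_coordinate jev_FG0 G1 G2 G3 G4 q1_zero q2_zero)
  qed
qed

end

section \<open>Normalization by automorphisms of the target\<close>

lemma rho_zero: "rho \<epsilon> 0 = 0" by (simp add: rho_def)

lemma proj_map_zero: "proj_denom \<epsilon> a r 0 = 1" "proj_map \<epsilon> a r 0 = 0"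
  by (simp_all add: proj_denom_def proj_map_def cscale_def herm_zero vec_eq_iff zero_prod_def)

lemma translate_zero: "translate \<epsilon> p 0 = p" by (simp add: translate_def herm_zero prod_eq_iff)

lemma (in ah_map_at) origin:
  assumes "p = 0" "h 0 = 0"
  shows "lam v = - \<i> / 2 * snd v" "jev (F k) = 0" "jev G = 0" "jev (jD v G) = of_real (Q p) * snd v"
proof -
  show l: "lam v = - \<i> / 2 * snd v" unfolding lam_eq by (simp add: assms herm_zero)
  show "jev (F k) = 0" "jev G = 0" unfolding F_def G_def jev_jet[OF smooth_components(2)] jev_jet[OF smooth_components(3)]
    by (simp_all add: assms)
  show "jev (jD v G) = of_real (Q p) * snd v"
    using identity_1[of v] unfolding l by (simp add: assms herm_zero)
qed

text \<open>The parameter \<open>a\<close> removes the derivative of the first components along \<open>w\<close>, and \<open>r\<close> removes the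
  real part of the second derivative of the last component. Multiplying by the denominator turns the
  quotient into two identities of jets.\<close>

lemma projective_normalization:
  fixes \<epsilon> :: "'n::finite \<Rightarrow> real" and \<epsilon>' :: "'m::finite \<Rightarrow> real"
  assumes ah: "ah_map \<epsilon> \<epsilon>' 0 h Q" and h0: "h 0 = 0" and Q0: "Q 0 = 1"
  obtains a r Q' where "ah_map \<epsilon> \<epsilon>' 0 (\<lambda>x. proj_map \<epsilon>' a r (h x)) Q'" "Q' 0 = 1"
    "\<And>z. ah_map_at.D1 0 (\<lambda>x. proj_map \<epsilon>' a r (h x)) (z, 0) = ah_map_at.D1 0 h (z, 0)"
    "ah_map_at.D1 0 (\<lambda>x. proj_map \<epsilon>' a r (h x)) (0, 1) = 0"
    "Re (jev (jD (0, 1) (jD (0, 1) (ah_map_at.G 0 (\<lambda>x. proj_map \<epsilon>' a r (h x)))))) = 0"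
proof -
  interpret h: ah_map_at \<epsilon> \<epsilon>' 0 h Q by unfold_locales (rule ah)
  let ?T = "(0, 1) :: (complex^'n) \<times> complex"
  define a where "a = - h.D1 ?T"
  \<comment> \<open>The value for which the real part of \<open>GT\<close> below is zero.\<close>
  define r where "r = - Re (jev (jD ?T (jD ?T h.G)) + 4 * \<i> * herm \<epsilon>' (h.D1 ?T) a + 2 * \<i> * herm \<epsilon>' a a) / 2"
  define k where "k x = proj_map \<epsilon>' a r (h x)" for x
  define d where "d x = proj_denom \<epsilon>' a r (h x)" for x
  define c where "c x = Re (inverse (proj_denom \<epsilon>' a r x) * cnj (inverse (proj_denom \<epsilon>' a r x)))" for x
  have p: "ah_map \<epsilon>' \<epsilon>' (h 0) (proj_map \<epsilon>' a r) c" unfolding c_def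
    by (rule transfer_map_ah_map[OF transfer_map_proj_map]) (simp_all add: h0 proj_map_zero rho_zero)
  have kk: "ah_map \<epsilon> \<epsilon>' 0 k (\<lambda>x. c (h x) * Q x)" unfolding k_def by (rule ah_map_compose[OF ah p])
  interpret k: ah_map_at \<epsilon> \<epsilon>' 0 k "\<lambda>x. c (h x) * Q x" by unfold_locales (rule kk)
  have c0: "c (h 0) * Q 0 = 1" by (simp add: c_def h0 Q0 proj_map_zero)
  have k0: "k 0 = 0" by (simp add: k_def h0 proj_map_zero)
  define \<kappa> where "\<kappa> = of_real r + \<i> * herm \<epsilon>' a a"
  define dj where "dj = jconst 1 - (jconst (2 * \<i>) * (\<Sum>i\<in>UNIV. jconst (of_real (\<epsilon>' i)) * h.F i * jconst (cnj (a $ i))) + jconst \<kappa> * h.G)"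
  note sm = smooth_at_add smooth_at_diff smooth_at_mult smooth_at_sum smooth_at_const h.smooth_components
  have d_eq: "d = (\<lambda>x. 1 - (2 * \<i> * (\<Sum>i\<in>UNIV. of_real (\<epsilon>' i) * fst (h x) $ i * cnj (a $ i)) + \<kappa> * snd (h x)))"
    by (simp add: d_def proj_denom_def herm_def \<kappa>_def fun_eq_iff)
  have sd: "smooth_at 0 d" unfolding d_eq by (intro sm)
  have dj: "jet 0 d = dj" unfolding d_eq dj_def h.F_def h.G_def
    by (simp only: jet_add jet_diff jet_mult jet_sum_fun jet_const sm)
  have d0: "d 0 = 1" by (simp add: d_def h0 proj_map_zero)
  obtain W where W: "open W" "0 \<in> W" "\<And>x. x \<in> W \<Longrightarrow> d x \<noteq> 0"
  proof -
    obtain W where W: "open W" "0 \<in> W" "smooth_on W d" using smooth_atE[OF sd] .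
    have "open (d -` (- {0}) \<inter> W)"
      using continuous_on_open_vimage[OF W(1), of d] smooth_on_imp_continuous_on[OF W(3)] by (simp add: open_Compl)
    thus ?thesis using that[of "d -` (- {0}) \<inter> W"] d0 W(2) by auto
  qed
  have Fj: "k.F i * dj = h.F i + jconst (a $ i) * h.G" for i
  proof -
    have "k.F i * dj = jet 0 (\<lambda>x. fst (k x) $ i * d x)" unfolding k.F_def dj[symmetric] by (rule jet_mult[OF k.smooth_components(2) sd, symmetric])
    also have "\<dots> = jet 0 (\<lambda>x. fst (h x) $ i + a $ i * snd (h x))"
      by (rule jet_cong[OF smooth_at_mult[OF k.smooth_components(2) sd] W(1,2)]) (use W(3) in \<open>simp add: k_def d_def proj_map_def cscale_def field_simps\<close>)
    also have "\<dots> = h.F i + jconst (a $ i) * h.G" unfolding h.F_def h.G_def by (simp only: jet_add jet_mult jet_const sm)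
    finally show ?thesis .
  qed
  have Gj: "k.G * dj = h.G"
  proof -
    have "k.G * dj = jet 0 (\<lambda>x. snd (k x) * d x)" unfolding k.G_def dj[symmetric] by (rule jet_mult[OF k.smooth_components(3) sd, symmetric])
    also have "\<dots> = h.G" unfolding h.G_def
      by (rule jet_cong[OF smooth_at_mult[OF k.smooth_components(3) sd] W(1,2)]) (use W(3) in \<open>simp add: k_def d_def proj_map_def cscale_def field_simps\<close>)
    finally show ?thesis .
  qed
  have jd: "jev dj = 1" using d0 by (simp add: dj[symmetric] jev_jet sd)
  have jdT: "jev (jD ?T dj) = - (2 * \<i> * herm \<epsilon>' (h.D1 ?T) a + \<kappa>)"
    by (simp add: dj_def h.origin(4)[OF refl h0] Q0 herm_def h.D1_def)
  have D: "jev (jD v (k.F i)) = jev (jD v (h.F i)) + a $ i * snd v" for v i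
    using arg_cong[OF Fj, of "\<lambda>J. jev (jD v J)" i] by (simp add: jd k.origin[OF refl k0] h.origin[OF refl h0] Q0)
  have jev2: "jev (2 :: 'n jet) = 2" using jev_add[of "1 :: 'n jet" 1] by simp
  have "jev (jD ?T (jD ?T k.G)) + 2 * jev (jD ?T dj) = jev (jD ?T (jD ?T h.G))"
    using arg_cong[OF Gj, of "\<lambda>J. jev (jD ?T (jD ?T J))"] by (simp add: jd k.origin[OF refl k0] c0 jev2 add.commute)
  hence GT: "jev (jD ?T (jD ?T k.G)) = jev (jD ?T (jD ?T h.G)) + 2 * (2 * \<i> * herm \<epsilon>' (h.D1 ?T) a + \<kappa>)"
    unfolding jdT by (simp add: algebra_simps)
  show ?thesis
  proof (rule that[of a r, folded k_def, OF kk c0])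
    show "k.D1 (z, 0) = h.D1 (z, 0)" for z by (simp add: k.D1_def h.D1_def D)
    show "k.D1 ?T = 0" by (simp add: k.D1_def D vec_eq_iff) (simp add: a_def h.D1_def)
    show "Re (jev (jD ?T (jD ?T k.G))) = 0" unfolding GT by (simp add: \<kappa>_def r_def field_simps)
  qed
qed

text \<open>The images of the frame vectors, divided by the square root of \<open>Q\<close>, are pseudo-orthonormal with
  the signs of the source, so that Witt's theorem applies.\<close>

lemma linear_normalization:
  fixes \<epsilon> :: "'n::finite \<Rightarrow> real" and \<epsilon>' :: "'m::finite \<Rightarrow> real"
  assumes eps: "\<And>k. \<epsilon> k = -1 \<or> \<epsilon> k = 1" "\<And>k. \<epsilon>' k = -1 \<or> \<epsilon>' k = 1"
    and ah: "ah_map \<epsilon> \<epsilon>' 0 h Q" and h0: "h 0 = 0" and Q0: "Q 0 > 0"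
  obtains T s \<sigma> where "isometry \<epsilon>' T" "s \<noteq> 0" "inj \<sigma>" "\<And>\<alpha>. \<epsilon>' (\<sigma> \<alpha>) = \<epsilon> \<alpha>"
    "ah_map \<epsilon> \<epsilon>' 0 (\<lambda>x. dilate T s (h x)) (\<lambda>x. s * s * Q x)" "s * s * Q 0 = 1"
    "\<And>\<alpha>. ah_map_at.D1 0 (\<lambda>x. dilate T s (h x)) (axis \<alpha> 1, 0) = axis (\<sigma> \<alpha>) 1"
proof -
  interpret h: ah_map_at \<epsilon> \<epsilon>' 0 h Q by unfold_locales (rule ah)
  have lift: "horizontal_lift \<epsilon> 0 v = (v, 0)" for v by (simp add: horizontal_lift_def herm_zero)
  define s where "s = 1 / sqrt (Q 0)"
  have s: "s \<noteq> 0" "s * s * Q 0 = 1" using Q0 by (simp_all add: s_def)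
  define E where "E \<alpha> = of_real s *s h.D1 (axis \<alpha> 1, 0)" for \<alpha>
  have "herm \<epsilon>' (E \<alpha>) (E \<beta>) = of_real (s * s * Q 0) * herm \<epsilon> (axis \<alpha> 1) (axis \<beta> 1)" for \<alpha> \<beta>
    using h.D1_isometry[of "axis \<alpha> 1" "axis \<beta> 1"] by (simp add: E_def herm_scale lift)
  hence E: "herm \<epsilon>' (E \<alpha>) (E \<beta>) = (if \<alpha> = \<beta> then of_real (\<epsilon> \<alpha>) else 0)" for \<alpha> \<beta>
    unfolding s by (simp add: herm_axis) (simp add: axis_def)
  obtain T \<sigma> where T: "isometry \<epsilon>' T" "inj \<sigma>" "\<And>\<alpha>. \<epsilon>' (\<sigma> \<alpha>) = \<epsilon> \<alpha>" "\<And>\<alpha>. T (E \<alpha>) = axis (\<sigma> \<alpha>) 1"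
    by (rule Witt_extension[of \<epsilon> \<epsilon>' E, OF eps E]) (rule that)
  have "ah_map \<epsilon>' \<epsilon>' (h 0) (dilate T s) (\<lambda>x. s * s)"
    by (rule transfer_map_ah_map[OF transfer_map_dilate[OF T(1)]]) (simp_all add: h0 rho_zero)
  from ah_map_compose[OF ah this] have kk: "ah_map \<epsilon> \<epsilon>' 0 (\<lambda>x. dilate T s (h x)) (\<lambda>x. s * s * Q x)" .
  interpret k: ah_map_at \<epsilon> \<epsilon>' 0 "\<lambda>x. dilate T s (h x)" "\<lambda>x. s * s * Q x" by unfold_locales (rule kk)
  have "k.D1 v = of_real s *s T (h.D1 v)" for v
  proof -
    have "k.D1 v = fst (dir_deriv v (\<lambda>x. dilate T s (h x)) 0)"
      by (simp add: k.fst_pushforward[symmetric] pushforward_eq_dir_deriv k.hol)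
    also have "\<dots> = fst (dilate T s (dir_deriv v h 0))"
      using dir_deriv_bounded_linear[OF bounded_linear_dilate[OF T(1)] smooth_at_imp_differentiable[OF h.smooth_components(1)]] by simp
    also have "\<dots> = of_real s *s T (h.D1 v)"
      by (simp add: dilate_def h.fst_pushforward[symmetric] pushforward_eq_dir_deriv h.hol)
    finally show ?thesis .
  qed
  hence "k.D1 (axis \<alpha> 1, 0) = axis (\<sigma> \<alpha>) 1" for \<alpha> using T(4)[of \<alpha>] by (simp add: E_def isometryD[OF T(1)])
  thus ?thesis using that[OF T(1) s(1) T(2,3) kk s(2)] by blast
qed

theorem normalization:
  fixes \<epsilon> :: "'n::finite \<Rightarrow> real" and \<epsilon>' :: "'m::finite \<Rightarrow> real"
  assumes eps: "\<And>k. \<epsilon> k = -1 \<or> \<epsilon> k = 1" "\<And>k. \<epsilon>' k = -1 \<or> \<epsilon>' k = 1"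
    and ah: "ah_map \<epsilon> \<epsilon>' p h Q" and Qp: "Q p > 0"
  obtains V V' \<psi> k Q' \<sigma> where "transfer_pair \<epsilon>' V V' \<psi> k" "0 \<in> V" "h p \<in> V'" "\<psi> 0 = h p"
    "normalized_map \<epsilon> \<epsilon>' (\<lambda>x. k (h (translate \<epsilon> p x))) Q' \<sigma>"
proof -
  have rp: "rho \<epsilon> p = 0" and hp: "rho \<epsilon>' (h p) = 0" using ah by (auto simp: ah_map_def)
  have "ah_map \<epsilon> \<epsilon> 0 (translate \<epsilon> p) (\<lambda>x. 1)"
    by (rule transfer_map_ah_map[OF transfer_map_translate[OF rp]]) (simp_all add: rho_zero)
  from ah_map_compose[OF this, of \<epsilon>' h Q] ah have a1: "ah_map \<epsilon> \<epsilon>' 0 (\<lambda>x. h (translate \<epsilon> p x)) (\<lambda>x. Q (translate \<epsilon> p x))"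
    by (simp add: translate_zero)
  obtain p' where p': "rho \<epsilon>' p' = 0" "transfer_pair \<epsilon>' UNIV UNIV (translate \<epsilon>' (h p)) (translate \<epsilon>' p')"
    by (rule transfer_pair_translate[OF hp]) (rule that)
  have p'0: "translate \<epsilon>' p' (h p) = 0" using p'(2) translate_zero[of \<epsilon>' "h p"] unfolding transfer_pair_def by (metis UNIV_I)
  have "ah_map \<epsilon>' \<epsilon>' (h (translate \<epsilon> p 0)) (translate \<epsilon>' p') (\<lambda>x. 1)"
    by (rule transfer_map_ah_map[OF transfer_map_translate[OF p'(1)]]) (simp_all add: translate_zero hp)
  from ah_map_compose[OF a1 this]
  have a2: "ah_map \<epsilon> \<epsilon>' 0 (\<lambda>x. translate \<epsilon>' p' (h (translate \<epsilon> p x))) (\<lambda>x. Q (translate \<epsilon> p x))" by simp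
  have z2: "translate \<epsilon>' p' (h (translate \<epsilon> p 0)) = 0" "Q (translate \<epsilon> p 0) > 0" by (simp_all add: translate_zero p'0 Qp)
  obtain T s \<sigma> where T: "isometry \<epsilon>' T" "s \<noteq> 0" "inj \<sigma>" "\<And>\<alpha>. \<epsilon>' (\<sigma> \<alpha>) = \<epsilon> \<alpha>"
    and a3: "ah_map \<epsilon> \<epsilon>' 0 (\<lambda>x. dilate T s (translate \<epsilon>' p' (h (translate \<epsilon> p x)))) (\<lambda>x. s * s * Q (translate \<epsilon> p x))"
      "s * s * Q (translate \<epsilon> p 0) = 1"
      "\<And>\<alpha>. ah_map_at.D1 0 (\<lambda>x. dilate T s (translate \<epsilon>' p' (h (translate \<epsilon> p x)))) (axis \<alpha> 1, 0) = axis (\<sigma> \<alpha>) 1"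
    by (rule linear_normalization[OF eps a2 z2]) (rule that)
  have d0: "dilate T s 0 = 0" by (simp add: dilate_def isometryD[OF T(1)] zero_prod_def)
  hence z3: "dilate T s (translate \<epsilon>' p' (h (translate \<epsilon> p 0))) = 0" by (simp add: z2)
  obtain a r Q' where a4:
    "ah_map \<epsilon> \<epsilon>' 0 (\<lambda>x. proj_map \<epsilon>' a r (dilate T s (translate \<epsilon>' p' (h (translate \<epsilon> p x))))) Q'" "Q' 0 = 1"
    "\<And>z. ah_map_at.D1 0 (\<lambda>x. proj_map \<epsilon>' a r (dilate T s (translate \<epsilon>' p' (h (translate \<epsilon> p x))))) (z, 0)
      = ah_map_at.D1 0 (\<lambda>x. dilate T s (translate \<epsilon>' p' (h (translate \<epsilon> p x)))) (z, 0)"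
    "ah_map_at.D1 0 (\<lambda>x. proj_map \<epsilon>' a r (dilate T s (translate \<epsilon>' p' (h (translate \<epsilon> p x))))) (0, 1) = 0"
    "Re (jev (jD (0, 1) (jD (0, 1) (ah_map_at.G 0 (\<lambda>x. proj_map \<epsilon>' a r (dilate T s (translate \<epsilon>' p' (h (translate \<epsilon> p x))))))))) = 0"
    by (rule projective_normalization[OF a3(1) z3 a3(2)]) (rule that)
  define k where "k y = proj_map \<epsilon>' a r (dilate T s (translate \<epsilon>' p' y))" for y
  have nz: "\<epsilon>' i \<noteq> 0" for i using eps(2)[of i] by auto
  obtain g where g: "transfer_pair \<epsilon>' UNIV UNIV (dilate T s) g" using transfer_pair_dilate[OF T(1) nz T(2)] by blast
  have g0: "g 0 = 0" using g d0 unfolding transfer_pair_def by (metis UNIV_I)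
  note P = transfer_pair_compose[OF transfer_pair_compose[OF transfer_pair_sym[OF p'(2)] g] transfer_pair_proj_map[of \<epsilon>' a r],
      THEN transfer_pair_sym, folded k_def]
  show ?thesis
  proof (rule that[OF P])
    show "normalized_map \<epsilon> \<epsilon>' (\<lambda>x. k (h (translate \<epsilon> p x))) Q' \<sigma>"
      unfolding k_def
      by unfold_locales (use a4 a3 T eps z3 in \<open>simp_all add: proj_map_zero\<close>)
  qed (simp_all add: proj_map_zero g0 translate_zero p'0 d0)
qed

section \<open>The geometric rank\<close>

lemma smooth_at_vimage:
  assumes "smooth_at p f" "open N" "f p \<in> N"
  obtains W where "open W" "p \<in> W" "\<And>x. x \<in> W \<Longrightarrow> f x \<in> N"
proof -
  obtain W where W: "open W" "p \<in> W" "smooth_on W f" using smooth_atE[OF assms(1)] .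
  have "open (f -` N \<inter> W)"
    using continuous_on_open_vimage[OF W(1), of f] smooth_on_imp_continuous_on[OF W(3)] assms(2) by simp
  thus ?thesis using that[of "f -` N \<inter> W"] W(2) assms(3) by auto
qed

lemma ah_map_smooth: "ah_map \<epsilon> \<epsilon>' p h Q \<Longrightarrow> smooth_at p h"
  unfolding ah_map_def using almost_holomorphic_atD(1) by blast

lemma ah_map_hyperquadric:
  assumes "ah_map \<epsilon> \<epsilon>' p h Q"
  obtains W where "open W" "p \<in> W" "\<And>x. x \<in> W \<Longrightarrow> x \<in> hyperquadric \<epsilon> \<Longrightarrow> h x \<in> hyperquadric \<epsilon>'"
proof -
  have "\<exists>W. open W \<and> p \<in> W \<and> (\<forall>x\<in>W. rho \<epsilon>' (h x) = Q x * rho \<epsilon> x)" using assms by (simp add: ah_map_def)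
  then obtain W where "open W" "p \<in> W" "\<forall>x\<in>W. rho \<epsilon>' (h x) = Q x * rho \<epsilon> x" by blast
  thus ?thesis using that[of W] by (simp add: hyperquadric_def)
qed

definition agree_near :: "('n::finite \<Rightarrow> real) \<Rightarrow> (complex^'n) \<times> complex \<Rightarrow> ((complex^'n) \<times> complex \<Rightarrow> 'a) \<Rightarrow> ((complex^'n) \<times> complex \<Rightarrow> 'a) \<Rightarrow> bool" where
  "agree_near \<epsilon> p f g \<longleftrightarrow> (\<exists>W. open W \<and> p \<in> W \<and> (\<forall>x\<in>W. x \<in> hyperquadric \<epsilon> \<longrightarrow> f x = g x))"

lemma agree_near_compose:
  assumes hk: "agree_near \<epsilon> p h k" and fg: "agree_near \<epsilon>' (h p) f g" and h: "ah_map \<epsilon> \<epsilon>' p h Q"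
  shows "agree_near \<epsilon> p (\<lambda>x. f (h x)) (\<lambda>x. g (k x))"
proof -
  obtain W where W: "open W" "p \<in> W" "\<forall>x\<in>W. x \<in> hyperquadric \<epsilon> \<longrightarrow> h x = k x" using hk by (auto simp: agree_near_def)
  obtain N where N: "open N" "h p \<in> N" "\<forall>x\<in>N. x \<in> hyperquadric \<epsilon>' \<longrightarrow> f x = g x" using fg by (auto simp: agree_near_def)
  obtain M where M: "open M" "p \<in> M" "\<And>x. x \<in> M \<Longrightarrow> h x \<in> N" by (rule smooth_at_vimage[OF ah_map_smooth[OF h] N(1,2)]) (rule that)
  obtain L where L: "open L" "p \<in> L" "\<And>x. x \<in> L \<Longrightarrow> x \<in> hyperquadric \<epsilon> \<Longrightarrow> h x \<in> hyperquadric \<epsilon>'" by (rule ah_map_hyperquadric[OF h]) (rule that)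
  have "\<forall>x\<in>W \<inter> (M \<inter> L). x \<in> hyperquadric \<epsilon> \<longrightarrow> f (h x) = g (k x)" using W(3) N(3) M(3) L(3) by (metis IntD1 IntD2)
  thus ?thesis unfolding agree_near_def using W M L by (intro exI[of _ "W \<inter> (M \<inter> L)"]) (auto intro!: open_Int)
qed

lemma extension_ah_map:
  assumes U: "openin (top_of_set (hyperquadric \<epsilon>)) U" and p: "p \<in> U"
    and ext: "almost_holomorphic_extension \<epsilon> \<epsilon>' U H p W h Q"
  shows "ah_map \<epsilon> \<epsilon>' p h Q" "agree_near \<epsilon> p h H" "h p = H p"
proof -
  obtain T where T: "open T" "U = hyperquadric \<epsilon> \<inter> T" using U by (auto simp: openin_open)
  have W: "open W" "p \<in> W" "smooth_on W h" "\<forall>x\<in>U \<inter> W. h x = H x" "smooth_on W Q" "\<forall>x\<in>W. rho \<epsilon>' (h x) = Q x * rho \<epsilon> x"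
    and fl: "\<forall>v. (\<forall>k. vanishes_to_infinite_order_on (U \<inter> W) (wirtinger_bar (\<lambda>x. fst (h x) $ k) v)) \<and>
          vanishes_to_infinite_order_on (U \<inter> W) (wirtinger_bar (\<lambda>x. snd (h x)) v)"
    using ext unfolding almost_holomorphic_extension_def by simp_all
  have "flat_at p (wirtinger_bar (\<lambda>x. fst (h x) $ k) v)" "flat_at p (wirtinger_bar (\<lambda>x. snd (h x)) v)" for k v
    using fl p W(2) unfolding vanishes_to_infinite_order_iff by blast+
  hence "almost_holomorphic_at h p" unfolding almost_holomorphic_at_def using smooth_atI[OF W(1-3)] by blast
  moreover have "rho \<epsilon> p = 0" using p T by (simp add: hyperquadric_def)
  ultimately show "ah_map \<epsilon> \<epsilon>' p h Q" unfolding ah_map_def using smooth_atI[OF W(1,2,5)] W(1,2,6) by blast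
  show "agree_near \<epsilon> p h H" unfolding agree_near_def
    using W T p by (intro exI[of _ "W \<inter> T"]) auto
  show "h p = H p" using W(2,4) p by simp
qed

lemma CR_map_ah_map:
  assumes U: "openin (top_of_set (hyperquadric \<epsilon>)) U" and H: "CR_map_on \<epsilon> \<epsilon>' U H" and p: "p \<in> U"
  obtains h Q where "ah_map \<epsilon> \<epsilon>' p h Q" "agree_near \<epsilon> p h H" "h p = H p"
  using almost_holomorphic_extension_exists[OF assms] extension_ah_map[OF U p] by metis

text \<open>If \<open>Q\<close> vanished at \<open>p\<close>, the first-order identity would say that the differential maps every vector
  into the complex tangent space of the target. A derivative of \<open>H\<close> within \<open>U\<close> agrees with that of
  the extension on tangent vectors, as one sees along parabolas in the hyperquadric.\<close>

lemma transversal_imp_nonzero: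
  assumes U: "openin (top_of_set (hyperquadric \<epsilon>)) U" and p: "p \<in> U" and tr: "transversal_on \<epsilon> \<epsilon>' U H"
    and h: "ah_map \<epsilon> \<epsilon>' p h Q" and agree: "agree_near \<epsilon> p h H" and hp: "h p = H p"
  shows "Q p \<noteq> 0"
proof
  assume Q0: "Q p = 0"
  interpret ah_map_at \<epsilon> \<epsilon>' p h Q by unfold_locales (rule h)
  obtain T where T: "open T" "U = hyperquadric \<epsilon> \<inter> T" using U by (auto simp: openin_open)
  obtain W where W: "open W" "p \<in> W" "\<forall>x\<in>W. x \<in> hyperquadric \<epsilon> \<longrightarrow> h x = H x" using agree by (auto simp: agree_near_def)
  obtain D where D: "(H has_derivative D) (at p within U)"
    "{u + D v | u v. u \<in> complex_tangent \<epsilon>' (H p) \<and> v \<in> real_tangent \<epsilon> p} = real_tangent \<epsilon>' (H p)"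
    using tr p unfolding transversal_on_def by blast
  have dir: "dir_deriv v h p \<in> complex_tangent \<epsilon>' (H p)" for v
  proof -
    have "snd (pushforward h p v) = jev (jD v G)"
      by (simp add: pushforward_def G_def jD_jet smooth_components jev_jet smooth_at_wirtinger)
    thus ?thesis using identity_1[of v] Q0 hp
      by (simp add: complex_tangent_iff pushforward_eq_dir_deriv[OF hol, symmetric] fst_pushforward field_simps)
  qed
  have Dv: "D v = dir_deriv v h p" if v: "v \<in> real_tangent \<epsilon> p" for v
  proof -
    \<comment> \<open>The quadratic term compensates the second-order change of \<open>\<parallel>z\<parallel>\<^sup>2\<close> along the line.\<close>
    define c where "c t = p + t *\<^sub>R v + (t * t) *\<^sub>R (0, \<i> * herm \<epsilon> (fst v) (fst v))" for t
    have c0: "c 0 = p" by (simp add: c_def prod_eq_iff)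
    have ch: "c t \<in> hyperquadric \<epsilon>" for t
    proof -
      have "complex_of_real (rho \<epsilon> (c t)) = of_real (rho \<epsilon> p + t * (Im (snd v) - 2 * Re (herm \<epsilon> (fst v) (fst p))))"
      proof -
        have s: "t *\<^sub>R x = of_real t *s x" for x :: "complex^'a" by (simp add: vec_eq_iff) (simp add: scaleR_conv_of_real)
        have "herm \<epsilon> (fst p) (fst v) = cnj (herm \<epsilon> (fst v) (fst p))" by (simp add: cnj_herm)
        moreover have "Im (herm \<epsilon> (fst v) (fst v)) = 0" "Im (herm \<epsilon> (fst p) (fst p)) = 0" by (simp_all add: herm_self)
        ultimately show ?thesis
          unfolding rho_eq_Re c_def by (simp add: s herm_add herm_scale complex_eq_iff algebra_simps)
      qed
      thus ?thesis using rho_p v by (simp only: of_real_eq_iff) (simp add: real_tangent_iff hyperquadric_def)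
    qed
    have dc: "(c has_vector_derivative v) (at 0)" unfolding c_def
      by (auto intro!: derivative_eq_intros simp: prod_eq_iff)
    have cont: "isCont c 0" using has_vector_derivative_continuous[OF dc] .
    have "open (T \<inter> W)" "c 0 \<in> T \<inter> W" using T W p c0 by auto
    from topological_tendstoD[OF cont[unfolded isCont_def tendsto_at_iff_tendsto_nhds] this]
    obtain S where S: "open S" "0 \<in> S" "\<forall>t\<in>S. c t \<in> T \<inter> W" unfolding eventually_nhds by blast
    have im: "c ` S \<subseteq> U" using S ch T by auto
    have "(H has_derivative D) (at (c 0) within c ` S)" unfolding c0 by (rule has_derivative_subset[OF D(1) im])
    from diff_chain_within[OF _ this, of "\<lambda>t. t *\<^sub>R v"] dc
    have "((H \<circ> c) has_derivative (D \<circ> (\<lambda>t. t *\<^sub>R v))) (at 0 within S)"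
      using has_derivative_at_withinI unfolding has_vector_derivative_def by blast
    hence 1: "((H \<circ> c) has_derivative (D \<circ> (\<lambda>t. t *\<^sub>R v))) (at 0)" by (simp only: at_within_open[OF S(2,1)])
    have "((h \<circ> c) has_derivative ((\<lambda>v. dir_deriv v h p) \<circ> (\<lambda>t. t *\<^sub>R v))) (at 0)"
      by (rule diff_chain_at) (use dc c0 has_derivative_dir_deriv[OF smooth_at_imp_differentiable[OF smooth_components(1)]]
        in \<open>simp_all add: has_vector_derivative_def\<close>)
    hence "((H \<circ> c) has_derivative ((\<lambda>v. dir_deriv v h p) \<circ> (\<lambda>t. t *\<^sub>R v))) (at 0)"
      by (rule has_derivative_transform_within_open[OF _ S(1,2)]) (use S W ch in auto)
    from has_derivative_unique[OF 1 this] have "(D \<circ> (\<lambda>t. t *\<^sub>R v)) 1 = ((\<lambda>v. dir_deriv v h p) \<circ> (\<lambda>t. t *\<^sub>R v)) 1" by (rule fun_cong)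
    thus ?thesis by simp
  qed
  have "(0, 1) \<in> real_tangent \<epsilon>' (H p)" by (simp add: real_tangent_iff herm_zero)
  then obtain u v where uv: "(0, 1) = u + D v" "u \<in> complex_tangent \<epsilon>' (H p)" "v \<in> real_tangent \<epsilon> p"
    unfolding D(2)[symmetric] by blast
  have "u + D v \<in> complex_tangent \<epsilon>' (H p)"
    using uv(2) dir[of v] unfolding Dv[OF uv(3)] complex_tangent_iff by (simp add: herm_add algebra_simps)
  thus False unfolding uv(1)[symmetric] complex_tangent_iff by (simp add: herm_zero)
qed

text \<open>Both a local automorphism and its inverse have almost holomorphic extensions, and since these are
  inverse to each other on the hyperquadric, the quotients do not vanish.\<close>

lemma automorphism_ah_map:
  assumes g: "local_CR_automorphism \<epsilon> V g" and a: "a \<in> V"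
  obtains f Qf k Qk where "ah_map \<epsilon> \<epsilon> a f Qf" "Qf a \<noteq> 0" "agree_near \<epsilon> a f g" "f a = g a"
    "ah_map \<epsilon> \<epsilon> (g a) k Qk" "Qk (g a) \<noteq> 0" "agree_near \<epsilon> (g a) k (inv_into V g)"
proof -
  have V: "openin (top_of_set (hyperquadric \<epsilon>)) V" "CR_map_on \<epsilon> \<epsilon> V g" "inj_on g V"
    "openin (top_of_set (hyperquadric \<epsilon>)) (g ` V)" "CR_map_on \<epsilon> \<epsilon> (g ` V) (inv_into V g)"
    using g unfolding local_CR_automorphism_def by simp_all
  obtain f Qf where f: "ah_map \<epsilon> \<epsilon> a f Qf" "agree_near \<epsilon> a f g" "f a = g a" by (rule CR_map_ah_map[OF V(1,2) a]) (rule that)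
  have ga: "g a \<in> g ` V" using a by simp
  obtain k Qk where k: "ah_map \<epsilon> \<epsilon> (g a) k Qk" "agree_near \<epsilon> (g a) k (inv_into V g)" by (rule CR_map_ah_map[OF V(4,5) ga]) (rule that)
  have "agree_near \<epsilon> a (\<lambda>x. k (f x)) (\<lambda>x. inv_into V g (g x))"
    by (rule agree_near_compose[OF f(2) _ f(1)]) (simp add: f(3) k(2))
  then obtain W where W: "open W" "a \<in> W" "\<forall>x\<in>W. x \<in> hyperquadric \<epsilon> \<longrightarrow> k (f x) = inv_into V g (g x)" by (auto simp: agree_near_def)
  obtain T where T: "open T" "V = hyperquadric \<epsilon> \<inter> T" using V(1) by (auto simp: openin_open)
  have "k (f x) = x" if "x \<in> W \<inter> T" "x \<in> hyperquadric \<epsilon>" for x using W(3) V(3) T that by simp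
  moreover have "open (W \<inter> T)" "a \<in> W \<inter> T" using W T a by auto
  ultimately have "Qf a \<noteq> 0" "Qk (f a) \<noteq> 0" using Q_nonzero_of_inverse[OF f(1) k(1)[folded f(3)]] by blast+
  thus ?thesis using that[OF f(1) _ f(2,3) k(1) _ k(2)] f(3) by simp
qed

lemma normal_form_cong:
  assumes "agree_near \<epsilon> 0 F G"
  shows "normal_form \<epsilon> \<epsilon>' \<sigma> F A B \<longleftrightarrow> normal_form \<epsilon> \<epsilon>' \<sigma> G A B"
proof -
  obtain W where W: "open W" "0 \<in> W" "\<forall>x\<in>W. x \<in> hyperquadric \<epsilon> \<longrightarrow> F x = G x" using assms by (auto simp: agree_near_def)
  have "O_wt \<epsilon> k (\<lambda>x. fst (F x) $ i - f x) \<longleftrightarrow> O_wt \<epsilon> k (\<lambda>x. fst (G x) $ i - f x)"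
    "O_wt \<epsilon> k (\<lambda>x. snd (F x) - f x) \<longleftrightarrow> O_wt \<epsilon> k (\<lambda>x. snd (G x) - f x)" for k i f
    by (rule O_wt_cong[OF W(1,2)]; simp add: W(3))+
  thus ?thesis unfolding normal_form_def by simp
qed

text \<open>Automorphisms do not change the rank of the Ahlfors matrix, and for a map in normal form this
  matrix is \<open>A\<close> up to signs of the columns. Hence every choice of the automorphisms gives the same
  rank.\<close>

lemma rank_normal_form:
  fixes \<epsilon> :: "'n::finite \<Rightarrow> real" and \<epsilon>' :: "'m::finite \<Rightarrow> real"
  assumes eps: "\<And>k. \<epsilon> k = -1 \<or> \<epsilon> k = 1" "\<And>k. \<epsilon>' k = -1 \<or> \<epsilon>' k = 1"
    and h: "ah_map \<epsilon> \<epsilon>' p h Q" "Q p \<noteq> 0" and agree: "agree_near \<epsilon> p h H" "h p = H p"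
    and \<gamma>: "local_CR_automorphism \<epsilon> V \<gamma>" "0 \<in> V" "\<gamma> 0 = p"
    and \<psi>: "local_CR_automorphism \<epsilon>' V' \<psi>" "0 \<in> V'" "\<psi> 0 = H p"
    and nf: "normal_form \<epsilon> \<epsilon>' \<sigma> (inv_into V' \<psi> \<circ> H \<circ> \<gamma>) A B"
  shows "rank A = rank (ahlfors_matrix \<epsilon> Q p)"
proof -
  have nz: "\<epsilon> i \<noteq> 0" "\<epsilon>' j \<noteq> 0" for i j using eps(1)[of i] eps(2)[of j] by auto
  obtain g Qg where g: "ah_map \<epsilon> \<epsilon> 0 g Qg" "Qg 0 \<noteq> 0" "agree_near \<epsilon> 0 g \<gamma>" "g 0 = \<gamma> 0"
    by (rule automorphism_ah_map[OF \<gamma>(1,2)]) (rule that)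
  obtain k Qk where k: "ah_map \<epsilon>' \<epsilon>' (\<psi> 0) k Qk" "Qk (\<psi> 0) \<noteq> 0" "agree_near \<epsilon>' (\<psi> 0) k (inv_into V' \<psi>)"
    by (rule automorphism_ah_map[OF \<psi>(1,2)]) (rule that)
  have gp: "g 0 = p" and hg: "h (g 0) = H p" by (simp_all add: g \<gamma> agree)
  have h': "ah_map \<epsilon> \<epsilon>' (g 0) h Q" "Q (g 0) \<noteq> 0" using h by (simp_all add: gp)
  have k': "ah_map \<epsilon>' \<epsilon>' (h (g 0)) k Qk" "Qk (h (g 0)) \<noteq> 0" "agree_near \<epsilon>' (h (g 0)) k (inv_into V' \<psi>)"
    using k by (simp_all add: hg \<psi>)
  note R = rank_ahlfors_matrix_invariant[OF nz g(1,2) h' k'(1,2)]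
  have "agree_near \<epsilon> 0 (\<lambda>x. h (g x)) (\<lambda>x. H (\<gamma> x))"
    by (rule agree_near_compose[OF g(3) _ g(1)]) (simp add: gp agree)
  from agree_near_compose[OF this k'(3) ah_map_compose[OF g(1) h'(1)]]
  have "agree_near \<epsilon> 0 (\<lambda>x. k (h (g x))) (inv_into V' \<psi> \<circ> H \<circ> \<gamma>)" by (simp add: o_def)
  then obtain W where W: "open W" "0 \<in> W" "\<And>x. x \<in> W \<Longrightarrow> x \<in> hyperquadric \<epsilon> \<Longrightarrow> k (h (g x)) = (inv_into V' \<psi> \<circ> H \<circ> \<gamma>) x"
    unfolding agree_near_def by blast
  have "complex_of_real (\<epsilon> \<beta>) * of_real (\<epsilon> \<beta>) = 1" for \<beta> using eps(1)[of \<beta>] by auto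
  thus ?thesis using R(2) normal_form_ahlfors_matrix(2)[OF R(1) nz(1) W nf] rank_scale_columns[of "\<lambda>\<beta>. of_real (\<epsilon> \<beta>)" A]
    by (simp add: gp)
qed

text \<open>The normal form exists by the normalization above, and its rank is unique by the preceding lemma.\<close>

theorem normal_form_rank_eq:
  fixes \<epsilon> :: "'n::finite \<Rightarrow> real" and \<epsilon>' :: "'m::finite \<Rightarrow> real"
  assumes eps: "\<And>k. \<epsilon> k = -1 \<or> \<epsilon> k = 1" "\<And>k. \<epsilon>' k = -1 \<or> \<epsilon>' k = 1"
    and h: "ah_map \<epsilon> \<epsilon>' p h Q" "Q p > 0" and agree: "agree_near \<epsilon> p h H" "h p = H p"
  shows "normal_form_rank \<epsilon> \<epsilon>' H p = rank (ahlfors_matrix \<epsilon> Q p)"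
proof -
  have rp: "rho \<epsilon> p = 0" using h by (simp add: ah_map_def)
  have Q0: "Q p \<noteq> 0" using h by simp
  obtain V V' \<psi> k Q' \<sigma> where P: "transfer_pair \<epsilon>' V V' \<psi> k" "0 \<in> V" "h p \<in> V'" "\<psi> 0 = h p"
    "normalized_map \<epsilon> \<epsilon>' (\<lambda>x. k (h (translate \<epsilon> p x))) Q' \<sigma>"
    by (rule normalization[OF eps h]) (rule that)
  interpret N: normalized_map \<epsilon> \<epsilon>' "\<lambda>x. k (h (translate \<epsilon> p x))" Q' \<sigma> by (rule P(5))
  obtain p' where p': "transfer_pair \<epsilon> UNIV UNIV (translate \<epsilon> p) (translate \<epsilon> p')"
    by (rule transfer_pair_translate[OF rp]) (rule that)
  let ?V = "V \<inter> hyperquadric \<epsilon>'"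
  have zero: "0 \<in> hyperquadric e" for e :: "'i::finite \<Rightarrow> real" by (simp add: hyperquadric_def rho_zero)
  have auto1: "local_CR_automorphism \<epsilon> (UNIV \<inter> hyperquadric \<epsilon>) (translate \<epsilon> p)" "0 \<in> UNIV \<inter> hyperquadric \<epsilon>" "translate \<epsilon> p 0 = p"
    by (simp_all add: transfer_pair_automorphism(1)[OF p', simplified] zero translate_zero)
  have auto2: "local_CR_automorphism \<epsilon>' ?V \<psi>" "0 \<in> ?V" "\<psi> 0 = H p"
    using P by (simp_all add: transfer_pair_automorphism(1)[OF P(1)] zero agree)
  have a: "ah_map \<epsilon> \<epsilon> 0 (translate \<epsilon> p) (\<lambda>x. 1)"
    by (rule transfer_map_ah_map[OF transfer_map_translate[OF rp]]) (simp_all add: rho_zero)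
  have b: "ah_map \<epsilon> \<epsilon>' (translate \<epsilon> p 0) h Q" by (simp add: translate_zero h)
  have ag: "agree_near \<epsilon>' (h (translate \<epsilon> p 0)) k (inv_into ?V \<psi>)" unfolding agree_near_def translate_zero
  proof (intro exI conjI ballI impI)
    show "open V'" using P(1) unfolding transfer_pair_def transfer_map_def by blast
    show "k x = inv_into ?V \<psi> x" if "x \<in> V'" "x \<in> hyperquadric \<epsilon>'" for x
      using transfer_pair_automorphism(2)[OF P(1)] that by (simp add: hyperquadric_def)
  qed (rule P(3))
  have "agree_near \<epsilon> 0 (\<lambda>x. h (translate \<epsilon> p x)) (\<lambda>x. H (translate \<epsilon> p x))"
    by (rule agree_near_compose[OF _ _ a]) (auto simp: translate_zero agree agree_near_def[of _ 0 "translate \<epsilon> p"])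
  from agree_near_compose[OF this ag ah_map_compose[OF a b]]
  have "agree_near \<epsilon> 0 (\<lambda>x. k (h (translate \<epsilon> p x))) (\<lambda>x. inv_into ?V \<psi> (H (translate \<epsilon> p x)))" .
  from normal_form_cong[OF this] N.normal_form
  have nf: "normal_form \<epsilon> \<epsilon>' \<sigma> (inv_into ?V \<psi> \<circ> H \<circ> translate \<epsilon> p) N.A N.B" by (simp add: o_def)
  show ?thesis unfolding normal_form_rank_def
  proof (rule the_equality)
    have "rank (ahlfors_matrix \<epsilon> Q p) = rank N.A"
      by (rule rank_normal_form[OF eps h(1) Q0 agree auto1 auto2 nf, symmetric])
    thus "\<exists>V \<gamma> V' \<psi> \<sigma> A B. local_CR_automorphism \<epsilon> V \<gamma> \<and> 0 \<in> V \<and> \<gamma> 0 = p \<and>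
        local_CR_automorphism \<epsilon>' V' \<psi> \<and> 0 \<in> V' \<and> \<psi> 0 = H p \<and>
        normal_form \<epsilon> \<epsilon>' \<sigma> (inv_into V' \<psi> \<circ> H \<circ> \<gamma>) A B \<and> rank (ahlfors_matrix \<epsilon> Q p) = rank A"
      using auto1 auto2 nf by blast
  next
    fix r assume "\<exists>V \<gamma> V' \<psi> \<sigma> A B. local_CR_automorphism \<epsilon> V \<gamma> \<and> 0 \<in> V \<and> \<gamma> 0 = p \<and>
        local_CR_automorphism \<epsilon>' V' \<psi> \<and> 0 \<in> V' \<and> \<psi> 0 = H p \<and>
        normal_form \<epsilon> \<epsilon>' \<sigma> (inv_into V' \<psi> \<circ> H \<circ> \<gamma>) A B \<and> r = rank A"
    then obtain V \<gamma> V' \<psi> \<sigma> A B where *: "local_CR_automorphism \<epsilon> V \<gamma>" "0 \<in> V" "\<gamma> 0 = p"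
        "local_CR_automorphism \<epsilon>' V' \<psi>" "0 \<in> V'" "\<psi> 0 = H p"
        "normal_form \<epsilon> \<epsilon>' \<sigma> (inv_into V' \<psi> \<circ> H \<circ> \<gamma>) A B" and r: "r = rank A"
      by (elim exE conjE) (rule that)
    show "r = rank (ahlfors_matrix \<epsilon> Q p)" unfolding r by (rule rank_normal_form[OF eps h(1) Q0 agree *])
  qed
qed

lemma transfer_map_reflection:
  "transfer_map \<epsilon> (\<lambda>k. - \<epsilon> k) UNIV (\<lambda>x. (fst x, - snd x)) (\<lambda>x. - 1)"
proof -
  have "transfer_map \<epsilon> (\<lambda>k. - \<epsilon> k) UNIV (\<lambda>x. (fst x, - snd x) + 0) (\<lambda>x. - 1)"
  proof (rule transfer_map_affine)
    show "bounded_linear (\<lambda>x :: (complex^'a) \<times> complex. (fst x, - snd x))"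
      by (intro bounded_linear_Pair bounded_linear_fst bounded_linear_minus bounded_linear_snd)
  qed (simp_all add: cscale_def rho_def sum_negf)
  thus ?thesis by simp
qed

theorem corollary3p3:
  fixes \<epsilon> :: "'n::finite \<Rightarrow> real" and \<epsilon>' :: "'m::finite \<Rightarrow> real" and l l' :: nat
    and U :: "((complex^'n) \<times> complex) set"
    and H :: "(complex^'n) \<times> complex \<Rightarrow> (complex^'m) \<times> complex"
    and p :: "(complex^'n) \<times> complex"
  assumes "signs \<epsilon> l" and "2 * l \<le> CARD('n)" and "signs \<epsilon>' l'"
    and "openin (top_of_set (hyperquadric \<epsilon>)) U"
    and "CR_map_on \<epsilon> \<epsilon>' U H"
    and "transversal_on \<epsilon> \<epsilon>' U H"
    and "p \<in> U"
  shows "rank (CR_Ahlfors \<epsilon> \<epsilon>' U H p) = geometric_rank \<epsilon> \<epsilon>' U H p"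
proof -
  have eps: "\<epsilon> i = -1 \<or> \<epsilon> i = 1" "\<epsilon>' j = -1 \<or> \<epsilon>' j = 1" for i j using assms(1,3) by (auto simp: signs_def)
  note U = assms(4) and p = assms(7)
  have "\<exists>M W h Q. almost_holomorphic_extension \<epsilon> \<epsilon>' U H p W h Q \<and> M = ahlfors_matrix \<epsilon> Q p"
    using almost_holomorphic_extension_exists[OF U assms(5) p] by blast
  \<comment> \<open>The argument below applies to whichever extension the definition of the matrix picks.\<close>
  from someI_ex[OF this] obtain W h Q where ext: "almost_holomorphic_extension \<epsilon> \<epsilon>' U H p W h Q"
    and M: "CR_Ahlfors \<epsilon> \<epsilon>' U H p = ahlfors_matrix \<epsilon> Q p"
    unfolding CR_Ahlfors_def ahlfors_matrix_def log_hessian_def by blast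
  note h = extension_ah_map[OF U p ext]
  have Q0: "Q p \<noteq> 0" by (rule transversal_imp_nonzero[OF U p assms(6) h])
  show ?thesis
  proof (cases "Q p > 0")
    case True
    hence "preserves_sides_at \<epsilon> \<epsilon>' U H p" unfolding preserves_sides_at_def using ext by blast
    thus ?thesis unfolding geometric_rank_def M using normal_form_rank_eq[OF eps h(1) True h(2,3)] by simp
  next
    case False
    \<comment> \<open>The sign of \<open>Q\<close> at \<open>p\<close> is the same for all extensions.\<close>
    have "\<not> preserves_sides_at \<epsilon> \<epsilon>' U H p"
    proof
      assume "preserves_sides_at \<epsilon> \<epsilon>' U H p"
      then obtain W' h' Q' where ext': "almost_holomorphic_extension \<epsilon> \<epsilon>' U H p W' h' Q'" "Q' p > 0"
        unfolding preserves_sides_at_def by blast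
      note h' = extension_ah_map[OF U p ext'(1)]
      obtain S S' where S: "open S" "p \<in> S" "\<forall>x\<in>S. x \<in> hyperquadric \<epsilon> \<longrightarrow> h x = H x"
        "open S'" "p \<in> S'" "\<forall>x\<in>S'. x \<in> hyperquadric \<epsilon> \<longrightarrow> h' x = H x"
        using h(2) h'(2) unfolding agree_near_def by blast
      have "Q p = Q' p" by (rule Q_determined[OF h(1) h'(1), of "S \<inter> S'"]) (use S in \<open>auto intro: open_Int\<close>)
      thus False using False ext'(2) by simp
    qed
    \<comment> \<open>The reflection replaces \<open>Q\<close> by \<open>-Q\<close>, which does not affect \<open>log |Q|\<close>.\<close>
    moreover have "normal_form_rank \<epsilon> (\<lambda>k. - \<epsilon>' k) (\<lambda>x. (fst (H x), - snd (H x))) p = rank (ahlfors_matrix \<epsilon> (\<lambda>x. - 1 * Q x) p)"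
    proof (rule normal_form_rank_eq[OF eps(1), where h = "\<lambda>x. (fst (h x), - snd (h x))"])
      have "rho \<epsilon>' (h p) = 0" using h(1) by (auto simp: ah_map_def)
      thus "ah_map \<epsilon> (\<lambda>k. - \<epsilon>' k) p (\<lambda>x. (fst (h x), - snd (h x))) (\<lambda>x. - 1 * Q x)"
        by (intro ah_map_compose[OF h(1)] transfer_map_ah_map[OF transfer_map_reflection UNIV_I])
      show "agree_near \<epsilon> p (\<lambda>x. (fst (h x), - snd (h x))) (\<lambda>x. (fst (H x), - snd (H x)))"
        using h(2) unfolding agree_near_def by auto
      show "- \<epsilon>' k = -1 \<or> - \<epsilon>' k = 1" for k using eps(2)[of k] by auto
    qed (use False Q0 h(3) in auto)
    moreover have "ahlfors_matrix \<epsilon> (\<lambda>x. - 1 * Q x) p = ahlfors_matrix \<epsilon> Q p"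
      by (simp add: ahlfors_matrix_def log_hessian_def)
    ultimately show ?thesis unfolding geometric_rank_def M by simp
  qed
qed

end
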